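(* The functor of points $\mathrm{pt}=\mathbf{GTop}[\mathbf{Set},-]:\mathbf{GTop}\to\mathbf{Cat}$ sends pro-etale geometric morphisms to discrete opfibrations.
   Context: $\mathbf{GTop}$ is the 2-category of Grothendieck topoi, geometric morphisms and geometric transformations (a 2-cell $f\Rightarrow g$ is a natural transformation $f^*\Rightarrow g^*$); $\mathbf{GTop}/\mathcal{E}$ is the pseudoslice (1-cells are triangles commuting up to a specified invertible 2-cell). $\mathrm{pt}(\mathcal{E})$ is the category of geometric morphisms $\mathbf{Set}\to\mathcal{E}$ and geometric transformations. For $E\in\mathcal{E}$, $\pi_E:\mathcal{E}/E\to\mathcal{E}$ is the geometric morphism with inverse image $D\mapsto(E\times D\to E)$. A geometric morphism with codomain $\mathcal{E}$ is pro-etale if it is equivalent in $\mathbf{GTop}/\mathcal{E}$ to a bilimit $\operatorname{bilim}_{i\in I}\pi_{E_i}$ for some small cofiltered category $I$ and some functor $I\to\mathcal{E}$. "Discrete opfibration" is used in the relaxed, equivalence-invariant sense: a functor that is an opfibration (opcartesian lifts being taken up to isomorphism) whose fibers (consisting of objects together with an isomorphism of their image to the base object) are equivalent to discrete categories, rather than being discrete themselves. *)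

theory Defs
  imports Main "HOL-Library.FuncSet" "HOL-Library.Equipollence"
begin

section \<open>The universe of small sets\<close>

text \<open>
  A set is small if its cardinality is strictly below that of \<^typ>\<open>'u\<close>, where the cardinality
  of \<^typ>\<open>'u\<close> is an infinite regular strong limit cardinal; up to bijection, the small sets are
  then the members of a Grothendieck universe.  Uncountability is not demanded: it is not needed
  to formulate the notions below, and without it the class has an instance (\<^typ>\<open>nat\<close>).
\<close>

class universe =
  assumes universe_infinite: "infinite (UNIV :: 'a set)"
    and universe_strong_limit: "A \<prec> (UNIV :: 'a set) \<Longrightarrow> Pow (A :: 'a set) \<prec> (UNIV :: 'a set)"
    and universe_regular:
      "A \<prec> (UNIV :: 'a set) \<Longrightarrow> (\<And>a. a \<in> A \<Longrightarrow> B a \<prec> (UNIV :: 'a set)) \<Longrightarrow>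
        (\<Union>a\<in>(A :: 'a set). (B a :: 'a set)) \<prec> (UNIV :: 'a set)"

definition small :: "('u::universe) set \<Rightarrow> bool" where
  "small A \<longleftrightarrow> A \<prec> (UNIV :: 'u set)"

lemma lesspoll_UNIV_nat_iff: "A \<prec> (UNIV :: nat set) \<longleftrightarrow> finite A"
proof
  show "finite A" if "A \<prec> (UNIV :: nat set)"
    using that unfolding lesspoll_def
    by (metis infinite_le_lepoll lepoll_antisym)
  show "A \<prec> (UNIV :: nat set)" if "finite A"
    using infinite_UNIV_nat that by (rule finite_lesspoll_infinite)
qed

instance nat :: universe
  by standard (simp_all add: lesspoll_UNIV_nat_iff infinite_UNIV_nat)


section \<open>Categories, functors, natural transformations\<close>

record ('o, 'a) category =
  Obj :: "'o set"
  Arr :: "'a set"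
  Dom :: "'a \<Rightarrow> 'o"
  Cod :: "'a \<Rightarrow> 'o"
  Idn :: "'o \<Rightarrow> 'a"
  Cmp :: "'a \<Rightarrow> 'a \<Rightarrow> 'a"   \<comment> \<open>\<open>Cmp C g f\<close> is \<open>g\<close> after \<open>f\<close>\<close>

definition homset :: "('o, 'a) category \<Rightarrow> 'o \<Rightarrow> 'o \<Rightarrow> 'a set" where
  "homset C x y = {f \<in> Arr C. Dom C f = x \<and> Cod C f = y}"

definition category :: "('o, 'a) category \<Rightarrow> bool" where
  "category C \<longleftrightarrow>
    (\<forall>f\<in>Arr C. Dom C f \<in> Obj C \<and> Cod C f \<in> Obj C) \<and>
    (\<forall>x\<in>Obj C. Idn C x \<in> homset C x x) \<and>
    (\<forall>f\<in>Arr C. \<forall>g\<in>Arr C. Cod C f = Dom C g \<longrightarrow> Cmp C g f \<in> homset C (Dom C f) (Cod C g)) \<and>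
    (\<forall>f\<in>Arr C. Cmp C f (Idn C (Dom C f)) = f \<and> Cmp C (Idn C (Cod C f)) f = f) \<and>
    (\<forall>f\<in>Arr C. \<forall>g\<in>Arr C. \<forall>h\<in>Arr C. Cod C f = Dom C g \<longrightarrow> Cod C g = Dom C h \<longrightarrow>
      Cmp C h (Cmp C g f) = Cmp C (Cmp C h g) f)"

definition iso_arr :: "('o, 'a) category \<Rightarrow> 'a \<Rightarrow> bool" where
  "iso_arr C f \<longleftrightarrow> f \<in> Arr C \<and>
    (\<exists>g\<in>homset C (Cod C f) (Dom C f).
      Cmp C g f = Idn C (Dom C f) \<and> Cmp C f g = Idn C (Cod C f))"

definition op_cat :: "('o, 'a) category \<Rightarrow> ('o, 'a) category" where
  "op_cat C = \<lparr>Obj = Obj C, Arr = Arr C, Dom = Cod C, Cod = Dom C, Idn = Idn C,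
     Cmp = (\<lambda>g f. Cmp C f g)\<rparr>"

text \<open>
  Functors and transformations carry their source and target, and their maps are required to be
  extensional, so that equality of functors and of transformations is equality in HOL.
\<close>

record ('o, 'a, 'p, 'b) func =
  FDom :: "('o, 'a) category"
  FCod :: "('p, 'b) category"
  FO :: "'o \<Rightarrow> 'p"
  FA :: "'a \<Rightarrow> 'b"

definition is_functor :: "('o, 'a, 'p, 'b) func \<Rightarrow> bool" where
  "is_functor F \<longleftrightarrow>
    category (FDom F) \<and> category (FCod F) \<and>
    FO F \<in> Obj (FDom F) \<rightarrow>\<^sub>E Obj (FCod F) \<and>
    FA F \<in> Arr (FDom F) \<rightarrow>\<^sub>E Arr (FCod F) \<and>
    (\<forall>f\<in>Arr (FDom F). FA F f \<in> homset (FCod F) (FO F (Dom (FDom F) f)) (FO F (Cod (FDom F) f))) \<and>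
    (\<forall>x\<in>Obj (FDom F). FA F (Idn (FDom F) x) = Idn (FCod F) (FO F x)) \<and>
    (\<forall>f\<in>Arr (FDom F). \<forall>g\<in>Arr (FDom F). Cod (FDom F) f = Dom (FDom F) g \<longrightarrow>
      FA F (Cmp (FDom F) g f) = Cmp (FCod F) (FA F g) (FA F f))"

definition functor_from_to ::
    "('o, 'a, 'p, 'b) func \<Rightarrow> ('o, 'a) category \<Rightarrow> ('p, 'b) category \<Rightarrow> bool" where
  "functor_from_to F C D \<longleftrightarrow> is_functor F \<and> FDom F = C \<and> FCod F = D"

definition id_func :: "('o, 'a) category \<Rightarrow> ('o, 'a, 'o, 'a) func" where
  "id_func C = \<lparr>FDom = C, FCod = C, FO = (\<lambda>x\<in>Obj C. x), FA = (\<lambda>f\<in>Arr C. f)\<rparr>"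

definition cmp_func ::
    "('p, 'b, 'q, 'c) func \<Rightarrow> ('o, 'a, 'p, 'b) func \<Rightarrow> ('o, 'a, 'q, 'c) func" where
  "cmp_func G F = \<lparr>FDom = FDom F, FCod = FCod G,
     FO = compose (Obj (FDom F)) (FO G) (FO F), FA = compose (Arr (FDom F)) (FA G) (FA F)\<rparr>"

definition natural ::
    "('o, 'a, 'p, 'b) func \<Rightarrow> ('o, 'a, 'p, 'b) func \<Rightarrow> ('o \<Rightarrow> 'b) \<Rightarrow> bool" where
  "natural F G t \<longleftrightarrow>
    is_functor F \<and> is_functor G \<and> FDom F = FDom G \<and> FCod F = FCod G \<and>
    t \<in> extensional (Obj (FDom F)) \<and>
    (\<forall>x\<in>Obj (FDom F). t x \<in> homset (FCod F) (FO F x) (FO G x)) \<and>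
    (\<forall>f\<in>Arr (FDom F). Cmp (FCod F) (t (Cod (FDom F) f)) (FA F f) =
                      Cmp (FCod F) (FA G f) (t (Dom (FDom F) f)))"

definition natural_iso ::
    "('o, 'a, 'p, 'b) func \<Rightarrow> ('o, 'a, 'p, 'b) func \<Rightarrow> ('o \<Rightarrow> 'b) \<Rightarrow> bool" where
  "natural_iso F G t \<longleftrightarrow> natural F G t \<and> (\<forall>x\<in>Obj (FDom F). iso_arr (FCod F) (t x))"

definition equivalence_functor :: "('o, 'a, 'p, 'b) func \<Rightarrow> bool" where
  "equivalence_functor F \<longleftrightarrow> is_functor F \<and>
    (\<exists>G s t. functor_from_to G (FCod F) (FDom F) \<and>
      natural_iso (cmp_func G F) (id_func (FDom F)) s \<and>
      natural_iso (cmp_func F G) (id_func (FCod F)) t)"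

definition equivalent_categories :: "('o, 'a) category \<Rightarrow> ('p, 'b) category \<Rightarrow> bool" where
  "equivalent_categories C D \<longleftrightarrow> (\<exists>F. functor_from_to F C D \<and> equivalence_functor F)"

definition discrete_category :: "('o, 'a) category \<Rightarrow> bool" where
  "discrete_category C \<longleftrightarrow> category C \<and> (\<forall>f\<in>Arr C. f = Idn C (Dom C f))"


section \<open>Limits\<close>

definition is_cone :: "('i, 'k, 'o, 'a) func \<Rightarrow> 'o \<Rightarrow> ('i \<Rightarrow> 'a) \<Rightarrow> bool" where
  "is_cone D L l \<longleftrightarrow> L \<in> Obj (FCod D) \<and>
    (\<forall>i\<in>Obj (FDom D). l i \<in> homset (FCod D) L (FO D i)) \<and>
    (\<forall>u\<in>Arr (FDom D). Cmp (FCod D) (FA D u) (l (Dom (FDom D) u)) = l (Cod (FDom D) u))"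

definition is_limit :: "('i, 'k, 'o, 'a) func \<Rightarrow> 'o \<Rightarrow> ('i \<Rightarrow> 'a) \<Rightarrow> bool" where
  "is_limit D L l \<longleftrightarrow> is_cone D L l \<and>
    (\<forall>X x. is_cone D X x \<longrightarrow>
      (\<exists>!h. h \<in> homset (FCod D) X L \<and> (\<forall>i\<in>Obj (FDom D). Cmp (FCod D) (l i) h = x i)))"

text \<open>Every finite category is isomorphic to one with objects and arrows in \<^typ>\<open>nat\<close>.\<close>

definition left_exact :: "('o, 'a, 'p, 'b) func \<Rightarrow> bool" where
  "left_exact F \<longleftrightarrow>
    (\<forall>(J :: (nat, nat) category) D L l.
      finite (Obj J) \<and> finite (Arr J) \<and> functor_from_to D J (FDom F) \<and> is_limit D L l \<longrightarrow>
      is_limit (cmp_func F D) (FO F L) (\<lambda>j. FA F (l j)))"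

definition is_product ::
    "('o, 'a) category \<Rightarrow> 'o \<Rightarrow> 'o \<Rightarrow> 'o \<times> 'a \<times> 'a \<Rightarrow> bool" where
  "is_product C A B = (\<lambda>(P, p, q). p \<in> homset C P A \<and> q \<in> homset C P B \<and> P \<in> Obj C \<and>
    (\<forall>X\<in>Obj C. \<forall>f\<in>homset C X A. \<forall>g\<in>homset C X B.
      \<exists>!h. h \<in> homset C X P \<and> Cmp C p h = f \<and> Cmp C q h = g))"

definition is_pullback ::
    "('o, 'a) category \<Rightarrow> 'a \<Rightarrow> 'a \<Rightarrow> 'o \<times> 'a \<times> 'a \<Rightarrow> bool" where
  "is_pullback C u v = (\<lambda>(P, p, q).
    p \<in> homset C P (Dom C u) \<and> q \<in> homset C P (Dom C v) \<and> P \<in> Obj C \<and> Cmp C u p = Cmp C v q \<and>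
    (\<forall>X\<in>Obj C. \<forall>f\<in>homset C X (Dom C u). \<forall>g\<in>homset C X (Dom C v). Cmp C u f = Cmp C v g \<longrightarrow>
      (\<exists>!h. h \<in> homset C X P \<and> Cmp C p h = f \<and> Cmp C q h = g)))"

definition product :: "('o, 'a) category \<Rightarrow> 'o \<Rightarrow> 'o \<Rightarrow> 'o \<times> 'a \<times> 'a" where
  "product C A B = (SOME c. is_product C A B c)"

abbreviation "prod_obj C A B \<equiv> fst (product C A B)"
abbreviation "prod_fst C A B \<equiv> fst (snd (product C A B))"
abbreviation "prod_snd C A B \<equiv> snd (snd (product C A B))"

definition pullback :: "('o, 'a) category \<Rightarrow> 'a \<Rightarrow> 'a \<Rightarrow> 'o \<times> 'a \<times> 'a" where
  "pullback C u v = (SOME c. is_pullback C u v c)"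

abbreviation "pb_obj C u v \<equiv> fst (pullback C u v)"
abbreviation "pb_fst C u v \<equiv> fst (snd (pullback C u v))"
abbreviation "pb_snd C u v \<equiv> snd (snd (pullback C u v))"

definition cofiltered :: "('o, 'a) category \<Rightarrow> bool" where
  "cofiltered I \<longleftrightarrow> category I \<and> Obj I \<noteq> {} \<and>
    (\<forall>i\<in>Obj I. \<forall>j\<in>Obj I. \<exists>k\<in>Obj I. homset I k i \<noteq> {} \<and> homset I k j \<noteq> {}) \<and>
    (\<forall>i\<in>Obj I. \<forall>j\<in>Obj I. \<forall>u\<in>homset I i j. \<forall>v\<in>homset I i j.
      \<exists>k\<in>Obj I. \<exists>w\<in>homset I k i. Cmp I u w = Cmp I v w)"

definition small_category :: "('u::universe, 'u) category \<Rightarrow> bool" where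
  "small_category C \<longleftrightarrow> category C \<and> small (Obj C) \<and> small (Arr C)"


section \<open>The category of sets and Grothendieck topoi\<close>

text \<open>
  The objects and arrows of all topoi are taken from one type.  It contains the small sets and
  the maps between them, and it is closed under pairs (used for slices) and under families
  indexed by \<^typ>\<open>'u\<close>; so every category of sheaves on a small site is equivalent to a category
  with objects and arrows in this type (lemma \<open>sheaf_category_in_large\<close> below).
\<close>

datatype 'u large =
    Sub (elts: "'u set")
  | Map (map_dom: "'u set") (map_cod: "'u set") (app: "'u \<Rightarrow> 'u")
  | Tup (tfst: "'u large") (tsnd: "'u large")
  | Fam "'u \<Rightarrow> 'u large"

definition SetCat :: "('u::universe large, 'u large) category" where
  "SetCat = \<lparr>
     Obj = {Sub A | A. small A},
     Arr = {Map A B f | A B f. small A \<and> small B \<and> f \<in> A \<rightarrow>\<^sub>E B},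
     Dom = (\<lambda>m. Sub (map_dom m)),
     Cod = (\<lambda>m. Sub (map_cod m)),
     Idn = (\<lambda>X. Map (elts X) (elts X) (\<lambda>x\<in>elts X. x)),
     Cmp = (\<lambda>n m. Map (map_dom m) (map_cod n) (compose (map_dom m) (app n) (app m)))\<rparr>"

definition sieve :: "('o, 'a) category \<Rightarrow> 'o \<Rightarrow> 'a set \<Rightarrow> bool" where
  "sieve C c S \<longleftrightarrow> S \<subseteq> {f \<in> Arr C. Cod C f = c} \<and>
    (\<forall>f\<in>S. \<forall>g\<in>Arr C. Cod C g = Dom C f \<longrightarrow> Cmp C f g \<in> S)"

definition pullback_sieve :: "('o, 'a) category \<Rightarrow> 'a \<Rightarrow> 'a set \<Rightarrow> 'a set" where
  "pullback_sieve C f S = {g \<in> Arr C. Cod C g = Dom C f \<and> Cmp C f g \<in> S}"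

definition grothendieck_topology :: "('o, 'a) category \<Rightarrow> ('o \<Rightarrow> 'a set set) \<Rightarrow> bool" where
  "grothendieck_topology C J \<longleftrightarrow>
    (\<forall>c\<in>Obj C. \<forall>S\<in>J c. sieve C c S) \<and>
    (\<forall>c\<in>Obj C. {f \<in> Arr C. Cod C f = c} \<in> J c) \<and>
    (\<forall>f\<in>Arr C. \<forall>S\<in>J (Cod C f). pullback_sieve C f S \<in> J (Dom C f)) \<and>
    (\<forall>c\<in>Obj C. \<forall>S\<in>J c. \<forall>R. sieve C c R \<longrightarrow>
      (\<forall>f\<in>S. pullback_sieve C f R \<in> J (Dom C f)) \<longrightarrow> R \<in> J c)"

definition small_site :: "('u::universe, 'u) category \<Rightarrow> ('u \<Rightarrow> 'u set set) \<Rightarrow> bool" where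
  "small_site C J \<longleftrightarrow> small_category C \<and> grothendieck_topology C J"

definition is_sheaf ::
    "('u::universe, 'u) category \<Rightarrow> ('u \<Rightarrow> 'u set set) \<Rightarrow> ('u, 'u, 'u large, 'u large) func \<Rightarrow> bool" where
  "is_sheaf C J P \<longleftrightarrow> functor_from_to P (op_cat C) SetCat \<and>
    (\<forall>c\<in>Obj C. \<forall>S\<in>J c. \<forall>x.
      (\<forall>f\<in>S. x f \<in> elts (FO P (Dom C f))) \<and>
      (\<forall>f\<in>S. \<forall>g\<in>Arr C. Cod C g = Dom C f \<longrightarrow> x (Cmp C f g) = app (FA P g) (x f)) \<longrightarrow>
      (\<exists>!y. y \<in> elts (FO P c) \<and> (\<forall>f\<in>S. app (FA P f) y = x f)))"

record ('f, 'x, 'a) trans =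
  TDom :: 'f
  TCod :: 'f
  TMap :: "'x \<Rightarrow> 'a"

definition sheaf_category ::
    "('u::universe, 'u) category \<Rightarrow> ('u \<Rightarrow> 'u set set) \<Rightarrow>
     (('u, 'u, 'u large, 'u large) func,
      (('u, 'u, 'u large, 'u large) func, 'u, 'u large) trans) category" where
  "sheaf_category C J = \<lparr>
     Obj = {P. is_sheaf C J P},
     Arr = {t. is_sheaf C J (TDom t) \<and> is_sheaf C J (TCod t) \<and>
               natural (TDom t) (TCod t) (TMap t)},
     Dom = TDom, Cod = TCod,
     Idn = (\<lambda>P. \<lparr>TDom = P, TCod = P, TMap = (\<lambda>c\<in>Obj C. Idn SetCat (FO P c))\<rparr>),
     Cmp = (\<lambda>s t. \<lparr>TDom = TDom t, TCod = TCod s,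
                   TMap = (\<lambda>c\<in>Obj C. Cmp SetCat (TMap s c) (TMap t c))\<rparr>)\<rparr>"

lemma category_SetCat: "category SetCat"
proof -
  have id: "(\<lambda>x\<in>A. x) \<in> A \<rightarrow>\<^sub>E A" for A :: "'u set" by auto
  have cmp: "compose A g f \<in> A \<rightarrow>\<^sub>E D" if "f \<in> A \<rightarrow>\<^sub>E B" "g \<in> B \<rightarrow>\<^sub>E D" for f g and A B D :: "'u set"
    using that by (auto simp: compose_def)
  have un: "compose A f (\<lambda>x\<in>A. x) = f" "compose A (\<lambda>x\<in>B. x) f = f" if "f \<in> A \<rightarrow>\<^sub>E B" for f and A B :: "'u set"
    using that by (auto simp: PiE_iff intro!: Id_compose compose_Id)
  have as: "compose A h (compose A g f) = compose A (compose B h g) f" if "f \<in> A \<rightarrow>\<^sub>E B" for f g h and A B :: "'u set"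
    using that by (intro compose_assoc) (auto simp: PiE_iff)
  show ?thesis
    unfolding category_def SetCat_def homset_def
    by (auto simp: id un del: PiE_I intro: cmp as)
qed

lemma equivalent_category_along_injections:
  fixes C :: "('o,'a) category" and eo :: "'o \<Rightarrow> 'p" and ea :: "'a \<Rightarrow> 'b"
  assumes C: "category C" and io: "inj_on eo (Obj C)" and ia: "inj_on ea (Arr C)"
  shows "\<exists>T :: ('p,'b) category. category T \<and> equivalent_categories T C"
proof -
  define do where "do = inv_into (Obj C) eo"
  define da where "da = inv_into (Arr C) ea"
  have do [simp]: "do (eo x) = x" if "x \<in> Obj C" for x
    using that io by (simp add: do_def)
  have da [simp]: "da (ea x) = x" if "x \<in> Arr C" for x
    using that ia by (simp add: da_def)
  define T where "T = \<lparr>Obj = eo ` Obj C, Arr = ea ` Arr C, Dom = (\<lambda>f. eo (Dom C (da f))),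
    Cod = (\<lambda>f. eo (Cod C (da f))), Idn = (\<lambda>x. ea (Idn C (do x))),
    Cmp = (\<lambda>g f. ea (Cmp C (da g) (da f)))\<rparr>"
  have ax: "Dom C f \<in> Obj C" "Cod C f \<in> Obj C" if "f \<in> Arr C" for f
    using C that by (auto simp: category_def)
  have idn: "Idn C x \<in> Arr C" "Dom C (Idn C x) = x" "Cod C (Idn C x) = x" if "x \<in> Obj C" for x
    using C that by (auto simp: category_def homset_def)
  have cmp: "Cmp C g f \<in> Arr C" "Dom C (Cmp C g f) = Dom C f" "Cod C (Cmp C g f) = Cod C g"
    if "f \<in> Arr C" "g \<in> Arr C" "Cod C f = Dom C g" for f g
    using C that by (auto simp: category_def homset_def)
  have un: "Cmp C f (Idn C (Dom C f)) = f" "Cmp C (Idn C (Cod C f)) f = f" if "f \<in> Arr C" for f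
    using C that by (auto simp: category_def)
  have as: "Cmp C h (Cmp C g f) = Cmp C (Cmp C h g) f"
    if "f \<in> Arr C" "g \<in> Arr C" "h \<in> Arr C" "Cod C f = Dom C g" "Cod C g = Dom C h" for f g h
    using C that by (auto simp: category_def)
  have eoeq: "eo x = eo y \<longleftrightarrow> x = y" if "x \<in> Obj C" "y \<in> Obj C" for x y
    using io that by (auto simp: inj_on_def)
  have T: "category T"
    unfolding category_def T_def homset_def
    by (auto simp: ax idn cmp un as eoeq)
  define F where "F = \<lparr>FDom = T, FCod = C, FO = restrict do (Obj T), FA = restrict da (Arr T)\<rparr>"
  define G where "G = \<lparr>FDom = C, FCod = T, FO = restrict eo (Obj C), FA = restrict ea (Arr C)\<rparr>"
  have F: "is_functor F" unfolding is_functor_def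
    using T C by (auto simp: F_def T_def homset_def ax idn cmp eoeq)
  have G: "is_functor G" unfolding is_functor_def
    using T C by (auto simp: G_def T_def homset_def ax idn cmp eoeq)
  have GF: "cmp_func G F = id_func T"
    unfolding cmp_func_def id_func_def
    by (auto simp: F_def G_def T_def compose_def fun_eq_iff restrict_def)
  have FG: "cmp_func F G = id_func C"
    unfolding cmp_func_def id_func_def
    by (auto simp: F_def G_def T_def compose_def fun_eq_iff restrict_def)
  have idf: "is_functor (id_func A)" if "category A" for A :: "('x,'y) category"
    using that by (auto simp: is_functor_def id_func_def category_def homset_def)
  have nid: "natural_iso (id_func A) (id_func A) (\<lambda>x\<in>Obj A. Idn A x)" if "category A" for A :: "('x,'y) category"
    using that idf[OF that] unfolding natural_iso_def natural_def iso_arr_def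
    by (auto simp: id_func_def category_def homset_def) (metis)
  have "equivalence_functor F"
    unfolding equivalence_functor_def functor_from_to_def
    using F G nid[OF T] nid[OF C] GF FG
    by (intro conjI exI[of _ G]) (auto simp: F_def G_def intro!: exI)
  then show ?thesis
    unfolding equivalent_categories_def functor_from_to_def
    using T F by (intro exI[of _ T] exI[of _ F] conjI) (simp_all add: F_def)
qed

lemma category_sheaf_category:
  fixes C :: "('u::universe, 'u) category"
  assumes C: "category C"
  shows "category (sheaf_category C J)"
proof -
  note S = category_SetCat
  have ax: "Cmp SetCat g f \<in> homset SetCat x z" if "f \<in> homset SetCat x y" "g \<in> homset SetCat y z" for f g x y z
    using S that by (auto simp: category_def homset_def)
  have as: "Cmp SetCat h (Cmp SetCat g f) = Cmp SetCat (Cmp SetCat h g) f"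
    if "f \<in> homset SetCat x y" "g \<in> homset SetCat y z" "h \<in> homset SetCat z w" for f g h x y z w
    using S that by (auto simp: category_def homset_def)
  have idn: "Idn SetCat x \<in> homset SetCat x x" if "x \<in> Obj SetCat" for x :: "'u large"
    using S that by (auto simp: category_def homset_def)
  have un: "Cmp SetCat f (Idn SetCat x) = f" "Cmp SetCat (Idn SetCat y) f = f"
    if "f \<in> homset SetCat x y" for f x y
    using S that by (auto simp: category_def homset_def)
  have sh: "is_functor P" "FDom P = op_cat C" "FCod P = SetCat" if "is_sheaf C J P" for P
    using that by (auto simp: is_sheaf_def functor_from_to_def)
  have ob: "FO P x \<in> Obj SetCat" if "is_sheaf C J P" "x \<in> Obj C" for P x
    using sh[OF that(1)] that(2) by (auto simp: is_functor_def op_cat_def)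
  have ar: "FA P f \<in> homset SetCat (FO P (Cod C f)) (FO P (Dom C f))" if "is_sheaf C J P" "f \<in> Arr C" for P f
    using sh[OF that(1)] that(2) by (auto simp: is_functor_def op_cat_def)
  have CO: "Dom C f \<in> Obj C" "Cod C f \<in> Obj C" if "f \<in> Arr C" for f
    using C that by (auto simp: category_def)
  have nat: "natural P Q t \<longleftrightarrow> t \<in> extensional (Obj C) \<and> (\<forall>x\<in>Obj C. t x \<in> homset SetCat (FO P x) (FO Q x)) \<and>
     (\<forall>f\<in>Arr C. Cmp SetCat (t (Dom C f)) (FA P f) = Cmp SetCat (FA Q f) (t (Cod C f)))"
    if "is_sheaf C J P" "is_sheaf C J Q" for P Q t
    using sh[OF that(1)] sh[OF that(2)] by (simp add: natural_def) (simp add: op_cat_def)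
  have natid: "natural P P (\<lambda>c\<in>Obj C. Idn SetCat (FO P c))" if P: "is_sheaf C J P" for P
    unfolding nat[OF P P] using ob[OF P] idn un(1)[OF ar[OF P]] un(2)[OF ar[OF P]] by (auto simp: CO)
  have natcmp: "natural P R (\<lambda>c\<in>Obj C. Cmp SetCat (s c) (t c))"
    if P: "is_sheaf C J P" and Q: "is_sheaf C J Q" and R: "is_sheaf C J R"
      and t: "natural P Q t" and s: "natural Q R s" for P Q R s t
  proof -
    have t': "t x \<in> homset SetCat (FO P x) (FO Q x)" if "x \<in> Obj C" for x
      using t that by (simp add: nat[OF P Q])
    have s': "s x \<in> homset SetCat (FO Q x) (FO R x)" if "x \<in> Obj C" for x
      using s that by (simp add: nat[OF Q R])
    have "Cmp SetCat (Cmp SetCat (s (Dom C f)) (t (Dom C f))) (FA P f) =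
          Cmp SetCat (FA R f) (Cmp SetCat (s (Cod C f)) (t (Cod C f)))" if f: "f \<in> Arr C" for f
    proof -
      note d = CO[OF f]
      have tn: "Cmp SetCat (t (Dom C f)) (FA P f) = Cmp SetCat (FA Q f) (t (Cod C f))"
        using t f by (simp add: nat[OF P Q])
      have sn: "Cmp SetCat (s (Dom C f)) (FA Q f) = Cmp SetCat (FA R f) (s (Cod C f))"
        using s f by (simp add: nat[OF Q R])
      show ?thesis
        using as[OF ar[OF P f] t'[OF d(1)] s'[OF d(1)]]
          as[OF t'[OF d(2)] ar[OF Q f] s'[OF d(1)]] as[OF t'[OF d(2)] s'[OF d(2)] ar[OF R f]] tn sn
        by simp
    qed
    then show ?thesis unfolding nat[OF P R] using ax[OF t' s'] by (auto simp: CO)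
  qed
  have ext: "t \<in> extensional (Obj C)" if "is_sheaf C J P" "is_sheaf C J Q" "natural P Q t" for P Q t
    using that nat by blast
  have hom: "t x \<in> homset SetCat (FO P x) (FO Q x)" if "is_sheaf C J P" "is_sheaf C J Q" "natural P Q t" "x \<in> Obj C" for P Q t x
    using that nat by blast
  have unr: "(\<lambda>c\<in>Obj C. Cmp SetCat (t c) ((\<lambda>c\<in>Obj C. Idn SetCat (FO P c)) c)) = t"
    and unl: "(\<lambda>c\<in>Obj C. Cmp SetCat ((\<lambda>c\<in>Obj C. Idn SetCat (FO Q c)) c) (t c)) = t"
    if t: "is_sheaf C J P" "is_sheaf C J Q" "natural P Q t" for P Q t
    by (rule extensionalityI[OF restrict_extensional ext[OF t]]; simp add: un[OF hom[OF t]])+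
  have asr: "(\<lambda>c\<in>Obj C. Cmp SetCat (r c) ((\<lambda>c\<in>Obj C. Cmp SetCat (s c) (t c)) c)) =
        (\<lambda>c\<in>Obj C. Cmp SetCat ((\<lambda>c\<in>Obj C. Cmp SetCat (r c) (s c)) c) (t c))"
    if "is_sheaf C J P" "is_sheaf C J Q" "is_sheaf C J R" "is_sheaf C J S"
      "natural P Q t" "natural Q R s" "natural R S r" for P Q R S t s r
    using as[OF hom[OF that(1,2,5)] hom[OF that(2,3,6)] hom[OF that(3,4,7)]]
    by (intro restrict_ext) simp
  let ?S = "sheaf_category C J"
  have A: "t \<in> Arr ?S \<longleftrightarrow> is_sheaf C J (TDom t) \<and> is_sheaf C J (TCod t) \<and> natural (TDom t) (TCod t) (TMap t)"
    "P \<in> Obj ?S \<longleftrightarrow> is_sheaf C J P" "Dom ?S t = TDom t" "Cod ?S t = TCod t" for t P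
    by (simp_all add: sheaf_category_def)
  have I: "Idn ?S P = \<lparr>TDom = P, TCod = P, TMap = (\<lambda>c\<in>Obj C. Idn SetCat (FO P c))\<rparr>" for P
    by (simp add: sheaf_category_def)
  have M: "Cmp ?S s t = \<lparr>TDom = TDom t, TCod = TCod s,
       TMap = (\<lambda>c\<in>Obj C. Cmp SetCat (TMap s c) (TMap t c))\<rparr>" for s t
    by (simp add: sheaf_category_def)
  show ?thesis
    unfolding category_def homset_def mem_Collect_eq A
  proof (intro conjI ballI impI; (unfold A)?)
    fix f g :: "(('u, 'u, 'u large, 'u large) func, 'u, 'u large) trans"
      assume f: "is_sheaf C J (TDom f) \<and> is_sheaf C J (TCod f) \<and> natural (TDom f) (TCod f) (TMap f)"
      and g: "is_sheaf C J (TDom g) \<and> is_sheaf C J (TCod g) \<and> natural (TDom g) (TCod g) (TMap g)"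
      and fg: "TCod f = TDom g"
    show "natural (TDom (Cmp ?S g f)) (TCod (Cmp ?S g f)) (TMap (Cmp ?S g f))"
      using f g fg natcmp[of "TDom f" "TCod f" "TCod g" "TMap f" "TMap g"] by (simp only: M trans.simps)
  next
    fix f :: "(('u, 'u, 'u large, 'u large) func, 'u, 'u large) trans"
      assume f: "is_sheaf C J (TDom f) \<and> is_sheaf C J (TCod f) \<and> natural (TDom f) (TCod f) (TMap f)"
    show "Cmp ?S f (Idn ?S (TDom f)) = f" "Cmp ?S (Idn ?S (TCod f)) f = f"
      unfolding M I using f unr[of "TDom f" "TCod f" "TMap f"] unl[of "TDom f" "TCod f" "TMap f"]
      by (simp_all only: trans.simps simp_thms) simp_all
  next
    fix f g h :: "(('u, 'u, 'u large, 'u large) func, 'u, 'u large) trans"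
      assume "is_sheaf C J (TDom f) \<and> is_sheaf C J (TCod f) \<and> natural (TDom f) (TCod f) (TMap f)"
      "is_sheaf C J (TDom g) \<and> is_sheaf C J (TCod g) \<and> natural (TDom g) (TCod g) (TMap g)"
      "is_sheaf C J (TDom h) \<and> is_sheaf C J (TCod h) \<and> natural (TDom h) (TCod h) (TMap h)"
      "TCod f = TDom g" "TCod g = TDom h"
    then show "Cmp ?S h (Cmp ?S g f) = Cmp ?S (Cmp ?S h g) f"
      using asr[of "TDom f" "TCod f" "TCod g" "TCod h" "TMap f" "TMap g" "TMap h"]
      unfolding M by (simp only: trans.simps)
  qed (auto simp: A I M natid simp del: restrict_apply)
qed

lemma sheaf_category_in_large:
  fixes C :: "('u::universe, 'u) category"
  assumes C: "category C"
  shows "\<exists>T :: ('u large, 'u large) category. category T \<and> equivalent_categories T (sheaf_category C J)"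
proof (rule equivalent_category_along_injections[OF category_sheaf_category[OF C]])
  let ?e = "\<lambda>P :: ('u,'u,'u large,'u large) func. Tup (Fam (FO P)) (Fam (FA P))"
  have *: "P = Q" if "is_sheaf C J P" "is_sheaf C J Q" "FO P = FO Q" "FA P = FA Q" for P Q
    using that by (auto simp: is_sheaf_def functor_from_to_def intro: func.equality)
  show "inj_on ?e (Obj (sheaf_category C J))"
    by (rule inj_onI) (simp add: sheaf_category_def *)
  show "inj_on (\<lambda>t. Tup (Tup (?e (TDom t)) (?e (TCod t))) (Fam (TMap t))) (Arr (sheaf_category C J))"
    by (rule inj_onI, rule trans.equality) (simp_all add: sheaf_category_def *)
qed

definition grothendieck_topos :: "('u::universe large, 'u large) category \<Rightarrow> bool" where
  "grothendieck_topos E \<longleftrightarrow> category E \<and>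
    (\<exists>(C :: ('u, 'u) category) J. small_site C J \<and> equivalent_categories E (sheaf_category C J))"


section \<open>Strict 2-categories\<close>

text \<open>
  \<open>cmp1\<close> is the composition of 1-cells, \<open>vcmp\<close> and \<open>hcmp\<close> are the vertical and the horizontal
  composition of 2-cells, all written in the order of application of functions.  Only the data
  are recorded: the two instances used are the 2-category of Grothendieck topoi, in which
  composition is strictly associative and unital, and its pseudoslices.
\<close>

record ('c, 'f, 't) two_category =
  cells0 :: "'c set"
  cells1 :: "'f set"
  cells2 :: "'t set"
  src :: "'f \<Rightarrow> 'c"
  tgt :: "'f \<Rightarrow> 'c"
  dom2 :: "'t \<Rightarrow> 'f"
  cod2 :: "'t \<Rightarrow> 'f"
  id1 :: "'c \<Rightarrow> 'f"
  id2 :: "'f \<Rightarrow> 't"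
  cmp1 :: "'f \<Rightarrow> 'f \<Rightarrow> 'f"
  vcmp :: "'t \<Rightarrow> 't \<Rightarrow> 't"
  hcmp :: "'t \<Rightarrow> 't \<Rightarrow> 't"

definition hom1 :: "('c, 'f, 't) two_category \<Rightarrow> 'c \<Rightarrow> 'c \<Rightarrow> 'f set" where
  "hom1 K x y = {f \<in> cells1 K. src K f = x \<and> tgt K f = y}"

definition hom2 :: "('c, 'f, 't) two_category \<Rightarrow> 'f \<Rightarrow> 'f \<Rightarrow> 't set" where
  "hom2 K f g = {a \<in> cells2 K. dom2 K a = f \<and> cod2 K a = g}"

definition iso2 :: "('c, 'f, 't) two_category \<Rightarrow> 'f \<Rightarrow> 'f \<Rightarrow> 't set" where
  "iso2 K f g = {a \<in> hom2 K f g. \<exists>b\<in>hom2 K g f. vcmp K b a = id2 K f \<and> vcmp K a b = id2 K g}"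

definition hom_category :: "('c, 'f, 't) two_category \<Rightarrow> 'c \<Rightarrow> 'c \<Rightarrow> ('f, 't) category" where
  "hom_category K x y = \<lparr>
     Obj = hom1 K x y,
     Arr = {a \<in> cells2 K. dom2 K a \<in> hom1 K x y \<and> cod2 K a \<in> hom1 K x y},
     Dom = dom2 K, Cod = cod2 K, Idn = id2 K, Cmp = vcmp K\<rparr>"

abbreviation whisker_left :: "('c, 'f, 't) two_category \<Rightarrow> 'f \<Rightarrow> 't \<Rightarrow> 't" where
  "whisker_left K g a \<equiv> hcmp K (id2 K g) a"

abbreviation whisker_right :: "('c, 'f, 't) two_category \<Rightarrow> 't \<Rightarrow> 'f \<Rightarrow> 't" where
  "whisker_right K a f \<equiv> hcmp K a (id2 K f)"

definition postcompose :: "('c, 'f, 't) two_category \<Rightarrow> 'c \<Rightarrow> 'f \<Rightarrow> ('f, 't, 'f, 't) func" where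
  "postcompose K x p = \<lparr>
     FDom = hom_category K x (src K p),
     FCod = hom_category K x (tgt K p),
     FO = (\<lambda>f\<in>Obj (hom_category K x (src K p)). cmp1 K p f),
     FA = (\<lambda>a\<in>Arr (hom_category K x (src K p)). whisker_left K p a)\<rparr>"

definition equivalent0 :: "('c, 'f, 't) two_category \<Rightarrow> 'c \<Rightarrow> 'c \<Rightarrow> bool" where
  "equivalent0 K x y \<longleftrightarrow> x \<in> cells0 K \<and> y \<in> cells0 K \<and>
    (\<exists>f\<in>hom1 K x y. \<exists>g\<in>hom1 K y x.
      iso2 K (cmp1 K g f) (id1 K x) \<noteq> {} \<and> iso2 K (cmp1 K f g) (id1 K y) \<noteq> {})"


subsection \<open>Pseudoslices\<close>

text \<open>
  A 0-cell over \<open>E\<close> is a 1-cell with target \<open>E\<close>.  A 1-cell from \<open>p\<close> to \<open>q\<close> is a 1-cell \<open>f\<close> of \<open>K\<close>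
  together with an invertible 2-cell \<open>p \<Rightarrow> q f\<close>.
\<close>

record ('f, 't) triangle =
  tri_src :: 'f
  tri_tgt :: 'f
  tri_cell :: 'f
  tri_iso :: 't

definition pseudoslice ::
    "('c, 'f, 't) two_category \<Rightarrow> 'c \<Rightarrow>
     ('f, ('f, 't) triangle, ('f, 't) triangle \<times> ('f, 't) triangle \<times> 't) two_category" where
  "pseudoslice K E = (let
     S0 = {p \<in> cells1 K. tgt K p = E};
     S1 = {m. tri_src m \<in> S0 \<and> tri_tgt m \<in> S0 \<and>
              tri_cell m \<in> hom1 K (src K (tri_src m)) (src K (tri_tgt m)) \<and>
              tri_iso m \<in> iso2 K (tri_src m) (cmp1 K (tri_tgt m) (tri_cell m))};
     S2 = {(m, n, a). m \<in> S1 \<and> n \<in> S1 \<and> tri_src m = tri_src n \<and> tri_tgt m = tri_tgt n \<and>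
              a \<in> hom2 K (tri_cell m) (tri_cell n) \<and>
              vcmp K (whisker_left K (tri_tgt m) a) (tri_iso m) = tri_iso n};
     comp1 = (\<lambda>n m. \<lparr>tri_src = tri_src m, tri_tgt = tri_tgt n,
              tri_cell = cmp1 K (tri_cell n) (tri_cell m),
              tri_iso = vcmp K (whisker_right K (tri_iso n) (tri_cell m)) (tri_iso m)\<rparr>)
   in \<lparr>
     cells0 = S0, cells1 = S1, cells2 = S2,
     src = tri_src, tgt = tri_tgt,
     dom2 = (\<lambda>(m, n, a). m), cod2 = (\<lambda>(m, n, a). n),
     id1 = (\<lambda>p. \<lparr>tri_src = p, tri_tgt = p, tri_cell = id1 K (src K p), tri_iso = id2 K p\<rparr>),
     id2 = (\<lambda>m. (m, m, id2 K (tri_cell m))),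
     cmp1 = comp1,
     vcmp = (\<lambda>(m', n', b) (m, n, a). (m, n', vcmp K b a)),
     hcmp = (\<lambda>(m', n', b) (m, n, a). (comp1 m' m, comp1 n' n, hcmp K b a))\<rparr>)"


subsection \<open>Pseudofunctors on a category, pseudocones and bilimits\<close>

text \<open>
  The unitor at \<open>i\<close> is a 2-cell \<open>id (D i) \<Rightarrow> D (id i)\<close>, the compositor at \<open>v\<close>, \<open>u\<close> is a 2-cell
  \<open>D v D u \<Rightarrow> D (v u)\<close>.
\<close>

record ('i, 'k, 'c, 'f, 't) psfunctor =
  P0 :: "'i \<Rightarrow> 'c"
  P1 :: "'k \<Rightarrow> 'f"
  unitor :: "'i \<Rightarrow> 't"
  compositor :: "'k \<Rightarrow> 'k \<Rightarrow> 't"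

definition pseudofunctor ::
    "('i, 'k) category \<Rightarrow> ('c, 'f, 't) two_category \<Rightarrow> ('i, 'k, 'c, 'f, 't) psfunctor \<Rightarrow> bool" where
  "pseudofunctor I K D \<longleftrightarrow> category I \<and>
    (\<forall>i\<in>Obj I. P0 D i \<in> cells0 K) \<and>
    (\<forall>u\<in>Arr I. P1 D u \<in> hom1 K (P0 D (Dom I u)) (P0 D (Cod I u))) \<and>
    (\<forall>i\<in>Obj I. unitor D i \<in> iso2 K (id1 K (P0 D i)) (P1 D (Idn I i))) \<and>
    (\<forall>u\<in>Arr I. \<forall>v\<in>Arr I. Cod I u = Dom I v \<longrightarrow>
      compositor D v u \<in> iso2 K (cmp1 K (P1 D v) (P1 D u)) (P1 D (Cmp I v u))) \<and>
    (\<forall>u\<in>Arr I. \<forall>v\<in>Arr I. \<forall>w\<in>Arr I. Cod I u = Dom I v \<longrightarrow> Cod I v = Dom I w \<longrightarrow>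
      vcmp K (compositor D w (Cmp I v u)) (whisker_left K (P1 D w) (compositor D v u)) =
      vcmp K (compositor D (Cmp I w v) u) (whisker_right K (compositor D w v) (P1 D u))) \<and>
    (\<forall>u\<in>Arr I.
      vcmp K (compositor D u (Idn I (Dom I u))) (whisker_left K (P1 D u) (unitor D (Dom I u))) =
        id2 K (P1 D u) \<and>
      vcmp K (compositor D (Idn I (Cod I u)) u) (whisker_right K (unitor D (Cod I u)) (P1 D u)) =
        id2 K (P1 D u))"

text \<open>The 2-cell of a pseudocone at \<open>u : i \<rightarrow> j\<close> goes from \<open>D u c\<^sub>i\<close> to \<open>c\<^sub>j\<close>.\<close>

record ('i, 'k, 'f, 't) pscone =
  leg :: "'i \<Rightarrow> 'f"
  leg_iso :: "'k \<Rightarrow> 't"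

definition pseudocone ::
    "('i, 'k) category \<Rightarrow> ('c, 'f, 't) two_category \<Rightarrow> ('i, 'k, 'c, 'f, 't) psfunctor \<Rightarrow> 'c \<Rightarrow>
     ('i, 'k, 'f, 't) pscone \<Rightarrow> bool" where
  "pseudocone I K D X c \<longleftrightarrow>
    leg c \<in> extensional (Obj I) \<and> leg_iso c \<in> extensional (Arr I) \<and>
    (\<forall>i\<in>Obj I. leg c i \<in> hom1 K X (P0 D i)) \<and>
    (\<forall>u\<in>Arr I. leg_iso c u \<in> iso2 K (cmp1 K (P1 D u) (leg c (Dom I u))) (leg c (Cod I u))) \<and>
    (\<forall>i\<in>Obj I. vcmp K (leg_iso c (Idn I i)) (whisker_right K (unitor D i) (leg c i)) =
      id2 K (leg c i)) \<and>
    (\<forall>u\<in>Arr I. \<forall>v\<in>Arr I. Cod I u = Dom I v \<longrightarrow>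
      vcmp K (leg_iso c (Cmp I v u)) (whisker_right K (compositor D v u) (leg c (Dom I u))) =
      vcmp K (leg_iso c v) (whisker_left K (P1 D v) (leg_iso c u)))"

definition pseudocone_category ::
    "('i, 'k) category \<Rightarrow> ('c, 'f, 't) two_category \<Rightarrow> ('i, 'k, 'c, 'f, 't) psfunctor \<Rightarrow> 'c \<Rightarrow>
     (('i, 'k, 'f, 't) pscone, (('i, 'k, 'f, 't) pscone, 'i, 't) trans) category" where
  "pseudocone_category I K D X = \<lparr>
     Obj = {c. pseudocone I K D X c},
     Arr = {m. pseudocone I K D X (TDom m) \<and> pseudocone I K D X (TCod m) \<and>
               TMap m \<in> extensional (Obj I) \<and>
               (\<forall>i\<in>Obj I. TMap m i \<in> hom2 K (leg (TDom m) i) (leg (TCod m) i)) \<and>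
               (\<forall>u\<in>Arr I.
                 vcmp K (leg_iso (TCod m) u) (whisker_left K (P1 D u) (TMap m (Dom I u))) =
                 vcmp K (TMap m (Cod I u)) (leg_iso (TDom m) u))},
     Dom = TDom, Cod = TCod,
     Idn = (\<lambda>c. \<lparr>TDom = c, TCod = c, TMap = (\<lambda>i\<in>Obj I. id2 K (leg c i))\<rparr>),
     Cmp = (\<lambda>n m. \<lparr>TDom = TDom m, TCod = TCod n,
                   TMap = (\<lambda>i\<in>Obj I. vcmp K (TMap n i) (TMap m i))\<rparr>)\<rparr>"

definition restrict_cone ::
    "('i, 'k) category \<Rightarrow> ('c, 'f, 't) two_category \<Rightarrow> ('i, 'k, 'f, 't) pscone \<Rightarrow> 'f \<Rightarrow>
     ('i, 'k, 'f, 't) pscone" where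
  "restrict_cone I K c h = \<lparr>leg = (\<lambda>i\<in>Obj I. cmp1 K (leg c i) h),
     leg_iso = (\<lambda>u\<in>Arr I. whisker_right K (leg_iso c u) h)\<rparr>"

definition cone_comparison ::
    "('i, 'k) category \<Rightarrow> ('c, 'f, 't) two_category \<Rightarrow> ('i, 'k, 'c, 'f, 't) psfunctor \<Rightarrow>
     'c \<Rightarrow> ('i, 'k, 'f, 't) pscone \<Rightarrow> 'c \<Rightarrow>
     ('f, 't, ('i, 'k, 'f, 't) pscone, (('i, 'k, 'f, 't) pscone, 'i, 't) trans) func" where
  "cone_comparison I K D L c X = \<lparr>
     FDom = hom_category K X L,
     FCod = pseudocone_category I K D X,
     FO = (\<lambda>h\<in>Obj (hom_category K X L). restrict_cone I K c h),
     FA = (\<lambda>a\<in>Arr (hom_category K X L).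
       \<lparr>TDom = restrict_cone I K c (dom2 K a), TCod = restrict_cone I K c (cod2 K a),
        TMap = (\<lambda>i\<in>Obj I. whisker_left K (leg c i) a)\<rparr>)\<rparr>"

definition is_bilimit ::
    "('i, 'k) category \<Rightarrow> ('c, 'f, 't) two_category \<Rightarrow> ('i, 'k, 'c, 'f, 't) psfunctor \<Rightarrow>
     'c \<Rightarrow> ('i, 'k, 'f, 't) pscone \<Rightarrow> bool" where
  "is_bilimit I K D L c \<longleftrightarrow> pseudofunctor I K D \<and> L \<in> cells0 K \<and> pseudocone I K D L c \<and>
    (\<forall>X\<in>cells0 K. equivalence_functor (cone_comparison I K D L c X))"


section \<open>The 2-category of Grothendieck topoi\<close>

text \<open>A geometric morphism is given by its inverse image \<open>pull\<close>, its direct image \<open>push\<close> and the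
  unit and counit of the adjunction.\<close>

record 'w geom =
  pull :: "('w, 'w, 'w, 'w) func"
  push :: "('w, 'w, 'w, 'w) func"
  unit :: "'w \<Rightarrow> 'w"
  counit :: "'w \<Rightarrow> 'w"

definition gsrc :: "'w geom \<Rightarrow> ('w, 'w) category" where
  "gsrc f = FCod (pull f)"

definition gtgt :: "'w geom \<Rightarrow> ('w, 'w) category" where
  "gtgt f = FDom (pull f)"

definition geometric_morphism :: "'w geom \<Rightarrow> bool" where
  "geometric_morphism f \<longleftrightarrow>
    is_functor (pull f) \<and> functor_from_to (push f) (gsrc f) (gtgt f) \<and>
    natural (id_func (gtgt f)) (cmp_func (push f) (pull f)) (unit f) \<and>
    natural (cmp_func (pull f) (push f)) (id_func (gsrc f)) (counit f) \<and>
    (\<forall>D\<in>Obj (gtgt f). Cmp (gsrc f) (counit f (FO (pull f) D)) (FA (pull f) (unit f D)) =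
      Idn (gsrc f) (FO (pull f) D)) \<and>
    (\<forall>S\<in>Obj (gsrc f). Cmp (gtgt f) (FA (push f) (counit f S)) (unit f (FO (push f) S)) =
      Idn (gtgt f) (FO (push f) S)) \<and>
    left_exact (pull f)"

definition id_geom :: "('w, 'w) category \<Rightarrow> 'w geom" where
  "id_geom E = \<lparr>pull = id_func E, push = id_func E,
     unit = (\<lambda>D\<in>Obj E. Idn E D), counit = (\<lambda>D\<in>Obj E. Idn E D)\<rparr>"

definition cmp_geom :: "'w geom \<Rightarrow> 'w geom \<Rightarrow> 'w geom" where
  "cmp_geom g f = \<lparr>
     pull = cmp_func (pull f) (pull g),
     push = cmp_func (push g) (push f),
     unit = (\<lambda>D\<in>Obj (gtgt g). Cmp (gtgt g) (FA (push g) (unit f (FO (pull g) D))) (unit g D)),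
     counit = (\<lambda>S\<in>Obj (gsrc f). Cmp (gsrc f) (counit f S) (FA (pull f) (counit g (FO (push f) S))))\<rparr>"

definition GTop ::
    "(('u::universe large, 'u large) category, 'u large geom,
      ('u large geom, 'u large, 'u large) trans) two_category" where
  "GTop = (let
     G1 = {f. geometric_morphism f \<and> grothendieck_topos (gsrc f) \<and> grothendieck_topos (gtgt f)}
   in \<lparr>
     cells0 = {E. grothendieck_topos E},
     cells1 = G1,
     cells2 = {a. TDom a \<in> G1 \<and> TCod a \<in> G1 \<and>
                  natural (pull (TDom a)) (pull (TCod a)) (TMap a)},
     src = gsrc, tgt = gtgt, dom2 = TDom, cod2 = TCod,
     id1 = id_geom,
     id2 = (\<lambda>f. \<lparr>TDom = f, TCod = f, TMap = (\<lambda>D\<in>Obj (gtgt f). Idn (gsrc f) (FO (pull f) D))\<rparr>),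
     cmp1 = cmp_geom,
     vcmp = (\<lambda>b a. \<lparr>TDom = TDom a, TCod = TCod b,
       TMap = (\<lambda>D\<in>Obj (gtgt (TDom a)). Cmp (gsrc (TDom a)) (TMap b D) (TMap a D))\<rparr>),
     hcmp = (\<lambda>b a. \<lparr>TDom = cmp_geom (TDom b) (TDom a), TCod = cmp_geom (TCod b) (TCod a),
       TMap = (\<lambda>D\<in>Obj (gtgt (TDom b)). Cmp (gsrc (TDom a))
         (TMap a (FO (pull (TCod b)) D)) (FA (pull (TDom a)) (TMap b D)))\<rparr>)\<rparr>)"

text \<open>\<open>pt0\<close> and \<open>pt1\<close> are the action of \<open>GTop[Set, -]\<close> on topoi and on geometric morphisms.\<close>

definition pt0 ::
    "('u::universe large, 'u large) category \<Rightarrow>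
     ('u large geom, ('u large geom, 'u large, 'u large) trans) category" where
  "pt0 E = hom_category GTop SetCat E"

definition pt1 ::
    "('u::universe) large geom \<Rightarrow>
     ('u large geom, ('u large geom, 'u large, 'u large) trans,
      'u large geom, ('u large geom, 'u large, 'u large) trans) func" where
  "pt1 p = postcompose GTop SetCat p"


lemma pt1_from_to: "FDom (pt1 p) = pt0 (gsrc p)" "FCod (pt1 p) = pt0 (gtgt p)"
  by (simp_all add: pt1_def pt0_def postcompose_def GTop_def Let_def)


section \<open>Pro-etale geometric morphisms\<close>

text \<open>
  The objects of \<open>slice E A\<close> are the arrows with codomain \<open>A\<close>; the arrow from \<open>y h\<close> to \<open>y\<close> given
  by \<open>h\<close> is encoded as \<open>Tup y h\<close>.
\<close>

definition slice :: "('u large, 'u large) category \<Rightarrow> 'u large \<Rightarrow> ('u large, 'u large) category" where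
  "slice E A = \<lparr>
     Obj = {y \<in> Arr E. Cod E y = A},
     Arr = {Tup y h | y h. y \<in> Arr E \<and> Cod E y = A \<and> h \<in> Arr E \<and> Cod E h = Dom E y},
     Dom = (\<lambda>m. Cmp E (tfst m) (tsnd m)),
     Cod = tfst,
     Idn = (\<lambda>y. Tup y (Idn E (Dom E y))),
     Cmp = (\<lambda>n m. Tup (tfst n) (Cmp E (tsnd n) (tsnd m)))\<rparr>"

definition product_functor ::
    "('u large, 'u large) category \<Rightarrow> 'u large \<Rightarrow> ('u large, 'u large, 'u large, 'u large) func" where
  "product_functor E A = \<lparr>
     FDom = E, FCod = slice E A,
     FO = (\<lambda>X\<in>Obj E. prod_fst E A X),
     FA = (\<lambda>f\<in>Arr E. Tup (prod_fst E A (Cod E f))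
       (THE k. k \<in> homset E (prod_obj E A (Dom E f)) (prod_obj E A (Cod E f)) \<and>
          Cmp E (prod_fst E A (Cod E f)) k = prod_fst E A (Dom E f) \<and>
          Cmp E (prod_snd E A (Cod E f)) k = Cmp E f (prod_snd E A (Dom E f))))\<rparr>"

definition pullback_functor ::
    "('u large, 'u large) category \<Rightarrow> 'u large \<Rightarrow> ('u large, 'u large, 'u large, 'u large) func" where
  "pullback_functor E u = \<lparr>
     FDom = slice E (Cod E u), FCod = slice E (Dom E u),
     FO = (\<lambda>y\<in>Obj (slice E (Cod E u)). pb_fst E u y),
     FA = (\<lambda>m\<in>Arr (slice E (Cod E u)). let y' = Dom (slice E (Cod E u)) m; y = tfst m in
       Tup (pb_fst E u y)
       (THE k. k \<in> homset E (pb_obj E u y') (pb_obj E u y) \<and>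
          Cmp E (pb_fst E u y) k = pb_fst E u y' \<and>
          Cmp E (pb_snd E u y) k = Cmp E (tsnd m) (pb_snd E u y')))\<rparr>"

text \<open>
  \<open>etale_projection E A g\<close>: \<open>g\<close> is the geometric morphism \<open>\<pi>\<^sub>A\<close> from the slice to \<open>E\<close>.  A geometric
  morphism is determined by its inverse image up to unique isomorphism, so the choice of the
  direct image is left open.
\<close>

definition etale_projection ::
    "('u::universe large, 'u large) category \<Rightarrow> 'u large \<Rightarrow> 'u large geom \<Rightarrow> bool" where
  "etale_projection E A g \<longleftrightarrow> g \<in> cells1 GTop \<and> pull g = product_functor E A"

text \<open>
  \<open>etale_transition E u m\<close>: \<open>m\<close> is the 1-cell from \<open>\<pi>\<^sub>A\<close> to \<open>\<pi>\<^sub>B\<close> over \<open>E\<close> induced by \<open>u : A \<rightarrow> B\<close>.  Its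
  inverse image is pullback along \<open>u\<close>; the 2-cell consists of the canonical arrows over \<open>A\<close> from
  \<open>A \<times> X\<close> to the pullback along \<open>u\<close> of \<open>B \<times> X \<rightarrow> B\<close>, which are compatible with the projections to \<open>X\<close>.
\<close>

definition etale_transition ::
    "('u::universe large, 'u large) category \<Rightarrow> 'u large \<Rightarrow>
     ('u large geom, ('u large geom, 'u large, 'u large) trans) triangle \<Rightarrow> bool" where
  "etale_transition E u m \<longleftrightarrow> m \<in> cells1 (pseudoslice GTop E) \<and>
    etale_projection E (Dom E u) (tri_src m) \<and> etale_projection E (Cod E u) (tri_tgt m) \<and>
    pull (tri_cell m) = pullback_functor E u \<and>
    (\<forall>X\<in>Obj E.
      Cmp E (prod_snd E (Cod E u) X)
        (Cmp E (pb_snd E u (prod_fst E (Cod E u) X)) (tsnd (TMap (tri_iso m) X))) =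
      prod_snd E (Dom E u) X)"

text \<open>
  \<open>etale_diagram I e D\<close>: \<open>D\<close> is the composite of \<open>e : I \<rightarrow> E\<close> with the pseudofunctor sending \<open>A\<close> to
  \<open>\<pi>\<^sub>A\<close>.  Its unitors and compositors need not be specified, as parallel 2-cells between 1-cells
  over \<open>E\<close> into some \<open>\<pi>\<^sub>A\<close> are equal.
\<close>

definition etale_diagram ::
    "('u::universe, 'u) category \<Rightarrow> ('u, 'u, 'u large, 'u large) func \<Rightarrow>
     ('u, 'u, 'u large geom,
      ('u large geom, ('u large geom, 'u large, 'u large) trans) triangle,
      ('u large geom, ('u large geom, 'u large, 'u large) trans) triangle \<times>
      ('u large geom, ('u large geom, 'u large, 'u large) trans) triangle \<times>
      ('u large geom, 'u large, 'u large) trans) psfunctor \<Rightarrow> bool" where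
  "etale_diagram I e D \<longleftrightarrow> pseudofunctor I (pseudoslice GTop (FCod e)) D \<and>
    (\<forall>i\<in>Obj I. etale_projection (FCod e) (FO e i) (P0 D i)) \<and>
    (\<forall>u\<in>Arr I. etale_transition (FCod e) (FA e u) (P1 D u))"

definition pro_etale :: "('u::universe) large geom \<Rightarrow> bool" where
  "pro_etale p \<longleftrightarrow> p \<in> cells1 GTop \<and>
    (\<exists>(I :: ('u, 'u) category) e D L c.
      small_category I \<and> cofiltered I \<and> functor_from_to e I (gtgt p) \<and> etale_diagram I e D \<and>
      is_bilimit I (pseudoslice GTop (gtgt p)) D L c \<and>
      equivalent0 (pseudoslice GTop (gtgt p)) p L)"


section \<open>Discrete opfibrations\<close>

definition opcartesian :: "('o, 'a, 'p, 'b) func \<Rightarrow> 'a \<Rightarrow> bool" where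
  "opcartesian P k \<longleftrightarrow> k \<in> Arr (FDom P) \<and>
    (\<forall>h\<in>Arr (FDom P). \<forall>g\<in>Arr (FCod P).
      Dom (FDom P) h = Dom (FDom P) k \<and>
      g \<in> homset (FCod P) (FO P (Cod (FDom P) k)) (FO P (Cod (FDom P) h)) \<and>
      Cmp (FCod P) g (FA P k) = FA P h \<longrightarrow>
      (\<exists>!x. x \<in> homset (FDom P) (Cod (FDom P) k) (Cod (FDom P) h) \<and>
        Cmp (FDom P) x k = h \<and> FA P x = g))"

text \<open>Opcartesian lifts are only demanded up to an isomorphism in the base.\<close>

definition opfibration :: "('o, 'a, 'p, 'b) func \<Rightarrow> bool" where
  "opfibration P \<longleftrightarrow> is_functor P \<and>
    (\<forall>a\<in>Obj (FDom P). \<forall>f\<in>Arr (FCod P). Dom (FCod P) f = FO P a \<longrightarrow>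
      (\<exists>k s. opcartesian P k \<and> Dom (FDom P) k = a \<and> iso_arr (FCod P) s \<and>
        s \<in> homset (FCod P) (FO P (Cod (FDom P) k)) (Cod (FCod P) f) \<and>
        Cmp (FCod P) s (FA P k) = f))"

definition fiber ::
    "('o, 'a, 'p, 'b) func \<Rightarrow> 'p \<Rightarrow> ('o \<times> 'b, ('o \<times> 'b) \<times> ('o \<times> 'b) \<times> 'a) category" where
  "fiber P b = (let
     Ob = {(a, s). a \<in> Obj (FDom P) \<and> iso_arr (FCod P) s \<and> s \<in> homset (FCod P) (FO P a) b}
   in \<lparr>
     Obj = Ob,
     Arr = {((a, s), (a', s'), k). (a, s) \<in> Ob \<and> (a', s') \<in> Ob \<and>
              k \<in> homset (FDom P) a a' \<and> Cmp (FCod P) s' (FA P k) = s},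
     Dom = (\<lambda>(x, y, k). x),
     Cod = (\<lambda>(x, y, k). y),
     Idn = (\<lambda>x. (x, x, Idn (FDom P) (fst x))),
     Cmp = (\<lambda>(y', z, l) (x, y, k). (x, z, Cmp (FDom P) l k))\<rparr>)"

text \<open>
  If the fiber is equivalent to any discrete category, it is equivalent to one of the same type,
  with one object from every isomorphism class.
\<close>

definition discrete_opfibration :: "('o, 'a, 'p, 'b) func \<Rightarrow> bool" where
  "discrete_opfibration P \<longleftrightarrow> opfibration P \<and>
    (\<forall>b\<in>Obj (FCod P).
      \<exists>D :: ('o \<times> 'b, ('o \<times> 'b) \<times> ('o \<times> 'b) \<times> 'a) category.
        discrete_category D \<and> equivalent_categories (fiber P b) D)"

end

theory Submission
  imports Defs
begin

text \<open>
  A point of the slice over \<open>A\<close> is a point \<open>Z\<close> of \<open>E\<close> with an element of \<open>Z A\<close>; as an arrow of points acts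
  on these elements, \<open>\<pi>\<^sub>A\<close> induces a discrete opfibration on points.  A point of the bilimit is a compatible
  family of points of the slices, by its universal property applied to the topos of sets.  Arrows between points are
  lifted by applying that property to the Sierpinski topos, the geometric morphisms out of which are the arrows of
  points.  Being a discrete opfibration is finally transferred along the equivalence over \<open>E\<close>.
\<close>

section \<open>Categories, functors and natural transformations\<close>

text \<open>The universal property lives in the pseudoslice over \<open>E\<close>, whose 2-cells
  respect the triangles over \<open>E\<close>. Tested on the topos of sets it sees only arrows of
  points over a given isomorphism of points of \<open>E\<close>, whereas an opfibration concerns
  arrows over arbitrary ones. An arbitrary arrow of points of \<open>E\<close> becomes a single
  object of the pseudoslice once it is read as a geometric morphism from the Sierpinski topos. Hence
  that topos has to be exhibited in the universe of \<open>GTop\<close>, with both evaluations as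
  inverse images. Coherence is automatic: every object of the slice over \<open>A\<close> embeds
  into some \<open>A\<close> times \<open>D\<close>, left exact functors preserve the embedding, and
  so parallel 2-cells over \<open>E\<close> into an etale projection are equal. Arguments are about
  inverse images only. A geometric morphism is recovered from a left exact functor with a universal
  arrow at each object, so direct images appear only at the boundary with \<open>GTop\<close>.
  Likewise the three properties in \<open>discof\<close>, rather than the definition of a discrete
  opfibration, are moved around.\<close>

lemma mem_homset: "f \<in> homset C x y \<longleftrightarrow> f \<in> Arr C \<and> Dom C f = x \<and> Cod C f = y"
  by (auto simp: homset_def)

text \<open>Composability, and the object in the identity laws, are separate equations, so that the
  laws apply when the objects agree only provably.\<close>

lemma
  assumes "category C"
  shows Dom_Obj: "f \<in> Arr C \<Longrightarrow> Dom C f \<in> Obj C"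
    and Cod_Obj: "f \<in> Arr C \<Longrightarrow> Cod C f \<in> Obj C"
    and Idn_Arr: "x \<in> Obj C \<Longrightarrow> Idn C x \<in> Arr C"
    and Dom_Idn: "x \<in> Obj C \<Longrightarrow> Dom C (Idn C x) = x"
    and Cod_Idn: "x \<in> Obj C \<Longrightarrow> Cod C (Idn C x) = x"
    and Cmp_Arr: "f \<in> Arr C \<Longrightarrow> g \<in> Arr C \<Longrightarrow> Cod C f = Dom C g \<Longrightarrow> Cmp C g f \<in> Arr C"
    and Dom_Cmp: "f \<in> Arr C \<Longrightarrow> g \<in> Arr C \<Longrightarrow> Cod C f = Dom C g \<Longrightarrow> Dom C (Cmp C g f) = Dom C f"
    and Cod_Cmp: "f \<in> Arr C \<Longrightarrow> g \<in> Arr C \<Longrightarrow> Cod C f = Dom C g \<Longrightarrow> Cod C (Cmp C g f) = Cod C g"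
    and Cmp_Idn_right: "f \<in> Arr C \<Longrightarrow> Dom C f = x \<Longrightarrow> Cmp C f (Idn C x) = f"
    and Cmp_Idn_left: "f \<in> Arr C \<Longrightarrow> Cod C f = x \<Longrightarrow> Cmp C (Idn C x) f = f"
    and Cmp_assoc: "f \<in> Arr C \<Longrightarrow> g \<in> Arr C \<Longrightarrow> h \<in> Arr C \<Longrightarrow> Cod C f = Dom C g \<Longrightarrow>
      Cod C g = Dom C h \<Longrightarrow> Cmp C (Cmp C h g) f = Cmp C h (Cmp C g f)"
  using assms by (auto simp: category_def mem_homset)

lemmas cat_simps = Dom_Obj Cod_Obj Idn_Arr Dom_Idn Cod_Idn Cmp_Arr Dom_Cmp Cod_Cmp
  Cmp_Idn_right Cmp_Idn_left Cmp_assoc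

text \<open>Composites are kept nested to the right, where an equation between binary composites is
  no longer visible inside a longer one. This is the equation with a further arrow \<open>r\<close>
  applied before it.\<close>

lemma Cmp_eq_prefix:
  assumes "category C" "Cmp C a b = Cmp C c d"
    and "a \<in> Arr C" "b \<in> Arr C" "c \<in> Arr C" "d \<in> Arr C" "r \<in> Arr C"
    and "Cod C b = Dom C a" "Cod C d = Dom C c" "Cod C r = Dom C b" "Cod C r = Dom C d"
  shows "Cmp C a (Cmp C b r) = Cmp C c (Cmp C d r)"
  using assms Cmp_assoc[OF assms(1)] by metis

lemma Cmp_eq_prefix1:
  assumes "category C" "Cmp C a b = c"
    and "a \<in> Arr C" "b \<in> Arr C" "r \<in> Arr C" "Cod C b = Dom C a" "Cod C r = Dom C b"
  shows "Cmp C a (Cmp C b r) = Cmp C c r"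
  using assms Cmp_assoc[OF assms(1)] by metis

section \<open>Functors between given categories\<close>

lemma
  assumes "functor_from_to F C D"
  shows functor_category_dom: "category C" and functor_category_cod: "category D"
    and FDom_eq: "FDom F = C" and FCod_eq: "FCod F = D"
    and FO_Obj: "x \<in> Obj C \<Longrightarrow> FO F x \<in> Obj D"
    and FA_Arr: "f \<in> Arr C \<Longrightarrow> FA F f \<in> Arr D"
    and FA_Dom: "f \<in> Arr C \<Longrightarrow> Dom D (FA F f) = FO F (Dom C f)"
    and FA_Cod: "f \<in> Arr C \<Longrightarrow> Cod D (FA F f) = FO F (Cod C f)"
    and FA_Idn: "x \<in> Obj C \<Longrightarrow> FA F (Idn C x) = Idn D (FO F x)"
    and FA_Cmp: "f \<in> Arr C \<Longrightarrow> g \<in> Arr C \<Longrightarrow> Cod C f = Dom C g \<Longrightarrow>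
      FA F (Cmp C g f) = Cmp D (FA F g) (FA F f)"
  using assms by (auto simp: functor_from_to_def is_functor_def mem_homset)

lemmas functor_simps = FDom_eq FCod_eq FO_Obj FA_Arr FA_Dom FA_Cod FA_Idn FA_Cmp

lemma functor_ext: "functor_from_to F C D \<Longrightarrow> FO F \<in> extensional (Obj C) \<and> FA F \<in> extensional (Arr C)"
  by (auto simp: functor_from_to_def is_functor_def PiE_iff)

lemma functorI:
  assumes "category C" "category D" "FDom F = C" "FCod F = D"
    and "FO F \<in> extensional (Obj C)" "FA F \<in> extensional (Arr C)"
    and "\<And>x. x \<in> Obj C \<Longrightarrow> FO F x \<in> Obj D"
    and "\<And>f. f \<in> Arr C \<Longrightarrow> FA F f \<in> Arr D"
    and "\<And>f. f \<in> Arr C \<Longrightarrow> Dom D (FA F f) = FO F (Dom C f)"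
    and "\<And>f. f \<in> Arr C \<Longrightarrow> Cod D (FA F f) = FO F (Cod C f)"
    and "\<And>x. x \<in> Obj C \<Longrightarrow> FA F (Idn C x) = Idn D (FO F x)"
    and "\<And>f g. f \<in> Arr C \<Longrightarrow> g \<in> Arr C \<Longrightarrow> Cod C f = Dom C g \<Longrightarrow>
      FA F (Cmp C g f) = Cmp D (FA F g) (FA F f)"
  shows "functor_from_to F C D"
  using assms by (auto simp: functor_from_to_def is_functor_def mem_homset PiE_iff)

lemma functor_eqI:
  assumes "functor_from_to F C D" "functor_from_to G C D"
    and "\<And>x. x \<in> Obj C \<Longrightarrow> FO F x = FO G x" "\<And>f. f \<in> Arr C \<Longrightarrow> FA F f = FA G f"
  shows "F = G"
proof (rule func.equality)
  show "FO F = FO G" "FA F = FA G"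
    using assms functor_ext[OF assms(1)] functor_ext[OF assms(2)] by (auto intro: extensionalityI)
qed (use assms in \<open>auto simp: functor_from_to_def\<close>)

lemma cmp_func_simps:
  "FDom (cmp_func G F) = FDom F" "FCod (cmp_func G F) = FCod G"
  "x \<in> Obj (FDom F) \<Longrightarrow> FO (cmp_func G F) x = FO G (FO F x)"
  "f \<in> Arr (FDom F) \<Longrightarrow> FA (cmp_func G F) f = FA G (FA F f)"
  by (simp_all add: cmp_func_def compose_def)

lemma functor_cmp:
  assumes F: "functor_from_to F C D" and G: "functor_from_to G D E"
  shows "functor_from_to (cmp_func G F) C E"
proof -
  note [simp] = functor_simps[OF F] functor_simps[OF G] cmp_func_simps
    cat_simps[OF functor_category_dom[OF F]]
  show ?thesis
    by (rule functorI)
      (use F G in \<open>auto simp: functor_category_dom functor_category_cod, simp_all add: cmp_func_def compose_def\<close>)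
qed

lemma functor_id: "category C \<Longrightarrow> functor_from_to (id_func C) C C"
  by (rule functorI) (auto simp: id_func_def cat_simps)

lemma id_func_simps:
  "FDom (id_func C) = C" "FCod (id_func C) = C"
  "x \<in> Obj C \<Longrightarrow> FO (id_func C) x = x" "f \<in> Arr C \<Longrightarrow> FA (id_func C) f = f"
  by (simp_all add: id_func_def)

lemma cmp_func_assoc:
  assumes F: "functor_from_to F A B" and G: "functor_from_to G B C" and H: "functor_from_to H C D"
  shows "cmp_func H (cmp_func G F) = cmp_func (cmp_func H G) F"
  by (rule functor_eqI[OF functor_cmp[OF functor_cmp[OF F G] H] functor_cmp[OF F functor_cmp[OF G H]]])
    (simp_all add: cmp_func_simps functor_simps[OF F] functor_simps[OF G])

lemma cmp_func_id:
  assumes F: "functor_from_to F A B"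
  shows "cmp_func F (id_func A) = F" "cmp_func (id_func B) F = F"
proof -
  note C = functor_category_dom[OF F] and D = functor_category_cod[OF F]
  show "cmp_func F (id_func A) = F"
    by (rule functor_eqI[OF functor_cmp[OF functor_id[OF C] F] F])
      (simp_all add: cmp_func_simps functor_simps[OF F] id_func_simps)
  show "cmp_func (id_func B) F = F"
    by (rule functor_eqI[OF functor_cmp[OF F functor_id[OF D]] F])
      (simp_all add: cmp_func_simps functor_simps[OF F] id_func_simps)
qed

text \<open>Naturality with source and target categories as parameters: facts about components then
  mention \<open>C\<close> and \<open>D\<close> instead of the fields of \<open>F\<close>.\<close>

definition ntrans ::
    "('o, 'a) category \<Rightarrow> ('p, 'b) category \<Rightarrow> ('o, 'a, 'p, 'b) func \<Rightarrow> ('o, 'a, 'p, 'b) func \<Rightarrow>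
     ('o \<Rightarrow> 'b) \<Rightarrow> bool" where
  "ntrans C D F G t \<longleftrightarrow> functor_from_to F C D \<and> functor_from_to G C D \<and> natural F G t"

lemma
  assumes "ntrans C D F G t"
  shows ntrans_dom: "functor_from_to F C D" and ntrans_cod: "functor_from_to G C D"
    and ntrans_Arr: "x \<in> Obj C \<Longrightarrow> t x \<in> Arr D"
    and ntrans_Dom: "x \<in> Obj C \<Longrightarrow> Dom D (t x) = FO F x"
    and ntrans_Cod: "x \<in> Obj C \<Longrightarrow> Cod D (t x) = FO G x"
    and ntrans_sq: "f \<in> Arr C \<Longrightarrow> Cmp D (t (Cod C f)) (FA F f) = Cmp D (FA G f) (t (Dom C f))"
    and ntrans_ext: "t \<in> extensional (Obj C)"
  using assms by (auto simp: ntrans_def natural_def functor_from_to_def mem_homset)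

lemmas ntrans_simps = ntrans_Arr ntrans_Dom ntrans_Cod

lemma ntransI:
  assumes "functor_from_to F C D" "functor_from_to G C D" "t \<in> extensional (Obj C)"
    and "\<And>x. x \<in> Obj C \<Longrightarrow> t x \<in> Arr D"
    and "\<And>x. x \<in> Obj C \<Longrightarrow> Dom D (t x) = FO F x"
    and "\<And>x. x \<in> Obj C \<Longrightarrow> Cod D (t x) = FO G x"
    and "\<And>f. f \<in> Arr C \<Longrightarrow> Cmp D (t (Cod C f)) (FA F f) = Cmp D (FA G f) (t (Dom C f))"
  shows "ntrans C D F G t"
  using assms by (auto simp: ntrans_def natural_def functor_from_to_def mem_homset)

lemma ntrans_sq_prefix:
  assumes t: "ntrans C D F G t" and f: "f \<in> Arr C" and r: "r \<in> Arr D" "Cod D r = FO F (Dom C f)"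
  shows "Cmp D (t (Cod C f)) (Cmp D (FA F f) r) = Cmp D (FA G f) (Cmp D (t (Dom C f)) r)"
proof -
  note F = ntrans_dom[OF t] and G = ntrans_cod[OF t]
  show ?thesis
    by (rule Cmp_eq_prefix[OF functor_category_cod[OF F] ntrans_sq[OF t f]])
      (use f r in \<open>simp_all add: ntrans_simps[OF t] functor_simps[OF F] functor_simps[OF G]
        cat_simps[OF functor_category_dom[OF F]]\<close>)
qed

lemma natural_iff_ntrans: "natural F G t \<longleftrightarrow> ntrans (FDom F) (FCod F) F G t"
  by (auto simp: ntrans_def natural_def functor_from_to_def)

lemma ntrans_id: "functor_from_to F C D \<Longrightarrow> ntrans C D F F (\<lambda>x\<in>Obj C. Idn D (FO F x))"
  by (frule functor_category_dom, frule functor_category_cod, rule ntransI)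
    (auto simp: functor_simps cat_simps)

lemma ntrans_vcmp:
  assumes t: "ntrans C D F G t" and s: "ntrans C D G H s"
  shows "ntrans C D F H (\<lambda>x\<in>Obj C. Cmp D (s x) (t x))"
proof -
  note F = ntrans_dom[OF t] and G = ntrans_cod[OF t] and H = ntrans_cod[OF s]
  note C = functor_category_dom[OF F] and D = functor_category_cod[OF F]
  note [simp] = ntrans_simps[OF t] ntrans_simps[OF s] functor_simps[OF F] functor_simps[OF G]
    functor_simps[OF H] cat_simps[OF C] cat_simps[OF D]
  show ?thesis
  proof (rule ntransI[OF F H])
    fix f assume f: "f \<in> Arr C"
    have "Cmp D (s (Cod C f)) (Cmp D (t (Cod C f)) (FA F f)) =
        Cmp D (FA H f) (Cmp D (s (Dom C f)) (t (Dom C f)))"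
      using f ntrans_sq_prefix[OF s f, of "t (Dom C f)"] by (simp add: ntrans_sq[OF t])
    then show "Cmp D ((\<lambda>x\<in>Obj C. Cmp D (s x) (t x)) (Cod C f)) (FA F f) =
        Cmp D (FA H f) ((\<lambda>x\<in>Obj C. Cmp D (s x) (t x)) (Dom C f))"
      using f by simp
  qed auto
qed

lemma ntrans_whisker:
  assumes t: "ntrans C D F G t" and H: "functor_from_to H B C"
  shows "ntrans B D (cmp_func F H) (cmp_func G H) (\<lambda>x\<in>Obj B. t (FO H x))"
proof -
  note F = ntrans_dom[OF t] and G = ntrans_cod[OF t]
  note [simp] = functor_simps[OF H] ntrans_simps[OF t] cmp_func_simps
    cat_simps[OF functor_category_dom[OF H]]
  have "Cmp D (t (FO H (Cod B f))) (FA F (FA H f)) = Cmp D (FA G (FA H f)) (t (FO H (Dom B f)))"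
    if "f \<in> Arr B" for f
    using ntrans_sq[OF t, of "FA H f"] that by simp
  then show ?thesis
    by (intro ntransI functor_cmp[OF H] F G) auto
qed

lemma ntrans_postwhisker:
  assumes t: "ntrans C D F G t" and K: "functor_from_to K D E"
  shows "ntrans C E (cmp_func K F) (cmp_func K G) (\<lambda>x\<in>Obj C. FA K (t x))"
proof -
  note F = ntrans_dom[OF t] and G = ntrans_cod[OF t]
  note [simp] = functor_simps[OF F] functor_simps[OF G] functor_simps[OF K] ntrans_simps[OF t]
    cmp_func_simps cat_simps[OF functor_category_dom[OF F]]
  have "Cmp E (FA K (t (Cod C f))) (FA K (FA F f)) = Cmp E (FA K (FA G f)) (FA K (t (Dom C f)))"
    if "f \<in> Arr C" for f
    using ntrans_sq[OF t that] FA_Cmp[OF K, of "FA F f" "t (Cod C f)"]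
      FA_Cmp[OF K, of "t (Dom C f)" "FA G f"] that by simp
  then show ?thesis
    by (intro ntransI functor_cmp[OF _ K] F G) auto
qed

lemma ntrans_eqI:
  assumes "ntrans C D F G t" "ntrans C D F' G' s" "\<And>x. x \<in> Obj C \<Longrightarrow> t x = s x"
  shows "t = s"
  using ntrans_ext[OF assms(1)] ntrans_ext[OF assms(2)] assms(3) by (rule extensionalityI)

section \<open>Isomorphisms and invertible transformations\<close>

definition inv_arr :: "('o, 'a) category \<Rightarrow> 'a \<Rightarrow> 'a" where
  "inv_arr C f = (SOME g. g \<in> Arr C \<and> Dom C g = Cod C f \<and> Cod C g = Dom C f \<and>
      Cmp C g f = Idn C (Dom C f) \<and> Cmp C f g = Idn C (Cod C f))"

lemma
  assumes "iso_arr C f"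
  shows iso_Arr: "f \<in> Arr C" and inv_Arr: "inv_arr C f \<in> Arr C"
    and inv_Dom: "Dom C (inv_arr C f) = Cod C f" and inv_Cod: "Cod C (inv_arr C f) = Dom C f"
    and inv_left: "Cmp C (inv_arr C f) f = Idn C (Dom C f)"
    and inv_right: "Cmp C f (inv_arr C f) = Idn C (Cod C f)"
proof -
  have "\<exists>g. g \<in> Arr C \<and> Dom C g = Cod C f \<and> Cod C g = Dom C f \<and>
      Cmp C g f = Idn C (Dom C f) \<and> Cmp C f g = Idn C (Cod C f)"
    using assms by (auto simp: iso_arr_def mem_homset)
  from someI_ex[OF this] show "inv_arr C f \<in> Arr C" "Dom C (inv_arr C f) = Cod C f"
      "Cod C (inv_arr C f) = Dom C f" "Cmp C (inv_arr C f) f = Idn C (Dom C f)"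
      "Cmp C f (inv_arr C f) = Idn C (Cod C f)"
    by (simp_all add: inv_arr_def)
  show "f \<in> Arr C" using assms by (simp add: iso_arr_def)
qed

lemmas inv_simps = inv_Arr inv_Dom inv_Cod inv_left inv_right

lemma iso_arrI:
  assumes "f \<in> Arr C" "g \<in> Arr C" "Dom C g = Cod C f" "Cod C g = Dom C f"
    "Cmp C g f = Idn C (Dom C f)" "Cmp C f g = Idn C (Cod C f)"
  shows "iso_arr C f"
  using assms by (auto simp: iso_arr_def mem_homset)

lemma iso_inv: "iso_arr C f \<Longrightarrow> iso_arr C (inv_arr C f)"
  by (rule iso_arrI[of _ _ f]) (simp_all add: inv_simps iso_Arr)

lemma iso_Idn: "category C \<Longrightarrow> x \<in> Obj C \<Longrightarrow> iso_arr C (Idn C x)"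
  by (rule iso_arrI[of _ _ "Idn C x"]) (simp_all add: cat_simps)

lemma Cmp_inv_left:
  assumes "category C" "iso_arr C f" "r \<in> Arr C" "Cod C r = Dom C f"
  shows "Cmp C (inv_arr C f) (Cmp C f r) = r"
  using Cmp_assoc[OF assms(1), of r f "inv_arr C f"] assms
  by (simp add: inv_simps iso_Arr cat_simps)

lemma Cmp_inv_right:
  assumes "category C" "iso_arr C f" "r \<in> Arr C" "Cod C r = Cod C f"
  shows "Cmp C f (Cmp C (inv_arr C f) r) = r"
  using Cmp_assoc[OF assms(1), of r "inv_arr C f" f] assms
  by (simp add: inv_simps iso_Arr cat_simps)

lemma iso_cancel_right:
  assumes C: "category C" and f: "iso_arr C f" and "a \<in> Arr C" "b \<in> Arr C"
    and "Dom C a = Cod C f" "Dom C b = Cod C f" and e: "Cmp C a f = Cmp C b f"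
  shows "a = b"
proof -
  have "Cmp C (Cmp C a f) (inv_arr C f) = a" "Cmp C (Cmp C b f) (inv_arr C f) = b"
    using assms(3-6) by (simp_all add: cat_simps[OF C] inv_simps[OF f] iso_Arr[OF f])
  with e show ?thesis by metis
qed

lemma iso_cancel_left:
  assumes C: "category C" and f: "iso_arr C f" and "a \<in> Arr C" "b \<in> Arr C"
    and "Cod C a = Dom C f" "Cod C b = Dom C f" and e: "Cmp C f a = Cmp C f b"
  shows "a = b"
  by (metis assms Cmp_inv_left)

lemma iso_Cmp:
  assumes C: "category C" and f: "iso_arr C f" and g: "iso_arr C g" and fg: "Cod C f = Dom C g"
  shows "iso_arr C (Cmp C g f)"
proof (rule iso_arrI[of _ _ "Cmp C (inv_arr C f) (inv_arr C g)"])
  note [simp] = cat_simps[OF C] inv_simps[OF f] inv_simps[OF g] iso_Arr[OF f] iso_Arr[OF g] fg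
  show "Cmp C (Cmp C (inv_arr C f) (inv_arr C g)) (Cmp C g f) = Idn C (Dom C (Cmp C g f))"
    using Cmp_inv_left[OF C g, of f] by simp
  show "Cmp C (Cmp C g f) (Cmp C (inv_arr C f) (inv_arr C g)) = Idn C (Cod C (Cmp C g f))"
    using Cmp_inv_right[OF C f, of "inv_arr C g"] by simp
qed (simp_all add: cat_simps[OF C] inv_simps[OF f] inv_simps[OF g] iso_Arr[OF f] iso_Arr[OF g] fg)

lemma iso_FA:
  assumes F: "functor_from_to F C D" and f: "iso_arr C f"
  shows "iso_arr D (FA F f)"
proof (rule iso_arrI[of _ _ "FA F (inv_arr C f)"])
  note [simp] = functor_simps[OF F] inv_simps[OF f] iso_Arr[OF f]
    cat_simps[OF functor_category_dom[OF F]]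
  show "Cmp D (FA F (inv_arr C f)) (FA F f) = Idn D (Dom D (FA F f))"
    using FA_Cmp[OF F, of f "inv_arr C f"] by simp
  show "Cmp D (FA F f) (FA F (inv_arr C f)) = Idn D (Cod D (FA F f))"
    using FA_Cmp[OF F, of "inv_arr C f" f] by simp
qed (simp_all add: functor_simps[OF F] inv_simps[OF f] iso_Arr[OF f])

lemma ntrans_inv:
  assumes t: "ntrans C D F G t" and i: "\<And>x. x \<in> Obj C \<Longrightarrow> iso_arr D (t x)"
  shows "ntrans C D G F (\<lambda>x\<in>Obj C. inv_arr D (t x))"
proof -
  note F = ntrans_dom[OF t] and G = ntrans_cod[OF t]
  note C = functor_category_dom[OF F] and D = functor_category_cod[OF F]
  note [simp] = ntrans_simps[OF t] functor_simps[OF F] functor_simps[OF G] cat_simps[OF C]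
    cat_simps[OF D] inv_simps[OF i]
  show ?thesis
  proof (rule ntransI[OF G F])
    fix f assume f: "f \<in> Arr C"
    let ?s = "inv_arr D (t (Cod C f))" and ?r = "inv_arr D (t (Dom C f))"
    have "Cmp D ?s (FA G f) = Cmp D ?s (Cmp D (FA G f) (Cmp D (t (Dom C f)) ?r))"
      using f by simp
    also have "\<dots> = Cmp D ?s (Cmp D (t (Cod C f)) (Cmp D (FA F f) ?r))"
      using f ntrans_sq_prefix[OF t f, of ?r] by simp
    also have "\<dots> = Cmp D (FA F f) ?r"
      using f by (intro Cmp_inv_left[OF D i]) simp_all
    finally show "Cmp D ((\<lambda>x\<in>Obj C. inv_arr D (t x)) (Cod C f)) (FA G f) =
        Cmp D (FA F f) ((\<lambda>x\<in>Obj C. inv_arr D (t x)) (Dom C f))"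
      using f by simp
  qed auto
qed

definition ntiso ::
    "('o, 'a) category \<Rightarrow> ('p, 'b) category \<Rightarrow> ('o, 'a, 'p, 'b) func \<Rightarrow> ('o, 'a, 'p, 'b) func \<Rightarrow>
     ('o \<Rightarrow> 'b) \<Rightarrow> bool" where
  "ntiso C D F G t \<longleftrightarrow> ntrans C D F G t \<and> (\<forall>x\<in>Obj C. iso_arr D (t x))"

lemma natural_iso_iff_ntiso: "natural_iso F G t \<longleftrightarrow> ntiso (FDom F) (FCod F) F G t"
  by (simp add: natural_iso_def ntiso_def natural_iff_ntrans)

lemma ntiso_ntrans: "ntiso C D F G t \<Longrightarrow> ntrans C D F G t"
  and ntiso_iso: "ntiso C D F G t \<Longrightarrow> x \<in> Obj C \<Longrightarrow> iso_arr D (t x)"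
  by (auto simp: ntiso_def)

lemma ntiso_inv: "ntiso C D F G t \<Longrightarrow> ntiso C D G F (\<lambda>x\<in>Obj C. inv_arr D (t x))"
  by (simp add: ntiso_def ntrans_inv iso_inv)

lemma ntiso_id: "functor_from_to F C D \<Longrightarrow> ntiso C D F F (\<lambda>x\<in>Obj C. Idn D (FO F x))"
  by (simp add: ntiso_def ntrans_id iso_Idn functor_category_cod FO_Obj)

lemma ntiso_vcmp:
  assumes "ntiso C D F G t" "ntiso C D G H s"
  shows "ntiso C D F H (\<lambda>x\<in>Obj C. Cmp D (s x) (t x))"
  using assms ntrans_vcmp[of C D F G t H s] functor_category_cod[OF ntrans_dom, OF ntiso_ntrans, OF assms(1)]
  by (auto simp: ntiso_def ntrans_simps intro!: iso_Cmp)

lemma ntiso_postwhisker: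
  assumes "ntiso C D F G t" "functor_from_to K D E"
  shows "ntiso C E (cmp_func K F) (cmp_func K G) (\<lambda>x\<in>Obj C. FA K (t x))"
  using assms ntrans_postwhisker[of C D F G t K E] by (simp add: ntiso_def iso_FA)

section \<open>Equivalences of categories\<close>

lemma equivalence_functor_ess_surj:
  assumes F: "functor_from_to F C D" and eq: "equivalence_functor F" and y: "y \<in> Obj D"
  obtains x s where "x \<in> Obj C" "s \<in> Arr D" "Dom D s = FO F x" "Cod D s = y" "iso_arr D s"
proof -
  obtain G t where G: "functor_from_to G D C" and t: "natural_iso (cmp_func F G) (id_func D) t"
    using eq F by (auto simp: equivalence_functor_def functor_from_to_def)
  have t: "ntiso D D (cmp_func F G) (id_func D) t"
    using t F G by (simp add: natural_iso_iff_ntiso cmp_func_simps functor_simps)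
  note t' = ntrans_simps[OF ntiso_ntrans[OF t] y]
  show ?thesis
    using t' y G ntiso_iso[OF t y] functor_simps[OF G]
    by (intro that[of "FO G y" "t y"]) (simp_all add: cmp_func_simps id_func_simps)
qed

text \<open>Naturality of \<open>s\<close> from \<open>G F\<close> to the identity expresses
  \<open>f\<close> after the invertible \<open>s (Dom C f)\<close> through \<open>G (F f)\<close>,
  so \<open>F f\<close> determines \<open>f\<close>.\<close>

lemma equivalence_functor_faithful:
  assumes F: "functor_from_to F C D" and eq: "equivalence_functor F"
    and f: "f \<in> Arr C" "g \<in> Arr C" "Dom C f = Dom C g" "Cod C f = Cod C g" and e: "FA F f = FA F g"
  shows "f = g"
proof -
  obtain G s where G: "functor_from_to G D C" and s: "natural_iso (cmp_func G F) (id_func C) s"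
    using eq F by (auto simp: equivalence_functor_def functor_from_to_def)
  have s: "ntiso C C (cmp_func G F) (id_func C) s"
    using s F G by (simp add: natural_iso_iff_ntiso cmp_func_simps functor_simps)
  note C = functor_category_dom[OF F] and t = ntiso_ntrans[OF s]
  note [simp] = ntrans_simps[OF t] cmp_func_simps id_func_simps functor_simps[OF F]
    functor_simps[OF G] cat_simps[OF C]
  have "Cmp C f (s (Dom C f)) = Cmp C g (s (Dom C f))"
    using ntrans_sq[OF t f(1)] ntrans_sq[OF t f(2)] f e by simp
  then show ?thesis
    by (rule iso_cancel_right[OF C ntiso_iso[OF s, of "Dom C f"], rotated -1]) (use f in simp_all)
qed

text \<open>Conjugating \<open>FA G h\<close> by \<open>s\<close> gives the candidate
  \<open>f\<close>. Then \<open>G\<close> identifies \<open>FA F f\<close> with \<open>h\<close>,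
  and \<open>G\<close>, being an equivalence too, is faithful.\<close>

lemma equivalence_functor_full:
  assumes F: "functor_from_to F C D" and eq: "equivalence_functor F"
    and x: "x \<in> Obj C" "y \<in> Obj C" and h: "h \<in> Arr D" "Dom D h = FO F x" "Cod D h = FO F y"
  obtains f where "f \<in> Arr C" "Dom C f = x" "Cod C f = y" "FA F f = h"
proof -
  obtain G s t where G: "functor_from_to G D C" and s: "natural_iso (cmp_func G F) (id_func C) s"
    and eqG: "natural_iso (cmp_func F G) (id_func D) t"
    using eq F by (auto simp: equivalence_functor_def functor_from_to_def)
  have eG: "equivalence_functor G"
    unfolding equivalence_functor_def using G F s eqG
    by (auto simp: functor_from_to_def)
  have s: "ntiso C C (cmp_func G F) (id_func C) s"
    using s F G by (simp add: natural_iso_iff_ntiso cmp_func_simps functor_simps)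
  note C = functor_category_dom[OF F] and t = ntiso_ntrans[OF s]
  note [simp] = ntrans_simps[OF t] cmp_func_simps id_func_simps functor_simps[OF F]
    functor_simps[OF G] cat_simps[OF C] inv_simps[OF ntiso_iso[OF s]]
  define f where "f = Cmp C (s y) (Cmp C (FA G h) (inv_arr C (s x)))"
  have f: "f \<in> Arr C" "Dom C f = x" "Cod C f = y"
    using x h by (simp_all add: f_def)
  have "Cmp C (s y) (FA G (FA F f)) = Cmp C f (s x)"
    using ntrans_sq[OF t f(1)] f x by simp
  also have "\<dots> = Cmp C (s y) (FA G h)"
    using x h by (simp add: f_def)
  finally have "FA G (FA F f) = FA G h"
    by (rule iso_cancel_left[OF C ntiso_iso[OF s, of y], rotated -1]) (use f x h in simp_all)
  then have "FA F f = h"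
    by (rule equivalence_functor_faithful[OF G eG, rotated -1]) (use f x h in simp_all)
  with f that show ?thesis by blast
qed

section \<open>Geometric morphisms and their inverse images\<close>

lemma is_cone_iff:
  assumes "functor_from_to D J C"
  shows "is_cone D L l \<longleftrightarrow> L \<in> Obj C \<and>
    (\<forall>i\<in>Obj J. l i \<in> Arr C \<and> Dom C (l i) = L \<and> Cod C (l i) = FO D i) \<and>
    (\<forall>u\<in>Arr J. Cmp C (FA D u) (l (Dom J u)) = l (Cod J u))"
  using assms by (simp add: is_cone_def mem_homset functor_simps)

lemma is_limit_iff:
  assumes "functor_from_to D J C"
  shows "is_limit D L l \<longleftrightarrow> is_cone D L l \<and>
    (\<forall>X x. is_cone D X x \<longrightarrow>
      (\<exists>!h. h \<in> homset C X L \<and> (\<forall>i\<in>Obj J. Cmp C (l i) h = x i)))"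
  using assms by (simp add: is_limit_def functor_simps)

lemma is_cone_cong:
  assumes D: "functor_from_to D J C" and e: "\<And>i. i \<in> Obj J \<Longrightarrow> l i = l' i"
  shows "is_cone D L l \<longleftrightarrow> is_cone D L l'"
  unfolding is_cone_iff[OF D] using e by (simp add: cat_simps[OF functor_category_dom[OF D]])

lemma is_limit_cong:
  assumes D: "functor_from_to D J C" and e: "\<And>i. i \<in> Obj J \<Longrightarrow> l i = l' i"
  shows "is_limit D L l \<longleftrightarrow> is_limit D L l'"
  unfolding is_limit_iff[OF D] using e is_cone_cong[OF D, of l l'] by simp

lemma is_cone_FA:
  assumes D: "functor_from_to D J C" and F: "functor_from_to F C E" and l: "is_cone D L l"
  shows "is_cone (cmp_func F D) (FO F L) (\<lambda>j. FA F (l j))"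
  using l unfolding is_cone_iff[OF D] is_cone_iff[OF functor_cmp[OF D F]]
  by (auto simp: functor_simps[OF F] functor_simps[OF D] cmp_func_simps
      cat_simps[OF functor_category_dom[OF D]] simp flip: FA_Cmp[OF F])

lemma left_exactD:
  assumes "left_exact F" "functor_from_to F C E" "functor_from_to D (J :: (nat, nat) category) C"
    and "finite (Obj J)" "finite (Arr J)" "is_limit D L l"
  shows "is_limit (cmp_func F D) (FO F L) (\<lambda>j. FA F (l j))"
  using assms unfolding left_exact_def by (simp add: functor_simps)

lemma left_exactI:
  assumes F: "functor_from_to F C E"
    and "\<And>J D L l. finite (Obj J) \<Longrightarrow> finite (Arr J) \<Longrightarrow> functor_from_to D (J :: (nat, nat) category) C \<Longrightarrow>
      is_limit D L l \<Longrightarrow> is_limit (cmp_func F D) (FO F L) (\<lambda>j. FA F (l j))"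
  shows "left_exact F"
  unfolding left_exact_def by (simp add: FDom_eq[OF F]) (use assms(2) in blast)

lemma left_exact_cmp:
  assumes F: "functor_from_to F C D" and G: "functor_from_to G D E"
    and lF: "left_exact F" and lG: "left_exact G"
  shows "left_exact (cmp_func G F)"
proof (rule left_exactI[OF functor_cmp[OF F G]])
  fix J :: "(nat, nat) category" and K L l
  assume J: "finite (Obj J)" "finite (Arr J)" and K: "functor_from_to K J C" and L: "is_limit K L l"
  have "is_limit (cmp_func F K) (FO F L) (\<lambda>j. FA F (l j))"
    by (rule left_exactD[OF lF F K J L])
  from left_exactD[OF lG G functor_cmp[OF K F] J this]
  have *: "is_limit (cmp_func (cmp_func G F) K) (FO G (FO F L)) (\<lambda>j. FA G (FA F (l j)))"
    by (simp add: cmp_func_assoc[OF K F G])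
  have c: "is_cone K L l"
    using L by (simp add: is_limit_iff[OF K])
  then have "is_limit (cmp_func (cmp_func G F) K) (FO G (FO F L)) (\<lambda>j. FA (cmp_func G F) (l j))"
    using is_limit_cong[OF functor_cmp[OF K functor_cmp[OF F G]],
        of "\<lambda>j. FA (cmp_func G F) (l j)" "\<lambda>j. FA G (FA F (l j))"] *
    by (simp add: is_cone_iff[OF K] cmp_func_simps functor_simps[OF F])
  then show "is_limit (cmp_func (cmp_func G F) K) (FO (cmp_func G F) L) (\<lambda>j. FA (cmp_func G F) (l j))"
    using c by (simp add: is_cone_iff[OF K] cmp_func_simps functor_simps[OF F])
qed

text \<open>A terminal object of the comma category of \<open>F\<close> over \<open>Z\<close>: the
  value at \<open>Z\<close> of a right adjoint of \<open>F\<close>, with \<open>e\<close> the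
  component of the counit.\<close>

definition universal_arrow ::
    "('o, 'a) category \<Rightarrow> ('p, 'b) category \<Rightarrow> ('o, 'a, 'p, 'b) func \<Rightarrow> 'p \<Rightarrow> 'o \<Rightarrow> 'b \<Rightarrow> bool" where
  "universal_arrow C D F Z R e \<longleftrightarrow> R \<in> Obj C \<and> e \<in> Arr D \<and> Dom D e = FO F R \<and> Cod D e = Z \<and>
    (\<forall>X\<in>Obj C. \<forall>g\<in>Arr D. Dom D g = FO F X \<and> Cod D g = Z \<longrightarrow>
      (\<exists>!h. h \<in> Arr C \<and> Dom C h = X \<and> Cod C h = R \<and> Cmp D e (FA F h) = g))"

text \<open>A left exact functor with a right adjoint, where the adjoint is only asserted to exist
  object by object. Nothing is chosen, so this property of \<open>F\<close> can be composed and
  transported without equations between direct images.\<close>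

definition inverse_image ::
    "('o, 'a) category \<Rightarrow> ('p, 'b) category \<Rightarrow> ('o, 'a, 'p, 'b) func \<Rightarrow> bool" where
  "inverse_image C D F \<longleftrightarrow> functor_from_to F C D \<and> left_exact F \<and>
    (\<forall>Z\<in>Obj D. \<exists>R e. universal_arrow C D F Z R e)"

lemma universal_arrow_ex:
  assumes "universal_arrow C D F Z R e" "X \<in> Obj C" "g \<in> Arr D" "Dom D g = FO F X" "Cod D g = Z"
  obtains h where "h \<in> Arr C" "Dom C h = X" "Cod C h = R" "Cmp D e (FA F h) = g"
  using assms unfolding universal_arrow_def by blast

lemma universal_arrow_unique:
  assumes u: "universal_arrow C D F Z R e" and F: "functor_from_to F C D"
    and h: "h \<in> Arr C" "Cod C h = R" "h' \<in> Arr C" "Cod C h' = R" "Dom C h = Dom C h'"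
    and eq: "Cmp D e (FA F h) = Cmp D e (FA F h')"
  shows "h = h'"
proof -
  note [simp] = functor_simps[OF F] cat_simps[OF functor_category_dom[OF F]]
    cat_simps[OF functor_category_cod[OF F]]
  have e: "e \<in> Arr D" "Dom D e = FO F R" "Cod D e = Z"
    using u by (auto simp: universal_arrow_def)
  have "\<exists>!k. k \<in> Arr C \<and> Dom C k = Dom C h \<and> Cod C k = R \<and> Cmp D e (FA F k) = Cmp D e (FA F h)"
  proof -
    have "Dom C h \<in> Obj C" "Cmp D e (FA F h) \<in> Arr D" "Dom D (Cmp D e (FA F h)) = FO F (Dom C h)"
      "Cod D (Cmp D e (FA F h)) = Z"
      using h e by simp_all
    then show ?thesis using u unfolding universal_arrow_def by blast
  qed
  then show ?thesis using h eq by metis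
qed

lemma inverse_image_functor: "inverse_image C D F \<Longrightarrow> functor_from_to F C D"
  by (simp add: inverse_image_def)

text \<open>Universal arrows paste: for the composite at \<open>Z\<close>, take one for
  \<open>G\<close> at \<open>Z\<close>, with object \<open>R\<close>, and then one for
  \<open>F\<close> at \<open>R\<close>.\<close>

lemma inverse_image_cmp:
  assumes f: "inverse_image C D F" and g: "inverse_image D E G"
  shows "inverse_image C E (cmp_func G F)"
proof -
  note F = inverse_image_functor[OF f] and G = inverse_image_functor[OF g]
  note C = functor_category_dom[OF F] and D = functor_category_cod[OF F] and E = functor_category_cod[OF G]
  note [simp] = functor_simps[OF F] functor_simps[OF G] cat_simps[OF C] cat_simps[OF D]
    cat_simps[OF E] cmp_func_simps
  have "\<exists>R e. universal_arrow C E (cmp_func G F) Z R e" if Z: "Z \<in> Obj E" for Z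
  proof -
    obtain R e where u: "universal_arrow D E G Z R e"
      using g Z by (auto simp: inverse_image_def)
    have e [simp]: "R \<in> Obj D" "e \<in> Arr E" "Dom E e = FO G R" "Cod E e = Z"
      using u by (auto simp: universal_arrow_def)
    obtain Q d where v: "universal_arrow C D F R Q d"
      using f e(1) unfolding inverse_image_def by blast
    have d [simp]: "Q \<in> Obj C" "d \<in> Arr D" "Dom D d = FO F Q" "Cod D d = R"
      using v by (auto simp: universal_arrow_def)
    have "universal_arrow C E (cmp_func G F) Z Q (Cmp E e (FA G d))"
      unfolding universal_arrow_def
    proof (intro conjI ballI impI ex_ex1I)
      fix X g assume X: "X \<in> Obj C" and g: "g \<in> Arr E" "Dom E g = FO (cmp_func G F) X \<and> Cod E g = Z"
      obtain h where h: "h \<in> Arr D" "Dom D h = FO F X" "Cod D h = R" "Cmp E e (FA G h) = g"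
        by (rule universal_arrow_ex[OF u, of "FO F X" g]) (use X g in simp_all)
      obtain k where k: "k \<in> Arr C" "Dom C k = X" "Cod C k = Q" "Cmp D d (FA F k) = h"
        by (rule universal_arrow_ex[OF v, of X h]) (use X h in simp_all)
      have "Cmp E (FA G d) (FA G (FA F k)) = FA G h"
        using k FA_Cmp[OF G, of "FA F k" d] by simp
      then show "\<exists>k. k \<in> Arr C \<and> Dom C k = X \<and> Cod C k = Q \<and>
          Cmp E (Cmp E e (FA G d)) (FA (cmp_func G F) k) = g"
        using k h by (intro exI[of _ k]) simp
    next
      fix X g h k assume a: "h \<in> Arr C \<and> Dom C h = X \<and> Cod C h = Q \<and>
          Cmp E (Cmp E e (FA G d)) (FA (cmp_func G F) h) = g"
        "k \<in> Arr C \<and> Dom C k = X \<and> Cod C k = Q \<and>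
          Cmp E (Cmp E e (FA G d)) (FA (cmp_func G F) k) = g"
      have "Cmp E e (FA G (Cmp D d (FA F h))) = g" "Cmp E e (FA G (Cmp D d (FA F k))) = g"
        using a by auto
      then have "Cmp D d (FA F h) = Cmp D d (FA F k)"
        by - (rule universal_arrow_unique[OF u G], use a in simp_all)
      then show "h = k"
        by - (rule universal_arrow_unique[OF v F], use a in simp_all)
    qed simp_all
    then show ?thesis by blast
  qed
  then show ?thesis
    using left_exact_cmp[OF F G] functor_cmp[OF F G] f g by (auto simp: inverse_image_def)
qed

section \<open>Adjunctions as families of universal arrows\<close>

lemma
  assumes "geometric_morphism f"
  shows geom_pull: "functor_from_to (pull f) (gtgt f) (gsrc f)"
    and geom_push: "functor_from_to (push f) (gsrc f) (gtgt f)"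
    and geom_unit: "ntrans (gtgt f) (gtgt f) (id_func (gtgt f)) (cmp_func (push f) (pull f)) (unit f)"
    and geom_counit: "ntrans (gsrc f) (gsrc f) (cmp_func (pull f) (push f)) (id_func (gsrc f)) (counit f)"
    and geom_triangle1: "X \<in> Obj (gtgt f) \<Longrightarrow>
      Cmp (gsrc f) (counit f (FO (pull f) X)) (FA (pull f) (unit f X)) = Idn (gsrc f) (FO (pull f) X)"
    and geom_triangle2: "Z \<in> Obj (gsrc f) \<Longrightarrow>
      Cmp (gtgt f) (FA (push f) (counit f Z)) (unit f (FO (push f) Z)) = Idn (gtgt f) (FO (push f) Z)"
    and geom_left_exact: "left_exact (pull f)"
  using assms by (auto simp: geometric_morphism_def natural_iff_ntrans functor_from_to_def gsrc_def
      gtgt_def id_func_def cmp_func_simps)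

lemma geometric_morphismI:
  assumes "functor_from_to (pull f) E F" "functor_from_to (push f) F E"
    and "ntrans E E (id_func E) (cmp_func (push f) (pull f)) (unit f)"
    and "ntrans F F (cmp_func (pull f) (push f)) (id_func F) (counit f)"
    and "\<And>X. X \<in> Obj E \<Longrightarrow>
      Cmp F (counit f (FO (pull f) X)) (FA (pull f) (unit f X)) = Idn F (FO (pull f) X)"
    and "\<And>Z. Z \<in> Obj F \<Longrightarrow>
      Cmp E (FA (push f) (counit f Z)) (unit f (FO (push f) Z)) = Idn E (FO (push f) Z)"
    and "left_exact (pull f)"
  shows "geometric_morphism f"
  using assms by (auto simp: geometric_morphism_def ntrans_def functor_from_to_def gsrc_def gtgt_def)

text \<open>The counit is universal: the transpose of \<open>g\<close> is \<open>push\<close> of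
  \<open>g\<close> after the unit, and the two triangle identities give existence and
  uniqueness.\<close>

lemma inverse_image_pull:
  assumes f: "geometric_morphism f"
  shows "inverse_image (gtgt f) (gsrc f) (pull f)"
proof -
  note P = geom_pull[OF f] and Q = geom_push[OF f] and u = geom_unit[OF f] and c = geom_counit[OF f]
  let ?E = "gtgt f" and ?F = "gsrc f"
  note E = functor_category_dom[OF P] and F = functor_category_cod[OF P]
  note [simp] = functor_simps[OF P] functor_simps[OF Q] cat_simps[OF E] cat_simps[OF F] cmp_func_simps
    id_func_simps ntrans_simps[OF u] ntrans_simps[OF c]
  have "universal_arrow ?E ?F (pull f) Z (FO (push f) Z) (counit f Z)" if Z [simp]: "Z \<in> Obj ?F" for Z
    unfolding universal_arrow_def
  proof (intro conjI ballI impI ex_ex1I)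
    fix X g assume X [simp]: "X \<in> Obj ?E" and g [simp]: "g \<in> Arr ?F"
      and "Dom ?F g = FO (pull f) X \<and> Cod ?F g = Z"
    then have g' [simp]: "Dom ?F g = FO (pull f) X" "Cod ?F g = Z" by simp_all
    define h where "h = Cmp ?E (FA (push f) g) (unit f X)"
    have "Cmp ?F (counit f Z) (FA (pull f) h) =
        Cmp ?F (counit f Z) (Cmp ?F (FA (pull f) (FA (push f) g)) (FA (pull f) (unit f X)))"
      by (simp add: h_def)
    also have "\<dots> = Cmp ?F g (Cmp ?F (counit f (FO (pull f) X)) (FA (pull f) (unit f X)))"
      using ntrans_sq_prefix[OF c g, of "FA (pull f) (unit f X)"] by simp
    also have "\<dots> = g" by (simp add: geom_triangle1[OF f])
    finally show "\<exists>h. h \<in> Arr ?E \<and> Dom ?E h = X \<and> Cod ?E h = FO (push f) Z \<and>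
        Cmp ?F (counit f Z) (FA (pull f) h) = g"
      by (intro exI[of _ h]) (simp add: h_def)
  next
    fix X g h k assume a: "h \<in> Arr ?E \<and> Dom ?E h = X \<and> Cod ?E h = FO (push f) Z \<and>
        Cmp ?F (counit f Z) (FA (pull f) h) = g"
      "k \<in> Arr ?E \<and> Dom ?E k = X \<and> Cod ?E k = FO (push f) Z \<and>
        Cmp ?F (counit f Z) (FA (pull f) k) = g"
    \<comment> \<open>An arrow is recovered from its transpose by naturality of the unit and the
      second triangle identity.\<close>
    have *: "k = Cmp ?E (FA (push f) (Cmp ?F (counit f Z) (FA (pull f) k))) (unit f (Dom ?E k))"
      if [simp]: "k \<in> Arr ?E" "Cod ?E k = FO (push f) Z" for k
    proof -
      have "Cmp ?E (FA (push f) (FA (pull f) k)) (unit f (Dom ?E k)) = Cmp ?E (unit f (FO (push f) Z)) k"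
        using ntrans_sq[OF u, of k] by simp
      then have "Cmp ?E (FA (push f) (Cmp ?F (counit f Z) (FA (pull f) k))) (unit f (Dom ?E k)) =
        Cmp ?E (FA (push f) (counit f Z)) (Cmp ?E (unit f (FO (push f) Z)) k)"
        by simp
      also have "\<dots> = k"
        using Cmp_eq_prefix1[OF E geom_triangle2[OF f Z], of k] by simp
      finally show ?thesis by simp
    qed
    show "h = k" using a *[of h] *[of k] by simp
  qed simp_all
  then show ?thesis
    using P geom_left_exact[OF f] by (auto simp: inverse_image_def)
qed

text \<open>A choice of universal arrows \<open>e Z\<close> makes \<open>R\<close> a functor: its
  values on arrows, and the unit, are transposes \<open>tr\<close>, and the counit is
  \<open>e\<close>. Every equation between arrows into \<open>R Z\<close> is checked after
  \<open>e Z\<close>, which \<open>uniq\<close> permits.\<close>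

lemma geometric_morphism_of_inverse_image:
  assumes f: "inverse_image E F P"
  obtains f where "geometric_morphism f" "pull f = P"
proof -
  note P = inverse_image_functor[OF f]
  note E = functor_category_dom[OF P] and F = functor_category_cod[OF P]
  note [simp] = functor_simps[OF P] cat_simps[OF E] cat_simps[OF F] cmp_func_simps id_func_simps
  have "\<exists>R e. \<forall>Z\<in>Obj F. universal_arrow E F P Z (R Z) (e Z)"
    using f unfolding inverse_image_def by metis
  then obtain R e where u: "\<And>Z. Z \<in> Obj F \<Longrightarrow> universal_arrow E F P Z (R Z) (e Z)"
    by auto
  have ue [simp]: "R Z \<in> Obj E" "e Z \<in> Arr F" "Dom F (e Z) = FO P (R Z)" "Cod F (e Z) = Z"
    if "Z \<in> Obj F" for Z
    using u[OF that] by (auto simp: universal_arrow_def)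
  have "\<forall>Z\<in>Obj F. \<forall>X\<in>Obj E. \<forall>g. g \<in> Arr F \<and> Dom F g = FO P X \<and> Cod F g = Z \<longrightarrow>
    (\<exists>h. h \<in> Arr E \<and> Dom E h = X \<and> Cod E h = R Z \<and> Cmp F (e Z) (FA P h) = g)"
    using universal_arrow_ex[OF u] by metis
  then obtain tr where tr: "\<And>Z X g. Z \<in> Obj F \<Longrightarrow> X \<in> Obj E \<Longrightarrow> g \<in> Arr F \<Longrightarrow> Dom F g = FO P X \<Longrightarrow>
    Cod F g = Z \<Longrightarrow> tr Z X g \<in> Arr E \<and> Dom E (tr Z X g) = X \<and> Cod E (tr Z X g) = R Z \<and>
      Cmp F (e Z) (FA P (tr Z X g)) = g"
    by metis
  have tr1 [simp]: "tr Z X g \<in> Arr E" "Dom E (tr Z X g) = X" "Cod E (tr Z X g) = R Z"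
    "Cmp F (e Z) (FA P (tr Z X g)) = g"
    if "Z \<in> Obj F" "X \<in> Obj E" "g \<in> Arr F" "Dom F g = FO P X" "Cod F g = Z" for Z X g
    using tr[OF that] by auto
  have uniq: "h = k" if "h \<in> Arr E" "k \<in> Arr E" "Z \<in> Obj F" "Cod E h = R Z" "Cod E k = R Z"
    "Dom E h = Dom E k" "Cmp F (e Z) (FA P h) = Cmp F (e Z) (FA P k)" for h k Z
    using universal_arrow_unique[OF u P] that by metis
  have trp [simp]: "Cmp F (e Z) (Cmp F (FA P (tr Z X g)) r) = Cmp F g r"
    if "Z \<in> Obj F" "X \<in> Obj E" "g \<in> Arr F" "Dom F g = FO P X" "Cod F g = Z" "r \<in> Arr F"
      "Cod F r = FO P X" for Z X g r
    by (rule Cmp_eq_prefix1[OF F]) (use that in simp_all)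
  define Q where "Q = \<lparr>FDom = F, FCod = E, FO = (\<lambda>Z\<in>Obj F. R Z),
    FA = (\<lambda>g\<in>Arr F. tr (Cod F g) (R (Dom F g)) (Cmp F g (e (Dom F g))))\<rparr>"
  have Q: "functor_from_to Q F E"
  proof (rule functorI[OF F E])
    fix x assume "x \<in> Obj F" then show "FA Q (Idn F x) = Idn E (FO Q x)"
      by - (rule uniq[of _ _ x], simp_all add: Q_def)
  next
    fix h g assume "h \<in> Arr F" "g \<in> Arr F" "Cod F h = Dom F g"
    then show "FA Q (Cmp F g h) = Cmp E (FA Q g) (FA Q h)"
      by - (rule uniq[of _ _ "Cod F g"], simp_all add: Q_def)
  qed (simp_all add: Q_def)
  have Qs: "Z \<in> Obj F \<Longrightarrow> FO Q Z = R Z"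
    "g \<in> Arr F \<Longrightarrow> FA Q g = tr (Cod F g) (R (Dom F g)) (Cmp F g (e (Dom F g)))" for Z g
    by (simp_all add: Q_def)
  note [simp] = functor_simps[OF Q]
  define g where "g = \<lparr>pull = P, push = Q, unit = (\<lambda>X\<in>Obj E. tr (FO P X) X (Idn F (FO P X))),
    counit = (\<lambda>Z\<in>Obj F. e Z)\<rparr>"
  have "geometric_morphism g"
  proof (rule geometric_morphismI[of _ E F])
    show "ntrans E E (id_func E) (cmp_func (push g) (pull g)) (unit g)"
    proof (rule ntransI[OF functor_id[OF E]])
      fix f assume "f \<in> Arr E"
      then show "Cmp E (unit g (Cod E f)) (FA (id_func E) f) =
          Cmp E (FA (cmp_func (push g) (pull g)) f) (unit g (Dom E f))"
        by - (rule uniq[of _ _ "FO P (Cod E f)"], simp_all add: g_def Qs)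
    qed (auto simp: g_def Qs intro: functor_cmp[OF P Q])
    show "ntrans F F (cmp_func (pull g) (push g)) (id_func F) (counit g)"
      by (rule ntransI[OF _ functor_id[OF F]])
        (auto simp: g_def Qs intro: functor_cmp[OF Q P])
    fix Z assume "Z \<in> Obj F"
    then show "Cmp E (FA (push g) (counit g Z)) (unit g (FO (push g) Z)) = Idn E (FO (push g) Z)"
      by - (rule uniq[of _ _ Z], simp_all add: g_def Qs)
  qed (use f P Q in \<open>simp_all add: g_def inverse_image_def\<close>)
  then show ?thesis
    using that[of g] by (simp add: g_def)
qed

section \<open>Identity and composite geometric morphisms\<close>

lemma geometric_morphism_id:
  assumes E: "category E"
  shows "geometric_morphism (id_geom E)"
proof (rule geometric_morphismI)
  note [simp] = cat_simps[OF E] id_func_simps cmp_func_simps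
  note I = functor_id[OF E]
  show "left_exact (pull (id_geom E))"
  proof (rule left_exactI)
    show I': "functor_from_to (pull (id_geom E)) E E" using I by (simp add: id_geom_def)
    fix J :: "(nat, nat) category" and D L l
    assume D: "functor_from_to D J E" and l: "is_limit D L l"
    have "is_limit D L (\<lambda>j. FA (id_func E) (l j))"
      using l is_limit_cong[OF D, of l "\<lambda>j. FA (id_func E) (l j)" L]
      by (auto simp: is_limit_iff[OF D] is_cone_iff[OF D])
    then show "is_limit (cmp_func (pull (id_geom E)) D) (FO (pull (id_geom E)) L)
        (\<lambda>j. FA (pull (id_geom E)) (l j))"
      using l by (simp add: id_geom_def cmp_func_id[OF D] is_limit_iff[OF D] is_cone_iff[OF D])
  qed
  have "ntrans E E (id_func E) (id_func E) (\<lambda>x\<in>Obj E. Idn E x)"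
    by (rule ntransI[OF I I]) auto
  then show "ntrans E E (id_func E) (cmp_func (push (id_geom E)) (pull (id_geom E))) (unit (id_geom E))"
    "ntrans E E (cmp_func (pull (id_geom E)) (push (id_geom E))) (id_func E) (counit (id_geom E))"
    by (simp_all add: id_geom_def cmp_func_id[OF I])
qed (simp_all add: id_geom_def functor_id[OF E] id_func_simps cat_simps[OF E])

lemma cmp_geom_simps: "pull (cmp_geom g f) = cmp_func (pull f) (pull g)"
  "push (cmp_geom g f) = cmp_func (push g) (push f)"
  "gtgt (cmp_geom g f) = gtgt g" "gsrc (cmp_geom g f) = gsrc f"
  by (simp_all add: cmp_geom_def gtgt_def gsrc_def cmp_func_simps)

lemma geometric_morphism_cmp:
  assumes f: "geometric_morphism f" and g: "geometric_morphism g" and fg: "gsrc g = gtgt f"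
  shows "geometric_morphism (cmp_geom g f)"
proof -
  note Pf = geom_pull[OF f] and Qf = geom_push[OF f] and uf = geom_unit[OF f] and cf = geom_counit[OF f]
  note Pg = geom_pull[OF g, unfolded fg] and Qg = geom_push[OF g, unfolded fg]
    and ug = geom_unit[OF g, unfolded fg] and cg = geom_counit[OF g, unfolded fg]
  let ?E = "gtgt g" and ?F = "gtgt f" and ?X = "gsrc f"
  let ?Pf = "pull f" and ?Qf = "push f" and ?Pg = "pull g" and ?Qg = "push g"
  note E = functor_category_dom[OF Pg] and F = functor_category_dom[OF Pf] and X = functor_category_cod[OF Pf]
  note [simp] = functor_simps[OF Pf] functor_simps[OF Pg] functor_simps[OF Qf] functor_simps[OF Qg]
    cat_simps[OF E] cat_simps[OF F] cat_simps[OF X] cmp_func_simps id_func_simps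
    ntrans_simps[OF uf] ntrans_simps[OF cf] ntrans_simps[OF ug] ntrans_simps[OF cg]
  show ?thesis
  proof (rule geometric_morphismI[of _ ?E ?X])
    show "functor_from_to (pull (cmp_geom g f)) ?E ?X" "functor_from_to (push (cmp_geom g f)) ?X ?E"
      by (simp_all add: cmp_geom_simps functor_cmp[OF Pg Pf] functor_cmp[OF Qf Qg])
    show "left_exact (pull (cmp_geom g f))"
      by (simp add: cmp_geom_simps left_exact_cmp[OF Pg Pf] geom_left_exact f g)
    have "ntrans ?E ?E (cmp_func ?Qg ?Pg) (cmp_func ?Qg (cmp_func (cmp_func ?Qf ?Pf) ?Pg))
        (\<lambda>x\<in>Obj ?E. FA ?Qg ((\<lambda>x\<in>Obj ?E. unit f (FO ?Pg x)) x))"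
      using ntrans_postwhisker[OF ntrans_whisker[OF uf Pg] Qg] by (simp add: cmp_func_id[OF Pg])
    from ntrans_vcmp[OF ug this]
    have "ntrans ?E ?E (id_func ?E) (cmp_func ?Qg (cmp_func (cmp_func ?Qf ?Pf) ?Pg)) (unit (cmp_geom g f))"
      by (rule back_subst[of "ntrans _ _ _ _"]) (simp add: cmp_geom_def restrict_def fun_eq_iff)
    then show "ntrans ?E ?E (id_func ?E) (cmp_func (push (cmp_geom g f)) (pull (cmp_geom g f))) (unit (cmp_geom g f))"
      by (simp add: cmp_geom_simps cmp_func_assoc[OF functor_cmp[OF Pg Pf] Qf Qg, symmetric]
          cmp_func_assoc[OF Pg Pf Qf])
    have "ntrans ?X ?X (cmp_func ?Pf (cmp_func (cmp_func ?Pg ?Qg) ?Qf)) (cmp_func ?Pf ?Qf)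
        (\<lambda>x\<in>Obj ?X. FA ?Pf ((\<lambda>x\<in>Obj ?X. counit g (FO ?Qf x)) x))"
      using ntrans_postwhisker[OF ntrans_whisker[OF cg Qf] Pf] by (simp add: cmp_func_id[OF Qf])
    from ntrans_vcmp[OF this cf]
    have "ntrans ?X ?X (cmp_func ?Pf (cmp_func (cmp_func ?Pg ?Qg) ?Qf)) (id_func ?X) (counit (cmp_geom g f))"
      by (rule back_subst[of "ntrans _ _ _ _"]) (simp add: cmp_geom_def restrict_def fun_eq_iff)
    then show "ntrans ?X ?X (cmp_func (pull (cmp_geom g f)) (push (cmp_geom g f))) (id_func ?X) (counit (cmp_geom g f))"
      by (simp add: cmp_geom_simps cmp_func_assoc[OF functor_cmp[OF Qf Qg] Pg Pf, symmetric]
          cmp_func_assoc[OF Qf Qg Pg])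
  next
    fix D assume D [simp]: "D \<in> Obj ?E"
    let ?D = "FO ?Pg D"
    \<comment> \<open>Naturality of \<open>counit g\<close> at \<open>unit f ?D\<close> leaves the
      first triangle identity of \<open>g\<close>. Applying \<open>pull f\<close> to the result
      reduces the claim to the first triangle identity of \<open>f\<close>.\<close>
    have 1: "Cmp ?F (counit g (FO ?Qf (FO ?Pf ?D))) (Cmp ?F (FA ?Pg (FA ?Qg (unit f ?D))) (FA ?Pg (unit g D))) = unit f ?D"
      using ntrans_sq_prefix[OF cg, of "unit f ?D" "FA ?Pg (unit g D)"] geom_triangle1[OF g] fg by simp
    show "Cmp ?X (counit (cmp_geom g f) (FO (pull (cmp_geom g f)) D)) (FA (pull (cmp_geom g f)) (unit (cmp_geom g f) D)) =
        Idn ?X (FO (pull (cmp_geom g f)) D)"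
      using arg_cong[OF 1, of "FA ?Pf"] geom_triangle1[OF f, of ?D]
      by (simp add: cmp_geom_simps) (simp add: cmp_geom_def)
  next
    fix Z assume Z [simp]: "Z \<in> Obj ?X"
    let ?Z = "FO ?Qf Z"
    \<comment> \<open>Dually, naturality of \<open>unit f\<close> at \<open>counit g ?Z\<close>
      leaves the second triangle identity of \<open>f\<close>, and applying \<open>push g\<close>
      reduces the claim to that of \<open>g\<close>.\<close>
    have 1: "Cmp ?F (FA ?Qf (counit f Z)) (Cmp ?F (FA ?Qf (FA ?Pf (counit g ?Z))) (unit f (FO ?Pg (FO ?Qg ?Z)))) = counit g ?Z"
      using ntrans_sq[OF uf, of "counit g ?Z"] Cmp_eq_prefix1[OF F geom_triangle2[OF f Z], of "counit g ?Z"] by simp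
    show "Cmp ?E (FA (push (cmp_geom g f)) (counit (cmp_geom g f) Z)) (unit (cmp_geom g f) (FO (push (cmp_geom g f)) Z)) =
        Idn ?E (FO (push (cmp_geom g f)) Z)"
      using arg_cong[OF 1, of "\<lambda>x. Cmp ?E (FA ?Qg x) (unit g (FO ?Qg ?Z))"] geom_triangle2[OF g, of ?Z]
      by (simp add: cmp_geom_simps fg) (simp add: cmp_geom_def)
  qed
qed

text \<open>Strict equality holds since functors are extensional and the composite units and counits
  agree componentwise. Composition in a pseudoslice relies on it: the 2-cell of a composite triangle
  has a composite 1-cell as its codomain.\<close>

lemma cmp_geom_assoc:
  assumes f: "geometric_morphism f" and g: "geometric_morphism g" and h: "geometric_morphism h"
    and fg: "gsrc g = gtgt f" and gh: "gsrc h = gtgt g"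
  shows "cmp_geom h (cmp_geom g f) = cmp_geom (cmp_geom h g) f"
proof (rule geom.equality)
  note Pf = geom_pull[OF f] and Qf = geom_push[OF f] and uf = geom_unit[OF f] and cf = geom_counit[OF f]
  note Pg = geom_pull[OF g, unfolded fg] and Qg = geom_push[OF g, unfolded fg]
    and ug = geom_unit[OF g, unfolded fg] and cg = geom_counit[OF g, unfolded fg]
  note Ph = geom_pull[OF h, unfolded gh] and Qh = geom_push[OF h, unfolded gh]
    and uh = geom_unit[OF h, unfolded gh] and ch = geom_counit[OF h, unfolded gh]
  note [simp] = functor_simps[OF Pf] functor_simps[OF Pg] functor_simps[OF Qf] functor_simps[OF Qg]
    functor_simps[OF Ph] functor_simps[OF Qh] cmp_func_simps id_func_simps cmp_geom_simps
    cat_simps[OF functor_category_dom[OF Pf]] cat_simps[OF functor_category_dom[OF Pg]]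
    cat_simps[OF functor_category_dom[OF Ph]] cat_simps[OF functor_category_dom[OF Qf]]
    ntrans_simps[OF uf] ntrans_simps[OF cf] ntrans_simps[OF ug] ntrans_simps[OF cg]
    ntrans_simps[OF uh] ntrans_simps[OF ch]
  show "pull (cmp_geom h (cmp_geom g f)) = pull (cmp_geom (cmp_geom h g) f)"
    by (simp add: cmp_func_assoc[OF Ph Pg Pf])
  show "push (cmp_geom h (cmp_geom g f)) = push (cmp_geom (cmp_geom h g) f)"
    by (simp add: cmp_func_assoc[OF Qf Qg Qh])
  show "unit (cmp_geom h (cmp_geom g f)) = unit (cmp_geom (cmp_geom h g) f)"
    by (simp add: cmp_geom_def gtgt_def[of "\<lparr>pull = _, push = _, unit = _, counit = _\<rparr>"])
      (simp add: restrict_def fun_eq_iff fg gh)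
  show "counit (cmp_geom h (cmp_geom g f)) = counit (cmp_geom (cmp_geom h g) f)"
    by (simp add: cmp_geom_def gsrc_def[of "\<lparr>pull = _, push = _, unit = _, counit = _\<rparr>"])
      (simp add: restrict_def fun_eq_iff fg gh)
qed simp

lemma cmp_geom_id:
  assumes f: "geometric_morphism f"
  shows "cmp_geom (id_geom (gtgt f)) f = f"
proof (rule geom.equality)
  note Pf = geom_pull[OF f] and Qf = geom_push[OF f] and uf = geom_unit[OF f] and cf = geom_counit[OF f]
  note [simp] = functor_simps[OF Pf] functor_simps[OF Qf] cmp_func_simps id_func_simps cmp_geom_simps
    cat_simps[OF functor_category_dom[OF Pf]] cat_simps[OF functor_category_dom[OF Qf]]
    ntrans_simps[OF uf] ntrans_simps[OF cf]
  show "pull (cmp_geom (id_geom (gtgt f)) f) = pull f" "push (cmp_geom (id_geom (gtgt f)) f) = push f"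
    by (simp_all add: id_geom_def cmp_func_id[OF Pf] cmp_func_id[OF Qf])
  have [simp]: "gtgt (id_geom (gtgt f)) = gtgt f"
    by (simp only: gtgt_def id_geom_def id_func_def geom.simps func.simps)
  show "unit (cmp_geom (id_geom (gtgt f)) f) = unit f"
    using ntrans_ext[OF uf] by (intro extensionalityI[of _ "Obj (gtgt f)"]) (simp_all add: cmp_geom_def, simp_all add: id_geom_def)
  show "counit (cmp_geom (id_geom (gtgt f)) f) = counit f"
    using ntrans_ext[OF cf] by (intro extensionalityI[of _ "Obj (gsrc f)"]) (simp_all add: cmp_geom_def, simp_all add: id_geom_def)
qed simp

section \<open>Small sets\<close>

lemma small_subset: "small B \<Longrightarrow> A \<subseteq> B \<Longrightarrow> small A"
  unfolding small_def by (meson lesspoll_trans1 subset_imp_lepoll)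

lemma small_image: "small A \<Longrightarrow> small (f ` A)" for f :: "'u::universe \<Rightarrow> 'u"
  unfolding small_def by (meson lesspoll_trans1 image_lepoll)

lemma small_finite: "finite A \<Longrightarrow> small (A :: 'u::universe set)"
  unfolding small_def by (rule finite_lesspoll_infinite[OF universe_infinite])

lemma small_UN: "small A \<Longrightarrow> (\<And>a. a \<in> A \<Longrightarrow> small (B a)) \<Longrightarrow> small (\<Union>a\<in>A. B a)"
  for B :: "'u::universe \<Rightarrow> 'u set"
  unfolding small_def by (rule universe_regular)

text \<open>A pairing inside the type, available because an infinite set is equinumerous with its
  square. Elements of sets in \<open>SetCat\<close> have type \<open>'u\<close>, so the elements of
  a product have to be coded there.\<close>

definition upair :: "'u::universe \<Rightarrow> 'u \<Rightarrow> 'u" where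
  "upair = (SOME f. \<forall>a b c d. f a b = f c d \<longrightarrow> a = c \<and> b = d)"

definition ufst :: "'u::universe \<Rightarrow> 'u" where "ufst x = (THE a. \<exists>b. x = upair a b)"
definition usnd :: "'u::universe \<Rightarrow> 'u" where "usnd x = (THE b. \<exists>a. x = upair a b)"

lemma upair_inject [simp]: "upair a b = upair c d \<longleftrightarrow> a = c \<and> b = (d :: 'u::universe)"
proof -
  have "(UNIV :: 'u set) \<times> (UNIV :: 'u set) \<approx> (UNIV :: 'u set)"
    by (rule eqpoll_iff_card_of_ordIso[THEN iffD2, OF card_of_Times_same_infinite[OF universe_infinite]])
  then obtain f :: "'u \<times> 'u \<Rightarrow> 'u" where f: "inj f"
    by (auto simp: eqpoll_def bij_betw_def)
  have "\<forall>a b c d. upair a b = upair c d \<longrightarrow> a = c \<and> b = (d :: 'u)"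
    unfolding upair_def
    by (rule someI[of _ "\<lambda>a b. f (a, b)"]) (use f in \<open>auto dest: injD\<close>)
  then show ?thesis by blast
qed

lemma ufst_upair [simp]: "ufst (upair a b) = a" and usnd_upair [simp]: "usnd (upair a b) = b"
  by (simp_all add: ufst_def usnd_def)

text \<open>The pairs lie in a small union of small images, so regularity of the universe
  suffices.\<close>

lemma small_pairs:
  assumes "small A" "small B"
  shows "small {upair a b | a b. a \<in> A \<and> b \<in> B \<and> R a b}"
proof -
  have "small (\<Union>a\<in>A. upair a ` B)"
    using assms by (intro small_UN small_image)
  then show ?thesis by (rule small_subset) auto
qed

section \<open>The category of sets\<close>

lemma SetCat_simps: "Dom SetCat m = Sub (map_dom m)" "Cod SetCat m = Sub (map_cod m)"
  "Idn SetCat X = Map (elts X) (elts X) (\<lambda>x\<in>elts X. x)"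
  "Cmp SetCat n m = Map (map_dom m) (map_cod n) (compose (map_dom m) (app n) (app m))"
  by (simp_all add: SetCat_def)

lemma SetCat_Obj: "X \<in> Obj SetCat \<longleftrightarrow> X = Sub (elts X) \<and> small (elts X)"
  by (auto simp: SetCat_def)

lemma SetCat_Arr: "m \<in> Arr SetCat \<longleftrightarrow> m = Map (map_dom m) (map_cod m) (app m) \<and>
    small (map_dom m) \<and> small (map_cod m) \<and> app m \<in> map_dom m \<rightarrow>\<^sub>E map_cod m"
  by (auto simp: SetCat_def)

lemma app_in: "m \<in> Arr SetCat \<Longrightarrow> t \<in> elts (Dom SetCat m) \<Longrightarrow> app m t \<in> elts (Cod SetCat m)"
  unfolding SetCat_Arr by (auto simp: SetCat_simps)

lemma app_Cmp: "t \<in> elts (Dom SetCat m) \<Longrightarrow> app (Cmp SetCat n m) t = app n (app m t)"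
  by (simp add: SetCat_simps compose_def)

lemma app_Idn: "t \<in> elts X \<Longrightarrow> app (Idn SetCat X) t = t"
  by (simp add: SetCat_simps)

lemma SetCat_eqI:
  assumes "m \<in> Arr SetCat" "n \<in> Arr SetCat" "Dom SetCat m = Dom SetCat n" "Cod SetCat m = Cod SetCat n"
    and "\<And>t. t \<in> elts (Dom SetCat m) \<Longrightarrow> app m t = app n t"
  shows "m = n"
proof -
  have "app m = app n"
    using assms unfolding SetCat_Arr
    by (intro extensionalityI[of _ "map_dom m"]) (auto simp: PiE_iff SetCat_simps)
  then show ?thesis
    using assms unfolding SetCat_Arr by (metis SetCat_simps(1,2) large.inject(1))
qed

definition smap :: "'u large \<Rightarrow> 'u large \<Rightarrow> ('u \<Rightarrow> 'u) \<Rightarrow> 'u large" where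
  "smap X Y f = Map (elts X) (elts Y) (restrict f (elts X))"

lemma
  assumes "X \<in> Obj SetCat" "Y \<in> Obj SetCat"
  shows smap_Arr: "(\<And>t. t \<in> elts X \<Longrightarrow> f t \<in> elts Y) \<Longrightarrow> smap X Y f \<in> Arr SetCat"
    and smap_Dom: "Dom SetCat (smap X Y f) = X" and smap_Cod: "Cod SetCat (smap X Y f) = Y"
  using assms unfolding SetCat_Obj SetCat_Arr by (auto simp: smap_def SetCat_simps)

lemma app_smap: "t \<in> elts X \<Longrightarrow> app (smap X Y f) t = f t"
  by (simp add: smap_def)

lemma iso_SetCat:
  assumes m: "m \<in> Arr SetCat" and b: "bij_betw (app m) (elts (Dom SetCat m)) (elts (Cod SetCat m))"
  shows "iso_arr SetCat m"
proof -
  note S = category_SetCat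
  let ?X = "Dom SetCat m" and ?Y = "Cod SetCat m"
  define n where "n = smap ?Y ?X (inv_into (elts ?X) (app m))"
  have X: "?X \<in> Obj SetCat" "?Y \<in> Obj SetCat" using m by (simp_all add: cat_simps[OF S])
  have i: "inv_into (elts ?X) (app m) t \<in> elts ?X" "app m (inv_into (elts ?X) (app m) t) = t"
    if "t \<in> elts ?Y" for t
    using that b by (auto simp: bij_betw_def inv_into_into f_inv_into_f)
  have n: "n \<in> Arr SetCat" "Dom SetCat n = ?Y" "Cod SetCat n = ?X"
    using X i by (simp_all add: n_def smap_Arr smap_Dom smap_Cod)
  note [simp] = n X m cat_simps[OF S]
  show ?thesis
  proof (rule iso_arrI[OF m n])
    show "Cmp SetCat n m = Idn SetCat ?X"
    proof (rule SetCat_eqI)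
      fix t assume "t \<in> elts (Dom SetCat (Cmp SetCat n m))"
      then have t: "t \<in> elts ?X" by simp
      then show "app (Cmp SetCat n m) t = app (Idn SetCat ?X) t"
        using b app_in[OF m t] by (simp add: app_Cmp app_Idn n_def app_smap bij_betw_def)
    qed simp_all
    show "Cmp SetCat m n = Idn SetCat ?Y"
    proof (rule SetCat_eqI)
      fix t assume "t \<in> elts (Dom SetCat (Cmp SetCat m n))"
      then have t: "t \<in> elts ?Y" by simp
      then show "app (Cmp SetCat m n) t = app (Idn SetCat ?Y) t"
        using i by (simp add: app_Cmp app_Idn n(2)) (simp add: n_def app_smap)
    qed simp_all
  qed
qed

section \<open>Finite limits preserved by left exact functors\<close>

definition terminal_obj :: "('o, 'a) category \<Rightarrow> 'o \<Rightarrow> bool" where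
  "terminal_obj C T \<longleftrightarrow> T \<in> Obj C \<and> (\<forall>X\<in>Obj C. \<exists>!h. h \<in> homset C X T)"

text \<open>A cone over the empty diagram is a bare object, so a terminal object is a limit of empty
  shape.\<close>

lemma left_exact_terminal:
  assumes F: "functor_from_to F C D" and l: "left_exact F" and T: "terminal_obj C T"
  shows "terminal_obj D (FO F T)"
proof -
  define J :: "(nat, nat) category" where "J = \<lparr>Obj = {}, Arr = {}, Dom = id, Cod = id, Idn = id, Cmp = \<lambda>g f. f\<rparr>"
  define K where "K = \<lparr>FDom = J, FCod = C, FO = (\<lambda>_. undefined), FA = (\<lambda>_. undefined)\<rparr>"
  have J: "category J" by (simp add: category_def J_def)
  have K: "functor_from_to K J C"
    by (rule functorI[OF J functor_category_dom[OF F]]) (simp_all add: K_def J_def)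
  have *: "is_limit K' T' m \<longleftrightarrow> terminal_obj E T'" if "functor_from_to K' J E" for K' T' m E
    unfolding is_limit_iff[OF that] is_cone_iff[OF that] terminal_obj_def by (auto simp: J_def)
  have "is_limit K T (\<lambda>_. undefined)" using T by (simp add: *[OF K])
  from left_exactD[OF l F K _ _ this] show ?thesis
    by (simp add: *[OF functor_cmp[OF K F]] J_def)
qed

text \<open>Common form of products and pullbacks, the relation \<open>R\<close> being trivial for
  the former and commutation of the square for the latter. Transport along equivalences, the
  construction in sheaves and the description by elements are thereby done once.\<close>

definition univ_span ::
    "('o, 'a) category \<Rightarrow> 'o \<Rightarrow> 'o \<Rightarrow> ('a \<Rightarrow> 'a \<Rightarrow> bool) \<Rightarrow> 'o \<times> 'a \<times> 'a \<Rightarrow> bool" where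
  "univ_span C A B R = (\<lambda>(P, p, q). P \<in> Obj C \<and> p \<in> homset C P A \<and> q \<in> homset C P B \<and> R p q \<and>
    (\<forall>X\<in>Obj C. \<forall>f\<in>homset C X A. \<forall>g\<in>homset C X B. R f g \<longrightarrow>
      (\<exists>!h. h \<in> homset C X P \<and> Cmp C p h = f \<and> Cmp C q h = g)))"

lemma is_product_univ_span: "is_product C A B c \<longleftrightarrow> univ_span C A B (\<lambda>_ _. True) c"
  by (cases c) (auto simp: is_product_def univ_span_def)

lemma is_pullback_univ_span:
  "is_pullback C u v c \<longleftrightarrow> univ_span C (Dom C u) (Dom C v) (\<lambda>f g. Cmp C u f = Cmp C v g) c"
  by (cases c) (auto simp: is_pullback_def univ_span_def)

lemma
  assumes "univ_span C A B R (P, p, q)"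
  shows univ_span_Obj: "P \<in> Obj C"
    and univ_span_fst: "p \<in> Arr C" "Dom C p = P" "Cod C p = A"
    and univ_span_snd: "q \<in> Arr C" "Dom C q = P" "Cod C q = B" and univ_span_rel: "R p q"
  using assms by (auto simp: univ_span_def mem_homset)

lemma univ_spanI:
  assumes "P \<in> Obj C" and "p \<in> Arr C" "Dom C p = P" "Cod C p = A"
    and "q \<in> Arr C" "Dom C q = P" "Cod C q = B" "R p q"
    and ex: "\<And>f g. f \<in> Arr C \<Longrightarrow> g \<in> Arr C \<Longrightarrow> Dom C g = Dom C f \<Longrightarrow> Cod C f = A \<Longrightarrow> Cod C g = B \<Longrightarrow>
      R f g \<Longrightarrow> \<exists>h. h \<in> Arr C \<and> Dom C h = Dom C f \<and> Cod C h = P \<and> Cmp C p h = f \<and> Cmp C q h = g"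
    and uniq: "\<And>h k. h \<in> Arr C \<Longrightarrow> k \<in> Arr C \<Longrightarrow> Dom C k = Dom C h \<Longrightarrow> Cod C h = P \<Longrightarrow> Cod C k = P \<Longrightarrow>
      Cmp C p k = Cmp C p h \<Longrightarrow> Cmp C q k = Cmp C q h \<Longrightarrow> h = k"
  shows "univ_span C A B R (P, p, q)"
proof -
  have "\<exists>!h. (h \<in> Arr C \<and> Dom C h = X \<and> Cod C h = P) \<and> Cmp C p h = f \<and> Cmp C q h = g"
    if "f \<in> Arr C" "g \<in> Arr C" "Dom C f = X" "Dom C g = X" "Cod C f = A" "Cod C g = B" "R f g" for X f g
  proof (rule ex_ex1I)
    show "\<exists>h. (h \<in> Arr C \<and> Dom C h = X \<and> Cod C h = P) \<and> Cmp C p h = f \<and> Cmp C q h = g"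
      using ex[of f g] that by auto
  qed (rule uniq, auto)
  then show ?thesis
    using assms(1-8) by (auto simp: univ_span_def mem_homset)
qed

lemma univ_span_ex1:
  assumes u: "univ_span C A B R (P, p, q)" and C: "category C"
    and f: "f \<in> Arr C" "g \<in> Arr C" "Dom C f = X" "Dom C g = X" "Cod C f = A" "Cod C g = B" "R f g"
  shows "\<exists>!h. (h \<in> Arr C \<and> Dom C h = X \<and> Cod C h = P) \<and> Cmp C p h = f \<and> Cmp C q h = g"
proof -
  have X: "X \<in> Obj C" using f(1,3) Dom_Obj[OF C] by blast
  have "\<forall>X\<in>Obj C. \<forall>f\<in>homset C X A. \<forall>g\<in>homset C X B. R f g \<longrightarrow>
      (\<exists>!h. h \<in> homset C X P \<and> Cmp C p h = f \<and> Cmp C q h = g)"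
    using u by (simp add: univ_span_def)
  from this[rule_format, OF X, of f g] f show ?thesis by (simp add: mem_homset)
qed

lemma univ_span_ex:
  assumes "univ_span C A B R (P, p, q)" and "category C"
    and "f \<in> Arr C" "g \<in> Arr C" "Dom C f = X" "Dom C g = X" "Cod C f = A" "Cod C g = B" "R f g"
  obtains h where "h \<in> Arr C" "Dom C h = X" "Cod C h = P" "Cmp C p h = f" "Cmp C q h = g"
  using univ_span_ex1[OF assms] that by blast

lemma univ_span_unique:
  assumes u: "univ_span C A B R (P, p, q)" and C: "category C"
    and h: "h \<in> Arr C" "k \<in> Arr C" "Cod C h = P" "Cod C k = P" "Dom C h = Dom C k"
    and e: "Cmp C p h = Cmp C p k" "Cmp C q h = Cmp C q k"
    and R: "R (Cmp C p h) (Cmp C q h)"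
  shows "h = k"
proof -
  have "\<exists>!l. (l \<in> Arr C \<and> Dom C l = Dom C h \<and> Cod C l = P) \<and>
      Cmp C p l = Cmp C p h \<and> Cmp C q l = Cmp C q h"
    by (rule univ_span_ex1[OF u C])
      (use h R univ_span_fst[OF u] univ_span_snd[OF u] in \<open>simp_all add: cat_simps[OF C]\<close>)
  then show ?thesis using h e by metis
qed

lemma left_exact_product:
  assumes F: "functor_from_to F C D" and l: "left_exact F" and P: "is_product C A B (P, p, q)"
  shows "is_product D (FO F A) (FO F B) (FO F P, FA F p, FA F q)"
proof -
  note C = functor_category_dom[OF F]
  note pq = P[unfolded is_product_univ_span]
  \<comment> \<open>The discrete category on \<open>0\<close> and \<open>1\<close>; a number names
    an object and also its identity.\<close>
  define J :: "(nat, nat) category" where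
    "J = \<lparr>Obj = {0, 1}, Arr = {0, 1}, Dom = id, Cod = id, Idn = id, Cmp = \<lambda>g f. f\<rparr>"
  define K where "K = \<lparr>FDom = J, FCod = C, FO = (\<lambda>i\<in>{0, 1}. if i = 0 then A else B),
    FA = (\<lambda>i\<in>{0, 1}. Idn C (if i = 0 then A else B))\<rparr>"
  have AB: "A \<in> Obj C" "B \<in> Obj C"
    using univ_span_fst[OF pq] univ_span_snd[OF pq] C by (metis Cod_Obj)+
  have J: "category J" by (auto simp: category_def J_def mem_homset)
  have K: "functor_from_to K J C"
    by (rule functorI[OF J C]) (use AB in \<open>auto simp: K_def J_def cat_simps[OF C]\<close>)
  have *: "is_limit K' L m \<longleftrightarrow> is_product E (FO K' 0) (FO K' 1) (L, m 0, m 1)"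
    if K': "functor_from_to K' J E" for K' L m and E :: "('x, 'y) category"
  proof -
    note E = functor_category_cod[OF K']
    have a: "FA K' 0 = Idn E (FO K' 0)" "FA K' (Suc 0) = Idn E (FO K' (Suc 0))"
      using FA_Idn[OF K', of 0] FA_Idn[OF K', of 1] by (simp_all add: J_def)
    have c: "is_cone K' X x \<longleftrightarrow> X \<in> Obj E \<and> x 0 \<in> homset E X (FO K' 0) \<and> x 1 \<in> homset E X (FO K' 1)" for X x
      unfolding is_cone_iff[OF K'] by (auto simp: J_def a mem_homset cat_simps[OF E])
    show ?thesis
      unfolding is_limit_iff[OF K'] c is_product_def
    proof (simp, intro iffI conjI; (elim conjE)?)
      assume h: "\<forall>X x. X \<in> Obj E \<and> x 0 \<in> homset E X (FO K' 0) \<and> x (Suc 0) \<in> homset E X (FO K' (Suc 0)) \<longrightarrow>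
        (\<exists>!h. h \<in> homset E X L \<and> (\<forall>i\<in>Obj J. Cmp E (m i) h = x i))"
      show "\<forall>X\<in>Obj E. \<forall>f\<in>homset E X (FO K' 0). \<forall>g\<in>homset E X (FO K' (Suc 0)).
        \<exists>!h. h \<in> homset E X L \<and> Cmp E (m 0) h = f \<and> Cmp E (m (Suc 0)) h = g"
      proof (intro ballI)
        fix X f g assume "X \<in> Obj E" "f \<in> homset E X (FO K' 0)" "g \<in> homset E X (FO K' (Suc 0))"
        then show "\<exists>!h. h \<in> homset E X L \<and> Cmp E (m 0) h = f \<and> Cmp E (m (Suc 0)) h = g"
          using h[rule_format, of X "\<lambda>i. if i = 0 then f else g"] by (simp add: J_def)
      qed
    qed (auto simp: J_def)
  qed
  have 1: "is_limit K P (\<lambda>i. if i = 0 then p else q)"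
    using P by (simp add: *[OF K]) (simp add: K_def)
  show ?thesis
    using left_exactD[OF l F K _ _ 1] unfolding *[OF functor_cmp[OF K F]]
    by (simp add: J_def cmp_func_simps K_def)
qed

lemma left_exact_pullback:
  assumes F: "functor_from_to F C D" and l: "left_exact F" and P: "is_pullback C u v (P, p, q)"
    and uv: "u \<in> Arr C" "v \<in> Arr C" "Cod C u = Cod C v"
  shows "is_pullback D (FA F u) (FA F v) (FO F P, FA F p, FA F q)"
proof -
  note C = functor_category_dom[OF F]
  note pq = P[unfolded is_pullback_univ_span]
  \<comment> \<open>The cospan with \<open>3\<close> from \<open>0\<close> to \<open>2\<close> and
    \<open>4\<close> from \<open>1\<close> to \<open>2\<close>; the numbers \<open>0\<close>,
    \<open>1\<close>, \<open>2\<close> also name the identities.\<close>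
  define J :: "(nat, nat) category" where
    "J = \<lparr>Obj = {0, 1, 2}, Arr = {0, 1, 2, 3, 4}, Dom = (\<lambda>a. if a = 3 then 0 else if a = 4 then 1 else a),
      Cod = (\<lambda>a. if 3 \<le> a then 2 else a), Idn = id, Cmp = \<lambda>g f. if 3 \<le> f then f else g\<rparr>"
  define ob where "ob = (\<lambda>i::nat. if i = 0 then Dom C u else if i = 1 then Dom C v else Cod C u)"
  define K where "K = \<lparr>FDom = J, FCod = C, FO = restrict ob {0, 1, 2},
    FA = (\<lambda>i\<in>{0, 1, 2, 3, 4}. if i = 3 then u else if i = 4 then v else Idn C (ob i))\<rparr>"
  have J: "category J" by (auto simp: category_def J_def mem_homset)
  have K: "functor_from_to K J C"
  proof (rule functorI[OF J C])
    note [simp] = K_def J_def ob_def cat_simps[OF C] uv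
    show "x \<in> Obj J \<Longrightarrow> FO K x \<in> Obj C" "x \<in> Obj J \<Longrightarrow> FA K (Idn J x) = Idn C (FO K x)" for x
      by auto
    show "FA K f \<in> Arr C" "Dom C (FA K f) = FO K (Dom J f)" "Cod C (FA K f) = FO K (Cod J f)"
      if "f \<in> Arr J" for f
    proof -
      have "f = 0 \<or> f = 1 \<or> f = 2 \<or> f = 3 \<or> f = 4" using that by simp
      then show "FA K f \<in> Arr C" "Dom C (FA K f) = FO K (Dom J f)" "Cod C (FA K f) = FO K (Cod J f)"
        by (elim disjE; simp)+
    qed
    show "FA K (Cmp J g f) = Cmp C (FA K g) (FA K f)"
      if "f \<in> Arr J" "g \<in> Arr J" "Cod J f = Dom J g" for f g
    proof -
      have "f = 0 \<or> f = 1 \<or> f = 2 \<or> f = 3 \<or> f = 4" "g = 0 \<or> g = 1 \<or> g = 2 \<or> g = 3 \<or> g = 4"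
        using that by simp_all
      then show ?thesis using that(3) by (elim disjE; simp)
    qed
  qed (simp_all add: K_def J_def)
  have *: "is_limit K' L m \<longleftrightarrow> is_pullback E (FA K' 3) (FA K' 4) (L, m 0, m 1) \<and> m 2 = Cmp E (FA K' 3) (m 0)"
    if K': "functor_from_to K' J E" for K' L m and E :: "('x, 'y) category"
  proof -
    note E = functor_category_cod[OF K']
    have a: "FA K' 0 = Idn E (FO K' 0)" "FA K' (Suc 0) = Idn E (FO K' (Suc 0))" "FA K' 2 = Idn E (FO K' 2)"
      using FA_Idn[OF K', of 0] FA_Idn[OF K', of 1] FA_Idn[OF K', of 2] by (simp_all add: J_def)
    have b: "FA K' 3 \<in> Arr E" "Dom E (FA K' 3) = FO K' 0" "Cod E (FA K' 3) = FO K' 2"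
      "FA K' 4 \<in> Arr E" "Dom E (FA K' 4) = FO K' (Suc 0)" "Cod E (FA K' 4) = FO K' 2"
      using functor_simps(4,5,6)[OF K', of 3] functor_simps(4,5,6)[OF K', of 4] by (simp_all add: J_def)
    \<comment> \<open>The component at \<open>2\<close> is forced by the one at \<open>0\<close>, so
      a cone amounts to a commuting square.\<close>
    have c: "is_cone K' X x \<longleftrightarrow> X \<in> Obj E \<and> x 0 \<in> homset E X (FO K' 0) \<and>
        x (Suc 0) \<in> homset E X (FO K' (Suc 0)) \<and>
        x 2 = Cmp E (FA K' 3) (x 0) \<and> Cmp E (FA K' 3) (x 0) = Cmp E (FA K' 4) (x (Suc 0))" for X x
      unfolding is_cone_iff[OF K'] by (auto simp: J_def a b mem_homset cat_simps[OF E])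
    have d: "(\<forall>i\<in>Obj J. Cmp E (m i) h = x i) \<longleftrightarrow> Cmp E (m 0) h = x 0 \<and> Cmp E (m (Suc 0)) h = x (Suc 0)"
      if "is_cone K' L m" "is_cone K' X x" "h \<in> homset E X L" for X x h
    proof -
      have "Cmp E (m 2) h = x 2" if "Cmp E (m 0) h = x 0"
      proof -
        have "m 2 = Cmp E (FA K' 3) (m 0)" "x 2 = Cmp E (FA K' 3) (x 0)" "h \<in> Arr E" "m 0 \<in> Arr E"
          "Cod E h = Dom E (m 0)" "Cod E (m 0) = FO K' 0"
          using \<open>is_cone K' L m\<close> \<open>is_cone K' X x\<close> \<open>h \<in> homset E X L\<close> by (simp_all add: c mem_homset)
        then show ?thesis using that by (simp only: Cmp_assoc[OF E] b)
      qed
      then show ?thesis by (auto simp: J_def)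
    qed
    have "is_limit K' L m \<longleftrightarrow> is_cone K' L m \<and> (\<forall>X x. is_cone K' X x \<longrightarrow>
      (\<exists>!h. h \<in> homset E X L \<and> Cmp E (m 0) h = x 0 \<and> Cmp E (m (Suc 0)) h = x (Suc 0)))"
      unfolding is_limit_iff[OF K'] using d by (auto cong: conj_cong)
    also have "\<dots> \<longleftrightarrow> is_cone K' L m \<and> (\<forall>X\<in>Obj E. \<forall>f\<in>homset E X (FO K' 0).
      \<forall>g\<in>homset E X (FO K' (Suc 0)). Cmp E (FA K' 3) f = Cmp E (FA K' 4) g \<longrightarrow>
      (\<exists>!h. h \<in> homset E X L \<and> Cmp E (m 0) h = f \<and> Cmp E (m (Suc 0)) h = g))" (is "?c \<and> ?A \<longleftrightarrow> ?c \<and> ?B")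
    proof -
      have AB: "?B" if h: "?A"
      proof (intro ballI impI)
        fix X f g assume "X \<in> Obj E" "f \<in> homset E X (FO K' 0)" "g \<in> homset E X (FO K' (Suc 0))"
          "Cmp E (FA K' 3) f = Cmp E (FA K' 4) g"
        then show "\<exists>!h. h \<in> homset E X L \<and> Cmp E (m 0) h = f \<and> Cmp E (m (Suc 0)) h = g"
          using h[rule_format, of X "\<lambda>i. if i = 0 then f else if i = 1 then g else Cmp E (FA K' 3) f"]
          by (simp add: c)
      qed
      have BA: "?A" if B: "?B"
      proof (intro allI impI)
        fix X x assume "is_cone K' X x"
        then have "X \<in> Obj E" "x 0 \<in> homset E X (FO K' 0)" "x (Suc 0) \<in> homset E X (FO K' (Suc 0))"
          "Cmp E (FA K' 3) (x 0) = Cmp E (FA K' 4) (x (Suc 0))"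
          unfolding c by blast+
        with B show "\<exists>!h. h \<in> homset E X L \<and> Cmp E (m 0) h = x 0 \<and> Cmp E (m (Suc 0)) h = x (Suc 0)"
          by blast
      qed
      show ?thesis by (rule conj_cong[OF refl], rule iffI, erule AB, erule BA)
    qed
    also have "\<dots> \<longleftrightarrow> is_pullback E (FA K' 3) (FA K' 4) (L, m 0, m 1) \<and> m 2 = Cmp E (FA K' 3) (m 0)"
      unfolding is_pullback_def c by (auto simp: b)
    finally show ?thesis .
  qed
  have 1: "is_limit K P (\<lambda>i. if i = 0 then p else if i = 1 then q else Cmp C u p)"
    using P by (simp add: *[OF K]) (simp add: K_def)
  show ?thesis
    using left_exactD[OF l F K _ _ 1] unfolding *[OF functor_cmp[OF K F]]
    by (simp add: J_def cmp_func_simps K_def)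
qed

text \<open>An arrow is a monomorphism exactly when the square of two identities over it is a
  pullback, and \<open>F\<close> preserves this pullback.\<close>

lemma left_exact_mono:
  assumes F: "functor_from_to F C D" and l: "left_exact F" and m: "m \<in> Arr C"
    and mono: "\<And>f g. f \<in> Arr C \<Longrightarrow> g \<in> Arr C \<Longrightarrow> Dom C f = Dom C g \<Longrightarrow> Cod C f = Dom C m \<Longrightarrow>
      Cod C g = Dom C m \<Longrightarrow> Cmp C m f = Cmp C m g \<Longrightarrow> f = g"
    and fg: "f \<in> Arr D" "g \<in> Arr D" "Dom D f = Dom D g" "Cod D f = FO F (Dom C m)"
      "Cod D g = FO F (Dom C m)" and e: "Cmp D (FA F m) f = Cmp D (FA F m) g"
  shows "f = g"
proof -
  note C = functor_category_dom[OF F] and D = functor_category_cod[OF F]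
  let ?i = "Idn C (Dom C m)"
  have "is_pullback C m m (Dom C m, ?i, ?i)"
    unfolding is_pullback_univ_span
  proof (rule univ_spanI)
    fix f g assume fg: "f \<in> Arr C" "g \<in> Arr C" "Dom C g = Dom C f" "Cod C f = Dom C m" "Cod C g = Dom C m"
      "Cmp C m f = Cmp C m g"
    have "f = g" by (rule mono) (use fg in simp_all)
    then show "\<exists>h. h \<in> Arr C \<and> Dom C h = Dom C f \<and> Cod C h = Dom C m \<and> Cmp C ?i h = f \<and> Cmp C ?i h = g"
      using fg(1,4) by (intro exI[of _ f]) (simp add: cat_simps[OF C])
  qed (use m in \<open>simp_all add: cat_simps[OF C]\<close>)
  from left_exact_pullback[OF F l this m m refl]
  have "univ_span D (FO F (Dom C m)) (FO F (Dom C m)) (\<lambda>f g. Cmp D (FA F m) f = Cmp D (FA F m) g)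
      (FO F (Dom C m), Idn D (FO F (Dom C m)), Idn D (FO F (Dom C m)))"
    using m unfolding is_pullback_univ_span by (simp add: functor_simps[OF F] cat_simps[OF C])
  from univ_span_ex[OF this D fg(1,2) refl _ fg(4,5) e] fg show ?thesis
    by (metis cat_simps(10)[OF D])
qed

section \<open>Products and pullbacks in a topos\<close>

text \<open>The apex \<open>P\<close> is isomorphic to some \<open>FO F x\<close>, and fullness
  lifts the legs to \<open>x\<close>. The relations have to correspond under \<open>F\<close>, and
  \<open>R'\<close> has to be stable under precomposition so that moving the legs along the
  isomorphism \<open>s\<close> keeps them related.\<close>

lemma univ_span_equivalence:
  assumes F: "functor_from_to F C D" and eq: "equivalence_functor F"
    and AB: "A \<in> Obj C" "B \<in> Obj C"
    and P: "univ_span D (FO F A) (FO F B) R' (P, p, q)"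
    and R: "\<And>f g. f \<in> Arr C \<Longrightarrow> g \<in> Arr C \<Longrightarrow> Cod C f = A \<Longrightarrow> Cod C g = B \<Longrightarrow> Dom C f = Dom C g \<Longrightarrow>
      R f g \<longleftrightarrow> R' (FA F f) (FA F g)"
    and R': "\<And>f g s. f \<in> Arr D \<Longrightarrow> g \<in> Arr D \<Longrightarrow> s \<in> Arr D \<Longrightarrow> Dom D f = Cod D s \<Longrightarrow> Dom D g = Cod D s \<Longrightarrow>
      Cod D f = FO F A \<Longrightarrow> Cod D g = FO F B \<Longrightarrow> R' f g \<Longrightarrow> R' (Cmp D f s) (Cmp D g s)"
  shows "\<exists>c. univ_span C A B R c"
proof -
  note C = functor_category_dom[OF F] and D = functor_category_cod[OF F]
  note [simp] = functor_simps[OF F] cat_simps[OF C] cat_simps[OF D]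
  note p = univ_span_Obj[OF P] univ_span_fst[OF P] univ_span_snd[OF P]
  note [simp] = p
  obtain x s where x: "x \<in> Obj C" and s: "s \<in> Arr D" "Dom D s = FO F x" "Cod D s = P" and iss: "iso_arr D s"
    by (rule equivalence_functor_ess_surj[OF F eq p(1)])
  note [simp] = x s
  obtain p' where p': "p' \<in> Arr C" "Dom C p' = x" "Cod C p' = A" "FA F p' = Cmp D p s"
    by (rule equivalence_functor_full[OF F eq x AB(1), of "Cmp D p s"]) simp_all
  obtain q' where q': "q' \<in> Arr C" "Dom C q' = x" "Cod C q' = B" "FA F q' = Cmp D q s"
    by (rule equivalence_functor_full[OF F eq x AB(2), of "Cmp D q s"]) simp_all
  note [simp] = p' q'
  have "univ_span C A B R (x, p', q')"
  proof (rule univ_spanI)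
    show "R p' q'"
      by (simp add: R R' univ_span_rel[OF P])
    fix f g assume f [simp]: "f \<in> Arr C" "g \<in> Arr C" "Dom C g = Dom C f" "Cod C f = A" "Cod C g = B"
      and r: "R f g"
    have r': "R' (FA F f) (FA F g)" using r by (simp add: R)
    obtain h where h [simp]: "h \<in> Arr D" "Dom D h = FO F (Dom C f)" "Cod D h = P"
        "Cmp D p h = FA F f" "Cmp D q h = FA F g"
      by (rule univ_span_ex[OF P D, of "FA F f" "FA F g" "FO F (Dom C f)"]) (simp_all add: r')
    note [simp] = inv_simps[OF iss]
    obtain k where k [simp]: "k \<in> Arr C" "Dom C k = Dom C f" "Cod C k = x" "FA F k = Cmp D (inv_arr D s) h"
      by (rule equivalence_functor_full[OF F eq _ x, of "Dom C f" "Cmp D (inv_arr D s) h"]) simp_all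
    have a: "Cmp D s (Cmp D (inv_arr D s) h) = h"
      by (rule Cmp_inv_right[OF D iss]) simp_all
    have "Cmp C p' k = f" "Cmp C q' k = g"
      by (rule equivalence_functor_faithful[OF F eq]; simp add: a)+
    then show "\<exists>h. h \<in> Arr C \<and> Dom C h = Dom C f \<and> Cod C h = x \<and> Cmp C p' h = f \<and> Cmp C q' h = g"
      by (intro exI[of _ k]) simp
  next
    fix h k assume h: "h \<in> Arr C" "k \<in> Arr C" "Dom C k = Dom C h" "Cod C h = x" "Cod C k = x"
      and e: "Cmp C p' k = Cmp C p' h" "Cmp C q' k = Cmp C q' h"
    note [simp] = h
    \<comment> \<open>Uniqueness for the span in \<open>D\<close> concerns related pairs only;
      stability of \<open>R'\<close> provides the relation for arrows through the apex.\<close>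
    have "R' (Cmp D p (Cmp D s (FA F h))) (Cmp D q (Cmp D s (FA F h)))"
      by (intro R') (simp_all add: univ_span_rel[OF P])
    moreover have "Cmp D p (Cmp D s (FA F k)) = Cmp D p (Cmp D s (FA F h))"
      "Cmp D q (Cmp D s (FA F k)) = Cmp D q (Cmp D s (FA F h))"
      using e[THEN arg_cong[of _ _ "FA F"]] by simp_all
    ultimately have "Cmp D s (FA F h) = Cmp D s (FA F k)"
      by - (rule univ_span_unique[OF P D], simp_all)
    then have "FA F h = FA F k"
      by - (rule iso_cancel_left[OF D iss, rotated -1], simp_all)
    then show "h = k"
      by - (rule equivalence_functor_faithful[OF F eq, rotated -1], simp_all)
  qed simp_all
  then show ?thesis by blast
qed

text \<open>The product and the pullback of sheaves are both of this form.\<close>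

definition pair_presheaf ::
    "('u::universe, 'u) category \<Rightarrow> ('u, 'u, 'u large, 'u large) func \<Rightarrow> ('u, 'u, 'u large, 'u large) func \<Rightarrow>
     ('u \<Rightarrow> 'u \<Rightarrow> 'u \<Rightarrow> bool) \<Rightarrow> ('u, 'u, 'u large, 'u large) func" where
  "pair_presheaf C P Q R = (let
     ob = (\<lambda>c. Sub {upair a b | a b. a \<in> elts (FO P c) \<and> b \<in> elts (FO Q c) \<and> R c a b})
   in \<lparr>FDom = op_cat C, FCod = SetCat, FO = restrict ob (Obj C),
     FA = (\<lambda>f\<in>Arr C. smap (ob (Cod C f)) (ob (Dom C f))
       (\<lambda>t. upair (app (FA P f) (ufst t)) (app (FA Q f) (usnd t))))\<rparr>)"

section \<open>Sheaves of pairs\<close>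

lemma op_cat_simps: "Obj (op_cat C) = Obj C" "Arr (op_cat C) = Arr C" "Dom (op_cat C) = Cod C"
  "Cod (op_cat C) = Dom C" "Idn (op_cat C) = Idn C" "Cmp (op_cat C) g f = Cmp C f g"
  by (simp_all add: op_cat_def)

lemma category_op: "category C \<Longrightarrow> category (op_cat C)"
  unfolding category_def op_cat_simps mem_homset by auto

lemma
  assumes "is_sheaf C J P"
  shows sheaf_functor: "functor_from_to P (op_cat C) SetCat"
    and sheaf_Obj: "c \<in> Obj C \<Longrightarrow> FO P c \<in> Obj SetCat"
    and sheaf_Idn: "c \<in> Obj C \<Longrightarrow> FA P (Idn C c) = Idn SetCat (FO P c)"
    and sheaf_ex1: "c \<in> Obj C \<Longrightarrow> S \<in> J c \<Longrightarrow> (\<And>f. f \<in> S \<Longrightarrow> x f \<in> elts (FO P (Dom C f))) \<Longrightarrow>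
      (\<And>f g. f \<in> S \<Longrightarrow> g \<in> Arr C \<Longrightarrow> Cod C g = Dom C f \<Longrightarrow> x (Cmp C f g) = app (FA P g) (x f)) \<Longrightarrow>
      \<exists>!y. y \<in> elts (FO P c) \<and> (\<forall>f\<in>S. app (FA P f) y = x f)"
proof -
  show "functor_from_to P (op_cat C) SetCat"
    using assms by (simp add: is_sheaf_def)
  note sf = functor_simps[OF this, unfolded op_cat_simps]
  show "c \<in> Obj C \<Longrightarrow> FO P c \<in> Obj SetCat" "c \<in> Obj C \<Longrightarrow> FA P (Idn C c) = Idn SetCat (FO P c)"
    by (simp_all add: sf)
  have "\<forall>c\<in>Obj C. \<forall>S\<in>J c. \<forall>x. (\<forall>f\<in>S. x f \<in> elts (FO P (Dom C f))) \<and>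
      (\<forall>f\<in>S. \<forall>g\<in>Arr C. Cod C g = Dom C f \<longrightarrow> x (Cmp C f g) = app (FA P g) (x f)) \<longrightarrow>
      (\<exists>!y. y \<in> elts (FO P c) \<and> (\<forall>f\<in>S. app (FA P f) y = x f))"
    using assms by (simp add: is_sheaf_def)
  then show "c \<in> Obj C \<Longrightarrow> S \<in> J c \<Longrightarrow> (\<And>f. f \<in> S \<Longrightarrow> x f \<in> elts (FO P (Dom C f))) \<Longrightarrow>
      (\<And>f g. f \<in> S \<Longrightarrow> g \<in> Arr C \<Longrightarrow> Cod C g = Dom C f \<Longrightarrow> x (Cmp C f g) = app (FA P g) (x f)) \<Longrightarrow>
      \<exists>!y. y \<in> elts (FO P c) \<and> (\<forall>f\<in>S. app (FA P f) y = x f)"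
    by simp
qed

lemma app_FA_in:
  assumes F: "functor_from_to F C SetCat" and "f \<in> Arr C" "x \<in> elts (FO F (Dom C f))"
  shows "app (FA F f) x \<in> elts (FO F (Cod C f))"
  using app_in[of "FA F f" x] assms by (simp add: functor_simps[OF F])

lemma app_FA_Cmp:
  assumes F: "functor_from_to F C SetCat" and "f \<in> Arr C" "g \<in> Arr C" "Cod C f = Dom C g"
    "x \<in> elts (FO F (Dom C f))"
  shows "app (FA F (Cmp C g f)) x = app (FA F g) (app (FA F f) x)"
  using assms by (simp add: functor_simps[OF F] app_Cmp)

lemma app_FA_Idn:
  assumes F: "functor_from_to F C SetCat" and "c \<in> Obj C" "x \<in> elts (FO F c)"
  shows "app (FA F (Idn C c)) x = x"
  using assms by (simp add: functor_simps[OF F] app_Idn)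

lemma ntrans_app:
  assumes t: "ntrans C SetCat F G t" and c: "c \<in> Obj C" and x: "x \<in> elts (FO F c)"
  shows "app (t c) x \<in> elts (FO G c)"
  using app_in[of "t c" x] c x by (simp add: ntrans_simps[OF t])

lemma ntrans_app_sq:
  assumes t: "ntrans C SetCat F G t" and f: "f \<in> Arr C" and x: "x \<in> elts (FO F (Dom C f))"
  shows "app (t (Cod C f)) (app (FA F f) x) = app (FA G f) (app (t (Dom C f)) x)"
proof -
  note F = ntrans_dom[OF t]
  note [simp] = functor_simps[OF F] ntrans_simps[OF t] cat_simps[OF functor_category_dom[OF F]]
  have "app (Cmp SetCat (t (Cod C f)) (FA F f)) x = app (Cmp SetCat (FA G f) (t (Dom C f))) x"
    by (simp add: ntrans_sq[OF t f])
  then show ?thesis using f x by (simp add: app_Cmp)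
qed

lemma ntrans_smap:
  assumes F: "functor_from_to F C SetCat" and G: "functor_from_to G C SetCat"
    and "\<And>c x. c \<in> Obj C \<Longrightarrow> x \<in> elts (FO F c) \<Longrightarrow> \<tau> c x \<in> elts (FO G c)"
    and "\<And>f x. f \<in> Arr C \<Longrightarrow> x \<in> elts (FO F (Dom C f)) \<Longrightarrow>
      \<tau> (Cod C f) (app (FA F f) x) = app (FA G f) (\<tau> (Dom C f) x)"
  shows "ntrans C SetCat F G (\<lambda>c\<in>Obj C. smap (FO F c) (FO G c) (\<tau> c))"
proof -
  note [simp] = functor_simps[OF F] functor_simps[OF G] cat_simps[OF functor_category_dom[OF F]]
    cat_simps[OF category_SetCat] smap_Arr smap_Dom smap_Cod assms(3)
  show ?thesis
  proof (rule ntransI[OF F G])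
    fix f assume f: "f \<in> Arr C"
    show "Cmp SetCat ((\<lambda>c\<in>Obj C. smap (FO F c) (FO G c) (\<tau> c)) (Cod C f)) (FA F f) =
        Cmp SetCat (FA G f) ((\<lambda>c\<in>Obj C. smap (FO F c) (FO G c) (\<tau> c)) (Dom C f))"
      by (rule SetCat_eqI)
        (use f app_FA_in[OF F f] in \<open>auto simp: app_Cmp app_smap assms(4)\<close>)
  qed auto
qed

lemma ntrans_app_eqI:
  assumes t: "ntrans C SetCat F G t" and s: "ntrans C SetCat F G s"
    and e: "\<And>c x. c \<in> Obj C \<Longrightarrow> x \<in> elts (FO F c) \<Longrightarrow> app (t c) x = app (s c) x"
  shows "t = s"
  by (rule ntrans_eqI[OF t s], rule SetCat_eqI) (use e in \<open>simp_all add: ntrans_simps[OF t] ntrans_simps[OF s]\<close>)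

lemma
  assumes "C' = sheaf_category C J"
  shows sheaf_cat_Obj: "P \<in> Obj C' \<longleftrightarrow> is_sheaf C J P"
    and sheaf_cat_Arr: "t \<in> Arr C' \<longleftrightarrow> is_sheaf C J (TDom t) \<and> is_sheaf C J (TCod t) \<and>
      ntrans (op_cat C) SetCat (TDom t) (TCod t) (TMap t)"
    and sheaf_cat_Dom: "Dom C' t = TDom t" and sheaf_cat_Cod: "Cod C' t = TCod t"
    and sheaf_cat_Cmp: "Cmp C' s t = \<lparr>TDom = TDom t, TCod = TCod s,
                   TMap = (\<lambda>c\<in>Obj C. Cmp SetCat (TMap s c) (TMap t c))\<rparr>"
    and sheaf_cat_Idn: "Idn C' P = \<lparr>TDom = P, TCod = P, TMap = (\<lambda>c\<in>Obj C. Idn SetCat (FO P c))\<rparr>"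
proof -
  show "t \<in> Arr C' \<longleftrightarrow> is_sheaf C J (TDom t) \<and> is_sheaf C J (TCod t) \<and>
      ntrans (op_cat C) SetCat (TDom t) (TCod t) (TMap t)"
    using sheaf_functor[of C J "TDom t"] sheaf_functor[of C J "TCod t"] assms
    by (auto simp: sheaf_category_def ntrans_def)
qed (use assms in \<open>simp_all add: sheaf_category_def\<close>)

text \<open>A compatible family of pairs is glued in each component separately.
  \<open>stable\<close> makes restriction of related pairs well defined, and \<open>local\<close>
  puts the glued pair back into the relation.\<close>

lemma is_sheaf_pair_presheaf:
  assumes C: "category C" and J: "grothendieck_topology C J" and P: "is_sheaf C J P" and Q: "is_sheaf C J Q"
    and stable: "\<And>f a b. f \<in> Arr C \<Longrightarrow> a \<in> elts (FO P (Cod C f)) \<Longrightarrow> b \<in> elts (FO Q (Cod C f)) \<Longrightarrow>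
      R (Cod C f) a b \<Longrightarrow> R (Dom C f) (app (FA P f) a) (app (FA Q f) b)"
    and local: "\<And>c S a b. c \<in> Obj C \<Longrightarrow> S \<in> J c \<Longrightarrow> a \<in> elts (FO P c) \<Longrightarrow> b \<in> elts (FO Q c) \<Longrightarrow>
      (\<And>f. f \<in> S \<Longrightarrow> R (Dom C f) (app (FA P f) a) (app (FA Q f) b)) \<Longrightarrow> R c a b"
  shows "is_sheaf C J (pair_presheaf C P Q R)"
proof -
  let ?W = "pair_presheaf C P Q R"
  note FP = sheaf_functor[OF P] and FQ = sheaf_functor[OF Q]
  note [simp] = cat_simps[OF C] cat_simps[OF category_SetCat] op_cat_simps
  have FO: "FO ?W c = Sub {upair a b | a b. a \<in> elts (FO P c) \<and> b \<in> elts (FO Q c) \<and> R c a b}"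
    if "c \<in> Obj C" for c
    using that by (simp add: pair_presheaf_def Let_def)
  have FA: "FA ?W f = smap (FO ?W (Cod C f)) (FO ?W (Dom C f))
      (\<lambda>t. upair (app (FA P f) (ufst t)) (app (FA Q f) (usnd t)))" if "f \<in> Arr C" for f
    using that FO[of "Dom C f"] FO[of "Cod C f"] by (simp add: pair_presheaf_def Let_def)
  have ob [simp]: "FO ?W c \<in> Obj SetCat" if "c \<in> Obj C" for c
    using that sheaf_Obj[OF P that] sheaf_Obj[OF Q that] by (simp add: FO SetCat_Obj small_pairs)
  have in_P: "app (FA P f) a \<in> elts (FO P (Dom C f))" if "f \<in> Arr C" "a \<in> elts (FO P (Cod C f))" for f a
    using app_FA_in[OF FP, of f a] that by simp
  have in_Q: "app (FA Q f) a \<in> elts (FO Q (Dom C f))" if "f \<in> Arr C" "a \<in> elts (FO Q (Cod C f))" for f a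
    using app_FA_in[OF FQ, of f a] that by simp
  have W: "functor_from_to ?W (op_cat C) SetCat"
  proof (rule functorI[OF category_op[OF C] category_SetCat])
    show "FO ?W c \<in> Obj SetCat" if "c \<in> Obj (op_cat C)" for c
      using ob that by simp
    fix f assume "f \<in> Arr (op_cat C)"
    then have [simp]: "f \<in> Arr C" by simp
    show "FA ?W f \<in> Arr SetCat"
      unfolding FA[OF \<open>f \<in> Arr C\<close>] by (rule smap_Arr[OF ob ob]) (auto simp: FO in_P in_Q stable)
    show "Dom SetCat (FA ?W f) = FO ?W (Dom (op_cat C) f)" "Cod SetCat (FA ?W f) = FO ?W (Cod (op_cat C) f)"
      by (simp_all add: FA smap_Dom smap_Cod)
  next
    fix c assume "c \<in> Obj (op_cat C)"
    then have c [simp]: "c \<in> Obj C" by simp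
    have e: "upair (app (FA P (Idn C c)) (ufst t)) (app (FA Q (Idn C c)) (usnd t)) = t"
      "upair (app (FA P (Idn C c)) (ufst t)) (app (FA Q (Idn C c)) (usnd t)) \<in> elts (FO ?W c)"
      if "t \<in> elts (FO ?W c)" for t
      using that by (auto simp: FO app_Idn sheaf_Idn[OF P] sheaf_Idn[OF Q])
    have F: "FA ?W (Idn C c) = smap (FO ?W c) (FO ?W c)
        (\<lambda>t. upair (app (FA P (Idn C c)) (ufst t)) (app (FA Q (Idn C c)) (usnd t)))"
      using FA[of "Idn C c"] by simp
    have "FA ?W (Idn C c) = Idn SetCat (FO ?W c)"
      by (rule SetCat_eqI)
        (use ob[OF c] in \<open>simp_all add: F smap_Arr[OF ob ob] smap_Dom smap_Cod app_smap app_Idn e\<close>)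
    then show "FA ?W (Idn (op_cat C) c) = Idn SetCat (FO ?W c)" by simp
  next
    fix f g assume "f \<in> Arr (op_cat C)" "g \<in> Arr (op_cat C)" "Cod (op_cat C) f = Dom (op_cat C) g"
    then have fg [simp]: "f \<in> Arr C" "g \<in> Arr C" "Dom C f = Cod C g" by simp_all
    have A: "FA ?W h \<in> Arr SetCat" if [simp]: "h \<in> Arr C" for h
      unfolding FA[OF \<open>h \<in> Arr C\<close>] by (rule smap_Arr[OF ob ob]) (auto simp: FO in_P in_Q stable)
    have D: "Dom SetCat (FA ?W h) = FO ?W (Cod C h)" "Cod SetCat (FA ?W h) = FO ?W (Dom C h)" if "h \<in> Arr C" for h
      using that by (simp_all add: FA smap_Dom smap_Cod)
    show "FA ?W (Cmp (op_cat C) g f) = Cmp SetCat (FA ?W g) (FA ?W f)"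
    proof (rule SetCat_eqI)
      fix t assume t: "t \<in> elts (Dom SetCat (FA ?W (Cmp (op_cat C) g f)))"
      then obtain a b where ab: "t = upair a b" "a \<in> elts (FO P (Cod C f))" "b \<in> elts (FO Q (Cod C f))" "R (Cod C f) a b"
        by (auto simp: D FO)
      have t': "t \<in> elts (FO ?W (Cod C f))" using t by (simp add: D)
      have 1: "app (FA ?W f) t = upair (app (FA P f) a) (app (FA Q f) b)"
        using t' ab by (simp add: FA app_smap)
      have 2: "app (FA ?W f) t \<in> elts (FO ?W (Cod C g))"
        using app_in[OF A[OF fg(1)], of t] t' by (simp add: D)
      have 3: "app (FA ?W g) (app (FA ?W f) t) = upair (app (FA P g) (app (FA P f) a)) (app (FA Q g) (app (FA Q f) b))"
        using 2 unfolding 1 by (simp add: FA app_smap)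
      have 4: "app (FA ?W (Cmp C f g)) t = upair (app (FA P (Cmp C f g)) a) (app (FA Q (Cmp C f g)) b)"
        using t' ab by (simp add: FA app_smap)
      show "app (FA ?W (Cmp (op_cat C) g f)) t = app (Cmp SetCat (FA ?W g) (FA ?W f)) t"
        using t' ab(2-) app_FA_Cmp[OF FP, of f g a] app_FA_Cmp[OF FQ, of f g b]
        by (simp add: app_Cmp D 3 4)
    qed (simp_all add: A D)
  qed (simp_all add: pair_presheaf_def Let_def op_cat_simps)
  have ap: "app (FA ?W f) (upair a b) = upair (app (FA P f) a) (app (FA Q f) b)"
    if "f \<in> Arr C" "upair a b \<in> elts (FO ?W (Cod C f))" for f a b
    using that by (simp add: FA app_smap)
  show ?thesis
    unfolding is_sheaf_def
  proof (intro conjI ballI allI impI; (elim conjE)?)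
    fix c S x assume c: "c \<in> Obj C" and S: "S \<in> J c" and x: "\<forall>f\<in>S. x f \<in> elts (FO ?W (Dom C f))"
      and xg: "\<forall>f\<in>S. \<forall>g\<in>Arr C. Cod C g = Dom C f \<longrightarrow> x (Cmp C f g) = app (FA ?W g) (x f)"
    have Sf [simp]: "f \<in> Arr C" "Cod C f = c" if "f \<in> S" for f
      using J c S that by (auto simp: grothendieck_topology_def sieve_def)
    have x': "\<exists>a b. x f = upair a b \<and> a \<in> elts (FO P (Dom C f)) \<and> b \<in> elts (FO Q (Dom C f)) \<and> R (Dom C f) a b"
      if "f \<in> S" for f
      using x that by (auto simp: FO)
    have xp: "ufst (x f) \<in> elts (FO P (Dom C f))" "usnd (x f) \<in> elts (FO Q (Dom C f))"
      "R (Dom C f) (ufst (x f)) (usnd (x f))" if "f \<in> S" for f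
      using x'[OF that] by auto
    have xx: "x f = upair (ufst (x f)) (usnd (x f))" if "f \<in> S" for f using x'[OF that] by auto
    have xg': "x (Cmp C f g) = upair (app (FA P g) (ufst (x f))) (app (FA Q g) (usnd (x f)))"
      if "f \<in> S" "g \<in> Arr C" "Cod C g = Dom C f" for f g
      using xg that ap[of g "ufst (x f)" "usnd (x f)"] x xx[OF that(1)] by simp
    have "\<exists>!y. y \<in> elts (FO P c) \<and> (\<forall>f\<in>S. app (FA P f) y = ufst (x f))"
      by (rule sheaf_ex1[OF P c S, of "\<lambda>f. ufst (x f)"]) (simp_all add: xp xg')
    then obtain a where a: "a \<in> elts (FO P c)" "\<And>f. f \<in> S \<Longrightarrow> app (FA P f) a = ufst (x f)"
      and a': "\<And>y. y \<in> elts (FO P c) \<Longrightarrow> \<forall>f\<in>S. app (FA P f) y = ufst (x f) \<Longrightarrow> y = a"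
      by blast
    have "\<exists>!y. y \<in> elts (FO Q c) \<and> (\<forall>f\<in>S. app (FA Q f) y = usnd (x f))"
      by (rule sheaf_ex1[OF Q c S, of "\<lambda>f. usnd (x f)"]) (simp_all add: xp xg')
    then obtain b where b: "b \<in> elts (FO Q c)" "\<And>f. f \<in> S \<Longrightarrow> app (FA Q f) b = usnd (x f)"
      and b': "\<And>y. y \<in> elts (FO Q c) \<Longrightarrow> \<forall>f\<in>S. app (FA Q f) y = usnd (x f) \<Longrightarrow> y = b"
      by blast
    have R: "R c a b"
      by (rule local[OF c S a(1) b(1)]) (simp add: a b xp)
    show "\<exists>!y. y \<in> elts (FO ?W c) \<and> (\<forall>f\<in>S. app (FA ?W f) y = x f)"
    proof (rule ex1I[of _ "upair a b"])
      have ab: "upair a b \<in> elts (FO ?W c)" using a b R c by (auto simp: FO)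
      then show "upair a b \<in> elts (FO ?W c) \<and> (\<forall>f\<in>S. app (FA ?W f) (upair a b) = x f)"
        using ap[of _ a b] a(2) b(2) xx by simp
      fix y assume y: "y \<in> elts (FO ?W c) \<and> (\<forall>f\<in>S. app (FA ?W f) y = x f)"
      then obtain d e where de: "y = upair d e" "d \<in> elts (FO P c)" "e \<in> elts (FO Q c)"
        using c by (auto simp: FO)
      have "upair (app (FA P f) d) (app (FA Q f) e) = x f" if "f \<in> S" for f
        using ap[of f d e] y that de(1) by simp
      then have "app (FA P f) d = ufst (x f)" "app (FA Q f) e = usnd (x f)" if "f \<in> S" for f
        using that by (metis ufst_upair, metis usnd_upair)
      then show "y = upair a b" using a' b' de by simp
    qed
  qed (rule W)
qed

text \<open>The universal property is checked on sections: a mediating map must send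
  \<open>t\<close> to the pair of its two images. Accordingly \<open>R'\<close> is required to be
  \<open>R\<close> tested on all sections.\<close>

lemma sheaf_category_univ_span:
  assumes C: "category C" and J: "grothendieck_topology C J" and P: "is_sheaf C J P" and Q: "is_sheaf C J Q"
    and stable: "\<And>f a b. f \<in> Arr C \<Longrightarrow> a \<in> elts (FO P (Cod C f)) \<Longrightarrow> b \<in> elts (FO Q (Cod C f)) \<Longrightarrow>
      R (Cod C f) a b \<Longrightarrow> R (Dom C f) (app (FA P f) a) (app (FA Q f) b)"
    and local: "\<And>c S a b. c \<in> Obj C \<Longrightarrow> S \<in> J c \<Longrightarrow> a \<in> elts (FO P c) \<Longrightarrow> b \<in> elts (FO Q c) \<Longrightarrow>
      (\<And>f. f \<in> S \<Longrightarrow> R (Dom C f) (app (FA P f) a) (app (FA Q f) b)) \<Longrightarrow> R c a b"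
    and R': "\<And>f g. f \<in> Arr (sheaf_category C J) \<Longrightarrow> g \<in> Arr (sheaf_category C J) \<Longrightarrow>
      TDom g = TDom f \<Longrightarrow> TCod f = P \<Longrightarrow> TCod g = Q \<Longrightarrow>
      R' f g \<longleftrightarrow> (\<forall>c\<in>Obj C. \<forall>t\<in>elts (FO (TDom f) c). R c (app (TMap f c) t) (app (TMap g c) t))"
  shows "\<exists>c. univ_span (sheaf_category C J) P Q R' c"
proof -
  let ?W = "pair_presheaf C P Q R" and ?S = "sheaf_category C J"
  have W: "is_sheaf C J ?W"
    by (rule is_sheaf_pair_presheaf[OF C J P Q, of R]) (rule stable local; assumption)+
  note FW = sheaf_functor[OF W] and FP = sheaf_functor[OF P] and FQ = sheaf_functor[OF Q]
  have FO: "FO ?W c = Sub {upair a b | a b. a \<in> elts (FO P c) \<and> b \<in> elts (FO Q c) \<and> R c a b}"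
    if "c \<in> Obj C" for c
    using that by (simp add: pair_presheaf_def Let_def)
  note [simp] = cat_simps[OF C] cat_simps[OF category_SetCat] op_cat_simps
  have ap: "app (FA ?W f) t = upair (app (FA P f) (ufst t)) (app (FA Q f) (usnd t))"
    if "f \<in> Arr C" "t \<in> elts (FO ?W (Cod C f))" for f t
    using that by (simp add: pair_presheaf_def Let_def app_smap)
  define p where "p = \<lparr>TDom = ?W, TCod = P, TMap = (\<lambda>c\<in>Obj C. smap (FO ?W c) (FO P c) ufst)\<rparr>"
  define q where "q = \<lparr>TDom = ?W, TCod = Q, TMap = (\<lambda>c\<in>Obj C. smap (FO ?W c) (FO Q c) usnd)\<rparr>"
  have "ntrans (op_cat C) SetCat ?W P (\<lambda>c\<in>Obj (op_cat C). smap (FO ?W c) (FO P c) ufst)"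
    by (rule ntrans_smap[OF FW FP]) (auto simp: FO ap)
  then have p: "p \<in> Arr ?S" by (simp add: sheaf_cat_Arr p_def W P)
  have "ntrans (op_cat C) SetCat ?W Q (\<lambda>c\<in>Obj (op_cat C). smap (FO ?W c) (FO Q c) usnd)"
    by (rule ntrans_smap[OF FW FQ]) (auto simp: FO ap)
  then have q: "q \<in> Arr ?S" by (simp add: sheaf_cat_Arr q_def W Q)
  have pt: "app (TMap p c) t = ufst t" "app (TMap q c) t = usnd t" if "c \<in> Obj C" "t \<in> elts (FO ?W c)" for c t
    using that by (simp_all add: p_def q_def app_smap)
  note sc = sheaf_cat_Obj sheaf_cat_Dom sheaf_cat_Cod sheaf_cat_Cmp
  have nt: "ntrans (op_cat C) SetCat (TDom h) (TCod h) (TMap h)" "is_sheaf C J (TDom h)" "is_sheaf C J (TCod h)"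
    if "h \<in> Arr ?S" for h
    using that by (simp_all add: sheaf_cat_Arr)
  have comp: "app (TMap (Cmp ?S g h) c) t = app (TMap g c) (app (TMap h c) t)"
    if "h \<in> Arr ?S" "c \<in> Obj C" "t \<in> elts (FO (TDom h) c)" for g h c t
    using that ntrans_simps(2)[OF nt(1)[OF that(1)]] by (simp add: sc app_Cmp)
  have eqI: "f = g" if fg: "f \<in> Arr ?S" "g \<in> Arr ?S" "TDom f = TDom g" "TCod f = TCod g"
    and e: "\<And>c t. c \<in> Obj C \<Longrightarrow> t \<in> elts (FO (TDom f) c) \<Longrightarrow> app (TMap f c) t = app (TMap g c) t" for f g
  proof -
    have "ntrans (op_cat C) SetCat (TDom f) (TCod f) (TMap g)" using nt[OF fg(2)] fg by simp
    from ntrans_app_eqI[OF nt(1)[OF fg(1)] this] e fg show ?thesis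
      by (intro trans.equality) simp_all
  qed
  have "univ_span ?S P Q R' (?W, p, q)"
  proof (rule univ_spanI)
    show "R' p q"
      using p q by (subst R') (auto simp: p_def q_def app_smap FO)
    fix f g assume f: "f \<in> Arr ?S" and g: "g \<in> Arr ?S" and "Dom ?S g = Dom ?S f" "Cod ?S f = P" "Cod ?S g = Q"
      and r: "R' f g"
    then have fg [simp]: "TDom g = TDom f" "TCod f = P" "TCod g = Q" by (simp_all add: sc)
    have r: "R c (app (TMap f c) t) (app (TMap g c) t)" if "c \<in> Obj C" "t \<in> elts (FO (TDom f) c)" for c t
      using r R'[OF f g] that by simp
    let ?X = "TDom f"
    note nf = nt(1)[OF f, simplified] and ng = nt(1)[OF g, simplified]
    define h where "h = \<lparr>TDom = ?X, TCod = ?W,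
      TMap = (\<lambda>c\<in>Obj C. smap (FO ?X c) (FO ?W c) (\<lambda>t. upair (app (TMap f c) t) (app (TMap g c) t)))\<rparr>"
    have hin: "upair (app (TMap f c) t) (app (TMap g c) t) \<in> elts (FO ?W c)"
      if "c \<in> Obj C" "t \<in> elts (FO ?X c)" for c t
      using that ntrans_app[OF nf, of c t] ntrans_app[OF ng, of c t] r by (simp add: FO)
    have "ntrans (op_cat C) SetCat ?X ?W
      (\<lambda>c\<in>Obj (op_cat C). smap (FO ?X c) (FO ?W c) (\<lambda>t. upair (app (TMap f c) t) (app (TMap g c) t)))"
    proof (rule ntrans_smap[OF sheaf_functor[OF nt(2)[OF f]] FW])
      fix u x assume u: "u \<in> Arr (op_cat C)" and x: "x \<in> elts (FO ?X (Dom (op_cat C) u))"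
      then show "upair (app (TMap f (Cod (op_cat C) u)) (app (FA ?X u) x)) (app (TMap g (Cod (op_cat C) u)) (app (FA ?X u) x)) =
        app (FA ?W u) (upair (app (TMap f (Dom (op_cat C) u)) x) (app (TMap g (Dom (op_cat C) u)) x))"
        using ntrans_app_sq[OF nf u x] ntrans_app_sq[OF ng u x] hin[of "Cod C u" x] by (simp add: ap)
    qed (simp add: hin)
    then have h: "h \<in> Arr ?S" by (simp add: sheaf_cat_Arr h_def W nt(2)[OF f])
    have ht: "app (TMap h c) t = upair (app (TMap f c) t) (app (TMap g c) t)" if "c \<in> Obj C" "t \<in> elts (FO ?X c)" for c t
      using that by (simp add: h_def app_smap)
    have hd: "TDom h = ?X" "TCod h = ?W" "TDom p = ?W" "TCod p = P" "TDom q = ?W" "TCod q = Q"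
      by (simp_all add: h_def p_def q_def)
    have cA: "Cmp ?S p h \<in> Arr ?S" "Cmp ?S q h \<in> Arr ?S"
      by (rule Cmp_Arr[OF category_sheaf_category[OF C]]; simp add: h p q sc hd)+
    have "Cmp ?S p h = f"
    proof (rule eqI[OF cA(1) f])
      fix c t assume c: "c \<in> Obj C" and "t \<in> elts (FO (TDom (Cmp ?S p h)) c)"
      then have t: "t \<in> elts (FO ?X c)" by (simp add: sc hd)
      then show "app (TMap (Cmp ?S p h) c) t = app (TMap f c) t"
        using comp[OF h c, of t p] c by (simp add: hd ht pt hin)
    qed (simp_all add: sc hd)
    moreover have "Cmp ?S q h = g"
    proof (rule eqI[OF cA(2) g])
      fix c t assume c: "c \<in> Obj C" and "t \<in> elts (FO (TDom (Cmp ?S q h)) c)"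
      then have t: "t \<in> elts (FO ?X c)" by (simp add: sc hd)
      then show "app (TMap (Cmp ?S q h) c) t = app (TMap g c) t"
        using comp[OF h c, of t q] c by (simp add: hd ht pt hin)
    qed (simp_all add: sc hd)
    ultimately show "\<exists>h. h \<in> Arr ?S \<and> Dom ?S h = Dom ?S f \<and> Cod ?S h = ?W \<and> Cmp ?S p h = f \<and> Cmp ?S q h = g"
      using h by (intro exI[of _ h]) (simp add: sheaf_cat_Dom sheaf_cat_Cod hd)
  next
    fix h k assume h: "h \<in> Arr ?S" and k: "k \<in> Arr ?S" and "Dom ?S k = Dom ?S h" "Cod ?S h = ?W" "Cod ?S k = ?W"
      and e: "Cmp ?S p k = Cmp ?S p h" "Cmp ?S q k = Cmp ?S q h"
    then have hk: "TDom k = TDom h" "TCod h = ?W" "TCod k = ?W" by (simp_all add: sc)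
    show "h = k"
    proof (rule eqI[OF h k])
      fix c t assume c: "c \<in> Obj C" and t: "t \<in> elts (FO (TDom h) c)"
      have "app (TMap h c) t \<in> elts (FO ?W c)" "app (TMap k c) t \<in> elts (FO ?W c)"
        using ntrans_app[OF nt(1)[OF h], of c t] ntrans_app[OF nt(1)[OF k], of c t] c t hk by simp_all
      moreover have "app (TMap p c) (app (TMap h c) t) = app (TMap p c) (app (TMap k c) t)"
        "app (TMap q c) (app (TMap h c) t) = app (TMap q c) (app (TMap k c) t)"
        using comp[OF h c t] comp[OF k c, of t] t hk e by metis+
      ultimately have "ufst (app (TMap h c) t) = ufst (app (TMap k c) t)"
        "usnd (app (TMap h c) t) = usnd (app (TMap k c) t)"
        "\<exists>a b. app (TMap h c) t = upair a b" "\<exists>a b. app (TMap k c) t = upair a b"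
        using c by (simp_all add: pt) (auto simp: FO)
      then show "app (TMap h c) t = app (TMap k c) t" by auto
    qed (simp_all add: hk)
  qed (simp_all add: sheaf_cat_Obj W p q sheaf_cat_Dom sheaf_cat_Cod, simp_all add: p_def q_def)
  then show ?thesis by blast
qed

lemma sheaf_category_product:
  assumes C: "category C" and J: "grothendieck_topology C J" and P: "is_sheaf C J P" and Q: "is_sheaf C J Q"
  shows "\<exists>c. univ_span (sheaf_category C J) P Q (\<lambda>_ _. True) c"
  by (rule sheaf_category_univ_span[OF C J P Q, where R = "\<lambda>_ _ _. True"]) simp_all

lemma sheaf_category_pullback:
  assumes C: "category C" and J: "grothendieck_topology C J"
    and u: "u \<in> Arr (sheaf_category C J)" and v: "v \<in> Arr (sheaf_category C J)" and uv: "TCod u = TCod v"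
  shows "\<exists>c. univ_span (sheaf_category C J) (TDom u) (TDom v)
    (\<lambda>f g. Cmp (sheaf_category C J) u f = Cmp (sheaf_category C J) v g) c"
proof -
  let ?S = "sheaf_category C J"
  note sc = sheaf_cat_Obj sheaf_cat_Dom sheaf_cat_Cod sheaf_cat_Cmp
  note [simp] = cat_simps[OF C] cat_simps[OF category_SetCat] op_cat_simps
  have nt: "ntrans (op_cat C) SetCat (TDom h) (TCod h) (TMap h)" "is_sheaf C J (TDom h)" "is_sheaf C J (TCod h)"
    if "h \<in> Arr ?S" for h
    using that by (simp_all add: sheaf_cat_Arr)
  note nu = nt(1)[OF u] and nv = nt(1)[OF v]
  have sqs: "app (TMap h (Dom C f)) (app (FA (TDom h) f) a) = app (FA (TCod h) f) (app (TMap h (Cod C f)) a)"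
    if "h \<in> Arr ?S" "f \<in> Arr C" "a \<in> elts (FO (TDom h) (Cod C f))" for h f a
    using ntrans_app_sq[OF nt(1)[OF that(1)], of f a] that by simp
  have app_in': "app (TMap h c) t \<in> elts (FO (TCod h) c)" if "h \<in> Arr ?S" "c \<in> Obj C" "t \<in> elts (FO (TDom h) c)" for h c t
    using ntrans_app[OF nt(1)[OF that(1)], of c t] that by simp
  have comp: "app (TMap (Cmp ?S g h) c) t = app (TMap g c) (app (TMap h c) t)"
    if "h \<in> Arr ?S" "c \<in> Obj C" "t \<in> elts (FO (TDom h) c)" for g h c t
    using that ntrans_simps(2)[OF nt(1)[OF that(1)]] by (simp add: sc app_Cmp)
  show ?thesis
  proof (rule sheaf_category_univ_span[OF C J nt(2)[OF u] nt(2)[OF v],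
        where R = "\<lambda>c a b. app (TMap u c) a = app (TMap v c) b"])
    fix f a b assume "f \<in> Arr C" "a \<in> elts (FO (TDom u) (Cod C f))" "b \<in> elts (FO (TDom v) (Cod C f))"
      "app (TMap u (Cod C f)) a = app (TMap v (Cod C f)) b"
    then show "app (TMap u (Dom C f)) (app (FA (TDom u) f) a) = app (TMap v (Dom C f)) (app (FA (TDom v) f) b)"
      by (simp add: sqs u v uv)
  next
    fix c S a b assume c: "c \<in> Obj C" and S: "S \<in> J c" and a: "a \<in> elts (FO (TDom u) c)" and b: "b \<in> elts (FO (TDom v) c)"
      and e: "\<And>f. f \<in> S \<Longrightarrow> app (TMap u (Dom C f)) (app (FA (TDom u) f) a) = app (TMap v (Dom C f)) (app (FA (TDom v) f) b)"
    let ?T = "TCod u"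
    note T = nt(3)[OF u]
    have Sf [simp]: "f \<in> Arr C" "Cod C f = c" if "f \<in> S" for f
      using J c S that by (auto simp: grothendieck_topology_def sieve_def)
    have ua: "app (TMap u c) a \<in> elts (FO ?T c)" by (rule app_in'[OF u c a])
    have vb: "app (TMap v c) b \<in> elts (FO ?T c)" unfolding uv by (rule app_in'[OF v c b])
    \<comment> \<open>Locality of the relation is separatedness of \<open>?T\<close>: both images in
      \<open>FO ?T c\<close> glue the same family of restrictions.\<close>
    have "\<exists>!y. y \<in> elts (FO ?T c) \<and> (\<forall>f\<in>S. app (FA ?T f) y = app (FA ?T f) (app (TMap u c) a))"
    proof (rule sheaf_ex1[OF T c S])
      show "app (FA ?T f) (app (TMap u c) a) \<in> elts (FO ?T (Dom C f))" if "f \<in> S" for f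
        using app_FA_in[OF sheaf_functor[OF T], of f] that ua by simp
      show "app (FA ?T (Cmp C f g)) (app (TMap u c) a) = app (FA ?T g) (app (FA ?T f) (app (TMap u c) a))"
        if "f \<in> S" "g \<in> Arr C" "Cod C g = Dom C f" for f g
        using app_FA_Cmp[OF sheaf_functor[OF T], of f g] that ua by simp
    qed
    moreover have "app (FA ?T f) (app (TMap v c) b) = app (FA ?T f) (app (TMap u c) a)" if "f \<in> S" for f
      using e[OF that] sqs[OF u, of f a] sqs[OF v, of f b] that a b uv by simp
    ultimately show "app (TMap u c) a = app (TMap v c) b" using ua vb by blast
  next
    fix f g assume f: "f \<in> Arr ?S" and g: "g \<in> Arr ?S" and fg: "TDom g = TDom f" "TCod f = TDom u" "TCod g = TDom v"
    have A: "Cmp ?S u f \<in> Arr ?S" "Cmp ?S v g \<in> Arr ?S"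
      by (rule Cmp_Arr[OF category_sheaf_category[OF C]]; simp add: f g u v sc fg)+
    have n: "ntrans (op_cat C) SetCat (TDom f) (TCod u) (TMap (Cmp ?S u f))"
      "ntrans (op_cat C) SetCat (TDom f) (TCod u) (TMap (Cmp ?S v g))"
      using nt(1)[OF A(1)] nt(1)[OF A(2)] by (simp_all add: sc fg uv)
    have "(Cmp ?S u f = Cmp ?S v g) \<longleftrightarrow> TMap (Cmp ?S u f) = TMap (Cmp ?S v g)"
      by (auto simp: sc fg uv)
    also have "\<dots> \<longleftrightarrow> (\<forall>c\<in>Obj C. \<forall>t\<in>elts (FO (TDom f) c). app (TMap (Cmp ?S u f) c) t = app (TMap (Cmp ?S v g) c) t)"
      using ntrans_app_eqI[OF n] by auto
    also have "\<dots> \<longleftrightarrow> (\<forall>c\<in>Obj C. \<forall>t\<in>elts (FO (TDom f) c). app (TMap u c) (app (TMap f c) t) = app (TMap v c) (app (TMap g c) t))"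
      using comp[OF f] comp[OF g] fg by auto
    finally show "(Cmp ?S u f = Cmp ?S v g) \<longleftrightarrow> \<dots>" .
  qed
qed

text \<open>Products and pullbacks exist in a category of sheaves and are transported to
  \<open>E\<close> along the equivalence. Existence makes the choices behind \<open>product\<close>
  and \<open>pullback\<close> meaningful.\<close>

lemma
  fixes E :: "('u::universe large, 'u large) category"
  assumes E: "grothendieck_topos E"
  shows topos_category: "category E"
    and topos_product: "A \<in> Obj E \<Longrightarrow> B \<in> Obj E \<Longrightarrow> is_product E A B (product E A B)"
    and topos_pullback: "u \<in> Arr E \<Longrightarrow> v \<in> Arr E \<Longrightarrow> Cod E u = Cod E v \<Longrightarrow> is_pullback E u v (pullback E u v)"
proof -
  show cE: "category E" using E by (simp add: grothendieck_topos_def)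
  obtain C :: "('u, 'u) category" and J where CJ: "small_site C J" and eqv: "equivalent_categories E (sheaf_category C J)"
    using E unfolding grothendieck_topos_def by blast
  have C: "category C" and J: "grothendieck_topology C J"
    using CJ by (simp_all add: small_site_def small_category_def)
  obtain F where F: "functor_from_to F E (sheaf_category C J)" and eq: "equivalence_functor F"
    using eqv unfolding equivalent_categories_def by blast
  let ?S = "sheaf_category C J"
  note [simp] = functor_simps[OF F] cat_simps[OF cE]
  note S = functor_category_cod[OF F]
  {
    assume AB: "A \<in> Obj E" "B \<in> Obj E"
    obtain P p q where P: "univ_span ?S (FO F A) (FO F B) (\<lambda>_ _. True) (P, p, q)"
      using sheaf_category_product[OF C J, of "FO F A" "FO F B"] FO_Obj[OF F] AB by (auto simp: sheaf_cat_Obj)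
    have "\<exists>c. univ_span E A B (\<lambda>_ _. True) c"
      by (rule univ_span_equivalence[OF F eq AB P]) simp_all
    then show "is_product E A B (product E A B)"
      unfolding product_def is_product_univ_span by (rule someI_ex)
  next
    assume uv: "u \<in> Arr E" "v \<in> Arr E" "Cod E u = Cod E v"
    have "\<exists>c. univ_span ?S (TDom (FA F u)) (TDom (FA F v)) (\<lambda>f g. Cmp ?S (FA F u) f = Cmp ?S (FA F v) g) c"
      by (rule sheaf_category_pullback[OF C J])
        (use uv FA_Cod[OF F, of u] FA_Cod[OF F, of v] in \<open>simp_all add: sheaf_cat_Cod\<close>)
    then obtain P p q where P: "univ_span ?S (FO F (Dom E u)) (FO F (Dom E v)) (\<lambda>f g. Cmp ?S (FA F u) f = Cmp ?S (FA F v) g) (P, p, q)"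
      using FA_Dom[OF F, of u] FA_Dom[OF F, of v] uv by (auto simp: sheaf_cat_Dom)
    have "\<exists>c. univ_span E (Dom E u) (Dom E v) (\<lambda>f g. Cmp E u f = Cmp E v g) c"
    proof (rule univ_span_equivalence[OF F eq _ _ P])
      fix f g assume fg: "f \<in> Arr E" "g \<in> Arr E" "Cod E f = Dom E u" "Cod E g = Dom E v" "Dom E f = Dom E g"
      have "Cmp E u f = Cmp E v g \<longleftrightarrow> FA F (Cmp E u f) = FA F (Cmp E v g)"
      proof
        assume "FA F (Cmp E u f) = FA F (Cmp E v g)"
        then show "Cmp E u f = Cmp E v g"
          by (rule equivalence_functor_faithful[OF F eq, rotated -1]) (use fg uv in simp_all)
      qed (simp only:)
      then show "Cmp E u f = Cmp E v g \<longleftrightarrow> Cmp ?S (FA F u) (FA F f) = Cmp ?S (FA F v) (FA F g)"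
        using fg uv FA_Cmp[OF F, of f u] FA_Cmp[OF F, of g v] by metis
    next
      fix f g s assume "f \<in> Arr ?S" "g \<in> Arr ?S" "s \<in> Arr ?S" "Dom ?S f = Cod ?S s" "Dom ?S g = Cod ?S s"
        "Cod ?S f = FO F (Dom E u)" "Cod ?S g = FO F (Dom E v)" and e: "Cmp ?S (FA F u) f = Cmp ?S (FA F v) g"
      then show "Cmp ?S (FA F u) (Cmp ?S f s) = Cmp ?S (FA F v) (Cmp ?S g s)"
        by (intro Cmp_eq_prefix[OF S]) (use uv in simp_all)
    qed (use uv in simp_all)
    then show "is_pullback E u v (pullback E u v)"
      unfolding pullback_def is_pullback_univ_span by (rule someI_ex)
  }
qed

section \<open>The Sierpinski topos\<close>

lemma is_limit_cone: "is_limit D L l \<Longrightarrow> is_cone D L l"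
  by (simp add: is_limit_def)

lemma limit_ex:
  assumes "functor_from_to D J C" "is_limit D L l" "is_cone D X x"
  obtains h where "h \<in> Arr C" "Dom C h = X" "Cod C h = L" "\<forall>i\<in>Obj J. Cmp C (l i) h = x i"
  using assms unfolding is_limit_iff[OF assms(1)] mem_homset by metis

lemma limit_unique:
  assumes D: "functor_from_to D J C" and l: "is_limit D L l"
    and h: "h \<in> Arr C" "k \<in> Arr C" "Dom C h = Dom C k" "Cod C h = L" "Cod C k = L"
    and e: "\<And>i. i \<in> Obj J \<Longrightarrow> Cmp C (l i) h = Cmp C (l i) k"
  shows "h = k"
proof -
  note C = functor_category_cod[OF D]
  note [simp] = cat_simps[OF C] cat_simps[OF functor_category_dom[OF D]] functor_simps[OF D]
  have c: "is_cone D L l" using l by (rule is_limit_cone)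
  then have l': "l i \<in> Arr C" "Dom C (l i) = L" "Cod C (l i) = FO D i" if "i \<in> Obj J" for i
    using that by (simp_all add: is_cone_iff[OF D])
  have "Cmp C (FA D u) (Cmp C (l (Dom J u)) h) = Cmp C (l (Cod J u)) h" if "u \<in> Arr J" for u
    by (rule Cmp_eq_prefix1[OF C]) (use c that h in \<open>simp_all add: is_cone_iff[OF D]\<close>)
  then have "is_cone D (Dom C h) (\<lambda>i. Cmp C (l i) h)"
    using h l' by (simp add: is_cone_iff[OF D])
  then have "\<exists>!h'. h' \<in> homset C (Dom C h) L \<and> (\<forall>i\<in>Obj J. Cmp C (l i) h' = Cmp C (l i) h)"
    using l unfolding is_limit_iff[OF D] by blast
  then show ?thesis using h e unfolding mem_homset by metis
qed

lemma is_limitI: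
  assumes D: "functor_from_to D J C" and "is_cone D L l"
    and ex: "\<And>X x. is_cone D X x \<Longrightarrow> \<exists>h. h \<in> Arr C \<and> Dom C h = X \<and> Cod C h = L \<and> (\<forall>i\<in>Obj J. Cmp C (l i) h = x i)"
    and uniq: "\<And>h k. h \<in> Arr C \<Longrightarrow> k \<in> Arr C \<Longrightarrow> Dom C k = Dom C h \<Longrightarrow> Cod C h = L \<Longrightarrow> Cod C k = L \<Longrightarrow>
      (\<And>i. i \<in> Obj J \<Longrightarrow> Cmp C (l i) h = Cmp C (l i) k) \<Longrightarrow> h = k"
  shows "is_limit D L l"
  unfolding is_limit_iff[OF D]
proof (intro conjI allI impI ex_ex1I)
  show "\<exists>h. h \<in> homset C X L \<and> (\<forall>i\<in>Obj J. Cmp C (l i) h = x i)" if "is_cone D X x" for X x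
    using ex[OF that] by (auto simp: mem_homset)
  show "h = k" if "h \<in> homset C X L \<and> (\<forall>i\<in>Obj J. Cmp C (l i) h = x i)"
    "k \<in> homset C X L \<and> (\<forall>i\<in>Obj J. Cmp C (l i) k = x i)" for X x h k
    by (rule uniq) (use that in \<open>auto simp: mem_homset\<close>)
qed fact

text \<open>The vertical arrows \<open>m\<close> and \<open>n\<close> are stored next to the
  horizontal ones \<open>g\<close> and \<open>h\<close>, so that source and target of a square can
  be read off its code.\<close>

definition sq :: "'w large \<Rightarrow> 'w large \<Rightarrow> 'w large \<Rightarrow> 'w large \<Rightarrow> 'w large" where
  "sq m n g h = Tup (Tup m n) (Tup g h)"

definition sq0 :: "'w large \<Rightarrow> 'w large" where "sq0 a = tfst (tsnd a)"
definition sq1 :: "'w large \<Rightarrow> 'w large" where "sq1 a = tsnd (tsnd a)"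

lemma sq_simps [simp]: "sq0 (sq m n g h) = g" "sq1 (sq m n g h) = h"
  "sq m n g h = sq m' n' g' h' \<longleftrightarrow> m = m' \<and> n = n' \<and> g = g' \<and> h = h'"
  by (simp_all add: sq_def sq0_def sq1_def)

text \<open>For \<open>C = SetCat\<close> this is the Sierpinski topos. Coding squares in the type
  \<open>large\<close> places it among the 0-cells of \<open>GTop\<close>.\<close>

definition arrow_cat :: "('w large, 'w large) category \<Rightarrow> ('w large, 'w large) category" where
  "arrow_cat C = \<lparr>Obj = Arr C,
     Arr = {sq m n g h | m n g h. m \<in> Arr C \<and> n \<in> Arr C \<and> g \<in> homset C (Dom C m) (Dom C n) \<and>
       h \<in> homset C (Cod C m) (Cod C n) \<and> Cmp C n g = Cmp C h m},
     Dom = (\<lambda>a. tfst (tfst a)), Cod = (\<lambda>a. tsnd (tfst a)),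
     Idn = (\<lambda>m. sq m m (Idn C (Dom C m)) (Idn C (Cod C m))),
     Cmp = (\<lambda>b a. sq (tfst (tfst a)) (tsnd (tfst b)) (Cmp C (sq0 b) (sq0 a)) (Cmp C (sq1 b) (sq1 a)))\<rparr>"

lemma arrow_cat_Obj: "Obj (arrow_cat C) = Arr C"
  and arrow_cat_Idn: "Idn (arrow_cat C) m = sq m m (Idn C (Dom C m)) (Idn C (Cod C m))"
  and arrow_cat_Dom_sq: "Dom (arrow_cat C) (sq m n g h) = m"
  and arrow_cat_Cod_sq: "Cod (arrow_cat C) (sq m n g h) = n"
  and arrow_cat_Cmp: "Cmp (arrow_cat C) b a =
    sq (Dom (arrow_cat C) a) (Cod (arrow_cat C) b) (Cmp C (sq0 b) (sq0 a)) (Cmp C (sq1 b) (sq1 a))"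
  and arrow_cat_sq_Arr: "sq m n g h \<in> Arr (arrow_cat C) \<longleftrightarrow> m \<in> Arr C \<and> n \<in> Arr C \<and>
    g \<in> homset C (Dom C m) (Dom C n) \<and> h \<in> homset C (Cod C m) (Cod C n) \<and> Cmp C n g = Cmp C h m"
  by (auto simp: arrow_cat_def) (simp_all add: sq_def)

lemma
  assumes "a \<in> Arr (arrow_cat C)"
  shows arrow_cat_Dom: "Dom (arrow_cat C) a \<in> Arr C" and arrow_cat_Cod: "Cod (arrow_cat C) a \<in> Arr C"
    and sq0_Arr: "sq0 a \<in> Arr C" and sq0_Dom: "Dom C (sq0 a) = Dom C (Dom (arrow_cat C) a)"
    and sq0_Cod: "Cod C (sq0 a) = Dom C (Cod (arrow_cat C) a)"
    and sq1_Arr: "sq1 a \<in> Arr C" and sq1_Dom: "Dom C (sq1 a) = Cod C (Dom (arrow_cat C) a)"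
    and sq1_Cod: "Cod C (sq1 a) = Cod C (Cod (arrow_cat C) a)"
    and sq_comm: "Cmp C (Cod (arrow_cat C) a) (sq0 a) = Cmp C (sq1 a) (Dom (arrow_cat C) a)"
    and sq_collapse: "sq (Dom (arrow_cat C) a) (Cod (arrow_cat C) a) (sq0 a) (sq1 a) = a"
proof -
  have "\<exists>m n g h. a = sq m n g h"
    using assms by (auto simp: arrow_cat_def)
  then obtain m n g h where a: "a = sq m n g h" by blast
  note S = assms[unfolded a arrow_cat_sq_Arr mem_homset]
  show "Dom (arrow_cat C) a \<in> Arr C" "Cod (arrow_cat C) a \<in> Arr C"
    "sq0 a \<in> Arr C" "Dom C (sq0 a) = Dom C (Dom (arrow_cat C) a)"
    "Cod C (sq0 a) = Dom C (Cod (arrow_cat C) a)"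
    "sq1 a \<in> Arr C" "Dom C (sq1 a) = Cod C (Dom (arrow_cat C) a)"
    "Cod C (sq1 a) = Cod C (Cod (arrow_cat C) a)"
    "Cmp C (Cod (arrow_cat C) a) (sq0 a) = Cmp C (sq1 a) (Dom (arrow_cat C) a)"
    "sq (Dom (arrow_cat C) a) (Cod (arrow_cat C) a) (sq0 a) (sq1 a) = a"
    unfolding a arrow_cat_Dom_sq arrow_cat_Cod_sq sq_simps by (simp_all only: S simp_thms)
qed

lemmas sq_facts = arrow_cat_Dom arrow_cat_Cod sq0_Arr sq0_Dom sq0_Cod sq1_Arr sq1_Dom sq1_Cod

lemma arrow_cat_eqI:
  assumes "a \<in> Arr (arrow_cat C)" "b \<in> Arr (arrow_cat C)"
    "Dom (arrow_cat C) a = Dom (arrow_cat C) b" "Cod (arrow_cat C) a = Cod (arrow_cat C) b"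
    "sq0 a = sq0 b" "sq1 a = sq1 b"
  shows "a = b"
  using sq_collapse[OF assms(1)] sq_collapse[OF assms(2)] assms(3-) by metis

lemma category_arrow_cat:
  assumes C: "category C"
  shows "category (arrow_cat C)"
proof -
  let ?S = "arrow_cat C"
  note [simp] = cat_simps[OF C] sq_facts arrow_cat_Obj arrow_cat_Idn arrow_cat_Dom_sq arrow_cat_Cod_sq
    arrow_cat_Cmp
  have cmp: "sq (Dom ?S f) (Cod ?S g) (Cmp C (sq0 g) (sq0 f)) (Cmp C (sq1 g) (sq1 f)) \<in> Arr ?S"
    if [simp]: "f \<in> Arr ?S" "g \<in> Arr ?S" and e: "Cod ?S f = Dom ?S g" for f g
  proof -
    have "Cmp C (Cod ?S g) (Cmp C (sq0 g) (sq0 f)) = Cmp C (sq1 g) (Cmp C (Dom ?S g) (sq0 f))"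
      by (rule Cmp_eq_prefix[OF C sq_comm]) (use e in simp_all)
    also have "\<dots> = Cmp C (sq1 g) (Cmp C (sq1 f) (Dom ?S f))"
      using sq_comm[of f C] e by simp
    finally show ?thesis using e by (simp add: arrow_cat_sq_Arr mem_homset)
  qed
  show ?thesis
    unfolding category_def mem_homset
  proof (intro conjI ballI impI)
    fix f assume f: "f \<in> Arr ?S"
    show "Cmp ?S f (Idn ?S (Dom ?S f)) = f" "Cmp ?S (Idn ?S (Cod ?S f)) f = f"
      using f sq_collapse[OF f] by simp_all
  qed (simp_all add: cmp, simp_all add: arrow_cat_sq_Arr mem_homset)
qed

text \<open>For \<open>C = SetCat\<close>, \<open>ev0\<close> and \<open>ev1\<close> are the inverse
  images of the two points of the Sierpinski topos.\<close>

definition ev0 :: "('w large, 'w large) category \<Rightarrow> ('w large, 'w large, 'w large, 'w large) func" where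
  "ev0 C = \<lparr>FDom = arrow_cat C, FCod = C, FO = restrict (Dom C) (Arr C), FA = restrict sq0 (Arr (arrow_cat C))\<rparr>"

definition ev1 :: "('w large, 'w large) category \<Rightarrow> ('w large, 'w large, 'w large, 'w large) func" where
  "ev1 C = \<lparr>FDom = arrow_cat C, FCod = C, FO = restrict (Cod C) (Arr C), FA = restrict sq1 (Arr (arrow_cat C))\<rparr>"

lemma ev_simps:
  "m \<in> Arr C \<Longrightarrow> FO (ev0 C) m = Dom C m" "a \<in> Arr (arrow_cat C) \<Longrightarrow> FA (ev0 C) a = sq0 a"
  "m \<in> Arr C \<Longrightarrow> FO (ev1 C) m = Cod C m" "a \<in> Arr (arrow_cat C) \<Longrightarrow> FA (ev1 C) a = sq1 a"
  by (simp_all add: ev0_def ev1_def)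

lemma
  assumes C: "category C"
  shows functor_ev0: "functor_from_to (ev0 C) (arrow_cat C) C"
    and functor_ev1: "functor_from_to (ev1 C) (arrow_cat C) C"
proof -
  note S = category_arrow_cat[OF C]
  note [simp] = cat_simps[OF C] sq_facts ev_simps arrow_cat_Obj
  have I: "Idn (arrow_cat C) m \<in> Arr (arrow_cat C)" if "m \<in> Arr C" for m
    using that Idn_Arr[OF S, of m] by simp
  note Cc = Cmp_Arr[OF S]
  show "functor_from_to (ev0 C) (arrow_cat C) C"
    by (rule functorI[OF S C]) (simp_all add: I Cc, simp_all add: arrow_cat_Idn arrow_cat_Cmp, simp_all add: ev0_def)
  show "functor_from_to (ev1 C) (arrow_cat C) C"
    by (rule functorI[OF S C]) (simp_all add: I Cc, simp_all add: arrow_cat_Idn arrow_cat_Cmp, simp_all add: ev1_def)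
qed

text \<open>A transformation from \<open>F\<close> to \<open>G\<close> is the same as a functor into
  arrows whose evaluations are \<open>F\<close> and \<open>G\<close>. This is one direction of the
  correspondence; \<open>ntrans_ev\<close> is the other.\<close>

definition arr_fun ::
    "('o, 'a, 'w large, 'w large) func \<Rightarrow> ('o, 'a, 'w large, 'w large) func \<Rightarrow> ('o \<Rightarrow> 'w large) \<Rightarrow>
     ('o, 'a, 'w large, 'w large) func" where
  "arr_fun F G t = \<lparr>FDom = FDom F, FCod = arrow_cat (FCod F), FO = restrict t (Obj (FDom F)),
     FA = (\<lambda>f\<in>Arr (FDom F). sq (t (Dom (FDom F) f)) (t (Cod (FDom F) f)) (FA F f) (FA G f))\<rparr>"

lemma
  assumes t: "ntrans E C F G t"
  shows functor_arr_fun: "functor_from_to (arr_fun F G t) E (arrow_cat C)"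
    and arr_fun_FO: "x \<in> Obj E \<Longrightarrow> FO (arr_fun F G t) x = t x"
    and arr_fun_FA: "f \<in> Arr E \<Longrightarrow> FA (arr_fun F G t) f = sq (t (Dom E f)) (t (Cod E f)) (FA F f) (FA G f)"
    and ev0_arr_fun: "cmp_func (ev0 C) (arr_fun F G t) = F"
    and ev1_arr_fun: "cmp_func (ev1 C) (arr_fun F G t) = G"
proof -
  note F = ntrans_dom[OF t] and G = ntrans_cod[OF t]
  note E = functor_category_dom[OF F] and C = functor_category_cod[OF F]
  note [simp] = functor_simps[OF F] functor_simps[OF G] cat_simps[OF C] cat_simps[OF E] ntrans_simps[OF t]
  show FO: "FO (arr_fun F G t) x = t x" if "x \<in> Obj E" for x
    using that by (simp add: arr_fun_def)
  show FA: "FA (arr_fun F G t) f = sq (t (Dom E f)) (t (Cod E f)) (FA F f) (FA G f)" if "f \<in> Arr E" for f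
    using that by (simp add: arr_fun_def)
  have S: "sq (t (Dom E f)) (t (Cod E f)) (FA F f) (FA G f) \<in> Arr (arrow_cat C)" if "f \<in> Arr E" for f
    using that ntrans_sq[OF t that] by (simp add: arrow_cat_sq_Arr mem_homset)
  show A: "functor_from_to (arr_fun F G t) E (arrow_cat C)"
    by (rule functorI[OF E category_arrow_cat[OF C]])
      (simp_all add: FO FA S arrow_cat_Obj arrow_cat_Dom_sq arrow_cat_Cod_sq arrow_cat_Idn arrow_cat_Cmp,
       simp_all add: arr_fun_def)
  show "cmp_func (ev0 C) (arr_fun F G t) = F"
    by (rule functor_eqI[OF functor_cmp[OF A functor_ev0[OF C]] F])
      (simp_all add: cmp_func_simps functor_simps[OF A] FO FA ev_simps S)
  show "cmp_func (ev1 C) (arr_fun F G t) = G"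
    by (rule functor_eqI[OF functor_cmp[OF A functor_ev1[OF C]] G])
      (simp_all add: cmp_func_simps functor_simps[OF A] FO FA ev_simps S)
qed

lemma ntrans_ev:
  assumes B: "functor_from_to B E (arrow_cat C)" and C: "category C"
  shows "ntrans E C (cmp_func (ev0 C) B) (cmp_func (ev1 C) B) (restrict (FO B) (Obj E))"
proof -
  note [simp] = functor_simps[OF B] cmp_func_simps cat_simps[OF functor_category_dom[OF B]]
  have ob [simp]: "FO B x \<in> Arr C" if "x \<in> Obj E" for x
    using FO_Obj[OF B that] by (simp add: arrow_cat_Obj)
  show ?thesis
  proof (rule ntransI[OF functor_cmp[OF B functor_ev0[OF C]] functor_cmp[OF B functor_ev1[OF C]]])
    fix f assume f: "f \<in> Arr E"
    show "Cmp C (restrict (FO B) (Obj E) (Cod E f)) (FA (cmp_func (ev0 C) B) f) =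
      Cmp C (FA (cmp_func (ev1 C) B) f) (restrict (FO B) (Obj E) (Dom E f))"
      using f sq_comm[OF FA_Arr[OF B f]] by (simp add: ev_simps)
  qed (simp_all add: ev_simps)
qed

text \<open>The two evaluations of the transformation are natural separately; joining them to
  squares takes only compatibility with the arrows \<open>FO B x\<close> and
  \<open>FO B' x\<close>.\<close>

lemma ntrans_arrow_catI:
  assumes B: "functor_from_to B E (arrow_cat C)" and B': "functor_from_to B' E (arrow_cat C)" and C: "category C"
    and a0: "ntrans E C (cmp_func (ev0 C) B) (cmp_func (ev0 C) B') a0"
    and a1: "ntrans E C (cmp_func (ev1 C) B) (cmp_func (ev1 C) B') a1"
    and comm: "\<And>x. x \<in> Obj E \<Longrightarrow> Cmp C (FO B' x) (a0 x) = Cmp C (a1 x) (FO B x)"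
  shows "ntrans E (arrow_cat C) B B' (\<lambda>x\<in>Obj E. sq (FO B x) (FO B' x) (a0 x) (a1 x))"
proof -
  note [simp] = functor_simps[OF B] functor_simps[OF B'] cmp_func_simps cat_simps[OF functor_category_dom[OF B]]
    cat_simps[OF C] sq_facts
  have ob [simp]: "FO B x \<in> Arr C" "FO B' x \<in> Arr C" if "x \<in> Obj E" for x
    using FO_Obj[OF B that] FO_Obj[OF B' that] by (simp_all add: arrow_cat_Obj)
  have S: "sq (FO B x) (FO B' x) (a0 x) (a1 x) \<in> Arr (arrow_cat C)" if "x \<in> Obj E" for x
    using that comm[OF that] by (simp add: arrow_cat_sq_Arr mem_homset ntrans_simps[OF a0] ntrans_simps[OF a1] ev_simps)
  show ?thesis
  proof (rule ntransI[OF B B'])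
    fix f assume f: "f \<in> Arr E"
    show "Cmp (arrow_cat C) ((\<lambda>x\<in>Obj E. sq (FO B x) (FO B' x) (a0 x) (a1 x)) (Cod E f)) (FA B f) =
      Cmp (arrow_cat C) (FA B' f) ((\<lambda>x\<in>Obj E. sq (FO B x) (FO B' x) (a0 x) (a1 x)) (Dom E f))"
      using f ntrans_sq[OF a0 f] ntrans_sq[OF a1 f]
      by (simp add: arrow_cat_Cmp arrow_cat_Dom_sq arrow_cat_Cod_sq ev_simps)
  qed (simp_all add: S arrow_cat_Dom_sq arrow_cat_Cod_sq)
qed

text \<open>The inverses of the two sides form a square again: it commutes because \<open>a\<close>
  does, after cancelling \<open>sq1 a\<close>.\<close>

lemma arrow_cat_isoI:
  assumes C: "category C" and a: "a \<in> Arr (arrow_cat C)" and i: "iso_arr C (sq0 a)" "iso_arr C (sq1 a)"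
  shows "iso_arr (arrow_cat C) a"
proof -
  let ?S = "arrow_cat C" and ?b = "sq (Cod (arrow_cat C) a) (Dom (arrow_cat C) a) (inv_arr C (sq0 a)) (inv_arr C (sq1 a))"
  note [simp] = cat_simps[OF C] sq_facts[OF a] inv_simps[OF i(1)] inv_simps[OF i(2)]
  have "Cmp C (sq1 a) (Cmp C (Dom ?S a) (inv_arr C (sq0 a))) = Cmp C (Cod ?S a) (Cmp C (sq0 a) (inv_arr C (sq0 a)))"
    by (rule Cmp_eq_prefix[OF C sq_comm[OF a, symmetric]]) simp_all
  also have "\<dots> = Cmp C (sq1 a) (Cmp C (inv_arr C (sq1 a)) (Cod ?S a))"
    using Cmp_inv_right[OF C i(2), of "Cod ?S a"] by simp
  finally have "Cmp C (Dom ?S a) (inv_arr C (sq0 a)) = Cmp C (inv_arr C (sq1 a)) (Cod ?S a)"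
    by - (rule iso_cancel_left[OF C i(2), rotated -1], simp_all)
  then have b: "?b \<in> Arr ?S" by (simp add: arrow_cat_sq_Arr mem_homset)
  show ?thesis
    by (rule iso_arrI[OF a b]) (simp_all add: arrow_cat_Dom_sq arrow_cat_Cod_sq arrow_cat_Cmp arrow_cat_Idn)
qed

text \<open>Limits of arrows are computed on domains and codomains. The evaluations of a cone have
  mediating arrows \<open>h0\<close> and \<open>h1\<close>, and these form a square because both
  ways round it agree after each projection \<open>FA G (l i)\<close>.\<close>

lemma left_exact_arr_fun:
  assumes t: "ntrans E C F G t" and lF: "left_exact F" and lG: "left_exact G"
  shows "left_exact (arr_fun F G t)"
proof (rule left_exactI[OF functor_arr_fun[OF t]])
  fix J :: "(nat, nat) category" and D L l
  assume J: "finite (Obj J)" "finite (Arr J)" and D: "functor_from_to D J E" and L: "is_limit D L l"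
  let ?A = "arr_fun F G t" and ?S = "arrow_cat C"
  note F = ntrans_dom[OF t] and G = ntrans_cod[OF t] and A = functor_arr_fun[OF t]
  note C = functor_category_cod[OF F]
  note FD = functor_cmp[OF D F] and GD = functor_cmp[OF D G] and AD = functor_cmp[OF D A]
  note limF = left_exactD[OF lF F D J L] and limG = left_exactD[OF lG G D J L]
  have l: "is_cone D L l" by (rule is_limit_cone[OF L])
  have l' [simp]: "L \<in> Obj E" "i \<in> Obj J \<Longrightarrow> l i \<in> Arr E" "i \<in> Obj J \<Longrightarrow> Dom E (l i) = L"
    "i \<in> Obj J \<Longrightarrow> Cod E (l i) = FO D i" for i
    using l by (simp_all add: is_cone_iff[OF D])
  note [simp] = functor_simps[OF F] functor_simps[OF G] functor_simps[OF D] cat_simps[OF C]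
    cat_simps[OF functor_category_dom[OF F]] cmp_func_simps ntrans_simps[OF t] arr_fun_FO[OF t] arr_fun_FA[OF t]
    functor_simps[OF A] arrow_cat_Dom_sq arrow_cat_Cod_sq
  show "is_limit (cmp_func ?A D) (FO ?A L) (\<lambda>j. FA ?A (l j))"
  proof (rule is_limitI[OF AD is_cone_FA[OF D A l]])
    fix X x assume x: "is_cone (cmp_func ?A D) X x"
    then have x' [simp]: "X \<in> Arr C" "i \<in> Obj J \<Longrightarrow> x i \<in> Arr ?S" "i \<in> Obj J \<Longrightarrow> Dom ?S (x i) = X"
      "i \<in> Obj J \<Longrightarrow> Cod ?S (x i) = t (FO D i)" for i
      by (simp_all add: is_cone_iff[OF AD] arrow_cat_Obj)
    have "is_cone (cmp_func F D) (Dom C X) (\<lambda>i. FA (ev0 C) (x i))"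
      using is_cone_FA[OF AD functor_ev0[OF C] x] x'(1)
      by (simp add: cmp_func_assoc[OF D A functor_ev0[OF C]] ev0_arr_fun[OF t] ev_simps)
    then obtain h0 where h0 [simp]: "h0 \<in> Arr C" "Dom C h0 = Dom C X" "Cod C h0 = FO F L"
      and h0x': "\<forall>i\<in>Obj J. Cmp C (FA F (l i)) h0 = FA (ev0 C) (x i)"
      by (rule limit_ex[OF FD limF])
    note h0x = h0x'[rule_format]
    have "is_cone (cmp_func G D) (Cod C X) (\<lambda>i. FA (ev1 C) (x i))"
      using is_cone_FA[OF AD functor_ev1[OF C] x] x'(1)
      by (simp add: cmp_func_assoc[OF D A functor_ev1[OF C]] ev1_arr_fun[OF t] ev_simps)
    then obtain h1 where h1 [simp]: "h1 \<in> Arr C" "Dom C h1 = Cod C X" "Cod C h1 = FO G L"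
      and h1x': "\<forall>i\<in>Obj J. Cmp C (FA G (l i)) h1 = FA (ev1 C) (x i)"
      by (rule limit_ex[OF GD limG])
    note h1x = h1x'[rule_format]
    have comm: "Cmp C (t L) h0 = Cmp C h1 X"
    proof (rule limit_unique[OF GD limG])
      fix i assume i: "i \<in> Obj J"
      have "Cmp C (FA G (l i)) (Cmp C (t L) h0) = Cmp C (t (FO D i)) (Cmp C (FA F (l i)) h0)"
        using ntrans_sq_prefix[OF t, of "l i" h0] i by simp
      also have "\<dots> = Cmp C (sq1 (x i)) X"
        using sq_comm[of "x i" C] i by (simp add: h0x ev_simps)
      also have "\<dots> = Cmp C (FA G (l i)) (Cmp C h1 X)"
        using Cmp_eq_prefix1[OF C h1x[OF i], of X] i by (simp add: ev_simps)
      finally show "Cmp C (FA G (l i)) (Cmp C (t L) h0) = Cmp C (FA G (l i)) (Cmp C h1 X)" .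
    qed simp_all
    have "sq X (t L) h0 h1 \<in> Arr ?S" using comm by (simp add: arrow_cat_sq_Arr mem_homset)
    moreover have "Cmp ?S (FA ?A (l i)) (sq X (t L) h0 h1) = x i" if i: "i \<in> Obj J" for i
      using i h0x[OF i] h1x[OF i] sq_collapse[of "x i" C] by (simp add: arrow_cat_Cmp ev_simps)
    ultimately show "\<exists>h. h \<in> Arr ?S \<and> Dom ?S h = X \<and> Cod ?S h = FO ?A L \<and> (\<forall>i\<in>Obj J. Cmp ?S (FA ?A (l i)) h = x i)"
      by (intro exI[of _ "sq X (t L) h0 h1"]) simp
  next
    fix h k assume h: "h \<in> Arr ?S" "k \<in> Arr ?S" "Dom ?S k = Dom ?S h" "Cod ?S h = FO ?A L" "Cod ?S k = FO ?A L"
      and e: "\<And>i. i \<in> Obj J \<Longrightarrow> Cmp ?S (FA ?A (l i)) h = Cmp ?S (FA ?A (l i)) k"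
    have e': "Cmp C (FA F (l i)) (sq0 h) = Cmp C (FA F (l i)) (sq0 k)"
      "Cmp C (FA G (l i)) (sq1 h) = Cmp C (FA G (l i)) (sq1 k)" if "i \<in> Obj J" for i
      using e[OF that] that by (simp_all add: arrow_cat_Cmp)
    have "sq0 h = sq0 k"
      by (rule limit_unique[OF FD limF]) (use h e' in \<open>simp_all add: sq_facts\<close>)
    moreover have "sq1 h = sq1 k"
      by (rule limit_unique[OF GD limG]) (use h e' in \<open>simp_all add: sq_facts\<close>)
    ultimately show "h = k"
      by (intro arrow_cat_eqI[OF h(1,2)]) (use h in simp_all)
  qed
qed

text \<open>The right adjoint at \<open>u\<close> is a pullback in \<open>E\<close>, of the direct
  image of \<open>u\<close> along \<open>F\<close> and the mate of \<open>t\<close>, which goes from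
  the direct image of \<open>Cod C u\<close> along \<open>G\<close> to that along \<open>F\<close>.
  An arrow from \<open>X\<close> into it is a pair of transposes whose images agree, and this
  agreement is commutation of the square from \<open>t X\<close> to \<open>u\<close>.\<close>

lemma inverse_image_arr_fun:
  assumes t: "ntrans E C F G t" and F': "inverse_image E C F" and G': "inverse_image E C G"
    and pb: "\<And>u v. u \<in> Arr E \<Longrightarrow> v \<in> Arr E \<Longrightarrow> Cod E u = Cod E v \<Longrightarrow> \<exists>c. is_pullback E u v c"
  shows "inverse_image E (arrow_cat C) (arr_fun F G t)"
proof -
  let ?A = "arr_fun F G t" and ?S = "arrow_cat C"
  note F = ntrans_dom[OF t] and G = ntrans_cod[OF t] and A = functor_arr_fun[OF t]
  note C = functor_category_cod[OF F] and E = functor_category_dom[OF F]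
  note [simp] = functor_simps[OF F] functor_simps[OF G] cat_simps[OF C]
    cat_simps[OF E] ntrans_simps[OF t] arr_fun_FO[OF t] arr_fun_FA[OF t]
    functor_simps[OF A] arrow_cat_Dom_sq arrow_cat_Cod_sq
  have "\<exists>R e. universal_arrow E ?S ?A u R e" if "u \<in> Obj ?S" for u
  proof -
    have u [simp]: "u \<in> Arr C" using that by (simp add: arrow_cat_Obj)
    have "Dom C u \<in> Obj C" "Cod C u \<in> Obj C" by simp_all
    then obtain RA eA RB eB RC eC where
      UA: "universal_arrow E C F (Dom C u) RA eA" and
      UC: "universal_arrow E C F (Cod C u) RC eC" and
      UB: "universal_arrow E C G (Cod C u) RB eB"
      using F' G' unfolding inverse_image_def by metis
    have [simp]: "RA \<in> Obj E" "eA \<in> Arr C" "Dom C eA = FO F RA" "Cod C eA = Dom C u"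
      "RC \<in> Obj E" "eC \<in> Arr C" "Dom C eC = FO F RC" "Cod C eC = Cod C u"
      "RB \<in> Obj E" "eB \<in> Arr C" "Dom C eB = FO G RB" "Cod C eB = Cod C u"
      using UA UB UC by (simp_all add: universal_arrow_def)
    \<comment> \<open>\<open>u'\<close> is the direct image of \<open>u\<close> along
      \<open>F\<close>, and \<open>t'\<close> below is the mate of \<open>t\<close>; both are
      transposes with respect to \<open>eC\<close>.\<close>
    obtain u' where u' [simp]: "u' \<in> Arr E" "Dom E u' = RA" "Cod E u' = RC" and u'e: "Cmp C eC (FA F u') = Cmp C u eA"
      by (rule universal_arrow_ex[OF UC, of RA "Cmp C u eA"]) simp_all
    obtain t' where t' [simp]: "t' \<in> Arr E" "Dom E t' = RB" "Cod E t' = RC" and t'e: "Cmp C eC (FA F t') = Cmp C eB (t RB)"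
      by (rule universal_arrow_ex[OF UC, of RB "Cmp C eB (t RB)"]) simp_all
    obtain R p q where pq: "is_pullback E u' t' (R, p, q)"
      using pb[of u' t'] by auto
    note span = pq[unfolded is_pullback_univ_span]
    have [simp]: "R \<in> Obj E" "p \<in> Arr E" "Dom E p = R" "Cod E p = RA" "q \<in> Arr E" "Dom E q = R" "Cod E q = RB"
      using univ_span_Obj[OF span] univ_span_fst[OF span] univ_span_snd[OF span] by simp_all
    have rel: "Cmp E u' p = Cmp E t' q" by (rule univ_span_rel[OF span])
    let ?e0 = "Cmp C eA (FA F p)" and ?e1 = "Cmp C eB (FA G q)"
    \<comment> \<open>\<open>key\<close> and \<open>key2\<close> transpose the two ways round a
      square, so that its commutation becomes an equation between composites with \<open>u'\<close>
      and \<open>t'\<close>.\<close>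
    have key: "Cmp C u (Cmp C eA (FA F a)) = Cmp C eC (FA F (Cmp E u' a))" if "a \<in> Arr E" "Cod E a = RA" for a
      using Cmp_eq_prefix[OF C u'e, of "FA F a"] that by simp
    have key2: "Cmp C (Cmp C eB (FA G b)) (t (Dom E b)) = Cmp C eC (FA F (Cmp E t' b))" if b: "b \<in> Arr E" "Cod E b = RB" for b
    proof -
      have "Cmp C (Cmp C eB (FA G b)) (t (Dom E b)) = Cmp C eB (Cmp C (t RB) (FA F b))"
        using ntrans_sq[OF t b(1)] b by simp
      also have "\<dots> = Cmp C eC (Cmp C (FA F t') (FA F b))"
        using Cmp_eq_prefix[OF C t'e, of "FA F b"] b by simp
      finally show ?thesis using b by simp
    qed
    have e: "sq (t R) u ?e0 ?e1 \<in> Arr ?S"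
      using key[of p] key2[of q] rel by (simp add: arrow_cat_sq_Arr mem_homset)
    have "universal_arrow E ?S ?A u R (sq (t R) u ?e0 ?e1)"
      unfolding universal_arrow_def
    proof (intro conjI ballI impI ex_ex1I)
      fix X a assume X [simp]: "X \<in> Obj E" and a [simp]: "a \<in> Arr ?S" and "Dom ?S a = FO ?A X \<and> Cod ?S a = u"
      then have [simp]: "Dom ?S a = t X" "Cod ?S a = u" by simp_all
      note [simp] = sq_facts[OF a]
      obtain g where g [simp]: "g \<in> Arr E" "Dom E g = X" "Cod E g = RA" and ge: "Cmp C eA (FA F g) = sq0 a"
        by (rule universal_arrow_ex[OF UA, of X "sq0 a"]) simp_all
      obtain h where h [simp]: "h \<in> Arr E" "Dom E h = X" "Cod E h = RB" and he: "Cmp C eB (FA G h) = sq1 a"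
        by (rule universal_arrow_ex[OF UB, of X "sq1 a"]) simp_all
      have "Cmp C eC (FA F (Cmp E u' g)) = Cmp C eC (FA F (Cmp E t' h))"
        using key[of g] key2[of h] sq_comm[OF a] by (simp add: ge he del: FA_Cmp[OF F])
      then have "Cmp E u' g = Cmp E t' h"
        by - (rule universal_arrow_unique[OF UC F, rotated -1], simp_all)
      then obtain r where r [simp]: "r \<in> Arr E" "Dom E r = X" "Cod E r = R" and re: "Cmp E p r = g" "Cmp E q r = h"
        by - (rule univ_span_ex[OF span E, of g h X], simp_all)
      have "Cmp C ?e0 (FA F r) = sq0 a" "Cmp C ?e1 (FA G r) = sq1 a"
        using re[THEN arg_cong[of _ _ "FA F"]] re[THEN arg_cong[of _ _ "FA G"]] ge he by simp_all
      then show "\<exists>r. r \<in> Arr E \<and> Dom E r = X \<and> Cod E r = R \<and> Cmp ?S (sq (t R) u ?e0 ?e1) (FA ?A r) = a"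
        using sq_collapse[OF a] by (intro exI[of _ r]) (simp add: arrow_cat_Cmp del: Cmp_assoc[OF C])
    next
      fix X a h k
      assume h: "h \<in> Arr E \<and> Dom E h = X \<and> Cod E h = R \<and> Cmp ?S (sq (t R) u ?e0 ?e1) (FA ?A h) = a"
        and k: "k \<in> Arr E \<and> Dom E k = X \<and> Cod E k = R \<and> Cmp ?S (sq (t R) u ?e0 ?e1) (FA ?A k) = a"
      have hk [simp]: "h \<in> Arr E" "Dom E h = X" "Cod E h = R" "k \<in> Arr E" "Dom E k = X" "Cod E k = R"
        using h k by blast+
      have e: "Cmp ?S (sq (t R) u ?e0 ?e1) (FA ?A h) = Cmp ?S (sq (t R) u ?e0 ?e1) (FA ?A k)"
        using h k by metis
      have "Cmp C eA (FA F (Cmp E p h)) = Cmp C eA (FA F (Cmp E p k))"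
        "Cmp C eB (FA G (Cmp E q h)) = Cmp C eB (FA G (Cmp E q k))"
        using e by (simp_all add: arrow_cat_Cmp)
      then have "Cmp E p h = Cmp E p k" "Cmp E q h = Cmp E q k"
        by - (rule universal_arrow_unique[OF UA F, rotated -1], simp_all,
          rule universal_arrow_unique[OF UB G, rotated -1], simp_all)
      then show "h = k"
        by - (rule univ_span_unique[OF span E], simp_all add: Cmp_eq_prefix[OF E rel])
    qed (simp_all add: e)
    then show ?thesis by blast
  qed
  then show ?thesis
    using A left_exact_arr_fun[OF t] F' G' by (auto simp: inverse_image_def)
qed

text \<open>\<open>ev0\<close> has a left adjoint, sending \<open>X\<close> to its identity. A cone
  with vertex \<open>X\<close> over the domains extends to a cone with vertex
  \<open>Idn C X\<close>, whose codomain component at \<open>i\<close> is \<open>FO D i\<close>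
  after \<open>x i\<close>.\<close>

lemma left_exact_ev0:
  assumes C: "category C"
  shows "left_exact (ev0 C)"
proof (rule left_exactI[OF functor_ev0[OF C]])
  fix J :: "(nat, nat) category" and D L l
  let ?S = "arrow_cat C"
  assume D: "functor_from_to D J ?S" and L: "is_limit D L l"
  note ED = functor_cmp[OF D functor_ev0[OF C]] and J = functor_category_dom[OF D]
  have l: "is_cone D L l" by (rule is_limit_cone[OF L])
  have l' [simp]: "L \<in> Arr C" "i \<in> Obj J \<Longrightarrow> l i \<in> Arr ?S" "i \<in> Obj J \<Longrightarrow> Dom ?S (l i) = L"
    "i \<in> Obj J \<Longrightarrow> Cod ?S (l i) = FO D i" for i
    using l by (simp_all add: is_cone_iff[OF D] arrow_cat_Obj)
  have D' [simp]: "FO D i \<in> Arr C" if "i \<in> Obj J" for i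
    using FO_Obj[OF D that] by (simp add: arrow_cat_Obj)
  note [simp] = functor_simps[OF D] cat_simps[OF C] cat_simps[OF J] cmp_func_simps arrow_cat_Dom_sq arrow_cat_Cod_sq
    ev_simps sq_facts
  have ext: "sq (Idn C X) (FO D i) x (Cmp C (FO D i) x) \<in> Arr ?S"
    if "i \<in> Obj J" "x \<in> Arr C" "Dom C x = X" "Cod C x = Dom C (FO D i)" "X \<in> Obj C" for i x X
    using that by (simp add: arrow_cat_sq_Arr mem_homset)
  show "is_limit (cmp_func (ev0 C) D) (FO (ev0 C) L) (\<lambda>j. FA (ev0 C) (l j))"
  proof (rule is_limitI[OF ED is_cone_FA[OF D functor_ev0[OF C] l]])
    fix X x assume x: "is_cone (cmp_func (ev0 C) D) X x"
    then have x' [simp]: "X \<in> Obj C" "i \<in> Obj J \<Longrightarrow> x i \<in> Arr C" "i \<in> Obj J \<Longrightarrow> Dom C (x i) = X"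
      "i \<in> Obj J \<Longrightarrow> Cod C (x i) = Dom C (FO D i)"
      and xu: "u \<in> Arr J \<Longrightarrow> Cmp C (sq0 (FA D u)) (x (Dom J u)) = x (Cod J u)" for i u
      by (simp_all add: is_cone_iff[OF ED])
    have "Cmp C (sq1 (FA D u)) (Cmp C (FO D (Dom J u)) (x (Dom J u))) =
        Cmp C (FO D (Cod J u)) (x (Cod J u))" if u: "u \<in> Arr J" for u
      using Cmp_eq_prefix[OF C sq_comm[OF FA_Arr[OF D u], symmetric], of "x (Dom J u)"] u by (simp add: xu)
    then have "is_cone D (Idn C X) (\<lambda>i. sq (Idn C X) (FO D i) (x i) (Cmp C (FO D i) (x i)))"
      unfolding is_cone_iff[OF D] by (simp add: ext arrow_cat_Obj arrow_cat_Cmp xu)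
    then obtain h where h [simp]: "h \<in> Arr ?S" "Dom ?S h = Idn C X" "Cod ?S h = L"
      and hx: "\<forall>i\<in>Obj J. Cmp ?S (l i) h = sq (Idn C X) (FO D i) (x i) (Cmp C (FO D i) (x i))"
      by (rule limit_ex[OF D L])
    have "Cmp C (sq0 (l i)) (sq0 h) = x i" if "i \<in> Obj J" for i
      using hx that by (simp add: arrow_cat_Cmp)
    then show "\<exists>h. h \<in> Arr C \<and> Dom C h = X \<and> Cod C h = FO (ev0 C) L \<and> (\<forall>i\<in>Obj J. Cmp C (FA (ev0 C) (l i)) h = x i)"
      by (intro exI[of _ "sq0 h"]) simp
  next
    fix h k assume h: "h \<in> Arr C" "k \<in> Arr C" "Dom C k = Dom C h" "Cod C h = FO (ev0 C) L" "Cod C k = FO (ev0 C) L"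
      and e: "\<And>i. i \<in> Obj J \<Longrightarrow> Cmp C (FA (ev0 C) (l i)) h = Cmp C (FA (ev0 C) (l i)) k"
    note [simp] = h
    define X where "X = Dom C h"
    have [simp]: "X \<in> Obj C" by (simp add: X_def)
    have c: "Cmp ?S (l i) (sq (Idn C X) L h (Cmp C L h)) = sq (Idn C X) (FO D i) (Cmp C (sq0 (l i)) h) (Cmp C (FO D i) (Cmp C (sq0 (l i)) h))"
      if i: "i \<in> Obj J" and h: "h \<in> Arr C" "Cod C h = Dom C L" for i h
      using Cmp_eq_prefix[OF C sq_comm[of "l i" C], of h] i h by (simp add: arrow_cat_Cmp)
    have "sq (Idn C X) L h (Cmp C L h) = sq (Idn C X) L k (Cmp C L k)"
    proof (rule limit_unique[OF D L])
      show "sq (Idn C X) L h (Cmp C L h) \<in> Arr ?S" "sq (Idn C X) L k (Cmp C L k) \<in> Arr ?S"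
        by (simp_all add: arrow_cat_sq_Arr mem_homset X_def)
      show "Cmp ?S (l i) (sq (Idn C X) L h (Cmp C L h)) = Cmp ?S (l i) (sq (Idn C X) L k (Cmp C L k))"
        if "i \<in> Obj J" for i
        using e[OF that] that c[OF that, of h] c[OF that, of k] by simp
    qed simp_all
    then show "h = k" by simp
  qed
qed

section \<open>Evaluations as inverse images\<close>

lemma empty_SetCat: "Sub {} \<in> Obj SetCat"
  by (simp add: SetCat_Obj small_finite)

lemma from_empty_eq:
  assumes "f \<in> Arr SetCat" "g \<in> Arr SetCat" "Dom SetCat f = Sub {}" "Dom SetCat g = Sub {}" "Cod SetCat f = Cod SetCat g"
  shows "f = g"
  by (rule SetCat_eqI) (use assms in simp_all)

definition from_empty :: "'u large \<Rightarrow> 'u large" where "from_empty X = smap (Sub {}) X (\<lambda>x. x)"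

lemma from_empty:
  assumes "X \<in> Obj SetCat"
  shows "from_empty X \<in> Arr SetCat" "Dom SetCat (from_empty X) = Sub {}" "Cod SetCat (from_empty X) = X"
  unfolding from_empty_def using assms empty_SetCat by (auto intro!: smap_Arr smap_Dom smap_Cod)

text \<open>Evaluation at 1 has a left adjoint, since there is an initial set.\<close>

lemma left_exact_ev1: "left_exact (ev1 SetCat)"
proof (rule left_exactI[OF functor_ev1[OF category_SetCat]])
  fix J :: "(nat, nat) category" and D L l
  let ?S = "arrow_cat SetCat"
  let ?C = SetCat
  note C = category_SetCat
  assume D: "functor_from_to D J ?S" and L: "is_limit D L l"
  note ED = functor_cmp[OF D functor_ev1[OF C]] and J = functor_category_dom[OF D]
  have l: "is_cone D L l" by (rule is_limit_cone[OF L])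
  have l' [simp]: "L \<in> Arr ?C" "i \<in> Obj J \<Longrightarrow> l i \<in> Arr ?S" "i \<in> Obj J \<Longrightarrow> Dom ?S (l i) = L"
    "i \<in> Obj J \<Longrightarrow> Cod ?S (l i) = FO D i" for i
    using l by (simp_all add: is_cone_iff[OF D] arrow_cat_Obj)
  have D' [simp]: "FO D i \<in> Arr ?C" if "i \<in> Obj J" for i
    using FO_Obj[OF D that] by (simp add: arrow_cat_Obj)
  note [simp] = functor_simps[OF D] cat_simps[OF C] cat_simps[OF J] cmp_func_simps arrow_cat_Dom_sq arrow_cat_Cod_sq
    ev_simps sq_facts from_empty
  have ext: "sq (from_empty X) m (from_empty (Dom ?C m)) x \<in> Arr ?S"
    if "m \<in> Arr ?C" "x \<in> Arr ?C" "Dom ?C x = X" "Cod ?C x = Cod ?C m" "X \<in> Obj ?C" for m x X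
  proof -
    have "Cmp ?C m (from_empty (Dom ?C m)) = Cmp ?C x (from_empty X)"
      by (rule from_empty_eq) (use that in simp_all)
    then show ?thesis using that by (simp add: arrow_cat_sq_Arr mem_homset)
  qed
  have fe: "Cmp ?C f (from_empty X) = from_empty Y" if "f \<in> Arr ?C" "Dom ?C f = X" "Cod ?C f = Y" for f X Y
    by (rule from_empty_eq) (use that in auto)
  show "is_limit (cmp_func (ev1 ?C) D) (FO (ev1 ?C) L) (\<lambda>j. FA (ev1 ?C) (l j))"
  proof (rule is_limitI[OF ED is_cone_FA[OF D functor_ev1[OF C] l]])
    fix X x assume x: "is_cone (cmp_func (ev1 ?C) D) X x"
    then have x' [simp]: "X \<in> Obj ?C" "i \<in> Obj J \<Longrightarrow> x i \<in> Arr ?C" "i \<in> Obj J \<Longrightarrow> Dom ?C (x i) = X"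
      "i \<in> Obj J \<Longrightarrow> Cod ?C (x i) = Cod ?C (FO D i)"
      and xu: "u \<in> Arr J \<Longrightarrow> Cmp ?C (sq1 (FA D u)) (x (Dom J u)) = x (Cod J u)" for i u
      by (simp_all add: is_cone_iff[OF ED])
    have "is_cone D (from_empty X) (\<lambda>i. sq (from_empty X) (FO D i) (from_empty (Dom ?C (FO D i))) (x i))"
      unfolding is_cone_iff[OF D] by (simp add: ext arrow_cat_Obj arrow_cat_Cmp xu fe)
    then obtain h where h [simp]: "h \<in> Arr ?S" "Dom ?S h = from_empty X" "Cod ?S h = L"
      and hx: "\<forall>i\<in>Obj J. Cmp ?S (l i) h = sq (from_empty X) (FO D i) (from_empty (Dom ?C (FO D i))) (x i)"
      by (rule limit_ex[OF D L])
    have "Cmp ?C (sq1 (l i)) (sq1 h) = x i" if "i \<in> Obj J" for i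
      using hx that by (simp add: arrow_cat_Cmp)
    then show "\<exists>h. h \<in> Arr ?C \<and> Dom ?C h = X \<and> Cod ?C h = FO (ev1 ?C) L \<and> (\<forall>i\<in>Obj J. Cmp ?C (FA (ev1 ?C) (l i)) h = x i)"
      by (intro exI[of _ "sq1 h"]) simp
  next
    fix h k assume h: "h \<in> Arr ?C" "k \<in> Arr ?C" "Dom ?C k = Dom ?C h" "Cod ?C h = FO (ev1 ?C) L" "Cod ?C k = FO (ev1 ?C) L"
      and e: "\<And>i. i \<in> Obj J \<Longrightarrow> Cmp ?C (FA (ev1 ?C) (l i)) h = Cmp ?C (FA (ev1 ?C) (l i)) k"
    note [simp] = h
    define X where "X = Dom ?C h"
    have [simp]: "X \<in> Obj ?C" by (simp add: X_def)
    have "sq (from_empty X) L (from_empty (Dom ?C L)) h = sq (from_empty X) L (from_empty (Dom ?C L)) k"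
    proof (rule limit_unique[OF D L])
      show "sq (from_empty X) L (from_empty (Dom ?C L)) h \<in> Arr ?S" "sq (from_empty X) L (from_empty (Dom ?C L)) k \<in> Arr ?S"
        by (rule ext; simp add: X_def)+
      show "Cmp ?S (l i) (sq (from_empty X) L (from_empty (Dom ?C L)) h) = Cmp ?S (l i) (sq (from_empty X) L (from_empty (Dom ?C L)) k)"
        if "i \<in> Obj J" for i
        using e[OF that] that by (simp add: arrow_cat_Cmp)
    qed simp_all
    then show "h = k" by simp
  qed
qed

definition one_set :: "'u large" where "one_set = Sub {undefined}"

lemma one_set_Obj: "one_set \<in> Obj SetCat"
  by (simp add: one_set_def SetCat_Obj small_finite)

definition to_one :: "'u large \<Rightarrow> 'u large" where "to_one X = smap X one_set (\<lambda>_. undefined)"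

lemma to_one:
  assumes "X \<in> Obj SetCat"
  shows "to_one X \<in> Arr SetCat" "Dom SetCat (to_one X) = X" "Cod SetCat (to_one X) = one_set"
proof -
  show "to_one X \<in> Arr SetCat"
    unfolding to_one_def by (rule smap_Arr[OF assms one_set_Obj]) (simp add: one_set_def)
qed (simp_all add: to_one_def smap_Dom[OF assms one_set_Obj] smap_Cod[OF assms one_set_Obj])

lemma to_one_eq:
  assumes "f \<in> Arr SetCat" "g \<in> Arr SetCat" "Dom SetCat f = Dom SetCat g" "Cod SetCat f = one_set" "Cod SetCat g = one_set"
  shows "f = g"
proof (rule SetCat_eqI)
  fix t assume "t \<in> elts (Dom SetCat f)"
  then show "app f t = app g t"
    using app_in[of f t] app_in[of g t] assms by (simp add: one_set_def)
qed (use assms in simp_all)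

text \<open>The right adjoint sends a set \<open>Z\<close> to the arrow from \<open>Z\<close> to a
  singleton: a square into it is free on domains and forced on codomains.\<close>

lemma inverse_image_ev0: "inverse_image (arrow_cat SetCat) SetCat (ev0 SetCat)"
proof -
  let ?C = SetCat and ?S = "arrow_cat SetCat"
  note C = category_SetCat
  note [simp] = cat_simps[OF C] arrow_cat_Dom_sq arrow_cat_Cod_sq ev_simps sq_facts to_one arrow_cat_Obj
  have "universal_arrow ?S ?C (ev0 ?C) Z (to_one Z) (Idn ?C Z)" if [simp]: "Z \<in> Obj ?C" for Z
    unfolding universal_arrow_def
  proof (intro conjI ballI impI ex_ex1I)
    fix X g assume X: "X \<in> Obj ?S" and "g \<in> Arr ?C" "Dom ?C g = FO (ev0 ?C) X \<and> Cod ?C g = Z"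
    then have [simp]: "X \<in> Arr ?C" "g \<in> Arr ?C" "Dom ?C g = Dom ?C X" "Cod ?C g = Z" by simp_all
    have "Cmp ?C (to_one Z) g = Cmp ?C (to_one (Cod ?C X)) X"
      by (rule to_one_eq) simp_all
    then have "sq X (to_one Z) g (to_one (Cod ?C X)) \<in> Arr ?S"
      by (simp add: arrow_cat_sq_Arr mem_homset)
    then show "\<exists>h. h \<in> Arr ?S \<and> Dom ?S h = X \<and> Cod ?S h = to_one Z \<and> Cmp ?C (Idn ?C Z) (FA (ev0 ?C) h) = g"
      by (intro exI[of _ "sq X (to_one Z) g (to_one (Cod ?C X))"]) simp
  next
    fix X g h k assume h: "h \<in> Arr ?S \<and> Dom ?S h = X \<and> Cod ?S h = to_one Z \<and> Cmp ?C (Idn ?C Z) (FA (ev0 ?C) h) = g"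
      and k: "k \<in> Arr ?S \<and> Dom ?S k = X \<and> Cod ?S k = to_one Z \<and> Cmp ?C (Idn ?C Z) (FA (ev0 ?C) k) = g"
    have hk [simp]: "h \<in> Arr ?S" "k \<in> Arr ?S" and hk': "Dom ?S h = X" "Dom ?S k = X"
      "Cod ?S h = to_one Z" "Cod ?S k = to_one Z" using h k by blast+
    have "sq0 h = Cmp ?C (Idn ?C Z) (FA (ev0 ?C) h)" "sq0 k = Cmp ?C (Idn ?C Z) (FA (ev0 ?C) k)"
      by (simp_all add: hk')
    then have "sq0 h = sq0 k" using h k by metis
    moreover have "sq1 h = sq1 k" by (rule to_one_eq) (simp_all add: hk')
    ultimately show "h = k" by (intro arrow_cat_eqI[OF hk]) (simp_all add: hk')
  qed simp_all
  then show ?thesis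
    using functor_ev0[OF C] left_exact_ev0[OF C] by (auto simp: inverse_image_def)
qed

text \<open>The right adjoint sends \<open>Z\<close> to its identity: the domain part of a square
  into an identity is determined by the codomain part.\<close>

lemma inverse_image_ev1: "inverse_image (arrow_cat SetCat) SetCat (ev1 SetCat)"
proof -
  let ?C = SetCat and ?S = "arrow_cat SetCat"
  note C = category_SetCat
  note [simp] = cat_simps[OF C] arrow_cat_Dom_sq arrow_cat_Cod_sq ev_simps sq_facts arrow_cat_Obj
  have "universal_arrow ?S ?C (ev1 ?C) Z (Idn ?C Z) (Idn ?C Z)" if [simp]: "Z \<in> Obj ?C" for Z
    unfolding universal_arrow_def
  proof (intro conjI ballI impI ex_ex1I)
    fix X g assume X: "X \<in> Obj ?S" and "g \<in> Arr ?C" "Dom ?C g = FO (ev1 ?C) X \<and> Cod ?C g = Z"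
    then have [simp]: "X \<in> Arr ?C" "g \<in> Arr ?C" "Dom ?C g = Cod ?C X" "Cod ?C g = Z" by simp_all
    have "sq X (Idn ?C Z) (Cmp ?C g X) g \<in> Arr ?S"
      by (simp add: arrow_cat_sq_Arr mem_homset)
    then show "\<exists>h. h \<in> Arr ?S \<and> Dom ?S h = X \<and> Cod ?S h = Idn ?C Z \<and> Cmp ?C (Idn ?C Z) (FA (ev1 ?C) h) = g"
      by (intro exI[of _ "sq X (Idn ?C Z) (Cmp ?C g X) g"]) simp
  next
    fix X g h k assume h: "h \<in> Arr ?S \<and> Dom ?S h = X \<and> Cod ?S h = Idn ?C Z \<and> Cmp ?C (Idn ?C Z) (FA (ev1 ?C) h) = g"
      and k: "k \<in> Arr ?S \<and> Dom ?S k = X \<and> Cod ?S k = Idn ?C Z \<and> Cmp ?C (Idn ?C Z) (FA (ev1 ?C) k) = g"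
    have hk [simp]: "h \<in> Arr ?S" "k \<in> Arr ?S" and hk': "Dom ?S h = X" "Dom ?S k = X"
      "Cod ?S h = Idn ?C Z" "Cod ?S k = Idn ?C Z" using h k by blast+
    have "sq1 h = Cmp ?C (Idn ?C Z) (FA (ev1 ?C) h)" "sq1 k = Cmp ?C (Idn ?C Z) (FA (ev1 ?C) k)"
      by (simp_all add: hk')
    then have e: "sq1 h = sq1 k" using h k by metis
    have "Cmp ?C (Idn ?C Z) (sq0 h) = Cmp ?C (Idn ?C Z) (sq0 k)"
      using sq_comm[OF hk(1)] sq_comm[OF hk(2)] unfolding hk' e by simp
    then have "sq0 h = sq0 k" by (simp add: hk')
    then show "h = k" using e by (intro arrow_cat_eqI[OF hk]) (simp_all add: hk')
  qed simp_all
  then show ?thesis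
    using functor_ev1[OF C] left_exact_ev1 by (auto simp: inverse_image_def)
qed

section \<open>Arrows of sets as a topos of presheaves\<close>

lemma bijective_functor_equivalence:
  assumes F: "functor_from_to F C D" and bO: "bij_betw (FO F) (Obj C) (Obj D)" and bA: "bij_betw (FA F) (Arr C) (Arr D)"
  shows "equivalence_functor F"
proof -
  note C = functor_category_dom[OF F] and D = functor_category_cod[OF F]
  note [simp] = functor_simps[OF F] cat_simps[OF C] cat_simps[OF D]
  define o' where "o' = inv_into (Obj C) (FO F)"
  define a' where "a' = inv_into (Arr C) (FA F)"
  have o1 [simp]: "o' y \<in> Obj C" "FO F (o' y) = y" if "y \<in> Obj D" for y
    using that bO by (auto simp: o'_def bij_betw_def inv_into_into f_inv_into_f)
  have a1 [simp]: "a' y \<in> Arr C" "FA F (a' y) = y" if "y \<in> Arr D" for y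
    using that bA by (auto simp: a'_def bij_betw_def inv_into_into f_inv_into_f)
  have io: "x = y" if "x \<in> Obj C" "y \<in> Obj C" "FO F x = FO F y" for x y
    using that bO by (auto simp: bij_betw_def inj_on_def)
  have ia: "x = y" if "x \<in> Arr C" "y \<in> Arr C" "FA F x = FA F y" for x y
    using that bA by (auto simp: bij_betw_def inj_on_def)
  have od [simp]: "Dom C (a' f) = o' (Dom D f)" "Cod C (a' f) = o' (Cod D f)" if f: "f \<in> Arr D" for f
  proof -
    show "Dom C (a' f) = o' (Dom D f)"
      by (rule io) (use f FA_Dom[OF F, of "a' f"] in simp_all)
    show "Cod C (a' f) = o' (Cod D f)"
      by (rule io) (use f FA_Cod[OF F, of "a' f"] in simp_all)
  qed
  define G where "G = \<lparr>FDom = D, FCod = C, FO = restrict o' (Obj D), FA = restrict a' (Arr D)\<rparr>"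
  have G: "functor_from_to G D C"
  proof (rule functorI[OF D C])
    fix x assume "x \<in> Obj D" then show "FA G (Idn D x) = Idn C (FO G x)"
      by - (rule ia, simp_all add: G_def)
  next
    fix f g assume "f \<in> Arr D" "g \<in> Arr D" "Cod D f = Dom D g"
    then show "FA G (Cmp D g f) = Cmp C (FA G g) (FA G f)"
      by - (rule ia, simp_all add: G_def)
  qed (simp_all add: G_def)
  have Gs: "x \<in> Obj D \<Longrightarrow> FO G x = o' x" "f \<in> Arr D \<Longrightarrow> FA G f = a' f" for x f
    by (simp_all add: G_def)
  have 1: "cmp_func G F = id_func C"
  proof (rule functor_eqI[OF functor_cmp[OF F G] functor_id[OF C]])
    fix x assume "x \<in> Obj C" then show "FO (cmp_func G F) x = FO (id_func C) x"
      by - (rule io, simp_all add: cmp_func_simps Gs id_func_simps)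
  next
    fix x assume "x \<in> Arr C" then show "FA (cmp_func G F) x = FA (id_func C) x"
      by - (rule ia, simp_all add: cmp_func_simps Gs id_func_simps)
  qed
  have 2: "cmp_func F G = id_func D"
    by (rule functor_eqI[OF functor_cmp[OF G F] functor_id[OF D]])
      (simp_all add: cmp_func_simps functor_simps[OF G] Gs id_func_simps)
  have "natural_iso (cmp_func G F) (id_func C) (\<lambda>x\<in>Obj C. Idn C (FO (id_func C) x))"
    using ntiso_id[OF functor_id[OF C]] by (simp add: 1 natural_iso_iff_ntiso id_func_simps)
  moreover have "natural_iso (cmp_func F G) (id_func D) (\<lambda>x\<in>Obj D. Idn D (FO (id_func D) x))"
    using ntiso_id[OF functor_id[OF D]] by (simp add: 2 natural_iso_iff_ntiso id_func_simps)
  ultimately show ?thesis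
    using F G unfolding equivalence_functor_def by (auto simp: functor_from_to_def)
qed

text \<open>Only maximal sieves cover. The sheaf condition is then vacuous: a compatible family is
  given by its value at the identity.\<close>

definition trivial_topology :: "('o, 'a) category \<Rightarrow> 'o \<Rightarrow> 'a set set" where
  "trivial_topology C c = {{f \<in> Arr C. Cod C f = c}}"

lemma grothendieck_topology_trivial:
  assumes C: "category C"
  shows "grothendieck_topology C (trivial_topology C)"
proof -
  note [simp] = cat_simps[OF C]
  have "R = {f \<in> Arr C. Cod C f = c}"
    if c: "c \<in> Obj C" and R: "sieve C c R"
      and p: "\<forall>f\<in>{f \<in> Arr C. Cod C f = c}. pullback_sieve C f R \<in> trivial_topology C (Dom C f)" for c R
  proof -
    have i: "pullback_sieve C (Idn C c) R = {f \<in> Arr C. Cod C f = c}"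
      using p c by (auto simp: trivial_topology_def)
    have "f \<in> R" if f: "f \<in> Arr C" "Cod C f = c" for f
    proof -
      have "f \<in> pullback_sieve C (Idn C c) R" using i f by simp
      then show ?thesis using f by (simp add: pullback_sieve_def)
    qed
    then show ?thesis using R by (auto simp: sieve_def)
  qed
  then show ?thesis
    unfolding grothendieck_topology_def
    by (auto simp: trivial_topology_def sieve_def pullback_sieve_def)
qed

lemma is_sheaf_trivial_topology:
  assumes P: "functor_from_to P (op_cat C) SetCat" and C: "category C"
  shows "is_sheaf C (trivial_topology C) P"
  unfolding is_sheaf_def
proof (intro conjI P ballI allI impI; (elim conjE)?)
  note [simp] = cat_simps[OF C] op_cat_simps
  fix c S x assume c: "c \<in> Obj C" and "S \<in> trivial_topology C c" and x: "\<forall>f\<in>S. x f \<in> elts (FO P (Dom C f))"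
    and xg: "\<forall>f\<in>S. \<forall>g\<in>Arr C. Cod C g = Dom C f \<longrightarrow> x (Cmp C f g) = app (FA P g) (x f)"
  then have S: "f \<in> S \<longleftrightarrow> f \<in> Arr C \<and> Cod C f = c" for f by (simp add: trivial_topology_def)
  show "\<exists>!y. y \<in> elts (FO P c) \<and> (\<forall>f\<in>S. app (FA P f) y = x f)"
  proof (rule ex1I[of _ "x (Idn C c)"])
    have "app (FA P f) (x (Idn C c)) = x f" if "f \<in> Arr C" "Cod C f = c" for f
      using xg[rule_format, of "Idn C c" f] that c by (simp add: S)
    moreover have "x (Idn C c) \<in> elts (FO P c)" using x[rule_format, of "Idn C c"] c by (simp add: S)
    ultimately show "x (Idn C c) \<in> elts (FO P c) \<and> (\<forall>f\<in>S. app (FA P f) (x (Idn C c)) = x f)"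
      by (simp add: S)
    fix y assume y: "y \<in> elts (FO P c) \<and> (\<forall>f\<in>S. app (FA P f) y = x f)"
    then have "app (FA P (Idn C c)) y = x (Idn C c)" using c by (simp add: S)
    then show "y = x (Idn C c)" using app_FA_Idn[OF P, of c y] y c by simp
  qed
qed

text \<open>Arrows of sets are presheaves on the category with one arrow besides the identities,
  hence sheaves for the trivial topology on it. As functors and transformations are extensional, the
  correspondence is bijective on objects and arrows.\<close>

lemma grothendieck_topos_arrow_SetCat: "grothendieck_topos (arrow_cat SetCat :: ('u::universe large, 'u large) category)"
proof -
  let ?S = "arrow_cat SetCat :: ('u large, 'u large) category"
  have S: "category ?S" by (rule category_arrow_cat[OF category_SetCat])
  \<comment> \<open>Names for the two objects and the arrow of the site; an infinite type has three
    distinct elements. The objects also name their identities.\<close>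
  obtain z w n :: 'u where d [simp]: "z \<noteq> w" "n \<noteq> z" "n \<noteq> w"
  proof -
    obtain z :: 'u where True by blast
    obtain w where w: "w \<notin> {z}" using ex_new_if_finite[OF universe_infinite, of "{z}"] by auto
    obtain n where "n \<notin> {z, w}" using ex_new_if_finite[OF universe_infinite, of "{z, w}"] by auto
    then show ?thesis using that[of z w n] w by auto
  qed
  note [simp] = d[symmetric]
  text \<open>The arrow \<open>n\<close> goes from \<open>w\<close> to \<open>z\<close>, so presheaves are arrows from the value at \<open>z\<close> to the value at \<open>w\<close>.\<close>
  define C :: "('u, 'u) category" where "C = \<lparr>Obj = {z, w}, Arr = {z, w, n}, Dom = (\<lambda>a. if a = n then w else a),
    Cod = (\<lambda>a. if a = n then z else a), Idn = (\<lambda>x. x), Cmp = (\<lambda>g f. if f = n then n else g)\<rparr>"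
  have C: "category C"
    by (auto simp: category_def C_def mem_homset)
  have Cs: "Obj C = {z, w}" "Arr C = {z, w, n}" "Dom C a = (if a = n then w else a)" "Cod C a = (if a = n then z else a)"
    "Idn C a = a" "Cmp C b a = (if a = n then n else b)" for a b
    by (simp_all add: C_def)
  let ?J = "trivial_topology C"
  let ?H = "sheaf_category C ?J"
  note T = category_SetCat
  note [simp] = cat_simps[OF T] op_cat_simps arrow_cat_Obj
  have H: "category ?H" by (rule category_sheaf_category[OF C])
  define ps where "ps = (\<lambda>m :: 'u large. \<lparr>FDom = op_cat C, FCod = SetCat,
    FO = (\<lambda>c\<in>{z, w}. if c = z then Dom SetCat m else Cod SetCat m),
    FA = (\<lambda>a\<in>{z, w, n}. if a = n then m else Idn SetCat (if a = z then Dom SetCat m else Cod SetCat m))\<rparr>)"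
  have pss: "FO (ps m) z = Dom SetCat m" "FO (ps m) w = Cod SetCat m" "FA (ps m) n = m"
    "FA (ps m) z = Idn SetCat (Dom SetCat m)" "FA (ps m) w = Idn SetCat (Cod SetCat m)" for m
    by (simp_all add: ps_def)
  have psF: "functor_from_to (ps m) (op_cat C) SetCat" if m: "m \<in> Arr SetCat" for m
  proof (rule functorI[OF category_op[OF C] T])
    fix f g assume fg: "f \<in> Arr (op_cat C)" "g \<in> Arr (op_cat C)" "Cod (op_cat C) f = Dom (op_cat C) g"
    then have "f = z \<or> f = w \<or> f = n" "g = z \<or> g = w \<or> g = n" by (simp_all add: Cs)
    then show "FA (ps m) (Cmp (op_cat C) g f) = Cmp SetCat (FA (ps m) g) (FA (ps m) f)"
      using m fg(3) by (elim disjE) (simp_all add: Cs pss)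
  qed (use m in \<open>auto simp: Cs pss\<close>, simp_all add: ps_def Cs)
  have psS: "is_sheaf C ?J (ps m)" if "m \<in> Arr SetCat" for m
    by (rule is_sheaf_trivial_topology[OF psF[OF that] C])
  define tr where "tr = (\<lambda>a :: 'u large. \<lparr>TDom = ps (Dom ?S a), TCod = ps (Cod ?S a),
    TMap = (\<lambda>c\<in>{z, w}. if c = z then sq0 a else sq1 a)\<rparr>)"
  have trA: "tr a \<in> Arr ?H" if a: "a \<in> Arr ?S" for a
  proof -
    have "ntrans (op_cat C) SetCat (ps (Dom ?S a)) (ps (Cod ?S a)) (\<lambda>c\<in>{z, w}. if c = z then sq0 a else sq1 a)"
      by (rule ntransI[OF psF psF]) (use sq_facts[OF a] sq_comm[OF a] in \<open>auto simp: Cs pss\<close>)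
    then show ?thesis
      using psS sq_facts[OF a] by (simp add: sheaf_cat_Arr tr_def)
  qed
  define F where "F = \<lparr>FDom = ?S, FCod = ?H, FO = restrict ps (Arr SetCat), FA = restrict tr (Arr ?S)\<rparr>"
  have F: "functor_from_to F ?S ?H"
  proof (rule functorI[OF S H])
    fix x assume "x \<in> Obj ?S"
    then show "FA F (Idn ?S x) = Idn ?H (FO F x)"
      using cat_simps(3)[OF S, of x]
      by (auto simp: F_def tr_def sheaf_cat_Idn arrow_cat_Idn arrow_cat_Dom_sq arrow_cat_Cod_sq Cs pss restrict_def fun_eq_iff)
  next
    fix f g assume "f \<in> Arr ?S" "g \<in> Arr ?S" "Cod ?S f = Dom ?S g"
    then show "FA F (Cmp ?S g f) = Cmp ?H (FA F g) (FA F f)"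
      using cat_simps(6)[OF S, of f g]
      by (auto simp: F_def tr_def sheaf_cat_Cmp arrow_cat_Cmp arrow_cat_Dom_sq arrow_cat_Cod_sq Cs pss restrict_def fun_eq_iff)
  qed (simp_all add: F_def trA psS sheaf_cat_Obj sq_facts, simp_all add: tr_def sheaf_cat_Dom sheaf_cat_Cod)
  have inj: "m = n'" if "ps m = ps n'" for m n'
    using arg_cong[OF that, of "\<lambda>P. FA P n"] by (simp add: pss)
  \<comment> \<open>A presheaf is recovered from its restriction map at \<open>n\<close>, the only
    one that is not an identity.\<close>
  have ps_surj: "ps (FA P n) = P" "FA P n \<in> Arr SetCat" if P: "is_sheaf C ?J P" for P
  proof -
    note FP = sheaf_functor[OF P]
    note [simp] = functor_simps[OF FP] Cs
    show A: "FA P n \<in> Arr SetCat" by simp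
    have i: "FA P z = Idn SetCat (FO P z)" "FA P w = Idn SetCat (FO P w)"
      using FA_Idn[OF FP, of z] FA_Idn[OF FP, of w] by simp_all
    show "ps (FA P n) = P"
      by (rule functor_eqI[OF psF[OF A] FP]) (auto simp: pss i)
  qed
  have "equivalence_functor F"
  proof (rule bijective_functor_equivalence[OF F])
    show "bij_betw (FO F) (Obj ?S) (Obj ?H)"
      by (rule bij_betw_byWitness[where f' = "\<lambda>P. FA P n"])
        (auto simp: F_def pss sheaf_cat_Obj ps_surj psS)
    have "inj_on (FA F) (Arr ?S)"
    proof (rule inj_onI)
      fix a b assume a: "a \<in> Arr ?S" and b: "b \<in> Arr ?S" and "FA F a = FA F b"
      then have e: "tr a = tr b" by (simp add: F_def)
      have "TMap (tr a) z = TMap (tr b) z" "TMap (tr a) w = TMap (tr b) w"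
        "TDom (tr a) = TDom (tr b)" "TCod (tr a) = TCod (tr b)" by (simp_all only: e)
      then show "a = b"
        by (intro arrow_cat_eqI[OF a b]) (auto simp: tr_def dest: inj)
    qed
    moreover have "FA F ` Arr ?S = Arr ?H"
    proof
      show "FA F ` Arr ?S \<subseteq> Arr ?H" using trA by (auto simp: F_def)
      show "Arr ?H \<subseteq> FA F ` Arr ?S"
      proof
        fix t assume "t \<in> Arr ?H"
        then have sh: "is_sheaf C ?J (TDom t)" "is_sheaf C ?J (TCod t)"
          and nt: "ntrans (op_cat C) SetCat (TDom t) (TCod t) (TMap t)" by (simp_all add: sheaf_cat_Arr)
        note [simp] = functor_simps[OF ntrans_dom[OF nt]] functor_simps[OF ntrans_cod[OF nt]] ntrans_simps[OF nt] Cs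
        define a where "a = sq (FA (TDom t) n) (FA (TCod t) n) (TMap t z) (TMap t w)"
        have a: "a \<in> Arr ?S"
          using ntrans_sq[OF nt, of n] by (simp add: a_def arrow_cat_sq_Arr mem_homset)
        have "TMap (tr a) = TMap t"
          using ntrans_ext[OF nt] by (intro extensionalityI[of _ "{z, w}"]) (auto simp: tr_def a_def)
        then have "tr a = t"
          by (intro trans.equality) (simp_all, simp_all add: tr_def a_def arrow_cat_Dom_sq arrow_cat_Cod_sq ps_surj sh)
        then show "t \<in> FA F ` Arr ?S" using a by (auto simp: F_def intro!: image_eqI[of _ _ a])
      qed
    qed
    ultimately show "bij_betw (FA F) (Arr ?S) (Arr ?H)" by (simp add: bij_betw_def)
  qed
  then have "equivalent_categories ?S ?H" using F by (auto simp: equivalent_categories_def)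
  moreover have "small_site C ?J"
    using C grothendieck_topology_trivial[OF C] by (simp add: small_site_def small_category_def Cs small_finite)
  ultimately show ?thesis
    using S unfolding grothendieck_topos_def by blast
qed

section \<open>Functors of points that are discrete opfibrations\<close>

text \<open>The geometric morphism goes from \<open>X\<close> to \<open>E\<close>; the arguments are
  ordered as for its inverse image \<open>F\<close>.\<close>

definition geo :: "('u::universe large, 'u large) category \<Rightarrow> ('u large, 'u large) category \<Rightarrow>
    ('u large, 'u large, 'u large, 'u large) func \<Rightarrow> bool" where
  "geo E X F \<longleftrightarrow> grothendieck_topos E \<and> grothendieck_topos X \<and> inverse_image E X F"

lemma geo_functor: "geo E X F \<Longrightarrow> functor_from_to F E X"
  and geo_left_exact: "geo E X F \<Longrightarrow> left_exact F"
  and geo_dom: "geo E X F \<Longrightarrow> grothendieck_topos E" and geo_cod: "geo E X F \<Longrightarrow> grothendieck_topos X"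
  and geo_inverse_image: "geo E X F \<Longrightarrow> inverse_image E X F"
  by (simp_all add: geo_def inverse_image_def)

lemma geo_cmp: "geo E F P \<Longrightarrow> geo F X Q \<Longrightarrow> geo E X (cmp_func Q P)"
  by (auto simp: geo_def inverse_image_cmp)

text \<open>\<open>discof E F P\<close> says that the geometric morphism from \<open>F\<close> to \<open>E\<close> with inverse image \<open>P\<close> induces a
  discrete opfibration on points, points being represented by their inverse images: the functor
  on points is faithful, commuting triangles can be lifted, and so can arrows (up to isomorphism).\<close>

definition discof :: "('u::universe large, 'u large) category \<Rightarrow> ('u large, 'u large) category \<Rightarrow>
    ('u large, 'u large, 'u large, 'u large) func \<Rightarrow> bool" where
  "discof E F P \<longleftrightarrow>
    (\<forall>a b s t. geo F SetCat a \<longrightarrow> geo F SetCat b \<longrightarrow> ntrans F SetCat a b s \<longrightarrow> ntrans F SetCat a b t \<longrightarrow>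
      (\<forall>D\<in>Obj E. s (FO P D) = t (FO P D)) \<longrightarrow> s = t) \<and>
    (\<forall>a b c k h g. geo F SetCat a \<longrightarrow> geo F SetCat b \<longrightarrow> geo F SetCat c \<longrightarrow>
      ntrans F SetCat a b k \<longrightarrow> ntrans F SetCat a c h \<longrightarrow>
      ntrans E SetCat (cmp_func b P) (cmp_func c P) g \<longrightarrow>
      (\<forall>D\<in>Obj E. Cmp SetCat (g D) (k (FO P D)) = h (FO P D)) \<longrightarrow>
      (\<exists>x. ntrans F SetCat b c x \<and> (\<forall>D\<in>Obj E. x (FO P D) = g D))) \<and>
    (\<forall>a y f. geo F SetCat a \<longrightarrow> geo E SetCat y \<longrightarrow> ntrans E SetCat (cmp_func a P) y f \<longrightarrow>
      (\<exists>b k s. geo F SetCat b \<and> ntrans F SetCat a b k \<and> ntiso E SetCat (cmp_func b P) y s \<and>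
        (\<forall>D\<in>Obj E. Cmp SetCat (s D) (k (FO P D)) = f D)))"

lemma discof_faithful:
  "discof E F P \<Longrightarrow> geo F SetCat a \<Longrightarrow> geo F SetCat b \<Longrightarrow> ntrans F SetCat a b s \<Longrightarrow> ntrans F SetCat a b t \<Longrightarrow>
      (\<And>D. D \<in> Obj E \<Longrightarrow> s (FO P D) = t (FO P D)) \<Longrightarrow> s = t"
  unfolding discof_def by blast

lemma discof_triangle:
  assumes "discof E F P" "geo F SetCat a" "geo F SetCat b" "geo F SetCat c"
    "ntrans F SetCat a b k" "ntrans F SetCat a c h" "ntrans E SetCat (cmp_func b P) (cmp_func c P) g"
    "\<And>D. D \<in> Obj E \<Longrightarrow> Cmp SetCat (g D) (k (FO P D)) = h (FO P D)"
  obtains x where "ntrans F SetCat b c x" "\<forall>D\<in>Obj E. x (FO P D) = g D"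
  using assms unfolding discof_def by metis

lemma discof_lift:
  assumes "discof E F P" "geo F SetCat a" "geo E SetCat y" "ntrans E SetCat (cmp_func a P) y f"
  obtains b k s where "geo F SetCat b" "ntrans F SetCat a b k" "ntiso E SetCat (cmp_func b P) y s"
    "\<forall>D\<in>Obj E. Cmp SetCat (s D) (k (FO P D)) = f D"
  using assms unfolding discof_def by metis

section \<open>Points of slices\<close>

definition point_map :: "'u large \<Rightarrow> 'u \<Rightarrow> 'u large" where
  "point_map X a = smap one_set X (\<lambda>_. a)"

lemma point_map:
  assumes "X \<in> Obj SetCat" "a \<in> elts X"
  shows "point_map X a \<in> Arr SetCat" "Dom SetCat (point_map X a) = one_set" "Cod SetCat (point_map X a) = X"
    "app (point_map X a) undefined = a"
  using assms by (simp_all add: point_map_def smap_Arr smap_Dom smap_Cod one_set_Obj app_smap)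
    (simp add: one_set_def app_smap)

lemma undefined_one_set: "undefined \<in> elts one_set" "t \<in> elts one_set \<Longrightarrow> t = undefined"
  by (simp_all add: one_set_def)

text \<open>Arrows from a one-element set are elements, so the universal property tested on
  \<open>one_set\<close> becomes a statement about elements.\<close>

lemma univ_span_elts:
  assumes u: "univ_span SetCat A B R (P, p, q)" and a: "a \<in> elts A" and b: "b \<in> elts B"
    and r: "R (point_map A a) (point_map B b)"
  shows "\<exists>!t. t \<in> elts P \<and> app p t = a \<and> app q t = b"
proof -
  note T = category_SetCat
  note p = univ_span_fst[OF u] and q = univ_span_snd[OF u] and P = univ_span_Obj[OF u]
  have AB: "A \<in> Obj SetCat" "B \<in> Obj SetCat" using p q cat_simps(2)[OF T] by metis+
  note [simp] = p q P AB cat_simps[OF T] point_map[OF AB(1) a] point_map[OF AB(2) b]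
  obtain h where h [simp]: "h \<in> Arr SetCat" "Dom SetCat h = one_set" "Cod SetCat h = P"
    and ph: "Cmp SetCat p h = point_map A a" "Cmp SetCat q h = point_map B b"
    by (rule univ_span_ex[OF u T, of "point_map A a" "point_map B b" one_set]) (simp_all add: r)
  show ?thesis
  proof (rule ex1I[of _ "app h undefined"])
    show "app h undefined \<in> elts P \<and> app p (app h undefined) = a \<and> app q (app h undefined) = b"
      using app_in[of h undefined] ph[THEN arg_cong[of _ _ "\<lambda>m. app m undefined"]]
      by (simp add: app_Cmp undefined_one_set(1))
    fix t assume t: "t \<in> elts P \<and> app p t = a \<and> app q t = b"
    then have [simp]: "point_map P t \<in> Arr SetCat" "Dom SetCat (point_map P t) = one_set"
      "Cod SetCat (point_map P t) = P" "app (point_map P t) undefined = t"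
      by (simp_all add: point_map)
    have "Cmp SetCat p (point_map P t) = point_map A a"
    proof (rule SetCat_eqI)
      fix v assume "v \<in> elts (Dom SetCat (Cmp SetCat p (point_map P t)))"
      then have "v = undefined" by (simp add: undefined_one_set(2))
      then show "app (Cmp SetCat p (point_map P t)) v = app (point_map A a) v"
        using t by (simp add: app_Cmp undefined_one_set(1))
    qed simp_all
    moreover have "Cmp SetCat q (point_map P t) = point_map B b"
    proof (rule SetCat_eqI)
      fix v assume "v \<in> elts (Dom SetCat (Cmp SetCat q (point_map P t)))"
      then have "v = undefined" by (simp add: undefined_one_set(2))
      then show "app (Cmp SetCat q (point_map P t)) v = app (point_map B b) v"
        using t by (simp add: app_Cmp undefined_one_set(1))
    qed simp_all
    ultimately have "point_map P t = h"
      by - (rule univ_span_unique[OF u T], simp_all add: ph r)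
    then show "t = app h undefined" using t by (metis P point_map(4))
  qed
qed

lemma product_elts:
  assumes "is_product SetCat A B (P, p, q)" "a \<in> elts A" "b \<in> elts B"
  shows "\<exists>!t. t \<in> elts P \<and> app p t = a \<and> app q t = b"
  by (rule univ_span_elts[OF assms(1)[unfolded is_product_univ_span] assms(2,3)]) simp

lemma pullback_elts:
  assumes P: "is_pullback SetCat u v (P, p, q)" and u: "u \<in> Arr SetCat" and v: "v \<in> Arr SetCat"
    and uv: "Cod SetCat u = Cod SetCat v"
    and a: "a \<in> elts (Dom SetCat u)" and b: "b \<in> elts (Dom SetCat v)" and e: "app u a = app v b"
  shows "\<exists>!t. t \<in> elts P \<and> app p t = a \<and> app q t = b"
proof (rule univ_span_elts[OF P[unfolded is_pullback_univ_span] a b])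
  note [simp] = u v uv cat_simps[OF category_SetCat] point_map[OF Dom_Obj[OF category_SetCat u] a]
    point_map[OF Dom_Obj[OF category_SetCat v] b]
  show "Cmp SetCat u (point_map (Dom SetCat u) a) = Cmp SetCat v (point_map (Dom SetCat v) b)"
    by (rule SetCat_eqI) (auto simp: app_Cmp e dest!: undefined_one_set(2))
qed

lemma terminal_elts:
  assumes T: "terminal_obj SetCat T"
  shows "\<exists>!t. t \<in> elts T"
proof -
  have T': "T \<in> Obj SetCat" and "\<exists>!h. h \<in> homset SetCat one_set T"
    using T one_set_Obj by (auto simp: terminal_obj_def)
  then obtain h where h: "h \<in> Arr SetCat" "Dom SetCat h = one_set" "Cod SetCat h = T"
    and u: "\<forall>k. k \<in> Arr SetCat \<and> Dom SetCat k = one_set \<and> Cod SetCat k = T \<longrightarrow> k = h"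
    unfolding mem_homset by blast
  show ?thesis
  proof (rule ex1I[of _ "app h undefined"])
    show "app h undefined \<in> elts T" using app_in[of h undefined] h undefined_one_set(1) by simp
    fix t assume "t \<in> elts T"
    then show "t = app h undefined" using u point_map[OF T', of t] by metis
  qed
qed

section \<open>Slices and their finite limits\<close>

lemma
  shows slice_Obj: "y \<in> Obj (slice E A) \<longleftrightarrow> y \<in> Arr E \<and> Cod E y = A"
    and slice_Arr: "Tup y h \<in> Arr (slice E A) \<longleftrightarrow> y \<in> Arr E \<and> Cod E y = A \<and> h \<in> Arr E \<and> Cod E h = Dom E y"
    and slice_Dom: "Dom (slice E A) m = Cmp E (tfst m) (tsnd m)"
    and slice_Cod: "Cod (slice E A) m = tfst m"
    and slice_Idn: "Idn (slice E A) y = Tup y (Idn E (Dom E y))"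
    and slice_Cmp: "Cmp (slice E A) n m = Tup (tfst n) (Cmp E (tsnd n) (tsnd m))"
  by (auto simp: slice_def)

lemma
  assumes "m \<in> Arr (slice E A)"
  shows slice_tfst: "tfst m \<in> Arr E" "Cod E (tfst m) = A"
    and slice_tsnd: "tsnd m \<in> Arr E" "Cod E (tsnd m) = Dom E (tfst m)"
    and slice_Tup: "Tup (tfst m) (tsnd m) = m"
  using assms by (auto simp: slice_def)

lemmas slice_simps = slice_Obj slice_Arr slice_Dom slice_Cod slice_Idn slice_Cmp

text \<open>\<open>J\<close> with a terminal object adjoined. The new object is \<open>0\<close> and
  \<open>j\<close> becomes \<open>Suc j\<close>; \<open>Inl f\<close> codes an arrow of
  \<open>J\<close>, and \<open>Inr j\<close> the arrow from \<open>j\<close> to \<open>0\<close>,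
  with \<open>Inr 0\<close> the identity. \<open>sum_encode\<close> keeps arrows in
  \<open>nat\<close>, the type of shapes in \<open>left_exact\<close>.\<close>

definition cone_shape :: "(nat, nat) category \<Rightarrow> (nat, nat) category" where
  "cone_shape J = \<lparr>Obj = insert 0 (Suc ` Obj J),
     Arr = sum_encode ` (Inl ` Arr J \<union> Inr ` insert 0 (Suc ` Obj J)),
     Dom = (\<lambda>a. case sum_decode a of Inl f \<Rightarrow> Suc (Dom J f) | Inr j \<Rightarrow> j),
     Cod = (\<lambda>a. case sum_decode a of Inl f \<Rightarrow> Suc (Cod J f) | Inr j \<Rightarrow> 0),
     Idn = (\<lambda>j. case j of 0 \<Rightarrow> sum_encode (Inr 0) | Suc i \<Rightarrow> sum_encode (Inl (Idn J i))),
     Cmp = (\<lambda>g f. case sum_decode g of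
        Inl g' \<Rightarrow> (case sum_decode f of Inl f' \<Rightarrow> sum_encode (Inl (Cmp J g' f')) | Inr _ \<Rightarrow> undefined)
      | Inr _ \<Rightarrow> sum_encode (Inr (case sum_decode f of Inl f' \<Rightarrow> Suc (Dom J f') | Inr j \<Rightarrow> j)))\<rparr>"

lemma cone_shape_Arr_cases:
  assumes "a \<in> Arr (cone_shape J)"
  obtains f where "f \<in> Arr J" "a = sum_encode (Inl f)" | "a = sum_encode (Inr 0)"
    | j where "j \<in> Obj J" "a = sum_encode (Inr (Suc j))"
  using assms by (auto simp: cone_shape_def)

lemma cone_shape_Arr: "f \<in> Arr J \<Longrightarrow> sum_encode (Inl f) \<in> Arr (cone_shape J)"
  "j \<in> Obj J \<Longrightarrow> sum_encode (Inr (Suc j)) \<in> Arr (cone_shape J)" "sum_encode (Inr 0) \<in> Arr (cone_shape J)"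
  by (auto simp: cone_shape_def)

lemma cone_shape_simps:
  "Obj (cone_shape J) = insert 0 (Suc ` Obj J)"
  "Dom (cone_shape J) (sum_encode (Inl f)) = Suc (Dom J f)" "Dom (cone_shape J) (sum_encode (Inr j)) = j"
  "Cod (cone_shape J) (sum_encode (Inl f)) = Suc (Cod J f)" "Cod (cone_shape J) (sum_encode (Inr j)) = 0"
  "Idn (cone_shape J) 0 = sum_encode (Inr 0)" "Idn (cone_shape J) (Suc i) = sum_encode (Inl (Idn J i))"
  "Cmp (cone_shape J) (sum_encode (Inl g)) (sum_encode (Inl f)) = sum_encode (Inl (Cmp J g f))"
  "Cmp (cone_shape J) (sum_encode (Inr i)) (sum_encode (Inl f)) = sum_encode (Inr (Suc (Dom J f)))"
  "Cmp (cone_shape J) (sum_encode (Inr i)) (sum_encode (Inr j)) = sum_encode (Inr j)"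
  by (simp_all add: cone_shape_def)

lemma category_cone_shape:
  assumes J: "category J"
  shows "category (cone_shape J)"
proof -
  note [simp] = cat_simps[OF J] cone_shape_Arr cone_shape_simps
  show ?thesis
    unfolding category_def mem_homset
  proof (intro conjI ballI impI)
    fix f g h assume "f \<in> Arr (cone_shape J)" "g \<in> Arr (cone_shape J)" "h \<in> Arr (cone_shape J)"
      "Cod (cone_shape J) f = Dom (cone_shape J) g" "Cod (cone_shape J) g = Dom (cone_shape J) h"
    then show "Cmp (cone_shape J) h (Cmp (cone_shape J) g f) = Cmp (cone_shape J) (Cmp (cone_shape J) h g) f"
      by (elim cone_shape_Arr_cases) simp_all
  next
    fix f g assume fg: "f \<in> Arr (cone_shape J)" "g \<in> Arr (cone_shape J)" "Cod (cone_shape J) f = Dom (cone_shape J) g"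
    then show "Cmp (cone_shape J) g f \<in> Arr (cone_shape J)"
      "Dom (cone_shape J) (Cmp (cone_shape J) g f) = Dom (cone_shape J) f"
      "Cod (cone_shape J) (Cmp (cone_shape J) g f) = Cod (cone_shape J) g"
      by (elim cone_shape_Arr_cases; simp)+
  next
    fix f assume "f \<in> Arr (cone_shape J)"
    then show "Dom (cone_shape J) f \<in> Obj (cone_shape J)" "Cod (cone_shape J) f \<in> Obj (cone_shape J)"
      "Cmp (cone_shape J) f (Idn (cone_shape J) (Dom (cone_shape J) f)) = f"
      "Cmp (cone_shape J) (Idn (cone_shape J) (Cod (cone_shape J) f)) f = f"
      by (elim cone_shape_Arr_cases; simp)+
  qed auto
qed

text \<open>A limit in a slice is a limit of a diagram with one more object, the base.\<close>

definition slice_diagram :: "('u large, 'u large) category \<Rightarrow> 'u large \<Rightarrow> (nat, nat, 'u large, 'u large) func \<Rightarrow>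
    (nat, nat, 'u large, 'u large) func" where
  "slice_diagram E A D = \<lparr>FDom = cone_shape (FDom D), FCod = E,
     FO = (\<lambda>i\<in>Obj (cone_shape (FDom D)). case i of 0 \<Rightarrow> A | Suc j \<Rightarrow> Dom E (FO D j)),
     FA = (\<lambda>a\<in>Arr (cone_shape (FDom D)). case sum_decode a of Inl f \<Rightarrow> tsnd (FA D f)
        | Inr i \<Rightarrow> (case i of 0 \<Rightarrow> Idn E A | Suc j \<Rightarrow> FO D j))\<rparr>"

lemma
  assumes E: "category E" and A: "A \<in> Obj E" and D: "functor_from_to D J (slice E A)"
  shows functor_slice_diagram: "functor_from_to (slice_diagram E A D) (cone_shape J) E"
    and is_limit_slice_diagram: "is_limit D L l \<Longrightarrow>
      is_limit (slice_diagram E A D) (Dom E L) (\<lambda>i. case i of 0 \<Rightarrow> L | Suc j \<Rightarrow> tsnd (l j))"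
proof -
  let ?S = "slice E A" and ?D = "slice_diagram E A D" and ?J = "cone_shape J"
  note J = functor_category_dom[OF D] and S = functor_category_cod[OF D]
  note [simp] = cat_simps[OF E] cat_simps[OF J] cone_shape_Arr cone_shape_simps A
  have DO [simp]: "FO D j \<in> Arr E" "Cod E (FO D j) = A" if "j \<in> Obj J" for j
    using FO_Obj[OF D that] by (simp_all add: slice_Obj)
  have DA: "FA D f \<in> Arr ?S" "tfst (FA D f) = FO D (Cod J f)" "Cmp E (FO D (Cod J f)) (tsnd (FA D f)) = FO D (Dom J f)"
    if "f \<in> Arr J" for f
    using functor_simps(4-6)[OF D that] by (simp_all add: slice_Cod slice_Dom)
  have DA' [simp]: "tsnd (FA D f) \<in> Arr E" "Cod E (tsnd (FA D f)) = Dom E (FO D (Cod J f))"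
    if "f \<in> Arr J" for f
    using slice_tsnd[OF DA(1)[OF that]] DA(2)[OF that] by simp_all
  have DA'' [simp]: "Dom E (tsnd (FA D f)) = Dom E (FO D (Dom J f))" if "f \<in> Arr J" for f
    using arg_cong[OF DA(3)[OF that], of "Dom E"] that by simp
  have Ds [simp]: "FO ?D 0 = A" "j \<in> Obj J \<Longrightarrow> FO ?D (Suc j) = Dom E (FO D j)"
    "FA ?D (sum_encode (Inr 0)) = Idn E A" "j \<in> Obj J \<Longrightarrow> FA ?D (sum_encode (Inr (Suc j))) = FO D j"
    "f \<in> Arr J \<Longrightarrow> FA ?D (sum_encode (Inl f)) = tsnd (FA D f)" for j f
    by (simp_all add: slice_diagram_def FDom_eq[OF D])
  show F: "functor_from_to ?D ?J E"
  proof (rule functorI[OF category_cone_shape[OF J] E])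
    fix f g assume "f \<in> Arr ?J" "g \<in> Arr ?J" "Cod ?J f = Dom ?J g"
    then show "FA ?D (Cmp ?J g f) = Cmp E (FA ?D g) (FA ?D f)"
      by (elim cone_shape_Arr_cases) (simp_all add: FA_Cmp[OF D] slice_Cmp DA)
  next
    fix f assume "f \<in> Arr ?J"
    then show "FA ?D f \<in> Arr E" "Dom E (FA ?D f) = FO ?D (Dom ?J f)" "Cod E (FA ?D f) = FO ?D (Cod ?J f)"
      by (elim cone_shape_Arr_cases; simp)+
  next
    fix x assume "x \<in> Obj ?J" then show "FA ?D (Idn ?J x) = Idn E (FO ?D x)"
      by (auto simp: FA_Idn[OF D] slice_Idn)
  qed (simp_all add: slice_diagram_def FDom_eq[OF D] del: cone_shape_simps(1), auto)
  assume L: "is_limit D L l"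
  \<comment> \<open>The component at \<open>0\<close> is an arrow to the base, and the arrows into
    \<open>0\<close> say that the other components lie over it. So this is a cone in the slice with
    vertex \<open>x 0\<close>.\<close>
  have cone: "is_cone ?D X x \<longleftrightarrow> X \<in> Obj E \<and> x 0 \<in> homset E X A \<and>
      (\<forall>j\<in>Obj J. x (Suc j) \<in> homset E X (Dom E (FO D j)) \<and> Cmp E (FO D j) (x (Suc j)) = x 0) \<and>
      (\<forall>f\<in>Arr J. Cmp E (tsnd (FA D f)) (x (Suc (Dom J f))) = x (Suc (Cod J f)))" for X x
  proof -
    have "(\<forall>u\<in>Arr ?J. Cmp E (FA ?D u) (x (Dom ?J u)) = x (Cod ?J u)) \<longleftrightarrow>
      Cmp E (Idn E A) (x 0) = x 0 \<and> (\<forall>j\<in>Obj J. Cmp E (FO D j) (x (Suc j)) = x 0) \<and>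
      (\<forall>f\<in>Arr J. Cmp E (tsnd (FA D f)) (x (Suc (Dom J f))) = x (Suc (Cod J f)))" (is "?a \<longleftrightarrow> ?b")
    proof
      assume a: ?a
      show ?b
      proof (intro conjI ballI)
        show "Cmp E (Idn E A) (x 0) = x 0"
          using bspec[OF a, of "sum_encode (Inr 0)"] by simp
        show "Cmp E (FO D j) (x (Suc j)) = x 0" if "j \<in> Obj J" for j
          using bspec[OF a, of "sum_encode (Inr (Suc j))"] that by simp
        show "Cmp E (tsnd (FA D f)) (x (Suc (Dom J f))) = x (Suc (Cod J f))" if "f \<in> Arr J" for f
          using bspec[OF a, of "sum_encode (Inl f)"] that by simp
      qed
    next
      assume ?b
      then show ?a by (auto elim!: cone_shape_Arr_cases)
    qed
    then show ?thesis
      unfolding is_cone_iff[OF F] by (auto simp: mem_homset)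
  qed
  have l: "is_cone D L l" by (rule is_limit_cone[OF L])
  have L' [simp]: "L \<in> Arr E" "Cod E L = A" using l by (simp_all add: is_cone_iff[OF D] slice_Obj)
  have l0: "l j \<in> Arr ?S" "Dom ?S (l j) = L" "Cod ?S (l j) = FO D j" if "j \<in> Obj J" for j
    using l that by (simp_all add: is_cone_iff[OF D])
  have l1: "l j \<in> Arr ?S" "tfst (l j) = FO D j" "Cmp E (FO D j) (tsnd (l j)) = L" if "j \<in> Obj J" for j
  proof -
    show "l j \<in> Arr ?S" by (rule l0[OF that])
    show f: "tfst (l j) = FO D j" using l0(3)[OF that] by (simp only: slice_Cod)
    show "Cmp E (FO D j) (tsnd (l j)) = L" using l0(2)[OF that] by (simp only: slice_Dom f)
  qed
  have l2 [simp]: "tsnd (l j) \<in> Arr E" "Cod E (tsnd (l j)) = Dom E (FO D j)" if "j \<in> Obj J" for j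
    using slice_tsnd[OF l1(1)[OF that]] l1(2)[OF that] by simp_all
  have l3 [simp]: "Dom E (tsnd (l j)) = Dom E L" if "j \<in> Obj J" for j
    using arg_cong[OF l1(3)[OF that], of "Dom E"] that by simp
  have l4: "Cmp E (tsnd (FA D f)) (tsnd (l (Dom J f))) = tsnd (l (Cod J f))" if "f \<in> Arr J" for f
  proof -
    have "Cmp ?S (FA D f) (l (Dom J f)) = l (Cod J f)" using l that by (simp add: is_cone_iff[OF D])
    from arg_cong[OF this, of tsnd] show ?thesis by (simp add: slice_Cmp)
  qed
  show "is_limit ?D (Dom E L) (\<lambda>i. case i of 0 \<Rightarrow> L | Suc j \<Rightarrow> tsnd (l j))"
  proof (rule is_limitI[OF F])
    show "is_cone ?D (Dom E L) (\<lambda>i. case i of 0 \<Rightarrow> L | Suc j \<Rightarrow> tsnd (l j))"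
      unfolding cone by (simp add: mem_homset l1 l4)
  next
    fix X x assume x: "is_cone ?D X x"
    then have x1 [simp]: "X \<in> Obj E" "x 0 \<in> Arr E" "Dom E (x 0) = X" "Cod E (x 0) = A"
      "j \<in> Obj J \<Longrightarrow> x (Suc j) \<in> Arr E" "j \<in> Obj J \<Longrightarrow> Dom E (x (Suc j)) = X"
      "j \<in> Obj J \<Longrightarrow> Cod E (x (Suc j)) = Dom E (FO D j)"
      and x2: "j \<in> Obj J \<Longrightarrow> Cmp E (FO D j) (x (Suc j)) = x 0"
      and x3: "f \<in> Arr J \<Longrightarrow> Cmp E (tsnd (FA D f)) (x (Suc (Dom J f))) = x (Suc (Cod J f))" for j f
      unfolding cone mem_homset by blast+
    have "is_cone D (x 0) (\<lambda>j. Tup (FO D j) (x (Suc j)))"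
      unfolding is_cone_iff[OF D] by (simp add: slice_simps x2 x3 DA)
    then obtain h where h: "h \<in> Arr ?S" "Dom ?S h = x 0" "Cod ?S h = L"
      and hx: "\<forall>i\<in>Obj J. Cmp ?S (l i) h = Tup (FO D i) (x (Suc i))"
      by (rule limit_ex[OF D L])
    have h' [simp]: "tsnd h \<in> Arr E" "Cod E (tsnd h) = Dom E L" and h0: "Cmp E L (tsnd h) = x 0"
      using slice_tsnd[OF h(1)] h by (simp_all add: slice_Cod slice_Dom)
    have "Dom E (tsnd h) = X"
      using arg_cong[OF h0, of "Dom E"] by simp
    moreover have "Cmp E (tsnd (l j)) (tsnd h) = x (Suc j)" if "j \<in> Obj J" for j
      using hx that by (simp add: slice_Cmp)
    ultimately show "\<exists>h. h \<in> Arr E \<and> Dom E h = X \<and> Cod E h = Dom E L \<and>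
        (\<forall>i\<in>Obj ?J. Cmp E (case i of 0 \<Rightarrow> L | Suc j \<Rightarrow> tsnd (l j)) h = x i)"
      by (intro exI[of _ "tsnd h"]) (auto simp: h0)
  next
    fix h k assume h: "h \<in> Arr E" "k \<in> Arr E" "Dom E k = Dom E h" "Cod E h = Dom E L" "Cod E k = Dom E L"
      and e: "\<And>i. i \<in> Obj ?J \<Longrightarrow> Cmp E (case i of 0 \<Rightarrow> L | Suc j \<Rightarrow> tsnd (l j)) h =
        Cmp E (case i of 0 \<Rightarrow> L | Suc j \<Rightarrow> tsnd (l j)) k"
    have e0: "Cmp E L h = Cmp E L k" using e[of 0] by simp
    have "Tup L h = Tup L k"
    proof (rule limit_unique[OF D L])
      show "Cmp ?S (l i) (Tup L h) = Cmp ?S (l i) (Tup L k)" if "i \<in> Obj J" for i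
        using e[of "Suc i"] that by (simp add: slice_Cmp)
    qed (use h in \<open>simp_all add: slice_simps e0\<close>)
    then show "h = k" by simp
  qed
qed

lemma finite_cone_shape: "finite (Obj J) \<Longrightarrow> finite (Arr J) \<Longrightarrow> finite (Obj (cone_shape J)) \<and> finite (Arr (cone_shape J))"
  by (simp add: cone_shape_def)

text \<open>The point of \<open>slice E A\<close> given by a point \<open>Z\<close> of \<open>E\<close> and an element \<open>s\<close> of \<open>Z\<close> at \<open>A\<close>.\<close>

definition fiber_point :: "('u::universe large, 'u large) category \<Rightarrow> 'u large \<Rightarrow> ('u large, 'u large, 'u large, 'u large) func \<Rightarrow>
    'u \<Rightarrow> ('u large, 'u large, 'u large, 'u large) func" where
  "fiber_point E A Z s = (let ob = (\<lambda>y. Sub {t \<in> elts (FO Z (Dom E y)). app (FA Z y) t = s})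
   in \<lparr>FDom = slice E A, FCod = SetCat, FO = restrict ob (Obj (slice E A)),
     FA = (\<lambda>m\<in>Arr (slice E A). smap (ob (Dom (slice E A) m)) (ob (tfst m)) (app (FA Z (tsnd m))))\<rparr>)"

lemma fiber_point_FO: "y \<in> Obj (slice E A) \<Longrightarrow>
    FO (fiber_point E A Z s) y = Sub {t \<in> elts (FO Z (Dom E y)). app (FA Z y) t = s}"
  by (simp add: fiber_point_def Let_def)

context
  fixes E :: "('u::universe large, 'u large) category" and A s and Z :: "('u large, 'u large, 'u large, 'u large) func"
  assumes Z: "functor_from_to Z E SetCat" and S: "category (slice E A)" and A: "A \<in> Obj E"
    and s: "s \<in> elts (FO Z A)"
begin

lemma functor_fiber_point: "functor_from_to (fiber_point E A Z s) (slice E A) SetCat"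
  and fiber_point_app: "m \<in> Arr (slice E A) \<Longrightarrow> t \<in> elts (FO (fiber_point E A Z s) (Dom (slice E A) m)) \<Longrightarrow>
    app (FA (fiber_point E A Z s) m) t = app (FA Z (tsnd m)) t"
proof -
  let ?W = "fiber_point E A Z s" and ?S = "slice E A"
  note E = functor_category_dom[OF Z]
  note [simp] = cat_simps[OF E] functor_simps[OF Z] cat_simps[OF category_SetCat]
  have FO: "FO ?W y = Sub {t \<in> elts (FO Z (Dom E y)). app (FA Z y) t = s}" if "y \<in> Arr E" "Cod E y = A" for y
    using that by (simp add: fiber_point_FO slice_Obj)
  have ob [simp]: "FO ?W y \<in> Obj SetCat" if "y \<in> Arr E" "Cod E y = A" for y
    using FO_Obj[OF Z, of "Dom E y"] that by (auto simp: FO SetCat_Obj intro: small_subset)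
  have FA: "FA ?W m = smap (FO ?W (Dom ?S m)) (FO ?W (tfst m)) (app (FA Z (tsnd m)))" if m: "m \<in> Arr ?S" for m
    using m fiber_point_FO[OF Dom_Obj[OF S m]] fiber_point_FO[OF Cod_Obj[OF S m]]
    by (simp add: fiber_point_def Let_def slice_Cod)
  have in_W: "app (FA Z (tsnd m)) t \<in> elts (FO ?W (tfst m))" if m: "m \<in> Arr ?S" and t: "t \<in> elts (FO ?W (Dom ?S m))" for m t
  proof -
    note [simp] = slice_tfst[OF m] slice_tsnd[OF m]
    have "t \<in> elts (FO Z (Dom E (tsnd m)))" "app (FA Z (Cmp E (tfst m) (tsnd m))) t = s"
      using t by (simp_all add: slice_Dom FO del: FA_Cmp[OF Z])
    then show ?thesis
      using app_FA_in[OF Z, of "tsnd m" t] app_FA_Cmp[OF Z, of "tsnd m" "tfst m" t] by (simp add: FO del: FA_Cmp[OF Z])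
  qed
  show ap: "app (FA ?W m) t = app (FA Z (tsnd m)) t" if "m \<in> Arr ?S" "t \<in> elts (FO ?W (Dom ?S m))" for m t
    using that by (simp add: FA app_smap)
  have ob': "FO ?W (Dom ?S m) \<in> Obj SetCat" "FO ?W (tfst m) \<in> Obj SetCat" if m: "m \<in> Arr ?S" for m
    using Dom_Obj[OF S m] slice_tfst[OF m] by (simp_all add: slice_Obj)
  have ar: "FA ?W m \<in> Arr SetCat" "Dom SetCat (FA ?W m) = FO ?W (Dom ?S m)" "Cod SetCat (FA ?W m) = FO ?W (Cod ?S m)"
    if "m \<in> Arr ?S" for m
    using that ob'[OF that] in_W by (simp_all add: FA smap_Arr smap_Dom smap_Cod slice_Cod)
  show W: "functor_from_to ?W ?S SetCat"
  proof (rule functorI[OF S category_SetCat])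
    fix y assume y: "y \<in> Obj ?S"
    note [simp] = ar[OF Idn_Arr[OF S y]] Idn_Arr[OF S y] Dom_Idn[OF S y] Cod_Idn[OF S y]
    have y' [simp]: "y \<in> Arr E" "Cod E y = A" using y by (simp_all add: slice_Obj)
    show "FA ?W (Idn ?S y) = Idn SetCat (FO ?W y)"
    proof (rule SetCat_eqI)
      fix t assume "t \<in> elts (Dom SetCat (FA ?W (Idn ?S y)))"
      then have t: "t \<in> elts (FO ?W y)" by simp
      then have "app (FA ?W (Idn ?S y)) t = app (FA Z (Idn E (Dom E y))) t"
        using ap[OF Idn_Arr[OF S y], of t] arg_cong[OF slice_Idn[of E A y], of tsnd] by simp
      also have "\<dots> = t" using app_FA_Idn[OF Z, of "Dom E y" t] t by (simp add: FO)
      finally show "app (FA ?W (Idn ?S y)) t = app (Idn SetCat (FO ?W y)) t" using t by (simp add: app_Idn)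
    qed simp_all
  next
    fix f g assume f: "f \<in> Arr ?S" and g: "g \<in> Arr ?S" and fg: "Cod ?S f = Dom ?S g"
    note [simp] = ar[OF f] ar[OF g] f g fg ar[OF Cmp_Arr[OF S f g fg]] Cmp_Arr[OF S f g fg] Dom_Cmp[OF S f g fg]
      Cod_Cmp[OF S f g fg] slice_tsnd[OF f] slice_tsnd[OF g] slice_tfst[OF f] slice_tfst[OF g]
    show "FA ?W (Cmp ?S g f) = Cmp SetCat (FA ?W g) (FA ?W f)"
    proof (rule SetCat_eqI)
      fix t assume "t \<in> elts (Dom SetCat (FA ?W (Cmp ?S g f)))"
      then have t: "t \<in> elts (FO ?W (Dom ?S f))" by simp
      have fg': "tfst f = Cmp E (tfst g) (tsnd g)" using fg by (simp add: slice_Dom slice_Cod)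
      have c: "Cod E (tsnd f) = Dom E (tsnd g)" using fg' by simp
      have t': "t \<in> elts (FO Z (Dom E (tsnd f)))"
        using t by (simp add: slice_Dom FO)
      have "app (FA ?W f) t \<in> elts (FO ?W (Dom ?S g))"
        using app_in[OF ar(1)[OF f], of t] t by simp
      then have "app (FA ?W g) (app (FA ?W f) t) = app (FA Z (tsnd g)) (app (FA Z (tsnd f)) t)"
        using ap[OF g] ap[OF f t] by simp
      moreover have "app (FA ?W (Cmp ?S g f)) t = app (FA Z (Cmp E (tsnd g) (tsnd f))) t"
        using t ap[OF Cmp_Arr[OF S f g fg], of t] arg_cong[OF slice_Cmp[of E A g f], of tsnd] by simp
      ultimately show "app (FA ?W (Cmp ?S g f)) t = app (Cmp SetCat (FA ?W g) (FA ?W f)) t"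
        using t app_FA_Cmp[OF Z, of "tsnd f" "tsnd g" t] t' c by (simp add: app_Cmp)
    qed simp_all
  qed (use ob ar in \<open>simp_all add: slice_Obj\<close>, simp_all add: fiber_point_def Let_def)
qed

lemma fiber_point_elts: "y \<in> Arr E \<Longrightarrow> Cod E y = A \<Longrightarrow>
    t \<in> elts (FO (fiber_point E A Z s) y) \<longleftrightarrow> t \<in> elts (FO Z (Dom E y)) \<and> app (FA Z y) t = s"
  by (simp add: fiber_point_FO slice_Obj)

text \<open>A limit in the slice is a limit in \<open>E\<close> of the diagram with the base added,
  which \<open>Z\<close> preserves. The elements over \<open>s\<close> form the limit of the fibres,
  because a cone over the fibres extends by the constant \<open>s\<close> at the base.\<close>

lemma left_exact_fiber_point:
  assumes lZ: "left_exact Z"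
  shows "left_exact (fiber_point E A Z s)"
proof (rule left_exactI[OF functor_fiber_point])
  let ?W = "fiber_point E A Z s" and ?S = "slice E A"
  note E = functor_category_dom[OF Z] and W = functor_fiber_point
  fix J :: "(nat, nat) category" and D L l
  assume fJ: "finite (Obj J)" "finite (Arr J)" and D: "functor_from_to D J ?S" and L: "is_limit D L l"
  let ?D = "slice_diagram E A D"
  note J = functor_category_dom[OF D]
  note D' = functor_slice_diagram[OF E A D] and L' = is_limit_slice_diagram[OF E A D L]
  note ZD = functor_cmp[OF D' Z] and WD = functor_cmp[OF D W]
  note limZ = left_exactD[OF lZ Z D' finite_cone_shape[OF fJ, THEN conjunct1] finite_cone_shape[OF fJ, THEN conjunct2] L']
  note [simp] = cat_simps[OF E] functor_simps[OF Z] cat_simps[OF category_SetCat] cmp_func_simps functor_simps[OF D]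
    functor_simps[OF D'] functor_simps[OF W] cone_shape_simps cat_simps[OF J]
  have l: "is_cone D L l" by (rule is_limit_cone[OF L])
  have l0 [simp]: "L \<in> Obj ?S" "j \<in> Obj J \<Longrightarrow> l j \<in> Arr ?S" "j \<in> Obj J \<Longrightarrow> Dom ?S (l j) = L" "j \<in> Obj J \<Longrightarrow> Cod ?S (l j) = FO D j" for j
    using l by (simp_all add: is_cone_iff[OF D])
  then have L1 [simp]: "L \<in> Arr E" "Cod E L = A" by (simp_all add: slice_Obj)
  have D1 [simp]: "FO D j \<in> Arr E" "Cod E (FO D j) = A" if "j \<in> Obj J" for j
    using FO_Obj[OF D that] by (simp_all add: slice_Obj)
  have l1: "tfst (l j) = FO D j" if "j \<in> Obj J" for j
    using l0(4)[OF that] by (simp only: slice_Cod)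
  have l2 [simp]: "tsnd (l j) \<in> Arr E" "Cod E (tsnd (l j)) = Dom E (FO D j)" if "j \<in> Obj J" for j
    using slice_tsnd[OF l0(2)[OF that]] l1[OF that] by simp_all
  have l2' [simp]: "Dom E (tsnd (l j)) = Dom E L" if j: "j \<in> Obj J" for j
    using arg_cong[OF l0(3)[OF j], of "Dom E"] j by (simp add: slice_Dom l1)
  have Ds: "FO ?D 0 = A" "j \<in> Obj J \<Longrightarrow> FO ?D (Suc j) = Dom E (FO D j)"
    "FA ?D (sum_encode (Inr 0)) = Idn E A" "j \<in> Obj J \<Longrightarrow> FA ?D (sum_encode (Inr (Suc j))) = FO D j"
    "f \<in> Arr J \<Longrightarrow> FA ?D (sum_encode (Inl f)) = tsnd (FA D f)" for j f
    by (simp_all add: slice_diagram_def FDom_eq[OF D] cone_shape_Arr)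
  have dA: "tsnd (FA D u) \<in> Arr E" "Dom E (tsnd (FA D u)) = Dom E (FO D (Dom J u))"
    "Cod E (tsnd (FA D u)) = Dom E (FO D (Cod J u))" if "u \<in> Arr J" for u
    using functor_simps(4-6)[OF D', of "sum_encode (Inl u)"] that by (simp_all add: cone_shape_Arr Ds)
  show "is_limit (cmp_func ?W D) (FO ?W L) (\<lambda>j. FA ?W (l j))"
  proof (rule is_limitI[OF WD is_cone_FA[OF D W l]])
    fix X x assume x: "is_cone (cmp_func ?W D) X x"
    then have x' [simp]: "X \<in> Obj SetCat" "j \<in> Obj J \<Longrightarrow> x j \<in> Arr SetCat" "j \<in> Obj J \<Longrightarrow> Dom SetCat (x j) = X"
      "j \<in> Obj J \<Longrightarrow> Cod SetCat (x j) = FO ?W (FO D j)"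
      and xu: "u \<in> Arr J \<Longrightarrow> Cmp SetCat (FA ?W (FA D u)) (x (Dom J u)) = x (Cod J u)" for j u
      by (simp_all add: is_cone_iff[OF WD])
    have xin: "app (x j) v \<in> elts (FO Z (Dom E (FO D j)))" "app (FA Z (FO D j)) (app (x j) v) = s"
      "app (x j) v \<in> elts (FO ?W (FO D j))"
      if "j \<in> Obj J" "v \<in> elts X" for j v
      using app_in[OF x'(2)[OF that(1)], of v] that by (simp_all add: fiber_point_elts)
    \<comment> \<open>Elements of the fibres are regarded as elements of the values of
      \<open>Z\<close>. The constant component at the base is compatible because all fibres lie over
      \<open>s\<close>.\<close>
    define x1 where "x1 = (\<lambda>i. case i of 0 \<Rightarrow> smap X (FO Z A) (\<lambda>_. s)
      | Suc j \<Rightarrow> smap X (FO Z (Dom E (FO D j))) (app (x j)))"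
    have ZA: "FO Z A \<in> Obj SetCat" "j \<in> Obj J \<Longrightarrow> FO Z (Dom E (FO D j)) \<in> Obj SetCat" for j using A by simp_all
    have x1A: "x1 0 \<in> Arr SetCat" "Dom SetCat (x1 0) = X" "Cod SetCat (x1 0) = FO Z A"
      using s by (simp_all add: x1_def smap_Arr[OF x'(1) ZA(1)] smap_Dom[OF x'(1) ZA(1)] smap_Cod[OF x'(1) ZA(1)])
    have x1B: "x1 (Suc j) \<in> Arr SetCat" "Dom SetCat (x1 (Suc j)) = X" "Cod SetCat (x1 (Suc j)) = FO Z (Dom E (FO D j))"
      if "j \<in> Obj J" for j
      using that xin
      by (simp_all add: x1_def smap_Arr[OF x'(1) ZA(2)] smap_Dom[OF x'(1) ZA(2)] smap_Cod[OF x'(1) ZA(2)])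
    have x1t: "v \<in> elts X \<Longrightarrow> app (x1 0) v = s" "v \<in> elts X \<Longrightarrow> app (x1 (Suc j)) v = app (x j) v" for v j
      by (simp_all add: x1_def app_smap)
    have "is_cone (cmp_func Z ?D) X x1"
      unfolding is_cone_iff[OF ZD]
    proof (intro conjI ballI)
      fix u assume "u \<in> Arr (cone_shape J)"
      then show "Cmp SetCat (FA (cmp_func Z ?D) u) (x1 (Dom (cone_shape J) u)) = x1 (Cod (cone_shape J) u)"
      proof (cases rule: cone_shape_Arr_cases)
        case (1 f)
        note f = 1(1)
        note [simp] = dA[OF f] f
        have "app (FA Z (tsnd (FA D f))) (app (x (Dom J f)) v) = app (x (Cod J f)) v" if v: "v \<in> elts X" for v
          using arg_cong[OF xu[OF f], of "\<lambda>m. app m v"] v xin(3)[of "Dom J f" v]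
            fiber_point_app[OF FA_Arr[OF D f], of "app (x (Dom J f)) v"]
          by (simp add: app_Cmp)
        then show ?thesis unfolding 1
          by - (rule SetCat_eqI, simp_all add: cone_shape_Arr Ds x1B app_Cmp x1t)
      next
        case 2
        show ?thesis unfolding 2 using A x1A by (simp add: cone_shape_Arr Ds)
      next
        case (3 j)
        show ?thesis unfolding 3 using 3(1) A x1A
          by - (rule SetCat_eqI, simp_all add: cone_shape_Arr Ds x1B app_Cmp x1t xin)
      qed
    qed (auto simp: x1A x1B Ds)
    then obtain h where h [simp]: "h \<in> Arr SetCat" "Dom SetCat h = X" "Cod SetCat h = FO Z (Dom E L)"
      and hx: "\<forall>i\<in>Obj (cone_shape J). Cmp SetCat (FA Z (case i of 0 \<Rightarrow> L | Suc j \<Rightarrow> tsnd (l j))) h = x1 i"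
      by (rule limit_ex[OF ZD limZ])
    have hin: "app h v \<in> elts (FO ?W L)" if v: "v \<in> elts X" for v
    proof -
      have "Cmp SetCat (FA Z L) h = x1 0" using hx by simp
      from arg_cong[OF this, of "\<lambda>m. app m v"] show ?thesis
        using v app_in[of h v] by (simp add: app_Cmp x1t fiber_point_elts)
    qed
    have WL: "FO ?W L \<in> Obj SetCat" by simp
    define h' where "h' = smap X (FO ?W L) (app h)"
    have h' [simp]: "h' \<in> Arr SetCat" "Dom SetCat h' = X" "Cod SetCat h' = FO ?W L"
      using hin by (simp_all add: h'_def smap_Arr[OF x'(1) WL] smap_Dom[OF x'(1) WL] smap_Cod[OF x'(1) WL])
    have "Cmp SetCat (FA ?W (l j)) h' = x j" if j: "j \<in> Obj J" for j
    proof (rule SetCat_eqI)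
      fix v assume "v \<in> elts (Dom SetCat (Cmp SetCat (FA ?W (l j)) h'))"
      then have v: "v \<in> elts X" using j by simp
      have e: "Cmp SetCat (FA Z (tsnd (l j))) h = x1 (Suc j)"
        using bspec[OF hx, of "Suc j"] j by simp
      have "app (FA Z (tsnd (l j))) (app h v) = app (x j) v"
        using arg_cong[OF e, of "\<lambda>m. app m v"] v by (simp add: app_Cmp x1t)
      then show "app (Cmp SetCat (FA ?W (l j)) h') v = app (x j) v"
        using v j hin[OF v] fiber_point_app[OF l0(2)[OF j], of "app h v"] by (simp add: app_Cmp h'(2)) (simp add: h'_def app_smap)
    qed (use j in simp_all)
    then show "\<exists>h. h \<in> Arr SetCat \<and> Dom SetCat h = X \<and> Cod SetCat h = FO ?W L \<and> (\<forall>i\<in>Obj J. Cmp SetCat (FA ?W (l i)) h = x i)"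
      by (intro exI[of _ h']) simp
  next
    fix h k assume h: "h \<in> Arr SetCat" "k \<in> Arr SetCat" "Dom SetCat k = Dom SetCat h" "Cod SetCat h = FO ?W L" "Cod SetCat k = FO ?W L"
      and e: "\<And>i. i \<in> Obj J \<Longrightarrow> Cmp SetCat (FA ?W (l i)) h = Cmp SetCat (FA ?W (l i)) k"
    note [simp] = h
    define X where "X = Dom SetCat h"
    have X: "X \<in> Obj SetCat" by (simp add: X_def)
    have ZL: "FO Z (Dom E L) \<in> Obj SetCat" by simp
    have hin: "app h v \<in> elts (FO ?W L)" "app k v \<in> elts (FO ?W L)" if "v \<in> elts X" for v
      using that app_in[of h v] app_in[of k v] by (simp_all add: X_def)
    then have hin': "app h v \<in> elts (FO Z (Dom E L))" "app k v \<in> elts (FO Z (Dom E L))" "app (FA Z L) (app h v) = s" "app (FA Z L) (app k v) = s"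
      if "v \<in> elts X" for v using that by (simp_all add: fiber_point_elts)
    \<comment> \<open>Arrows into the fibre are compared after its inclusion into
      \<open>FO Z (Dom E L)\<close>, where the limit is available.\<close>
    let ?i = "\<lambda>h. smap X (FO Z (Dom E L)) (app h)"
    have i: "?i h \<in> Arr SetCat" "?i k \<in> Arr SetCat" "Dom SetCat (?i g) = X" "Cod SetCat (?i g) = FO Z (Dom E L)" for g
      using hin' by (simp_all add: smap_Arr[OF X ZL] smap_Dom[OF X ZL] smap_Cod[OF X ZL])
    have "?i h = ?i k"
    proof (rule limit_unique[OF ZD limZ])
      fix i assume "i \<in> Obj (cone_shape J)"
      then consider "i = 0" | j where "j \<in> Obj J" "i = Suc j" by auto
      then show "Cmp SetCat (FA Z (case i of 0 \<Rightarrow> L | Suc j \<Rightarrow> tsnd (l j))) (?i h) =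
        Cmp SetCat (FA Z (case i of 0 \<Rightarrow> L | Suc j \<Rightarrow> tsnd (l j))) (?i k)"
      proof cases
        case 1
        then show ?thesis
          by - (rule SetCat_eqI, simp_all add: i app_Cmp app_smap hin')
      next
        case (2 j)
        have "app (FA Z (tsnd (l j))) (app h v) = app (FA Z (tsnd (l j))) (app k v)" if v: "v \<in> elts X" for v
          using arg_cong[OF e[OF 2(1)], of "\<lambda>m. app m v"] hin[OF v] v 2(1)
            fiber_point_app[OF l0(2)[OF 2(1)], of "app h v"] fiber_point_app[OF l0(2)[OF 2(1)], of "app k v"]
          by (simp add: app_Cmp X_def)
        then show ?thesis
          using 2 by - (rule SetCat_eqI, simp_all add: i app_Cmp app_smap)
      qed
    qed (simp_all add: i)
    then have "app (?i h) v = app (?i k) v" for v by simp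
    then have "app h v = app k v" if "v \<in> elts X" for v using that by (metis app_smap)
    then show "h = k" by - (rule SetCat_eqI, simp_all add: X_def)
  qed
qed

text \<open>The fibre point applies \<open>Z\<close> over \<open>A\<close> and then takes the fibre
  at \<open>s\<close> of a family over \<open>FO Z A\<close>. Its right adjoint reverses both:
  extend \<open>T\<close> to a family over \<open>FO Z A\<close>, apply the direct image of
  \<open>Z\<close>, and pull back along the unit at \<open>A\<close>.\<close>

lemma universal_arrow_fiber_point:
  assumes iZ: "inverse_image E SetCat Z" and T: "T \<in> Obj SetCat"
    and pb: "\<And>u v. u \<in> Arr E \<Longrightarrow> v \<in> Arr E \<Longrightarrow> Cod E u = Cod E v \<Longrightarrow> \<exists>c. is_pullback E u v c"
  shows "\<exists>R e. universal_arrow (slice E A) SetCat (fiber_point E A Z s) T R e"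
proof -
  let ?W = "fiber_point E A Z s" and ?S = "slice E A"
  note E = functor_category_dom[OF Z] and W = functor_fiber_point
  note [simp] = cat_simps[OF E] functor_simps[OF Z] cat_simps[OF category_SetCat] cmp_func_simps
    functor_simps[OF W] A T
  let ?B = "FO Z A"
  text \<open>The right adjoint sends \<open>T\<close> to the family over \<open>?B\<close> whose fibre is \<open>T\<close> over \<open>s\<close> and a singleton elsewhere.\<close>
  define BT where "BT = Sub (\<Union>b\<in>elts ?B. upair b ` (if b = s then elts T else {undefined}))"
  have BT: "BT \<in> Obj SetCat"
  proof -
    have "small (\<Union>b\<in>elts ?B. upair b ` (if b = s then elts T else {undefined}))"
      by (rule small_UN) (use FO_Obj[OF Z A] T in \<open>auto simp: SetCat_Obj intro: small_image small_finite\<close>)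
    then show ?thesis by (simp add: BT_def SetCat_Obj)
  qed
  have BTm: "v \<in> elts BT \<longleftrightarrow> (\<exists>b t. v = upair b t \<and> b \<in> elts ?B \<and> (if b = s then t \<in> elts T else t = undefined))" for v
    by (auto simp: BT_def split: if_splits)
  have B: "?B \<in> Obj SetCat" by simp
  define q where "q = smap BT ?B ufst"
  have q [simp]: "q \<in> Arr SetCat" "Dom SetCat q = BT" "Cod SetCat q = ?B"
  proof -
    show "q \<in> Arr SetCat" unfolding q_def by (rule smap_Arr[OF BT B]) (auto simp: BTm)
  qed (simp_all add: q_def smap_Dom[OF BT B] smap_Cod[OF BT B])
  have qa: "v \<in> elts BT \<Longrightarrow> app q v = ufst v" for v by (simp add: q_def app_smap)
  obtain RB eB where UB: "universal_arrow E SetCat Z ?B RB eB" using iZ B unfolding inverse_image_def by blast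
  obtain RT eT where UT: "universal_arrow E SetCat Z BT RT eT" using iZ BT unfolding inverse_image_def by blast
  have [simp]: "RB \<in> Obj E" "eB \<in> Arr SetCat" "Dom SetCat eB = FO Z RB" "Cod SetCat eB = ?B"
    "RT \<in> Obj E" "eT \<in> Arr SetCat" "Dom SetCat eT = FO Z RT" "Cod SetCat eT = BT"
    using UB UT by (simp_all add: universal_arrow_def)
  \<comment> \<open>\<open>q'\<close> is the direct image along \<open>Z\<close> of the family
    \<open>q\<close>.\<close>
  obtain q' where q' [simp]: "q' \<in> Arr E" "Dom E q' = RT" "Cod E q' = RB" and q'e: "Cmp SetCat eB (FA Z q') = Cmp SetCat q eT"
    by (rule universal_arrow_ex[OF UB, of RT "Cmp SetCat q eT"]) simp_all
  \<comment> \<open>\<open>n\<close> is the unit at \<open>A\<close>, the transpose of an identity.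
    Pulling \<open>q'\<close> back along it yields the family \<open>r2\<close> over
    \<open>A\<close> that represents arrows into \<open>T\<close>.\<close>
  obtain n where n [simp]: "n \<in> Arr E" "Dom E n = A" "Cod E n = RB" and ne: "Cmp SetCat eB (FA Z n) = Idn SetCat ?B"
    by (rule universal_arrow_ex[OF UB, of A "Idn SetCat ?B"]) simp_all
  obtain R0 r1 r2 where "is_pullback E q' n (R0, r1, r2)" using pb[of q' n] by auto
  then have P: "univ_span E RT A (\<lambda>f g. Cmp E q' f = Cmp E n g) (R0, r1, r2)"
    by (simp add: is_pullback_univ_span)
  note [simp] = univ_span_Obj[OF P] univ_span_fst[OF P] univ_span_snd[OF P]
  have rel: "Cmp E q' r1 = Cmp E n r2" by (rule univ_span_rel[OF P])
  text \<open>Composites into \<open>RT\<close> and \<open>A\<close> are compared through their transposes.\<close>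
  have k1: "app eB (app (FA Z (Cmp E q' f)) t) = ufst (app eT (app (FA Z f) t))"
    "app eT (app (FA Z f) t) \<in> elts BT"
    if "f \<in> Arr E" "Cod E f = RT" "t \<in> elts (FO Z (Dom E f))" for f t
  proof -
    have 1: "app (FA Z f) t \<in> elts (FO Z RT)" using app_FA_in[OF Z, of f t] that by simp
    show 2: "app eT (app (FA Z f) t) \<in> elts BT" using app_in[of eT, simplified, OF 1] by simp
    show "app eB (app (FA Z (Cmp E q' f)) t) = ufst (app eT (app (FA Z f) t))"
      using arg_cong[OF q'e, of "\<lambda>m. app m (app (FA Z f) t)"] 1 2 that app_FA_Cmp[OF Z, of f q' t]
      by (simp add: app_Cmp qa del: FA_Cmp[OF Z])
  qed
  have k2: "app eB (app (FA Z (Cmp E n g)) t) = app (FA Z g) t"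
    if "g \<in> Arr E" "Cod E g = A" "t \<in> elts (FO Z (Dom E g))" for g t
  proof -
    have 1: "app (FA Z g) t \<in> elts ?B" using app_FA_in[OF Z, of g t] that by simp
    show ?thesis
      using arg_cong[OF ne, of "\<lambda>m. app m (app (FA Z g) t)"] 1 that app_FA_Cmp[OF Z, of g n t]
      by (simp add: app_Cmp app_Idn del: FA_Cmp[OF Z])
  qed
  have k3: "ufst (app eT (app (FA Z (Cmp E r1 h)) t)) = app (FA Z (Cmp E r2 h)) t"
    if "h \<in> Arr E" "Cod E h = R0" "t \<in> elts (FO Z (Dom E h))" for h t
    using k1(1)[of "Cmp E r1 h" t] k2[of "Cmp E r2 h" t] that Cmp_eq_prefix[OF E rel, of h] by (simp del: FA_Cmp[OF Z])
  have r2S: "r2 \<in> Obj ?S" by (simp add: slice_Obj)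
  have WR: "FO ?W r2 \<in> Obj SetCat" using r2S by simp
  \<comment> \<open>The universal arrow transposes back to \<open>BT\<close> and keeps the second
    component. This lies in \<open>T\<close>, since the first component is \<open>s\<close> on the
    fibre.\<close>
  define e where "e = smap (FO ?W r2) T (\<lambda>t. usnd (app eT (app (FA Z r1) t)))"
  have ein: "usnd (app eT (app (FA Z r1) t)) \<in> elts T" if "t \<in> elts (FO ?W r2)" for t
  proof -
    have t: "t \<in> elts (FO Z R0)" "app (FA Z r2) t = s" using that by (simp_all add: fiber_point_elts)
    have "ufst (app eT (app (FA Z r1) t)) = s" using k3[of "Idn E R0" t] t by (simp del: FA_Cmp[OF Z])
    moreover have "app eT (app (FA Z r1) t) \<in> elts BT" using k1(2)[of r1 t] t by simp
    ultimately show ?thesis by (auto simp: BTm)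
  qed
  have e [simp]: "e \<in> Arr SetCat" "Dom SetCat e = FO ?W r2" "Cod SetCat e = T"
    using ein by (simp_all add: e_def smap_Arr[OF WR T] smap_Dom[OF WR T] smap_Cod[OF WR T])
  have ea: "app e t = usnd (app eT (app (FA Z r1) t))" if "t \<in> elts (FO ?W r2)" for t
    using that by (simp add: e_def app_smap)
  have comp: "app (Cmp SetCat e (FA ?W (Tup r2 h))) t = usnd (app eT (app (FA Z (Cmp E r1 h)) t))"
    if h: "h \<in> Arr E" "Cod E h = R0" and t: "t \<in> elts (FO ?W (Cmp E r2 h))" for h t
  proof -
    have H: "Tup r2 h \<in> Arr ?S" "Dom ?S (Tup r2 h) = Cmp E r2 h" "Cod ?S (Tup r2 h) = r2"
      using h by (simp_all add: slice_simps)
    have tZ: "t \<in> elts (FO Z (Dom E h))" using t h by (simp add: fiber_point_elts)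
    have a: "app (FA ?W (Tup r2 h)) t = app (FA Z h) t"
      using fiber_point_app[OF H(1), of t] t H by simp
    have "app (FA ?W (Tup r2 h)) t \<in> elts (FO ?W r2)"
      using app_FA_in[OF W H(1), of t] t H by simp
    then show ?thesis
      using t H ea[of "app (FA Z h) t"] a app_FA_Cmp[OF Z, of h r1 t] h tZ by (simp add: app_Cmp del: FA_Cmp[OF Z])
  qed
  have "universal_arrow ?S SetCat ?W T r2 e"
    unfolding universal_arrow_def
  proof (intro conjI ballI impI ex_ex1I)
    fix y g assume y: "y \<in> Obj ?S" and g [simp]: "g \<in> Arr SetCat" and "Dom SetCat g = FO ?W y \<and> Cod SetCat g = T"
    then have g' [simp]: "Dom SetCat g = FO ?W y" "Cod SetCat g = T" by simp_all
    have y' [simp]: "y \<in> Arr E" "Cod E y = A" using y by (simp_all add: slice_Obj)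
    let ?Y = "Dom E y"
    have ZY: "FO Z ?Y \<in> Obj SetCat" by simp
    \<comment> \<open>\<open>g\<close> is defined on the fibre over \<open>s\<close> only. It is
      extended to an arrow over \<open>?B\<close>; elsewhere the value is forced, the fibres of
      \<open>BT\<close> there being singletons.\<close>
    define g1 where "g1 = smap (FO Z ?Y) BT (\<lambda>u. upair (app (FA Z y) u) (if app (FA Z y) u = s then app g u else undefined))"
    have g1in: "upair (app (FA Z y) u) (if app (FA Z y) u = s then app g u else undefined) \<in> elts BT" if u: "u \<in> elts (FO Z ?Y)" for u
      using app_FA_in[OF Z, of y u] u app_in[OF g, of u] by (auto simp: BTm fiber_point_elts)
    have g1 [simp]: "g1 \<in> Arr SetCat" "Dom SetCat g1 = FO Z ?Y" "Cod SetCat g1 = BT"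
      using g1in by (simp_all add: g1_def smap_Arr[OF ZY BT] smap_Dom[OF ZY BT] smap_Cod[OF ZY BT])
    obtain g2 where g2 [simp]: "g2 \<in> Arr E" "Dom E g2 = ?Y" "Cod E g2 = RT" and g2e: "Cmp SetCat eT (FA Z g2) = g1"
      by (rule universal_arrow_ex[OF UT, of ?Y g1]) simp_all
    have g2a: "app eT (app (FA Z g2) u) = upair (app (FA Z y) u) (if app (FA Z y) u = s then app g u else undefined)"
      if "u \<in> elts (FO Z ?Y)" for u
      using arg_cong[OF g2e, of "\<lambda>m. app m u"] that by (simp add: app_Cmp) (simp add: g1_def app_smap)
    have "Cmp SetCat eB (FA Z (Cmp E q' g2)) = Cmp SetCat eB (FA Z (Cmp E n y))"
    proof (rule SetCat_eqI)
      fix u assume "u \<in> elts (Dom SetCat (Cmp SetCat eB (FA Z (Cmp E q' g2))))"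
      then have u: "u \<in> elts (FO Z ?Y)" by simp
      then show "app (Cmp SetCat eB (FA Z (Cmp E q' g2))) u = app (Cmp SetCat eB (FA Z (Cmp E n y))) u"
        using k1(1)[of g2 u] k2[of y u] by (simp add: app_Cmp g2a del: FA_Cmp[OF Z])
    qed simp_all
    then have "Cmp E q' g2 = Cmp E n y"
      by - (rule universal_arrow_unique[OF UB Z, rotated -1], simp_all)
    then obtain h where h [simp]: "h \<in> Arr E" "Dom E h = ?Y" "Cod E h = R0" and hp: "Cmp E r1 h = g2" "Cmp E r2 h = y"
      by - (rule univ_span_ex[OF P E, of g2 y ?Y], simp_all)
    have H: "Tup r2 h \<in> Arr ?S" "Dom ?S (Tup r2 h) = y" "Cod ?S (Tup r2 h) = r2"
      by (simp_all add: slice_simps hp)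
    have "Cmp SetCat e (FA ?W (Tup r2 h)) = g"
    proof (rule SetCat_eqI)
      fix t assume "t \<in> elts (Dom SetCat (Cmp SetCat e (FA ?W (Tup r2 h))))"
      then have t: "t \<in> elts (FO ?W y)" using H by simp
      then have "t \<in> elts (FO Z ?Y)" "app (FA Z y) t = s" by (simp_all add: fiber_point_elts)
      then show "app (Cmp SetCat e (FA ?W (Tup r2 h))) t = app g t"
        using comp[of h t] t by (simp add: hp g2a)
    qed (use H in simp_all)
    then show "\<exists>h. h \<in> Arr ?S \<and> Dom ?S h = y \<and> Cod ?S h = r2 \<and> Cmp SetCat e (FA ?W h) = g"
      using H by blast
  next
    fix y g m k
    assume m: "m \<in> Arr ?S \<and> Dom ?S m = y \<and> Cod ?S m = r2 \<and> Cmp SetCat e (FA ?W m) = g"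
      and k: "k \<in> Arr ?S \<and> Dom ?S k = y \<and> Cod ?S k = r2 \<and> Cmp SetCat e (FA ?W k) = g"
    have m1: "m \<in> Arr ?S" "k \<in> Arr ?S" using m k by blast+
    have m2: "tfst m = r2" "tfst k = r2" using m k slice_Cod[of E A m] slice_Cod[of E A k] by metis+
    define m' where "m' = tsnd m"
    define k' where "k' = tsnd k"
    have mk: "m = Tup r2 m'" "k = Tup r2 k'"
      using slice_Tup[OF m1(1)] slice_Tup[OF m1(2)] m2 by (simp_all add: m'_def k'_def)
    have [simp]: "m' \<in> Arr E" "Cod E m' = R0" "k' \<in> Arr E" "Cod E k' = R0"
      using m1 unfolding mk slice_Arr by simp_all
    have y: "Cmp E r2 m' = y" "Cmp E r2 k' = y"
      using m k unfolding mk slice_Dom by simp_all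
    have dm: "Dom E m' = Dom E y" "Dom E k' = Dom E y"
      using y[THEN arg_cong[of _ _ "Dom E"]] by simp_all
    have y' [simp]: "y \<in> Arr E" "Cod E y = A"
      using Cmp_Arr[OF E, of m' r2] Cod_Cmp[OF E, of m' r2] y(1) by simp_all
    have ce: "Cmp SetCat e (FA ?W (Tup r2 m')) = Cmp SetCat e (FA ?W (Tup r2 k'))" using m k mk by metis
    have "Cmp SetCat eT (FA Z (Cmp E r1 m')) = Cmp SetCat eT (FA Z (Cmp E r1 k'))"
    proof (rule SetCat_eqI)
      fix u assume "u \<in> elts (Dom SetCat (Cmp SetCat eT (FA Z (Cmp E r1 m'))))"
      then have u: "u \<in> elts (FO Z (Dom E y))" by (simp add: dm)
      let ?a = "app eT (app (FA Z (Cmp E r1 m')) u)" and ?b = "app eT (app (FA Z (Cmp E r1 k')) u)"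
      have f: "ufst ?a = app (FA Z y) u" "ufst ?b = app (FA Z y) u"
        using k3[of m' u] k3[of k' u] u y dm by (simp_all del: FA_Cmp[OF Z])
      have ab: "?a \<in> elts BT" "?b \<in> elts BT" using k1(2)[of "Cmp E r1 m'" u] k1(2)[of "Cmp E r1 k'" u] u dm by simp_all
      have "usnd ?a = usnd ?b"
      \<comment> \<open>Over \<open>s\<close> the two composites with \<open>e\<close> agree by
        hypothesis; over any other element the fibre of \<open>BT\<close> is a singleton.\<close>
      proof (cases "app (FA Z y) u = s")
        case True
        then have "u \<in> elts (FO ?W y)" using u by (simp add: fiber_point_elts)
        then show ?thesis
          using comp[of m' u] comp[of k' u] ce y by simp
      next
        case False then show ?thesis using ab f by (auto simp: BTm)
      qed
      then have "?a = ?b" using ab f by (auto simp: BTm)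
      then show "app (Cmp SetCat eT (FA Z (Cmp E r1 m'))) u = app (Cmp SetCat eT (FA Z (Cmp E r1 k'))) u"
        using u dm by (simp add: app_Cmp del: FA_Cmp[OF Z])
    qed (simp_all add: dm)
    then have "Cmp E r1 m' = Cmp E r1 k'"
      by - (rule universal_arrow_unique[OF UT Z, rotated -1], simp_all add: dm)
    then have "m' = k'"
      by - (rule univ_span_unique[OF P E], simp_all add: y dm Cmp_eq_prefix[OF E rel])
    then show "m = k" by (simp add: mk)
  qed (simp_all add: r2S)
  then show ?thesis by blast
qed

end

section \<open>The slice over a fixed object and its generic section\<close>

context
  fixes E :: "('u::universe large, 'u large) category" and A :: "'u large"
  assumes P: "geo E (slice E A) (product_functor E A)" and A: "A \<in> Obj E"
begin

private lemma E: "category E" and S: "category (slice E A)" and PF: "functor_from_to (product_functor E A) E (slice E A)"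
  using P geo_functor[OF P] by (auto simp: geo_def topos_category)

private lemma prod:
  assumes "X \<in> Obj E"
  shows "univ_span E A X (\<lambda>_ _. True) (prod_obj E A X, prod_fst E A X, prod_snd E A X)"
  using topos_product[OF geo_dom[OF P] A assms] by (simp add: is_product_univ_span)

text \<open>The arrow into the product with components \<open>f\<close> and \<open>g\<close>,
  described as in \<open>product_functor\<close>; this is what makes \<open>P_FA\<close>
  hold.\<close>

private definition pr :: "'u large \<Rightarrow> 'u large \<Rightarrow> 'u large" where
  "pr f g = (THE h. h \<in> Arr E \<and> Dom E h = Dom E f \<and> Cod E h = prod_obj E A (Cod E g) \<and>
    Cmp E (prod_fst E A (Cod E g)) h = f \<and> Cmp E (prod_snd E A (Cod E g)) h = g)"

private lemma pr_ex1:
  assumes "f \<in> Arr E" "g \<in> Arr E" "Cod E f = A" "Dom E g = Dom E f"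
  shows "\<exists>!h. h \<in> Arr E \<and> Dom E h = Dom E f \<and> Cod E h = prod_obj E A (Cod E g) \<and>
    Cmp E (prod_fst E A (Cod E g)) h = f \<and> Cmp E (prod_snd E A (Cod E g)) h = g"
  using univ_span_ex1[OF prod[OF Cod_Obj[OF E assms(2)]] E assms(1,2) refl assms(4) assms(3) refl] by simp

private lemma
  assumes "f \<in> Arr E" "g \<in> Arr E" "Cod E f = A" "Dom E g = Dom E f"
  shows pr_Arr: "pr f g \<in> Arr E" and pr_Dom: "Dom E (pr f g) = Dom E f"
    and pr_Cod: "Cod E (pr f g) = prod_obj E A (Cod E g)"
    and pr_fst: "Cmp E (prod_fst E A (Cod E g)) (pr f g) = f"
    and pr_snd: "Cmp E (prod_snd E A (Cod E g)) (pr f g) = g"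
  using theI'[OF pr_ex1[OF assms]] by (auto simp: pr_def)

private lemma
  assumes "X \<in> Obj E"
  shows prod_Obj: "prod_obj E A X \<in> Obj E"
    and prod_fst: "prod_fst E A X \<in> Arr E" "Dom E (prod_fst E A X) = prod_obj E A X" "Cod E (prod_fst E A X) = A"
    and prod_snd: "prod_snd E A X \<in> Arr E" "Dom E (prod_snd E A X) = prod_obj E A X" "Cod E (prod_snd E A X) = X"
  by (rule univ_span_Obj[OF prod[OF assms]] univ_span_fst[OF prod[OF assms]] univ_span_snd[OF prod[OF assms]])+

private lemma prod_eqI:
  assumes "X \<in> Obj E" "h \<in> Arr E" "k \<in> Arr E" "Cod E h = prod_obj E A X" "Cod E k = prod_obj E A X" "Dom E h = Dom E k"
    "Cmp E (prod_fst E A X) h = Cmp E (prod_fst E A X) k" "Cmp E (prod_snd E A X) h = Cmp E (prod_snd E A X) k"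
  shows "h = k"
  by (rule univ_span_unique[OF prod[OF assms(1)] E]) (use assms in simp_all)

private lemma P_FO: "X \<in> Obj E \<Longrightarrow> FO (product_functor E A) X = prod_fst E A X"
  by (simp add: product_functor_def)

private lemma P_FA: "f \<in> Arr E \<Longrightarrow> FA (product_functor E A) f =
    Tup (prod_fst E A (Cod E f)) (pr (prod_fst E A (Dom E f)) (Cmp E f (prod_snd E A (Dom E f))))"
  using prod_Obj[of "Dom E f"] prod_fst[of "Dom E f"] prod_snd[of "Dom E f"]
  by (simp add: product_functor_def pr_def cat_simps[OF E] mem_homset)

text \<open>The graph of \<open>y\<close>, with components \<open>y\<close> and the identity. It is
  the unit of the adjunction between the domain functor of the slice and
  \<open>product_functor\<close>.\<close>

private definition gam :: "'u large \<Rightarrow> 'u large" where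
  "gam y = Tup (prod_fst E A (Dom E y)) (pr y (Idn E (Dom E y)))"

text \<open>The diagonal of \<open>A\<close>, as an arrow over \<open>A\<close> from the terminal
  object to the product of \<open>A\<close> with itself.\<close>

private definition del :: "'u large" where "del = gam (Idn E A)"

private lemma
  assumes "y \<in> Obj (slice E A)"
  shows gam_Arr: "gam y \<in> Arr (slice E A)" and gam_Dom: "Dom (slice E A) (gam y) = y"
    and gam_Cod: "Cod (slice E A) (gam y) = FO (product_functor E A) (Dom E y)"
  using assms
  by (simp_all add: gam_def slice_simps prod_fst prod_Obj prod_snd pr_Arr pr_Dom pr_Cod P_FO cat_simps[OF E])
    (use pr_fst[of y "Idn E (Dom E y)"] in \<open>simp add: cat_simps[OF E]\<close>)

text \<open>The second projection is a retraction of the underlying arrow of the graph.\<close>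

private lemma gam_mono:
  assumes y: "y \<in> Obj (slice E A)" and f: "f \<in> Arr (slice E A)" and g: "g \<in> Arr (slice E A)"
    and c: "Cod (slice E A) f = y" "Cod (slice E A) g = y" and e: "Cmp (slice E A) (gam y) f = Cmp (slice E A) (gam y) g"
  shows "f = g"
proof -
  have y' [simp]: "y \<in> Arr E" "Cod E y = A" using y by (simp_all add: slice_Obj)
  have t: "tfst f = y" "tfst g = y" using c by (simp_all add: slice_Cod)
  note [simp] = slice_tsnd[OF f] slice_tsnd[OF g] t prod_snd pr_Arr pr_Dom pr_Cod cat_simps[OF E]
  have "Cmp E (pr y (Idn E (Dom E y))) (tsnd f) = Cmp E (pr y (Idn E (Dom E y))) (tsnd g)"
    using arg_cong[OF e, of tsnd] by (simp add: slice_Cmp gam_def)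
  moreover have "Cmp E (prod_snd E A (Dom E y)) (Cmp E (pr y (Idn E (Dom E y))) h) = h"
    if "h \<in> Arr E" "Cod E h = Dom E y" for h
    using Cmp_eq_prefix1[OF E pr_snd[of y "Idn E (Dom E y)"], of h] that by simp
  ultimately have "tsnd f = tsnd g" by (metis slice_tsnd[OF f] slice_tsnd[OF g] t)
  then show ?thesis using slice_Tup[OF f] slice_Tup[OF g] t by metis
qed

private lemma gam_natural:
  assumes m: "m \<in> Arr (slice E A)"
  shows "Cmp (slice E A) (FA (product_functor E A) (tsnd m)) (gam (Dom (slice E A) m)) =
    Cmp (slice E A) (gam (Cod (slice E A) m)) m"
proof -
  let ?y = "tfst m" and ?h = "tsnd m"
  note [simp] = slice_tsnd[OF m] slice_tfst[OF m] prod_snd prod_fst prod_Obj pr_Arr pr_Dom pr_Cod cat_simps[OF E]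
  let ?Y = "Dom E ?y" and ?X = "Dom E ?h"
  let ?k = "pr (prod_fst E A ?X) (Cmp E ?h (prod_snd E A ?X))"
  let ?l = "pr (Cmp E ?y ?h) (Idn E ?X)"
  have k: "?k \<in> Arr E" "Dom E ?k = prod_obj E A ?X" "Cod E ?k = prod_obj E A ?Y"
    and kf: "Cmp E (prod_fst E A ?Y) ?k = prod_fst E A ?X" and ks: "Cmp E (prod_snd E A ?Y) ?k = Cmp E ?h (prod_snd E A ?X)"
    using pr_fst[of "prod_fst E A ?X" "Cmp E ?h (prod_snd E A ?X)"] pr_snd[of "prod_fst E A ?X" "Cmp E ?h (prod_snd E A ?X)"] by simp_all
  have l: "?l \<in> Arr E" "Dom E ?l = ?X" "Cod E ?l = prod_obj E A ?X"
    and lf: "Cmp E (prod_fst E A ?X) ?l = Cmp E ?y ?h" and ls: "Cmp E (prod_snd E A ?X) ?l = Idn E ?X"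
    using pr_fst[of "Cmp E ?y ?h" "Idn E ?X"] pr_snd[of "Cmp E ?y ?h" "Idn E ?X"] by simp_all
  let ?r = "pr ?y (Idn E ?Y)"
  have r: "?r \<in> Arr E" "Dom E ?r = ?Y" "Cod E ?r = prod_obj E A ?Y"
    and rf: "Cmp E (prod_fst E A ?Y) ?r = ?y" and rs: "Cmp E (prod_snd E A ?Y) ?r = Idn E ?Y"
    using pr_fst[of "?y" "Idn E ?Y"] pr_snd[of "?y" "Idn E ?Y"] by simp_all
  have "Cmp E ?k ?l = Cmp E ?r ?h"
  proof (rule prod_eqI[of ?Y])
    show "Cmp E (prod_fst E A ?Y) (Cmp E ?k ?l) = Cmp E (prod_fst E A ?Y) (Cmp E ?r ?h)"
      using Cmp_eq_prefix1[OF E kf, of ?l] Cmp_eq_prefix1[OF E rf, of ?h] k l r lf by simp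
    show "Cmp E (prod_snd E A ?Y) (Cmp E ?k ?l) = Cmp E (prod_snd E A ?Y) (Cmp E ?r ?h)"
      using Cmp_eq_prefix[OF E ks, of ?l] Cmp_eq_prefix1[OF E rs, of ?h] k l r ls by simp
  qed (use k l r in simp_all)
  then show ?thesis
    by (simp add: slice_Cmp slice_Dom slice_Cod gam_def P_FA)
qed

private lemma left_exact_gam_mono:
  assumes F: "functor_from_to F (slice E A) X" and l: "left_exact F" and y: "y \<in> Obj (slice E A)"
    and "f \<in> Arr X" "g \<in> Arr X" "Dom X f = Dom X g" "Cod X f = FO F y" "Cod X g = FO F y"
    and "Cmp X (FA F (gam y)) f = Cmp X (FA F (gam y)) g"
  shows "f = g"
  by (rule left_exact_mono[OF F l gam_Arr[OF y]])
    (use assms gam_mono[OF y] in \<open>simp_all add: gam_Dom\<close>)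

text \<open>Every \<open>y\<close> embeds by \<open>gam y\<close> into an object coming from
  \<open>E\<close>, and \<open>N\<close> keeps this arrow a monomorphism. By naturality the
  component at \<open>y\<close> is then determined by the component at that object.\<close>

lemma etale_thin:
  assumes s: "ntrans (slice E A) X M N s" and t: "ntrans (slice E A) X M N t" and l: "left_exact N"
    and e: "\<And>D. D \<in> Obj E \<Longrightarrow> s (FO (product_functor E A) D) = t (FO (product_functor E A) D)"
  shows "s = t"
proof (rule ntrans_eqI[OF s t])
  fix y assume y: "y \<in> Obj (slice E A)"
  have y': "y \<in> Arr E" using y by (simp add: slice_Obj)
  note g = gam_Arr[OF y] gam_Dom[OF y] gam_Cod[OF y]
  have "s (FO (product_functor E A) (Dom E y)) = t (FO (product_functor E A) (Dom E y))"
    by (rule e) (simp add: cat_simps[OF E] y')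
  then have "Cmp X (FA N (gam y)) (s y) = Cmp X (FA N (gam y)) (t y)"
    using ntrans_sq[OF s g(1)] ntrans_sq[OF t g(1)] g by simp
  then show "s y = t y"
    by - (rule left_exact_gam_mono[OF ntrans_cod[OF s] l y],
      simp_all add: ntrans_simps[OF s] ntrans_simps[OF t] y)
qed

text \<open>A point of the slice is determined by the induced point of \<open>E\<close> together with the element that
  the generic section \<open>del\<close> picks out of its value at \<open>A\<close>.\<close>

private definition star :: "('u large, 'u large, 'u large, 'u large) func \<Rightarrow> 'u" where
  "star M = (THE t. t \<in> elts (FO M (Idn E A)))"

private definition sec :: "('u large, 'u large, 'u large, 'u large) func \<Rightarrow> 'u" where
  "sec M = app (FA M del) (star M)"

private lemma Idn_A: "Idn E A \<in> Obj (slice E A)"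
  by (simp add: slice_Obj A cat_simps[OF E])

private lemma to_Idn:
  assumes "y \<in> Obj (slice E A)"
  shows "Tup (Idn E A) y \<in> Arr (slice E A)" "Dom (slice E A) (Tup (Idn E A) y) = y"
    "Cod (slice E A) (Tup (Idn E A) y) = Idn E A"
  using assms A by (simp_all add: slice_simps cat_simps[OF E])

private lemma terminal_Idn: "terminal_obj (slice E A) (Idn E A)"
  unfolding terminal_obj_def mem_homset
proof (intro conjI ballI Idn_A)
  fix y assume y: "y \<in> Obj (slice E A)"
  show "\<exists>!h. h \<in> Arr (slice E A) \<and> Dom (slice E A) h = y \<and> Cod (slice E A) h = Idn E A"
  proof (rule ex1I[of _ "Tup (Idn E A) y"])
    fix h assume h: "h \<in> Arr (slice E A) \<and> Dom (slice E A) h = y \<and> Cod (slice E A) h = Idn E A"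
    then have t: "tfst h = Idn E A" by (simp add: slice_Cod)
    have "y = Cmp E (tfst h) (tsnd h)" using h by (simp add: slice_Dom)
    also have "\<dots> = tsnd h" using slice_tsnd[of h E A] h A by (simp add: t cat_simps[OF E])
    finally show "h = Tup (Idn E A) y" using slice_Tup[of h E A] h t by simp
  qed (simp add: to_Idn[OF y])
qed

private lemma star:
  assumes "functor_from_to M (slice E A) SetCat" "left_exact M"
  shows "star M \<in> elts (FO M (Idn E A))" "t \<in> elts (FO M (Idn E A)) \<Longrightarrow> t = star M"
proof -
  have "\<exists>!t. t \<in> elts (FO M (Idn E A))"
    by (rule terminal_elts[OF left_exact_terminal[OF assms terminal_Idn]])
  then show "star M \<in> elts (FO M (Idn E A))" "t \<in> elts (FO M (Idn E A)) \<Longrightarrow> t = star M"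
    unfolding star_def by (rule theI', metis theI')
qed

private lemma del: "del \<in> Arr (slice E A)" "Dom (slice E A) del = Idn E A" "Cod (slice E A) del = FO (product_functor E A) A"
  using gam_Arr[OF Idn_A] gam_Dom[OF Idn_A] gam_Cod[OF Idn_A] A by (simp_all add: del_def cat_simps[OF E])

text \<open>An element of \<open>y\<close> over a point of \<open>A\<close> is an element of
  \<open>Dom E y\<close> that \<open>y\<close> sends to this point. So each object of the slice is
  cut out of one coming from \<open>E\<close> by an equation with the generic section, and a left
  exact functor is controlled by its restriction to \<open>E\<close> together with its value at
  \<open>del\<close>.\<close>

private lemma gam_pullback:
  assumes y: "y \<in> Obj (slice E A)"
  shows "is_pullback (slice E A) (FA (product_functor E A) y) del (y, gam y, Tup (Idn E A) y)"
  unfolding is_pullback_univ_span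
proof (rule univ_spanI)
  let ?S = "slice E A" and ?P = "product_functor E A"
  have y' [simp]: "y \<in> Arr E" "Cod E y = A" using y by (simp_all add: slice_Obj)
  note g = gam_Arr[OF y] gam_Dom[OF y] gam_Cod[OF y] and i = to_Idn[OF y]
  show "gam y \<in> Arr ?S" "Dom ?S (gam y) = y" "Cod ?S (gam y) = Dom ?S (FA ?P y)"
    by (simp_all add: g functor_simps[OF PF])
  show "Tup (Idn E A) y \<in> Arr ?S" "Dom ?S (Tup (Idn E A) y) = y" "Cod ?S (Tup (Idn E A) y) = Dom ?S del"
    by (simp_all add: i del)
  show "Cmp ?S (FA ?P y) (gam y) = Cmp ?S del (Tup (Idn E A) y)"
    using gam_natural[OF i(1)] by (simp add: i del_def)
  fix f h assume f: "f \<in> Arr ?S" and h: "h \<in> Arr ?S" and fh: "Dom ?S h = Dom ?S f"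
    and cf: "Cod ?S f = Dom ?S (FA ?P y)" and ch: "Cod ?S h = Dom ?S del"
    and e: "Cmp ?S (FA ?P y) f = Cmp ?S del h"
  let ?Y = "Dom E y"
  have tf: "tfst f = prod_fst E A ?Y" using cf by (simp add: functor_simps[OF PF] slice_Cod P_FO cat_simps[OF E])
  have th: "tfst h = Idn E A" using ch by (simp add: del slice_Cod)
  note [simp] = slice_tsnd[OF f] slice_tsnd[OF h] tf th prod_fst prod_snd prod_Obj pr_Arr pr_Dom pr_Cod A cat_simps[OF E]
  let ?f = "tsnd f" and ?h = "tsnd h"
  have df: "Dom ?S f = ?h" using fh by (simp add: slice_Dom)
  have ff: "Cmp E (prod_fst E A ?Y) ?f = ?h" using df by (simp add: slice_Dom)
  have dd: "Dom E ?f = Dom E ?h" using arg_cong[OF ff, of "Dom E"] by simp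
  let ?k = "pr (prod_fst E A ?Y) (Cmp E y (prod_snd E A ?Y))" and ?d = "pr (Idn E A) (Idn E A)"
  have "Cmp E ?k ?f = Cmp E ?d ?h"
    using arg_cong[OF e, of tsnd] by (simp add: slice_Cmp P_FA del_def gam_def)
  then have "Cmp E (prod_snd E A A) (Cmp E ?k ?f) = Cmp E (prod_snd E A A) (Cmp E ?d ?h)" by simp
  moreover have "Cmp E (prod_snd E A A) (Cmp E ?k ?f) = Cmp E y (Cmp E (prod_snd E A ?Y) ?f)"
    using Cmp_eq_prefix1[OF E pr_snd[of "prod_fst E A ?Y" "Cmp E y (prod_snd E A ?Y)"], of ?f] by simp
  moreover have "Cmp E (prod_snd E A A) (Cmp E ?d ?h) = ?h"
    using Cmp_eq_prefix1[OF E pr_snd[of "Idn E A" "Idn E A"], of ?h] by simp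
  ultimately have yh: "Cmp E y (Cmp E (prod_snd E A ?Y) ?f) = ?h" by simp
  \<comment> \<open>The mediating arrow is the second component of \<open>f\<close>; commutation of
    the square forces \<open>y\<close> to send it to \<open>?h\<close>.\<close>
  let ?l = "Tup y (Cmp E (prod_snd E A ?Y) ?f)"
  have l: "?l \<in> Arr ?S" "Dom ?S ?l = Dom ?S f" "Cod ?S ?l = y"
    by (simp_all add: slice_simps yh df[unfolded slice_Dom] ff)
  have "Cmp E (pr y (Idn E ?Y)) (Cmp E (prod_snd E A ?Y) ?f) = ?f"
  proof (rule prod_eqI[of ?Y])
    show "Cmp E (prod_fst E A ?Y) (Cmp E (pr y (Idn E ?Y)) (Cmp E (prod_snd E A ?Y) ?f)) = Cmp E (prod_fst E A ?Y) ?f"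
      using Cmp_eq_prefix1[OF E pr_fst[of y "Idn E ?Y"], of "Cmp E (prod_snd E A ?Y) ?f"] yh ff by simp
    show "Cmp E (prod_snd E A ?Y) (Cmp E (pr y (Idn E ?Y)) (Cmp E (prod_snd E A ?Y) ?f)) = Cmp E (prod_snd E A ?Y) ?f"
      using Cmp_eq_prefix1[OF E pr_snd[of y "Idn E ?Y"], of "Cmp E (prod_snd E A ?Y) ?f"] by simp
  qed simp_all
  then have "Cmp ?S (gam y) ?l = Tup (tfst f) ?f" by (simp add: slice_Cmp gam_def)
  moreover have "Cmp ?S (Tup (Idn E A) y) ?l = Tup (tfst h) ?h" by (simp add: slice_Cmp yh)
  ultimately show "\<exists>l. l \<in> Arr ?S \<and> Dom ?S l = Dom ?S f \<and> Cod ?S l = y \<and> Cmp ?S (gam y) l = f \<and>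
      Cmp ?S (Tup (Idn E A) y) l = h"
    using l slice_Tup[OF f] slice_Tup[OF h] by (intro exI[of _ ?l]) simp
next
  fix h k assume "h \<in> Arr (slice E A)" "k \<in> Arr (slice E A)" "Cod (slice E A) h = y" "Cod (slice E A) k = y"
    "Cmp (slice E A) (gam y) k = Cmp (slice E A) (gam y) h"
  then show "h = k" by - (rule gam_mono[OF y], simp_all)
qed (rule y)

text \<open>A left exact functor has exactly one element at the terminal object, and transformations
  preserve it; naturality at \<open>del\<close> carries this over to \<open>sec\<close>.\<close>

private lemma sec_natural:
  assumes M: "left_exact M" and N: "left_exact N" and t: "ntrans (slice E A) SetCat M N t"
  shows "app (t (FO (product_functor E A) A)) (sec M) = sec N"
proof -
  note FM = ntrans_dom[OF t] and FN = ntrans_cod[OF t]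
  have "app (t (Idn E A)) (star M) = star N"
    by (rule star(2)[OF FN N]) (rule ntrans_app[OF t Idn_A star(1)[OF FM M]])
  then show ?thesis
    using ntrans_app_sq[OF t del(1), of "star M"] star(1)[OF FM M] by (simp add: del sec_def)
qed

text \<open>\<open>M\<close> preserves the pullback in \<open>gam_pullback\<close>, whose third
  corner has \<open>star M\<close> as its only element.\<close>

private lemma gam_elts:
  assumes FM: "functor_from_to M (slice E A) SetCat" and M: "left_exact M" and y: "y \<in> Obj (slice E A)"
    and u: "u \<in> elts (FO M (FO (product_functor E A) (Dom E y)))"
      "app (FA M (FA (product_functor E A) y)) u = sec M"
  shows "\<exists>!t. t \<in> elts (FO M y) \<and> app (FA M (gam y)) t = u"
proof -
  note [simp] = functor_simps[OF FM] functor_simps[OF PF] del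
  have y' [simp]: "y \<in> Arr E" "Cod E y = A" using y by (simp_all add: slice_Obj)
  have P: "is_pullback SetCat (FA M (FA (product_functor E A) y)) (FA M del) (FO M y, FA M (gam y), FA M (Tup (Idn E A) y))"
    by (rule left_exact_pullback[OF FM M gam_pullback[OF y]]) simp_all
  have "\<exists>!t. t \<in> elts (FO M y) \<and> app (FA M (gam y)) t = u \<and> app (FA M (Tup (Idn E A) y)) t = star M"
    by (rule pullback_elts[OF P]) (use u star(1)[OF FM M] in \<open>simp_all add: sec_def\<close>)
  moreover have "app (FA M (Tup (Idn E A) y)) t = star M" if "t \<in> elts (FO M y)" for t
    by (rule star(2)[OF FM M]) (use app_FA_in[OF FM to_Idn(1)[OF y], of t] to_Idn[OF y] that in simp)
  ultimately show ?thesis by metis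
qed

text \<open>By \<open>gam_elts\<close>, elements of \<open>M y\<close> are those elements of
  \<open>M\<close> at \<open>A\<close> times \<open>Dom E y\<close> that are sent to
  \<open>sec M\<close>. A transformation between the induced points of \<open>E\<close> that carries
  \<open>sec M\<close> to \<open>sec N\<close> restricts to these subsets, and naturality of
  \<open>gam\<close> makes the restriction natural.\<close>

lemma etale_full:
  assumes FM: "functor_from_to M (slice E A) SetCat" and M: "left_exact M"
    and FN: "functor_from_to N (slice E A) SetCat" and N: "left_exact N"
    and g: "ntrans E SetCat (cmp_func M (product_functor E A)) (cmp_func N (product_functor E A)) g"
    and gs: "app (g A) (sec M) = sec N"
  obtains x where "ntrans (slice E A) SetCat M N x" "\<forall>D\<in>Obj E. x (FO (product_functor E A) D) = g D"
proof -
  let ?S = "slice E A" and ?P = "product_functor E A"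
  note [simp] = functor_simps[OF FM] functor_simps[OF FN] functor_simps[OF PF] del cmp_func_simps cat_simps[OF E]
    gam_Arr gam_Dom gam_Cod
  have ex: "\<exists>!t'. t' \<in> elts (FO N y) \<and> app (FA N (gam y)) t' = app (g (Dom E y)) (app (FA M (gam y)) t)"
    if y: "y \<in> Obj ?S" and t: "t \<in> elts (FO M y)" for y t
  proof (rule gam_elts[OF FN N y])
    have y' [simp]: "y \<in> Arr E" "Cod E y = A" using y by (simp_all add: slice_Obj)
    have gt: "app (FA M (gam y)) t \<in> elts (FO M (FO ?P (Dom E y)))"
      using app_FA_in[OF FM gam_Arr[OF y], of t] y t by simp
    show "app (g (Dom E y)) (app (FA M (gam y)) t) \<in> elts (FO N (FO ?P (Dom E y)))"
      using ntrans_app[OF g, of "Dom E y"] gt by simp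
    have st: "app (FA M (Tup (Idn E A) y)) t = star M"
      by (rule star(2)[OF FM M]) (use app_FA_in[OF FM to_Idn(1)[OF y], of t] to_Idn[OF y] t in simp)
    have "app (FA M (FA ?P y)) (app (FA M (gam y)) t) = app (FA M (Cmp ?S (FA ?P y) (gam y))) t"
      by (subst app_FA_Cmp[OF FM]) (use y t in simp_all)
    also have "\<dots> = app (FA M (Cmp ?S del (Tup (Idn E A) y))) t"
      using gam_natural[OF to_Idn(1)[OF y]] to_Idn[OF y] by (simp add: del_def)
    also have "\<dots> = sec M"
      by (subst app_FA_Cmp[OF FM]) (use to_Idn[OF y] t st in \<open>simp_all add: sec_def\<close>)
    finally show "app (FA N (FA ?P y)) (app (g (Dom E y)) (app (FA M (gam y)) t)) = sec N"
      using ntrans_app_sq[OF g y'(1), of "app (FA M (gam y)) t"] gt gs by simp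
  qed
  define x where "x = (\<lambda>y t. THE t'. t' \<in> elts (FO N y) \<and> app (FA N (gam y)) t' = app (g (Dom E y)) (app (FA M (gam y)) t))"
  have x: "x y t \<in> elts (FO N y)" "app (FA N (gam y)) (x y t) = app (g (Dom E y)) (app (FA M (gam y)) t)"
    if "y \<in> Obj ?S" "t \<in> elts (FO M y)" for y t
    using theI'[OF ex[OF that]] by (auto simp: x_def)
  have xeq: "x y t = t'" if "y \<in> Obj ?S" "t \<in> elts (FO M y)" "t' \<in> elts (FO N y)"
    "app (FA N (gam y)) t' = app (g (Dom E y)) (app (FA M (gam y)) t)" for y t t'
    using ex[OF that(1,2)] x[OF that(1,2)] that(3,4) by blast
  have X: "ntrans ?S SetCat M N (\<lambda>y\<in>Obj ?S. smap (FO M y) (FO N y) (x y))"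
  proof (rule ntrans_smap[OF FM FN])
    fix m t assume m: "m \<in> Arr ?S" and t: "t \<in> elts (FO M (Dom ?S m))"
    let ?y = "Dom ?S m" and ?z = "Cod ?S m"
    have yz [simp]: "?y \<in> Obj ?S" "?z \<in> Obj ?S" using m by (simp_all add: cat_simps[OF S])
    note [simp] = slice_tsnd[OF m] slice_tfst[OF m] m
    have d: "Dom E ?y = Dom E (tsnd m)" "Dom E ?z = Dom E (tfst m)" by (simp_all add: slice_Dom slice_Cod)
    have z': "Dom E (tfst m) \<in> Obj E" by simp
    have gn: "Cmp ?S (FA ?P (tsnd m)) (gam ?y) = Cmp ?S (gam ?z) m" by (rule gam_natural[OF m])
    have nat: "app (FA F (FA ?P (tsnd m))) (app (FA F (gam ?y)) v) = app (FA F (gam ?z)) (app (FA F m) v)"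
      if F: "functor_from_to F ?S SetCat" and v: "v \<in> elts (FO F ?y)" for F v
      using arg_cong[OF gn, of "\<lambda>m. app (FA F m) v"] v
        app_FA_Cmp[OF F gam_Arr[OF yz(1)] FA_Arr[OF PF, of "tsnd m"], of v] app_FA_Cmp[OF F m gam_Arr[OF yz(2)], of v]
      by (simp add: d)
    show "x ?z (app (FA M m) t) = app (FA N m) (x ?y t)"
    proof (rule xeq)
      show "app (FA M m) t \<in> elts (FO M ?z)" using app_FA_in[OF FM m t] .
      show "app (FA N m) (x ?y t) \<in> elts (FO N ?z)" using app_FA_in[OF FN m x(1)[OF yz(1) t]] .
      have gt: "app (FA M (gam ?y)) t \<in> elts (FO M (FO ?P (Dom E (tsnd m))))"
        using app_FA_in[OF FM gam_Arr[OF yz(1)], of t] t d by simp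
      have "app (FA N (gam ?z)) (app (FA N m) (x ?y t)) = app (FA N (FA ?P (tsnd m))) (app (FA N (gam ?y)) (x ?y t))"
        using nat[OF FN x(1)[OF yz(1) t]] by simp
      also have "\<dots> = app (FA N (FA ?P (tsnd m))) (app (g (Dom E (tsnd m))) (app (FA M (gam ?y)) t))"
        using x(2)[OF yz(1) t] d by simp
      also have "\<dots> = app (g (Dom E (tfst m))) (app (FA M (FA ?P (tsnd m))) (app (FA M (gam ?y)) t))"
        using ntrans_app_sq[OF g, of "tsnd m" "app (FA M (gam ?y)) t"] gt by simp
      also have "\<dots> = app (g (Dom E (tfst m))) (app (FA M (gam ?z)) (app (FA M m) t))"
        using nat[OF FM t] by simp
      finally show "app (FA N (gam ?z)) (app (FA N m) (x ?y t)) = app (g (Dom E ?z)) (app (FA M (gam ?z)) (app (FA M m) t))"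
        by (simp add: d)
    qed simp
  qed (rule x)
  have "smap (FO M (FO ?P D)) (FO N (FO ?P D)) (x (FO ?P D)) = g D" if D: "D \<in> Obj E" for D
  proof -
    let ?y = "FO ?P D"
    have y: "?y \<in> Obj ?S" using D by simp
    have dy: "Dom E ?y = prod_obj E A D" using D by (simp add: P_FO prod_fst)
    note prodD = prod_fst[OF D] prod_snd[OF D] prod_Obj[OF D]
    let ?r = "FA ?P (prod_snd E A D)"
    have r: "?r \<in> Arr ?S" "Dom ?S ?r = FO ?P (prod_obj E A D)" "Cod ?S ?r = ?y" using prodD by simp_all
    \<comment> \<open>A triangle identity of the adjunction with unit \<open>gam\<close>, the counit
      being the second projection. With this retraction, \<open>x\<close> at an object coming from
      \<open>E\<close> is seen to be \<open>g\<close>.\<close>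
    have retr: "Cmp ?S ?r (gam ?y) = Idn ?S ?y"
    proof -
      note [simp] = prodD prod_fst prod_snd prod_Obj pr_Arr pr_Dom pr_Cod D
      let ?Q = "prod_obj E A D" and ?f = "prod_fst E A D" and ?s = "prod_snd E A D"
      let ?k = "pr (prod_fst E A ?Q) (Cmp E ?s (prod_snd E A ?Q))" and ?l = "pr ?f (Idn E ?Q)"
      have "Cmp E ?k ?l = Idn E ?Q"
      proof (rule prod_eqI[of D])
        show "Cmp E ?f (Cmp E ?k ?l) = Cmp E ?f (Idn E ?Q)"
          using Cmp_eq_prefix1[OF E pr_fst[of "prod_fst E A ?Q" "Cmp E ?s (prod_snd E A ?Q)"], of ?l] pr_fst[of ?f "Idn E ?Q"] by simp
        show "Cmp E ?s (Cmp E ?k ?l) = Cmp E ?s (Idn E ?Q)"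
          using Cmp_eq_prefix1[OF E pr_snd[of "prod_fst E A ?Q" "Cmp E ?s (prod_snd E A ?Q)"], of ?l] pr_snd[of ?f "Idn E ?Q"] by simp
      qed simp_all
      then show ?thesis by (simp add: slice_Cmp slice_Idn gam_def P_FA P_FO)
    qed
    have gD: "g D \<in> Arr SetCat" "Dom SetCat (g D) = FO M ?y" "Cod SetCat (g D) = FO N ?y"
      using D ntrans_simps[OF g, of D] by simp_all
    have ob: "FO M ?y \<in> Obj SetCat" "FO N ?y \<in> Obj SetCat" using y by simp_all
    have retr_app: "app (FA F ?r) (app (FA F (gam ?y)) v) = v" if F: "functor_from_to F ?S SetCat" and v: "v \<in> elts (FO F ?y)" for F v
      using arg_cong[OF retr, of "\<lambda>m. app (FA F m) v"] app_FA_Cmp[OF F gam_Arr[OF y] r(1), of v] y v r dy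
        app_FA_Idn[OF F y v] by simp
    show ?thesis
    proof (rule SetCat_eqI)
      fix t assume "t \<in> elts (Dom SetCat (smap (FO M ?y) (FO N ?y) (x ?y)))"
      then have t: "t \<in> elts (FO M ?y)" by (simp add: smap_Dom[OF ob])
      have gt: "app (FA M (gam ?y)) t \<in> elts (FO M (FO ?P (prod_obj E A D)))"
        using app_FA_in[OF FM gam_Arr[OF y], of t] t y dy by simp
      have "x ?y t = app (FA N ?r) (app (FA N (gam ?y)) (x ?y t))"
        using retr_app[OF FN x(1)[OF y t]] by simp
      also have "\<dots> = app (FA N ?r) (app (g (prod_obj E A D)) (app (FA M (gam ?y)) t))"
        using x(2)[OF y t] dy by simp
      also have "\<dots> = app (g D) (app (FA M ?r) (app (FA M (gam ?y)) t))"
        using ntrans_app_sq[OF g, of "prod_snd E A D" "app (FA M (gam ?y)) t"] gt prodD by simp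
      also have "\<dots> = app (g D) t" using retr_app[OF FM t] by simp
      finally show "app (smap (FO M ?y) (FO N ?y) (x ?y)) t = app (g D) t" using t by (simp add: app_smap)
    qed (use gD ob x(1)[OF y] in \<open>simp_all add: smap_Arr smap_Dom smap_Cod\<close>)
  qed
  with X that show ?thesis by (simp add: FO_Obj[OF PF])
qed

text \<open>Faithfulness is \<open>etale_thin\<close>. For triangles, \<open>k\<close> and
  \<open>h\<close> preserve the elements \<open>sec\<close>, hence so does \<open>g\<close>, and
  \<open>etale_full\<close> applies. For lifts, the generic element of \<open>a\<close> is carried
  along \<open>f\<close>, and the fibre point of \<open>y\<close> at the result is the
  target.\<close>

lemma discof_etale: "discof E (slice E A) (product_functor E A)"
  unfolding discof_def
proof (intro conjI allI impI)
  let ?S = "slice E A" and ?P = "product_functor E A"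
  fix a b s t assume b: "geo ?S SetCat b" and st: "ntrans ?S SetCat a b s" "ntrans ?S SetCat a b t"
    "\<forall>D\<in>Obj E. s (FO ?P D) = t (FO ?P D)"
  then show "s = t" by (intro etale_thin[OF st(1,2) geo_left_exact[OF b]]) simp
next
  let ?S = "slice E A" and ?P = "product_functor E A"
  fix a b c k h g assume a: "geo ?S SetCat a" and b: "geo ?S SetCat b" and c: "geo ?S SetCat c"
    and k: "ntrans ?S SetCat a b k" and h: "ntrans ?S SetCat a c h"
    and g: "ntrans E SetCat (cmp_func b ?P) (cmp_func c ?P) g"
    and e: "\<forall>D\<in>Obj E. Cmp SetCat (g D) (k (FO ?P D)) = h (FO ?P D)"
  note F = geo_functor[OF a] geo_functor[OF b] geo_functor[OF c]
  note l = geo_left_exact[OF a] geo_left_exact[OF b] geo_left_exact[OF c]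
  have PA: "FO ?P A \<in> Obj ?S" using A FO_Obj[OF PF] by simp
  have sa: "sec a \<in> elts (FO a (FO ?P A))"
    using app_FA_in[OF F(1) del(1), of "star a"] star(1)[OF F(1) l(1)] by (simp add: del sec_def)
  have "app (g A) (sec b) = sec c"
    using sec_natural[OF l(1,2) k] sec_natural[OF l(1,3) h] arg_cong[OF bspec[OF e A], of "\<lambda>m. app m (sec a)"] sa
    by (simp add: app_Cmp ntrans_simps[OF k PA])
  from etale_full[OF F(2) l(2) F(3) l(3) g this]
  show "\<exists>x. ntrans ?S SetCat b c x \<and> (\<forall>D\<in>Obj E. x (FO ?P D) = g D)" by metis
next
  let ?S = "slice E A" and ?P = "product_functor E A"
  fix a y f assume a: "geo ?S SetCat a" and y: "geo E SetCat y" and f: "ntrans E SetCat (cmp_func a ?P) y f"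
  note Fa = geo_functor[OF a] and Fy = geo_functor[OF y] and la = geo_left_exact[OF a] and ly = geo_left_exact[OF y]
  note [simp] = functor_simps[OF Fa] functor_simps[OF Fy] functor_simps[OF PF] cmp_func_simps cat_simps[OF E]
  \<comment> \<open>The image under \<open>f\<close> of the element that \<open>a\<close> assigns to
    the generic section; an arrow of points over \<open>f\<close> leaves no other choice.\<close>
  define s where "s = app (f A) (sec a)"
  have sa: "sec a \<in> elts (FO a (FO ?P A))"
    using app_FA_in[OF Fa del(1), of "star a"] star(1)[OF Fa la] by (simp add: del sec_def)
  have s: "s \<in> elts (FO y A)" using ntrans_app[OF f A, of "sec a"] sa A by (simp add: s_def)
  let ?W = "fiber_point E A y s"
  note W = functor_fiber_point[OF Fy S A s]
  note Wel = fiber_point_elts[OF Fy S A s] and Wap = fiber_point_app[OF Fy S A s]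
  have pb: "\<exists>c. is_pullback E u v c" if "u \<in> Arr E" "v \<in> Arr E" "Cod E u = Cod E v" for u v
    using topos_pullback[OF geo_dom[OF P] that] by blast
  have gW: "geo ?S SetCat ?W"
  proof -
    have "\<exists>R e. universal_arrow ?S SetCat ?W T R e" if "T \<in> Obj SetCat" for T
      by (rule universal_arrow_fiber_point[OF Fy S A s geo_inverse_image[OF y] that pb])
    then show ?thesis
      using geo_cod[OF P] geo_cod[OF y] W left_exact_fiber_point[OF Fy S A s ly]
      unfolding geo_def inverse_image_def by blast
  qed
  note [simp] = functor_simps[OF W]
  have WP: "functor_from_to (cmp_func ?W ?P) E SetCat" by (rule functor_cmp[OF PF W])
  have PD: "FO ?P D \<in> Arr E" "Cod E (FO ?P D) = A" "Dom E (FO ?P D) = prod_obj E A D" if "D \<in> Obj E" for D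
    using that prod_fst[OF that] by (simp_all add: P_FO)
  have el: "t \<in> elts (FO ?W (FO ?P D)) \<longleftrightarrow> t \<in> elts (FO y (prod_obj E A D)) \<and> app (FA y (prod_fst E A D)) t = s"
    if "D \<in> Obj E" for D t
    using Wel[OF PD(1,2)[OF that], of t] PD(3)[OF that] that by (simp add: P_FO)
  \<comment> \<open>The lift at \<open>A\<close> times \<open>D\<close> consists of pairs with first
    component \<open>s\<close>; the second projection identifies it with \<open>y\<close> at
    \<open>D\<close>.\<close>
  define sg where "sg = (\<lambda>D\<in>Obj E. smap (FO (cmp_func ?W ?P) D) (FO y D) (app (FA y (prod_snd E A D))))"
  have SG: "ntrans E SetCat (cmp_func ?W ?P) y sg"
    unfolding sg_def
  proof (rule ntrans_smap[OF WP Fy])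
    fix c x assume c: "c \<in> Obj E" and x: "x \<in> elts (FO (cmp_func ?W ?P) c)"
    then show "app (FA y (prod_snd E A c)) x \<in> elts (FO y c)"
      using app_FA_in[OF Fy prod_snd(1)[OF c], of x] prod_snd[OF c] by (simp add: el)
  next
    fix u x assume u: "u \<in> Arr E" and x: "x \<in> elts (FO (cmp_func ?W ?P) (Dom E u))"
    note [simp] = u prod_fst prod_snd prod_Obj pr_Arr pr_Dom pr_Cod
    have x': "x \<in> elts (FO y (prod_obj E A (Dom E u)))" using x by (simp add: el)
    let ?k = "pr (prod_fst E A (Dom E u)) (Cmp E u (prod_snd E A (Dom E u)))"
    have "app (FA ?W (FA ?P u)) x = app (FA y ?k) x"
    proof -
      have "tsnd (FA ?P u) = ?k" by (simp add: P_FA)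
      then show ?thesis using Wap[OF FA_Arr[OF PF u], of x] x by simp
    qed
    moreover have "app (FA y (prod_snd E A (Cod E u))) (app (FA y ?k) x) = app (FA y (Cmp E (prod_snd E A (Cod E u)) ?k)) x"
      by (subst app_FA_Cmp[OF Fy]) (use x' in simp_all)
    moreover have "\<dots> = app (FA y u) (app (FA y (prod_snd E A (Dom E u))) x)"
      using pr_snd[of "prod_fst E A (Dom E u)" "Cmp E u (prod_snd E A (Dom E u))"]
        app_FA_Cmp[OF Fy, of "prod_snd E A (Dom E u)" u x] x' by (simp del: FA_Cmp[OF Fy])
    ultimately show "app (FA y (prod_snd E A (Cod E u))) (app (FA (cmp_func ?W ?P) u) x) =
      app (FA y u) (app (FA y (prod_snd E A (Dom E u))) x)" by simp
  qed
  have sga: "app (sg D) t = app (FA y (prod_snd E A D)) t" if "D \<in> Obj E" "t \<in> elts (FO ?W (FO ?P D))" for D t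
    using that by (simp add: sg_def app_smap)
  have iSG: "ntiso E SetCat (cmp_func ?W ?P) y sg"
    unfolding ntiso_def
  proof (intro conjI SG ballI)
    fix D assume D: "D \<in> Obj E"
    have "is_product SetCat (FO y A) (FO y D) (FO y (prod_obj E A D), FA y (prod_fst E A D), FA y (prod_snd E A D))"
      by (rule left_exact_product[OF Fy ly]) (use prod[OF D] in \<open>simp add: is_product_univ_span\<close>)
    note pe = product_elts[OF this s]
    have "bij_betw (app (sg D)) (elts (FO ?W (FO ?P D))) (elts (FO y D))"
    proof (rule bij_betwI')
      fix t assume t: "t \<in> elts (FO ?W (FO ?P D))"
      show "app (sg D) t \<in> elts (FO y D)" using ntrans_app[OF SG D, of t] t D by simp
      fix t' assume t': "t' \<in> elts (FO ?W (FO ?P D))"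
      have "app (FA y (prod_snd E A D)) t \<in> elts (FO y D)"
        using ntrans_app[OF SG D, of t] t D by (simp add: sga)
      note u = pe[OF this]
      have "t = t'" if "app (sg D) t = app (sg D) t'"
        using u that sga[OF D t] sga[OF D t'] t t' el[OF D] by metis
      then show "app (sg D) t = app (sg D) t' \<longleftrightarrow> t = t'" by blast
    next
      fix d assume "d \<in> elts (FO y D)"
      from pe[OF this] show "\<exists>t\<in>elts (FO ?W (FO ?P D)). d = app (sg D) t"
        using D by (metis el sga)
    qed
    then show "iso_arr SetCat (sg D)"
      using D by (intro iso_SetCat) (simp_all add: ntrans_simps[OF SG])
  qed
  define g where "g = (\<lambda>D\<in>Obj E. Cmp SetCat ((\<lambda>D\<in>Obj E. inv_arr SetCat (sg D)) D) (f D))"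
  have g: "ntrans E SetCat (cmp_func a ?P) (cmp_func ?W ?P) g"
    unfolding g_def by (rule ntrans_vcmp[OF f ntiso_ntrans[OF ntiso_inv[OF iSG]]])
  have sgg: "Cmp SetCat (sg D) (g D) = f D" if "D \<in> Obj E" for D
    using Cmp_inv_right[OF category_SetCat ntiso_iso[OF iSG that], of "f D"] that
    by (simp add: g_def ntrans_simps[OF f] ntrans_simps[OF SG])
  \<comment> \<open>This is the hypothesis of \<open>etale_full\<close> on generic elements. It is
    checked through the bijection \<open>sg A\<close>, under which both sides become
    \<open>s\<close>; for \<open>sec ?W\<close> because the second projection undoes the
    diagonal.\<close>
  have secW: "sec ?W = app (g A) (sec a)"
  proof -
    note [simp] = prod_fst prod_snd prod_Obj pr_Arr pr_Dom pr_Cod A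
    have lW: "left_exact ?W" by (rule geo_left_exact[OF gW])
    have "s \<in> elts (FO ?W (Idn E A))"
      using Wel[of "Idn E A" s] s app_FA_Idn[OF Fy A s] by (simp del: FA_Idn[OF Fy])
    then have st: "star ?W = s" by (rule star(2)[OF W lW, symmetric])
    let ?d = "pr (Idn E A) (Idn E A)"
    have sW: "sec ?W = app (FA y ?d) s"
      using Wap[OF del(1), of s] \<open>s \<in> elts (FO ?W (Idn E A))\<close>
      by (simp add: sec_def st del) (simp add: del_def gam_def)
    have sWin: "sec ?W \<in> elts (FO ?W (FO ?P A))"
      using app_FA_in[OF W del(1), of "star ?W"] star(1)[OF W lW] by (simp add: del sec_def)
    have gin: "app (g A) (sec a) \<in> elts (FO ?W (FO ?P A))"
      using ntrans_app[OF g A, of "sec a"] sa by simp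
    have "app (sg A) (sec ?W) = app (FA y (Cmp E (prod_snd E A A) ?d)) s"
      using sWin app_FA_Cmp[OF Fy, of ?d "prod_snd E A A" s] s by (simp add: sga sW del: FA_Cmp[OF Fy])
    also have "\<dots> = s"
      using pr_snd[of "Idn E A" "Idn E A"] app_FA_Idn[OF Fy A s] by (simp del: FA_Idn[OF Fy])
    also have "s = app (sg A) (app (g A) (sec a))"
      using arg_cong[OF sgg[OF A], of "\<lambda>m. app m (sec a)"] sa by (simp add: s_def app_Cmp ntrans_simps[OF g])
    finally have "app (sg A) (sec ?W) = app (sg A) (app (g A) (sec a))" .
    then have "app (inv_arr SetCat (sg A)) (app (sg A) (sec ?W)) = app (inv_arr SetCat (sg A)) (app (sg A) (app (g A) (sec a)))"
      by simp
    moreover have "app (inv_arr SetCat (sg A)) (app (sg A) t) = t" if t: "t \<in> elts (FO ?W (FO ?P A))" for t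
      using arg_cong[OF inv_left[OF ntiso_iso[OF iSG A]], of "\<lambda>m. app m t"] t
      by (simp add: ntrans_simps[OF SG] app_Cmp app_Idn)
    ultimately show ?thesis using sWin gin by simp
  qed
  obtain k where k: "ntrans ?S SetCat a ?W k" "\<forall>D\<in>Obj E. k (FO ?P D) = g D"
    by (rule etale_full[OF Fa la W geo_left_exact[OF gW] g secW[symmetric]])
  show "\<exists>b k s. geo ?S SetCat b \<and> ntrans ?S SetCat a b k \<and> ntiso E SetCat (cmp_func b ?P) y s \<and>
        (\<forall>D\<in>Obj E. Cmp SetCat (s D) (k (FO ?P D)) = f D)"
    using gW k iSG sgg by (intro exI[of _ ?W] exI[of _ k] exI[of _ sg]) simp
qed

end

section \<open>The 2-category of topoi and its pseudoslices\<close>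

lemma GTop_simps:
  "cells0 GTop = {E. grothendieck_topos E}"
  "src GTop = gsrc" "tgt GTop = gtgt" "dom2 GTop = TDom" "cod2 GTop = TCod" "id1 GTop = id_geom"
  "id2 GTop f = \<lparr>TDom = f, TCod = f, TMap = (\<lambda>D\<in>Obj (gtgt f). Idn (gsrc f) (FO (pull f) D))\<rparr>"
  "cmp1 GTop = cmp_geom"
  "vcmp GTop b a = \<lparr>TDom = TDom a, TCod = TCod b,
       TMap = (\<lambda>D\<in>Obj (gtgt (TDom a)). Cmp (gsrc (TDom a)) (TMap b D) (TMap a D))\<rparr>"
  "hcmp GTop b a = \<lparr>TDom = cmp_geom (TDom b) (TDom a), TCod = cmp_geom (TCod b) (TCod a),
       TMap = (\<lambda>D\<in>Obj (gtgt (TDom b)). Cmp (gsrc (TDom a))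
         (TMap a (FO (pull (TCod b)) D)) (FA (pull (TDom a)) (TMap b D)))\<rparr>"
  by (simp_all add: GTop_def Let_def)

lemma cells1_GTop: "f \<in> cells1 GTop \<longleftrightarrow>
    geometric_morphism f \<and> grothendieck_topos (gsrc f) \<and> grothendieck_topos (gtgt f)"
  by (simp add: GTop_def Let_def)

lemma cells1_geo: "f \<in> cells1 GTop \<Longrightarrow> geo (gtgt f) (gsrc f) (pull f)"
  by (simp add: cells1_GTop geo_def inverse_image_pull)

text \<open>The way back from inverse images to 1-cells of \<open>GTop\<close>: a direct image is
  chosen by means of the universal arrows.\<close>

lemma geo_cells1:
  assumes "geo E X F"
  obtains f where "f \<in> cells1 GTop" "pull f = F" "gsrc f = X" "gtgt f = E"
proof -
  obtain f where f: "geometric_morphism f" "pull f = F"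
    using geometric_morphism_of_inverse_image[OF geo_inverse_image[OF assms]] by blast
  have "gsrc f = X" "gtgt f = E"
    using f(2) geo_functor[OF assms] by (simp_all add: gsrc_def gtgt_def functor_simps)
  with f assms that show ?thesis by (simp add: cells1_GTop geo_def)
qed

lemma cells1_cmp: "f \<in> cells1 GTop \<Longrightarrow> g \<in> cells1 GTop \<Longrightarrow> gsrc g = gtgt f \<Longrightarrow> cmp_geom g f \<in> cells1 GTop"
  by (simp add: cells1_GTop geometric_morphism_cmp cmp_geom_simps)

lemma cells1_id: "grothendieck_topos E \<Longrightarrow> id_geom E \<in> cells1 GTop"
  by (simp add: cells1_GTop geometric_morphism_id topos_category) (simp add: gsrc_def gtgt_def id_geom_def id_func_def)

lemma hom2_GTop: "a \<in> hom2 GTop f g \<longleftrightarrow> TDom a = f \<and> TCod a = g \<and> f \<in> cells1 GTop \<and> g \<in> cells1 GTop \<and>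
    ntrans (gtgt f) (gsrc f) (pull f) (pull g) (TMap a)"
  unfolding hom2_def
  by (auto simp: GTop_simps natural_iff_ntrans gtgt_def gsrc_def) (auto simp: GTop_def Let_def natural_iff_ntrans)

lemma hom2_GTop_src: "a \<in> hom2 GTop f g \<Longrightarrow> gsrc g = gsrc f \<and> gtgt g = gtgt f"
  unfolding hom2_GTop using FDom_eq FCod_eq ntrans_cod by (metis gsrc_def gtgt_def)

text \<open>Componentwise inverses of a natural transformation are again natural, so invertibility
  of a 2-cell is tested in the source topos.\<close>

lemma iso2_GTop: "a \<in> iso2 GTop f g \<longleftrightarrow> TDom a = f \<and> TCod a = g \<and> f \<in> cells1 GTop \<and> g \<in> cells1 GTop \<and>
    ntiso (gtgt f) (gsrc f) (pull f) (pull g) (TMap a)"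
proof
  assume a: "a \<in> iso2 GTop f g"
  then have a2: "a \<in> hom2 GTop f g" by (simp add: iso2_def)
  obtain b where b: "b \<in> hom2 GTop g f" and i: "vcmp GTop b a = id2 GTop f" "vcmp GTop a b = id2 GTop g"
    using a by (auto simp: iso2_def)
  have sg: "gsrc g = gsrc f" "gtgt g = gtgt f" using hom2_GTop_src[OF a2] by simp_all
  have ta: "ntrans (gtgt f) (gsrc f) (pull f) (pull g) (TMap a)" and tb: "ntrans (gtgt f) (gsrc f) (pull g) (pull f) (TMap b)"
    using a2 b by (simp_all add: hom2_GTop sg)
  have d: "TDom a = f" "TDom b = g" using a2 b by (simp_all add: hom2_GTop)
  have "iso_arr (gsrc f) (TMap a D)" if D: "D \<in> Obj (gtgt f)" for D
  proof (rule iso_arrI[of _ _ "TMap b D"])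
    show "Cmp (gsrc f) (TMap b D) (TMap a D) = Idn (gsrc f) (Dom (gsrc f) (TMap a D))"
      using fun_cong[OF arg_cong[OF i(1), of TMap], of D] D by (simp add: GTop_simps d ntrans_simps[OF ta])
    show "Cmp (gsrc f) (TMap a D) (TMap b D) = Idn (gsrc f) (Cod (gsrc f) (TMap a D))"
      using fun_cong[OF arg_cong[OF i(2), of TMap], of D] D by (simp add: GTop_simps d sg ntrans_simps[OF ta])
  qed (use D in \<open>simp_all add: ntrans_simps[OF ta] ntrans_simps[OF tb]\<close>)
  then show "TDom a = f \<and> TCod a = g \<and> f \<in> cells1 GTop \<and> g \<in> cells1 GTop \<and> ntiso (gtgt f) (gsrc f) (pull f) (pull g) (TMap a)"
    using a2 by (auto simp: hom2_GTop ntiso_def)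
next
  assume a: "TDom a = f \<and> TCod a = g \<and> f \<in> cells1 GTop \<and> g \<in> cells1 GTop \<and> ntiso (gtgt f) (gsrc f) (pull f) (pull g) (TMap a)"
  then have t: "ntiso (gtgt f) (gsrc f) (pull f) (pull g) (TMap a)" by simp
  have a2: "a \<in> hom2 GTop f g" using a by (simp add: hom2_GTop ntiso_def)
  have sg: "gsrc g = gsrc f" "gtgt g = gtgt f" using hom2_GTop_src[OF a2] by simp_all
  define b where "b = \<lparr>TDom = g, TCod = f, TMap = (\<lambda>D\<in>Obj (gtgt f). inv_arr (gsrc f) (TMap a D))\<rparr>"
  have b: "b \<in> hom2 GTop g f"
    using ntiso_ntrans[OF ntiso_inv[OF t]] a by (simp add: hom2_GTop b_def sg)
  have "vcmp GTop b a = id2 GTop f" "vcmp GTop a b = id2 GTop g"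
    using a inv_left[OF ntiso_iso[OF t]] inv_right[OF ntiso_iso[OF t]] ntrans_simps[OF ntiso_ntrans[OF t]]
    by (simp_all add: GTop_simps b_def sg cong: restrict_cong)
  then show "a \<in> iso2 GTop f g" using a2 b by (auto simp: iso2_def)
qed

text \<open>Normal form of a triangle: source and target of its 2-cell are determined by the other
  data, so only the components \<open>i\<close> are free.\<close>

definition tri :: "'w geom \<Rightarrow> 'w geom \<Rightarrow> 'w geom \<Rightarrow> ('w \<Rightarrow> 'w) \<Rightarrow> ('w geom, ('w geom, 'w, 'w) trans) triangle" where
  "tri q r h i = \<lparr>tri_src = q, tri_tgt = r, tri_cell = h, tri_iso = \<lparr>TDom = q, TCod = cmp_geom r h, TMap = i\<rparr>\<rparr>"

text \<open>Likewise for 2-cells of the pseudoslice: \<open>m\<close> and \<open>n\<close> determine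
  the boundary of the underlying 2-cell of \<open>GTop\<close>.\<close>

definition c2 :: "('w geom, ('w geom, 'w, 'w) trans) triangle \<Rightarrow> ('w geom, ('w geom, 'w, 'w) trans) triangle \<Rightarrow> ('w \<Rightarrow> 'w) \<Rightarrow>
    ('w geom, ('w geom, 'w, 'w) trans) triangle \<times> ('w geom, ('w geom, 'w, 'w) trans) triangle \<times> ('w geom, 'w, 'w) trans" where
  "c2 m n t = (m, n, \<lparr>TDom = tri_cell m, TCod = tri_cell n, TMap = t\<rparr>)"

lemma tri_simps: "tri_src (tri q r h i) = q" "tri_tgt (tri q r h i) = r" "tri_cell (tri q r h i) = h"
  "TMap (tri_iso (tri q r h i)) = i"
  by (simp_all add: tri_def)

lemma slice_cells0: "cells0 (pseudoslice GTop E) = {p \<in> cells1 GTop. gtgt p = E}"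
  by (simp add: pseudoslice_def Let_def GTop_simps)

lemma slice_cells1: "m \<in> cells1 (pseudoslice GTop E) \<longleftrightarrow>
    m = tri (tri_src m) (tri_tgt m) (tri_cell m) (TMap (tri_iso m)) \<and>
    tri_src m \<in> cells1 GTop \<and> gtgt (tri_src m) = E \<and> tri_tgt m \<in> cells1 GTop \<and> gtgt (tri_tgt m) = E \<and>
    tri_cell m \<in> cells1 GTop \<and> gsrc (tri_cell m) = gsrc (tri_src m) \<and> gtgt (tri_cell m) = gsrc (tri_tgt m) \<and>
    ntiso E (gsrc (tri_src m)) (pull (tri_src m)) (cmp_func (pull (tri_cell m)) (pull (tri_tgt m))) (TMap (tri_iso m))"
proof -
  have "m \<in> cells1 (pseudoslice GTop E) \<longleftrightarrow> tri_src m \<in> cells1 GTop \<and> gtgt (tri_src m) = E \<and> tri_tgt m \<in> cells1 GTop \<and>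
      gtgt (tri_tgt m) = E \<and> tri_cell m \<in> cells1 GTop \<and> gsrc (tri_cell m) = gsrc (tri_src m) \<and>
      gtgt (tri_cell m) = gsrc (tri_tgt m) \<and> tri_iso m \<in> iso2 GTop (tri_src m) (cmp_geom (tri_tgt m) (tri_cell m))"
    by (auto simp: pseudoslice_def Let_def GTop_simps hom1_def)
  moreover have "m = tri (tri_src m) (tri_tgt m) (tri_cell m) (TMap (tri_iso m)) \<longleftrightarrow>
      TDom (tri_iso m) = tri_src m \<and> TCod (tri_iso m) = cmp_geom (tri_tgt m) (tri_cell m)"
    by (cases m, cases "tri_iso m") (auto simp: tri_def)
  ultimately show ?thesis
    by (auto simp: iso2_GTop cmp_geom_simps cells1_cmp)
qed

lemma slice_hom1: "m \<in> hom1 (pseudoslice GTop E) q r \<longleftrightarrow> m \<in> cells1 (pseudoslice GTop E) \<and> tri_src m = q \<and> tri_tgt m = r"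
  by (simp add: hom1_def pseudoslice_def Let_def)

lemma slice_tri:
  "tri q r h i \<in> hom1 (pseudoslice GTop E) q r \<longleftrightarrow> q \<in> cells1 GTop \<and> gtgt q = E \<and> r \<in> cells1 GTop \<and> gtgt r = E \<and>
    h \<in> cells1 GTop \<and> gsrc h = gsrc q \<and> gtgt h = gsrc r \<and>
    ntiso E (gsrc q) (pull q) (cmp_func (pull h) (pull r)) i"
  unfolding slice_hom1 slice_cells1 by (simp add: tri_simps)

lemma
  assumes "m \<in> cells1 (pseudoslice GTop E)"
  shows slice_src: "tri_src m \<in> cells1 GTop" "gtgt (tri_src m) = E"
    and slice_tgt: "tri_tgt m \<in> cells1 GTop" "gtgt (tri_tgt m) = E"
    and slice_cell: "tri_cell m \<in> cells1 GTop" "gsrc (tri_cell m) = gsrc (tri_src m)" "gtgt (tri_cell m) = gsrc (tri_tgt m)"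
    and slice_iso: "ntiso E (gsrc (tri_src m)) (pull (tri_src m)) (cmp_func (pull (tri_cell m)) (pull (tri_tgt m))) (TMap (tri_iso m))"
    and slice_pull_tgt: "functor_from_to (pull (tri_tgt m)) E (gsrc (tri_tgt m))"
    and slice_pull_cell: "functor_from_to (pull (tri_cell m)) (gsrc (tri_tgt m)) (gsrc (tri_src m))"
    and slice_pull_src: "functor_from_to (pull (tri_src m)) E (gsrc (tri_src m))"
proof -
  note m = assms[unfolded slice_cells1]
  show "tri_src m \<in> cells1 GTop" "gtgt (tri_src m) = E" "tri_tgt m \<in> cells1 GTop" "gtgt (tri_tgt m) = E"
    "tri_cell m \<in> cells1 GTop" "gsrc (tri_cell m) = gsrc (tri_src m)" "gtgt (tri_cell m) = gsrc (tri_tgt m)"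
    "ntiso E (gsrc (tri_src m)) (pull (tri_src m)) (cmp_func (pull (tri_cell m)) (pull (tri_tgt m))) (TMap (tri_iso m))"
    using m by blast+
  show "functor_from_to (pull (tri_tgt m)) E (gsrc (tri_tgt m))"
    "functor_from_to (pull (tri_cell m)) (gsrc (tri_tgt m)) (gsrc (tri_src m))"
    "functor_from_to (pull (tri_src m)) E (gsrc (tri_src m))"
    using geo_functor[OF cells1_geo, of "tri_tgt m"] geo_functor[OF cells1_geo, of "tri_cell m"]
      geo_functor[OF cells1_geo, of "tri_src m"] m by auto
qed

lemma tri_eqI:
  assumes "m \<in> cells1 (pseudoslice GTop E)" "n \<in> cells1 (pseudoslice GTop E)"
    and "tri_src m = tri_src n" "tri_tgt m = tri_tgt n" "tri_cell m = tri_cell n"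
    and "\<And>D. D \<in> Obj E \<Longrightarrow> TMap (tri_iso m) D = TMap (tri_iso n) D"
  shows "m = n"
proof -
  have "TMap (tri_iso m) = TMap (tri_iso n)"
    using ntrans_ext[OF ntiso_ntrans[OF slice_iso[OF assms(1)]]] ntrans_ext[OF ntiso_ntrans[OF slice_iso[OF assms(2)]]] assms(6)
    by (rule extensionalityI)
  then show ?thesis using assms(1-5) unfolding slice_cells1 by metis
qed

text \<open>The condition of lying over \<open>E\<close> equates pasted 2-cells of
  \<open>GTop\<close>. It becomes an equation of components here, since whiskering with
  \<open>tri_tgt m\<close> amounts to evaluating \<open>t\<close> at
  \<open>FO (pull (tri_tgt m)) D\<close>.\<close>

lemma slice_hom2: "x \<in> hom2 (pseudoslice GTop E) m n \<longleftrightarrow> (\<exists>t. x = c2 m n t \<and>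
    m \<in> cells1 (pseudoslice GTop E) \<and> n \<in> cells1 (pseudoslice GTop E) \<and> tri_src m = tri_src n \<and> tri_tgt m = tri_tgt n \<and>
    ntrans (gsrc (tri_tgt m)) (gsrc (tri_src m)) (pull (tri_cell m)) (pull (tri_cell n)) t \<and>
    (\<forall>D\<in>Obj E. Cmp (gsrc (tri_src m)) (t (FO (pull (tri_tgt m)) D)) (TMap (tri_iso m) D) = TMap (tri_iso n) D))"
  (is "_ \<longleftrightarrow> (\<exists>t. ?R t)")
proof -
  let ?K = "pseudoslice GTop E"
  have key: "vcmp GTop (whisker_left GTop (tri_tgt m) a) (tri_iso m) = tri_iso n \<longleftrightarrow>
      (\<forall>D\<in>Obj E. Cmp (gsrc (tri_src m)) (TMap a (FO (pull (tri_tgt m)) D)) (TMap (tri_iso m) D) = TMap (tri_iso n) D)"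
    if m: "m \<in> cells1 ?K" and n: "n \<in> cells1 ?K" and mn: "tri_src m = tri_src n" "tri_tgt m = tri_tgt n"
      and a: "TDom a = tri_cell m" "TCod a = tri_cell n"
      and t: "ntrans (gsrc (tri_tgt m)) (gsrc (tri_src m)) (pull (tri_cell m)) (pull (tri_cell n)) (TMap a)" for a
  proof -
    note [simp] = slice_src[OF m] slice_tgt[OF m] slice_cell[OF m] functor_simps[OF slice_pull_tgt[OF m]]
      functor_simps[OF slice_pull_cell[OF m]] cat_simps[OF functor_category_cod[OF slice_pull_cell[OF m]]]
      cat_simps[OF functor_category_cod[OF slice_pull_tgt[OF m]]] ntrans_simps[OF t]
    have i: "TDom (tri_iso m) = tri_src m" "TCod (tri_iso m) = cmp_geom (tri_tgt m) (tri_cell m)"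
      "TDom (tri_iso n) = tri_src n" "TCod (tri_iso n) = cmp_geom (tri_tgt n) (tri_cell n)"
      using m n unfolding slice_cells1 by (metis tri_def triangle.simps(4) trans.simps(1,2))+
    have ext: "TMap (tri_iso n) \<in> extensional (Obj E)"
      by (rule ntrans_ext[OF ntiso_ntrans[OF slice_iso[OF n]]])
    have "vcmp GTop (whisker_left GTop (tri_tgt m) a) (tri_iso m) = \<lparr>TDom = tri_src m, TCod = cmp_geom (tri_tgt m) (tri_cell n),
        TMap = (\<lambda>D\<in>Obj E. Cmp (gsrc (tri_src m)) (TMap a (FO (pull (tri_tgt m)) D)) (TMap (tri_iso m) D))\<rparr>"
      by (simp add: GTop_simps a i cong: restrict_cong)
    also have "\<dots> = tri_iso n \<longleftrightarrow> (\<lambda>D\<in>Obj E. Cmp (gsrc (tri_src m)) (TMap a (FO (pull (tri_tgt m)) D)) (TMap (tri_iso m) D)) = TMap (tri_iso n)"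
      using i mn by (cases "tri_iso n") auto
    also have "\<dots> \<longleftrightarrow> (\<forall>D\<in>Obj E. Cmp (gsrc (tri_src m)) (TMap a (FO (pull (tri_tgt m)) D)) (TMap (tri_iso m) D) = TMap (tri_iso n) D)"
      using ext by (auto simp: fun_eq_iff extensional_def)
    finally show ?thesis .
  qed
  have cell2: "(m', n', a) \<in> cells2 ?K \<longleftrightarrow> m' \<in> cells1 ?K \<and> n' \<in> cells1 ?K \<and> tri_src m' = tri_src n' \<and> tri_tgt m' = tri_tgt n' \<and>
      a \<in> hom2 GTop (tri_cell m') (tri_cell n') \<and> vcmp GTop (whisker_left GTop (tri_tgt m') a) (tri_iso m') = tri_iso n'" for m' n' a
    by (simp add: pseudoslice_def Let_def)
  have dc: "dom2 ?K (m', n', a) = m'" "cod2 ?K (m', n', a) = n'" for m' n' a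
    by (simp_all add: pseudoslice_def Let_def)
  show ?thesis
  proof
    assume x: "x \<in> hom2 ?K m n"
    obtain a where xa: "x = (m, n, a)" using x dc unfolding hom2_def by (cases x) auto
    have "(m, n, a) \<in> cells2 ?K" using x by (simp add: xa hom2_def[of ?K])
    then have x': "m \<in> cells1 ?K" "n \<in> cells1 ?K" "tri_src m = tri_src n" "tri_tgt m = tri_tgt n"
      "a \<in> hom2 GTop (tri_cell m) (tri_cell n)" and v: "vcmp GTop (whisker_left GTop (tri_tgt m) a) (tri_iso m) = tri_iso n"
      unfolding cell2 by blast+
    have a: "TDom a = tri_cell m" "TCod a = tri_cell n"
      and t: "ntrans (gsrc (tri_tgt m)) (gsrc (tri_src m)) (pull (tri_cell m)) (pull (tri_cell n)) (TMap a)"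
      using x'(5) slice_cell[OF x'(1)] by (simp_all add: hom2_GTop)
    have "x = c2 m n (TMap a)" using a by (cases a) (simp add: xa c2_def)
    then show "\<exists>t. ?R t" using x' t key[OF x'(1-4) a t] v by blast
  next
    assume "\<exists>t. ?R t"
    then obtain t where xt: "x = c2 m n t" and m: "m \<in> cells1 ?K" and n: "n \<in> cells1 ?K"
      and e: "tri_src m = tri_src n" "tri_tgt m = tri_tgt n"
      and t: "ntrans (gsrc (tri_tgt m)) (gsrc (tri_src m)) (pull (tri_cell m)) (pull (tri_cell n)) t"
      and o: "\<forall>D\<in>Obj E. Cmp (gsrc (tri_src m)) (t (FO (pull (tri_tgt m)) D)) (TMap (tri_iso m) D) = TMap (tri_iso n) D"
      by blast
    let ?a = "\<lparr>TDom = tri_cell m, TCod = tri_cell n, TMap = t\<rparr>"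
    have "?a \<in> hom2 GTop (tri_cell m) (tri_cell n)"
      using t slice_cell[OF m] slice_cell[OF n] by (simp add: hom2_GTop)
    then show "x \<in> hom2 ?K m n"
      using m n e o key[OF m n e, of ?a] t
      by (simp only: hom2_def[of ?K] xt c2_def cell2 dc mem_Collect_eq trans.simps simp_thms)
  qed
qed

lemma slice_c2: "c2 m n t \<in> hom2 (pseudoslice GTop E) m n \<longleftrightarrow>
    m \<in> cells1 (pseudoslice GTop E) \<and> n \<in> cells1 (pseudoslice GTop E) \<and> tri_src m = tri_src n \<and> tri_tgt m = tri_tgt n \<and>
    ntrans (gsrc (tri_tgt m)) (gsrc (tri_src m)) (pull (tri_cell m)) (pull (tri_cell n)) t \<and>
    (\<forall>D\<in>Obj E. Cmp (gsrc (tri_src m)) (t (FO (pull (tri_tgt m)) D)) (TMap (tri_iso m) D) = TMap (tri_iso n) D)"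
  unfolding slice_hom2 by (auto simp: c2_def)

lemma slice_ops:
  "vcmp (pseudoslice GTop E) (c2 n' r s) (c2 m n t) =
    c2 m r (\<lambda>D\<in>Obj (gtgt (tri_cell m)). Cmp (gsrc (tri_cell m)) (s D) (t D))"
  "id2 (pseudoslice GTop E) m = c2 m m (\<lambda>D\<in>Obj (gtgt (tri_cell m)). Idn (gsrc (tri_cell m)) (FO (pull (tri_cell m)) D))"
  "hcmp (pseudoslice GTop E) (c2 m' n' s) (c2 m n t) =
    c2 (cmp1 (pseudoslice GTop E) m' m) (cmp1 (pseudoslice GTop E) n' n)
      (\<lambda>D\<in>Obj (gtgt (tri_cell m')). Cmp (gsrc (tri_cell m)) (t (FO (pull (tri_cell n')) D)) (FA (pull (tri_cell m)) (s D)))"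
  by (simp_all add: c2_def pseudoslice_def Let_def GTop_simps)

lemma slice_cmp1:
  assumes m: "m \<in> hom1 (pseudoslice GTop E) q r" and m': "m' \<in> hom1 (pseudoslice GTop E) r r'"
  shows "cmp1 (pseudoslice GTop E) m' m = tri q r' (cmp_geom (tri_cell m') (tri_cell m))
      (\<lambda>D\<in>Obj E. Cmp (gsrc q) (FA (pull (tri_cell m)) (TMap (tri_iso m') D)) (TMap (tri_iso m) D))"
    and slice_cmp1_hom1: "cmp1 (pseudoslice GTop E) m' m \<in> hom1 (pseudoslice GTop E) q r'"
proof -
  let ?K = "pseudoslice GTop E"
  have M: "m \<in> cells1 ?K" "tri_src m = q" "tri_tgt m = r" and M': "m' \<in> cells1 ?K" "tri_src m' = r" "tri_tgt m' = r'"
    using m m' by (simp_all add: slice_hom1)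
  note F = slice_pull_cell[OF M(1), unfolded M] and F' = slice_pull_cell[OF M'(1), unfolded M']
    and R = slice_pull_tgt[OF M'(1), unfolded M'] and Rs = slice_pull_src[OF M'(1), unfolded M']
    and i = slice_iso[OF M(1), unfolded M] and i' = slice_iso[OF M'(1), unfolded M']
  note [simp] = slice_src[OF M(1), unfolded M] slice_tgt[OF M(1), unfolded M] slice_cell[OF M(1), unfolded M]
    slice_src[OF M'(1), unfolded M'] slice_tgt[OF M'(1), unfolded M'] slice_cell[OF M'(1), unfolded M'] M(2,3) M'(2,3)
    functor_simps[OF F] functor_simps[OF F'] functor_simps[OF R] cmp_func_simps
    cat_simps[OF functor_category_cod[OF F]] cat_simps[OF functor_category_dom[OF F]]
    ntrans_simps[OF ntiso_ntrans[OF i]] ntrans_simps[OF ntiso_ntrans[OF i']]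
  have iso: "TDom (tri_iso m) = q" "TCod (tri_iso m) = cmp_geom r (tri_cell m)"
    "TDom (tri_iso m') = r" "TCod (tri_iso m') = cmp_geom r' (tri_cell m')"
    using M M' unfolding slice_cells1 by (metis tri_def triangle.simps(4) trans.simps(1,2))+
  have g: "geometric_morphism (tri_cell m)" "geometric_morphism (tri_cell m')" "geometric_morphism r'"
    using slice_cell(1)[OF M(1)] slice_cell(1)[OF M'(1)] slice_tgt(1)[OF M'(1)] by (simp_all add: cells1_GTop)
  have "cmp1 ?K m' m = \<lparr>tri_src = tri_src m, tri_tgt = tri_tgt m',
              tri_cell = cmp_geom (tri_cell m') (tri_cell m),
              tri_iso = vcmp GTop (whisker_right GTop (tri_iso m') (tri_cell m)) (tri_iso m)\<rparr>"
    by (simp add: pseudoslice_def Let_def GTop_simps(8))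
  also have "vcmp GTop (whisker_right GTop (tri_iso m') (tri_cell m)) (tri_iso m) =
    \<lparr>TDom = q, TCod = cmp_geom r' (cmp_geom (tri_cell m') (tri_cell m)),
     TMap = (\<lambda>D\<in>Obj E. Cmp (gsrc q) (FA (pull (tri_cell m)) (TMap (tri_iso m') D)) (TMap (tri_iso m) D))\<rparr>"
    by (simp add: GTop_simps iso cmp_geom_simps cmp_geom_assoc[OF g] cong: restrict_cong)
  finally show e: "cmp1 ?K m' m = tri q r' (cmp_geom (tri_cell m') (tri_cell m))
      (\<lambda>D\<in>Obj E. Cmp (gsrc q) (FA (pull (tri_cell m)) (TMap (tri_iso m') D)) (TMap (tri_iso m) D))"
    by (simp add: tri_def)
  have "ntiso E (gsrc q) (cmp_func (pull (tri_cell m)) (pull r)) (cmp_func (pull (tri_cell m)) (cmp_func (pull (tri_cell m')) (pull r')))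
      (\<lambda>D\<in>Obj E. FA (pull (tri_cell m)) (TMap (tri_iso m') D))"
    by (rule ntiso_postwhisker[OF i' F])
  from ntiso_vcmp[OF i this]
  have "ntiso E (gsrc q) (pull q) (cmp_func (cmp_func (pull (tri_cell m)) (pull (tri_cell m'))) (pull r'))
      (\<lambda>D\<in>Obj E. Cmp (gsrc q) (FA (pull (tri_cell m)) (TMap (tri_iso m') D)) (TMap (tri_iso m) D))"
    by (simp add: cmp_func_assoc[OF R F' F] cong: restrict_cong)
  then show "cmp1 ?K m' m \<in> hom1 ?K q r'"
    unfolding e slice_tri by (simp add: cmp_geom_simps cells1_cmp)
qed

lemma slice_cmp1_sel:
  assumes "m \<in> hom1 (pseudoslice GTop E) q r" and "m' \<in> hom1 (pseudoslice GTop E) r r'"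
  shows "tri_src (cmp1 (pseudoslice GTop E) m' m) = q" "tri_tgt (cmp1 (pseudoslice GTop E) m' m) = r'"
    "tri_cell (cmp1 (pseudoslice GTop E) m' m) = cmp_geom (tri_cell m') (tri_cell m)"
    "D \<in> Obj E \<Longrightarrow> TMap (tri_iso (cmp1 (pseudoslice GTop E) m' m)) D =
      Cmp (gsrc q) (FA (pull (tri_cell m)) (TMap (tri_iso m') D)) (TMap (tri_iso m) D)"
  by (simp_all add: slice_cmp1[OF assms] tri_simps)

text \<open>Equality of these composites, and not merely an isomorphism, makes the two sides of the
  coherence law of a pseudocone parallel 2-cells, to which \<open>cone_thin\<close> applies.\<close>

lemma slice_cmp1_assoc:
  assumes m: "m \<in> hom1 (pseudoslice GTop E) q r" and m': "m' \<in> hom1 (pseudoslice GTop E) r r'"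
    and m'': "m'' \<in> hom1 (pseudoslice GTop E) r' r''"
  shows "cmp1 (pseudoslice GTop E) m'' (cmp1 (pseudoslice GTop E) m' m) =
    cmp1 (pseudoslice GTop E) (cmp1 (pseudoslice GTop E) m'' m') m"
proof (rule tri_eqI)
  let ?K = "pseudoslice GTop E"
  have 1: "cmp1 ?K m' m \<in> hom1 ?K q r'" "cmp1 ?K m'' m' \<in> hom1 ?K r r''"
    by (rule slice_cmp1_hom1[OF m m'] slice_cmp1_hom1[OF m' m''])+
  show "cmp1 ?K m'' (cmp1 ?K m' m) \<in> cells1 ?K" "cmp1 ?K (cmp1 ?K m'' m') m \<in> cells1 ?K"
    using slice_cmp1_hom1[OF 1(1) m''] slice_cmp1_hom1[OF m 1(2)] by (simp_all add: slice_hom1)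
  note e = slice_cmp1_sel[OF 1(1) m''] slice_cmp1_sel[OF m 1(2)] slice_cmp1_sel[OF m m'] slice_cmp1_sel[OF m' m'']
  have M: "m \<in> cells1 ?K" "tri_src m = q" "tri_tgt m = r" and M': "m' \<in> cells1 ?K" "tri_src m' = r" "tri_tgt m' = r'"
    and M'': "m'' \<in> cells1 ?K" "tri_src m'' = r'" "tri_tgt m'' = r''"
    using m m' m'' by (simp_all add: slice_hom1)
  note [simp] = slice_cell[OF M(1), unfolded M] slice_cell[OF M'(1), unfolded M'] slice_cell[OF M''(1), unfolded M'']
  have g: "geometric_morphism (tri_cell m)" "geometric_morphism (tri_cell m')" "geometric_morphism (tri_cell m'')"
    using slice_cell(1)[OF M(1)] slice_cell(1)[OF M'(1)] slice_cell(1)[OF M''(1)] by (simp_all add: cells1_GTop)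
  show "tri_src (cmp1 ?K m'' (cmp1 ?K m' m)) = tri_src (cmp1 ?K (cmp1 ?K m'' m') m)"
    "tri_tgt (cmp1 ?K m'' (cmp1 ?K m' m)) = tri_tgt (cmp1 ?K (cmp1 ?K m'' m') m)"
    by (simp_all only: e)
  show "tri_cell (cmp1 ?K m'' (cmp1 ?K m' m)) = tri_cell (cmp1 ?K (cmp1 ?K m'' m') m)"
    by (simp only: e) (simp add: cmp_geom_assoc[OF g])
  fix D assume D: "D \<in> Obj E"
  note F = slice_pull_cell[OF M(1), unfolded M] and F' = slice_pull_cell[OF M'(1), unfolded M']
    and F'' = slice_pull_cell[OF M''(1), unfolded M'']
    and R = slice_pull_tgt[OF M'(1), unfolded M'] and R'' = slice_pull_tgt[OF M''(1), unfolded M'']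
    and R' = slice_pull_tgt[OF M(1), unfolded M]
    and i = slice_iso[OF M(1), unfolded M] and i' = slice_iso[OF M'(1), unfolded M'] and i'' = slice_iso[OF M''(1), unfolded M'']
  note [simp] = functor_simps[OF F] functor_simps[OF F'] functor_simps[OF F''] functor_simps[OF R] functor_simps[OF R'] functor_simps[OF R''] cmp_func_simps
    cat_simps[OF functor_category_cod[OF F]] cat_simps[OF functor_category_dom[OF F]]
    ntrans_simps[OF ntiso_ntrans[OF i]] ntrans_simps[OF ntiso_ntrans[OF i']] ntrans_simps[OF ntiso_ntrans[OF i'']]
  show "TMap (tri_iso (cmp1 ?K m'' (cmp1 ?K m' m))) D = TMap (tri_iso (cmp1 ?K (cmp1 ?K m'' m') m)) D"
    by (simp add: e D cmp_geom_simps)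
qed

lemma slice_id1_hom1: "r \<in> cells1 GTop \<Longrightarrow> gtgt r = E \<Longrightarrow> id1 (pseudoslice GTop E) r \<in> hom1 (pseudoslice GTop E) r r"
  and slice_id1: "r \<in> cells1 GTop \<Longrightarrow> gtgt r = E \<Longrightarrow>
    id1 (pseudoslice GTop E) r = tri r r (id_geom (gsrc r)) (\<lambda>D\<in>Obj E. Idn (gsrc r) (FO (pull r) D))"
proof -
  assume r: "r \<in> cells1 GTop" "gtgt r = E"
  have g: "geometric_morphism r" using r by (simp add: cells1_GTop)
  have F: "functor_from_to (pull r) E (gsrc r)" using geom_pull[OF g] r by simp
  have T: "functor_from_to (push r) (gsrc r) E" using geom_push[OF g] r by simp
  have U: "ntrans E E (id_func E) (cmp_func (push r) (pull r)) (unit r)"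
    "ntrans (gsrc r) (gsrc r) (cmp_func (pull r) (push r)) (id_func (gsrc r)) (counit r)"
    using geom_unit[OF g] geom_counit[OF g] r by simp_all
  have "gtgt (id_geom (gsrc r)) = gsrc r" "gsrc (id_geom (gsrc r)) = gsrc r"
    by (simp_all only: gtgt_def gsrc_def id_geom_def id_func_def geom.simps func.simps)
  note [simp] = this functor_simps[OF F] functor_simps[OF T] cmp_func_simps id_func_simps ntrans_simps[OF U(1)] ntrans_simps[OF U(2)]
    cat_simps[OF functor_category_cod[OF F]] cat_simps[OF functor_category_dom[OF F]]
  have pe: "pull (id_geom (gsrc r)) = id_func (gsrc r)" "push (id_geom (gsrc r)) = id_func (gsrc r)" by (simp_all add: id_geom_def)
  have c: "cmp_geom r (id_geom (gsrc r)) = r"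
  proof (rule geom.equality)
    show "unit (cmp_geom r (id_geom (gsrc r))) = unit r"
      using ntrans_ext[OF U(1)] by (intro extensionalityI[of _ "Obj E"]) (simp_all add: cmp_geom_def r(2), simp add: id_geom_def)
    show "counit (cmp_geom r (id_geom (gsrc r))) = counit r"
      using ntrans_ext[OF U(2)] by (intro extensionalityI[of _ "Obj (gsrc r)"]) (simp_all add: cmp_geom_def, simp add: id_geom_def)
  qed (simp_all add: cmp_geom_simps pe cmp_func_id[OF F] cmp_func_id[OF T])
  have "id1 (pseudoslice GTop E) r = \<lparr>tri_src = r, tri_tgt = r, tri_cell = id_geom (gsrc r), tri_iso = id2 GTop r\<rparr>"
    by (simp add: pseudoslice_def Let_def GTop_simps(2,6))
  then show e: "id1 (pseudoslice GTop E) r = tri r r (id_geom (gsrc r)) (\<lambda>D\<in>Obj E. Idn (gsrc r) (FO (pull r) D))"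
    using r by (simp add: tri_def GTop_simps c)
  show "id1 (pseudoslice GTop E) r \<in> hom1 (pseudoslice GTop E) r r"
    unfolding e slice_tri using r ntiso_id[OF F] cells1_id[of "gsrc r"]
    by (simp add: pe cmp_func_id[OF F] cells1_GTop)
qed

text \<open>It turns the whiskered unitor into a 2-cell that starts at the leg itself, so that the
  unit law of a pseudocone also falls under \<open>cone_thin\<close>.\<close>

lemma slice_cmp1_id:
  assumes m: "m \<in> hom1 (pseudoslice GTop E) q r"
  shows "cmp1 (pseudoslice GTop E) (id1 (pseudoslice GTop E) r) m = m"
proof (rule tri_eqI)
  let ?K = "pseudoslice GTop E"
  have M: "m \<in> cells1 ?K" "tri_src m = q" "tri_tgt m = r" using m by (simp_all add: slice_hom1)
  have r: "r \<in> cells1 GTop" "gtgt r = E" using slice_tgt[OF M(1)] M by simp_all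
  note i = slice_id1_hom1[OF r]
  note e = slice_cmp1_sel[OF m i]
  note e' = arg_cong[OF slice_id1[OF r], of tri_cell] arg_cong[OF slice_id1[OF r], of "\<lambda>m. TMap (tri_iso m)"]
  show "cmp1 ?K (id1 ?K r) m \<in> cells1 ?K" "m \<in> cells1 ?K"
    using slice_cmp1_hom1[OF m i] M by (simp_all add: slice_hom1)
  show "tri_src (cmp1 ?K (id1 ?K r) m) = tri_src m" "tri_tgt (cmp1 ?K (id1 ?K r) m) = tri_tgt m"
    by (simp_all only: e M)
  show "tri_cell (cmp1 ?K (id1 ?K r) m) = tri_cell m"
    using slice_cell[OF M(1)] cmp_geom_id[of "tri_cell m"] by (simp only: e e' tri_simps M cells1_GTop)
  fix D assume D: "D \<in> Obj E"
  note F = slice_pull_cell[OF M(1), unfolded M] and R = slice_pull_tgt[OF M(1), unfolded M] and j = slice_iso[OF M(1), unfolded M]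
  note [simp] = functor_simps[OF F] functor_simps[OF R] cmp_func_simps ntrans_simps[OF ntiso_ntrans[OF j]]
    cat_simps[OF functor_category_cod[OF F]]
  show "TMap (tri_iso (cmp1 ?K (id1 ?K r) m)) D = TMap (tri_iso m) D"
    by (simp only: e D e' tri_simps) (simp add: D)
qed

lemma
  assumes "c2 m n t \<in> hom2 (pseudoslice GTop E) m n"
  shows c2_dom: "m \<in> cells1 (pseudoslice GTop E)" and c2_cod: "n \<in> cells1 (pseudoslice GTop E)"
    and c2_src: "tri_src n = tri_src m" and c2_tgt: "tri_tgt n = tri_tgt m"
    and c2_ntrans: "ntrans (gsrc (tri_tgt m)) (gsrc (tri_src m)) (pull (tri_cell m)) (pull (tri_cell n)) t"
    and c2_over: "D \<in> Obj E \<Longrightarrow>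
      Cmp (gsrc (tri_src m)) (t (FO (pull (tri_tgt m)) D)) (TMap (tri_iso m) D) = TMap (tri_iso n) D"
  using assms unfolding slice_c2 by auto

lemma slice_id2: "m \<in> cells1 (pseudoslice GTop E) \<Longrightarrow> id2 (pseudoslice GTop E) m \<in> hom2 (pseudoslice GTop E) m m"
proof -
  assume m: "m \<in> cells1 (pseudoslice GTop E)"
  note [simp] = slice_cell[OF m] functor_simps[OF slice_pull_tgt[OF m]] functor_simps[OF slice_pull_cell[OF m]]
    ntrans_simps[OF ntiso_ntrans[OF slice_iso[OF m]]] cmp_func_simps cat_simps[OF functor_category_cod[OF slice_pull_cell[OF m]]]
  show ?thesis
    unfolding slice_ops slice_c2 using m ntrans_id[OF slice_pull_cell[OF m]] by simp
qed

lemma slice_vcmp: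
  assumes x: "x \<in> hom2 (pseudoslice GTop E) m n" and y: "y \<in> hom2 (pseudoslice GTop E) n r"
  shows "vcmp (pseudoslice GTop E) y x \<in> hom2 (pseudoslice GTop E) m r"
proof -
  let ?K = "pseudoslice GTop E"
  obtain t where xt: "x = c2 m n t" using x slice_hom2 by blast
  obtain s where ys: "y = c2 n r s" using y slice_hom2 by blast
  note X = x[unfolded xt] and Y = y[unfolded ys]
  note m = c2_dom[OF X] and n = c2_cod[OF X] and r = c2_cod[OF Y]
  note e = c2_src[OF X] c2_tgt[OF X] c2_src[OF Y] c2_tgt[OF Y]
  note t = c2_ntrans[OF X] and s = c2_ntrans[OF Y, unfolded e]
  note [simp] = slice_cell[OF m] functor_simps[OF slice_pull_tgt[OF m]] functor_simps[OF slice_pull_cell[OF m]]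
    ntrans_simps[OF ntiso_ntrans[OF slice_iso[OF m]]] cmp_func_simps cat_simps[OF functor_category_cod[OF slice_pull_cell[OF m]]]
    ntrans_simps[OF t] ntrans_simps[OF s]
  show ?thesis
    unfolding xt ys slice_ops slice_c2
    using m r e ntrans_vcmp[OF t s] c2_over[OF X] c2_over[OF Y] by simp
qed

text \<open>The horizontal composite lies over \<open>E\<close> because \<open>y\<close> does, then
  by naturality of its component \<open>t\<close> of \<open>x\<close>, and then because
  \<open>x\<close> does.\<close>

lemma slice_hcmp:
  assumes x: "x \<in> hom2 (pseudoslice GTop E) m n" and y: "y \<in> hom2 (pseudoslice GTop E) m' n'" and c: "tri_src m' = tri_tgt m"
  shows "hcmp (pseudoslice GTop E) y x \<in> hom2 (pseudoslice GTop E) (cmp1 (pseudoslice GTop E) m' m) (cmp1 (pseudoslice GTop E) n' n)"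
proof -
  let ?K = "pseudoslice GTop E"
  obtain t where xt: "x = c2 m n t" using x slice_hom2 by blast
  obtain s where ys: "y = c2 m' n' s" using y slice_hom2 by blast
  note X = x[unfolded xt] and Y = y[unfolded ys]
  define q r r' where "q = tri_src m" "r = tri_tgt m" "r' = tri_tgt m'"
  note d = q_r_r'_def[symmetric] c2_src[OF X] c2_tgt[OF X] c2_src[OF Y] c2_tgt[OF Y] c
  have m: "m \<in> cells1 ?K" "tri_src m = q" "tri_tgt m = r" and n: "n \<in> cells1 ?K" "tri_src n = q" "tri_tgt n = r"
    and m': "m' \<in> cells1 ?K" "tri_src m' = r" "tri_tgt m' = r'" and n': "n' \<in> cells1 ?K" "tri_src n' = r" "tri_tgt n' = r'"
    by (simp_all add: d c2_dom[OF X] c2_cod[OF X] c2_dom[OF Y] c2_cod[OF Y])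
  note t = c2_ntrans[OF X, unfolded m] and s = c2_ntrans[OF Y, unfolded m']
    and tq = c2_over[OF X, unfolded m] and sq = c2_over[OF Y, unfolded m']
  have hm: "m \<in> hom1 ?K q r" "n \<in> hom1 ?K q r" "m' \<in> hom1 ?K r r'" "n' \<in> hom1 ?K r r'"
    using m n m' n' by (simp_all add: slice_hom1)
  note Fm = slice_pull_cell[OF m(1), unfolded m] and Fn = slice_pull_cell[OF n(1), unfolded n]
    and Fm' = slice_pull_cell[OF m'(1), unfolded m'] and Fn' = slice_pull_cell[OF n'(1), unfolded n']
    and R = slice_pull_tgt[OF m(1), unfolded m] and R' = slice_pull_tgt[OF m'(1), unfolded m']
    and im = slice_iso[OF m(1), unfolded m, THEN ntiso_ntrans] and jn = slice_iso[OF n(1), unfolded n, THEN ntiso_ntrans]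
    and im' = slice_iso[OF m'(1), unfolded m', THEN ntiso_ntrans] and jn' = slice_iso[OF n'(1), unfolded n', THEN ntiso_ntrans]
  note X = functor_category_cod[OF Fm]
  note [simp] = slice_cell[OF m(1), unfolded m] slice_cell[OF n(1), unfolded n] slice_cell[OF m'(1), unfolded m'] slice_cell[OF n'(1), unfolded n']
    functor_simps[OF Fm] functor_simps[OF Fn] functor_simps[OF Fm'] functor_simps[OF Fn'] functor_simps[OF R] functor_simps[OF R']
    cmp_func_simps cat_simps[OF X] cat_simps[OF functor_category_cod[OF R]] cmp_geom_simps
    ntrans_simps[OF t] ntrans_simps[OF s] ntrans_simps[OF im] ntrans_simps[OF jn] ntrans_simps[OF im'] ntrans_simps[OF jn']
    m(2,3) n(2,3) m'(2,3) n'(2,3)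
  note e = slice_cmp1_sel[OF hm(1,3)] slice_cmp1_sel[OF hm(2,4)]
  let ?w = "\<lambda>D\<in>Obj (gsrc r'). Cmp (gsrc q) (t (FO (pull (tri_cell n')) D)) (FA (pull (tri_cell m)) (s D))"
  have "ntrans (gsrc r') (gsrc q) (cmp_func (pull (tri_cell m)) (pull (tri_cell m'))) (cmp_func (pull (tri_cell n)) (pull (tri_cell n'))) ?w"
    using ntrans_vcmp[OF ntrans_postwhisker[OF s Fm] ntrans_whisker[OF t Fn']] by (simp cong: restrict_cong)
  moreover have "Cmp (gsrc q) (?w (FO (pull r') D)) (Cmp (gsrc q) (FA (pull (tri_cell m)) (TMap (tri_iso m') D)) (TMap (tri_iso m) D)) =
      Cmp (gsrc q) (FA (pull (tri_cell n)) (TMap (tri_iso n') D)) (TMap (tri_iso n) D)" if D [simp]: "D \<in> Obj E" for D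
  proof -
    let ?m = "FA (pull (tri_cell m))" and ?X = "gsrc q"
    have 1: "Cmp ?X (?m (s (FO (pull r') D))) (?m (TMap (tri_iso m') D)) = ?m (TMap (tri_iso n') D)"
      using sq[OF D] FA_Cmp[OF Fm, of "TMap (tri_iso m') D" "s (FO (pull r') D)"] by simp
    have 2: "Cmp ?X (?m (s (FO (pull r') D))) (Cmp ?X (?m (TMap (tri_iso m') D)) (TMap (tri_iso m) D)) =
        Cmp ?X (?m (TMap (tri_iso n') D)) (TMap (tri_iso m) D)"
      by (rule Cmp_eq_prefix1[OF X 1]) simp_all
    have "Cmp ?X (?w (FO (pull r') D)) (Cmp ?X (?m (TMap (tri_iso m') D)) (TMap (tri_iso m) D)) =
        Cmp ?X (t (FO (pull (tri_cell n')) (FO (pull r') D))) (Cmp ?X (?m (TMap (tri_iso n') D)) (TMap (tri_iso m) D))"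
      by (simp add: 2)
    also have "\<dots> = Cmp ?X (FA (pull (tri_cell n)) (TMap (tri_iso n') D)) (Cmp ?X (t (FO (pull r) D)) (TMap (tri_iso m) D))"
      using ntrans_sq_prefix[OF t, of "TMap (tri_iso n') D" "TMap (tri_iso m) D"] by simp
    finally show ?thesis by (simp add: tq)
  qed
  ultimately show ?thesis
    unfolding xt ys slice_ops slice_c2
    using slice_cmp1_hom1[OF hm(1,3)] slice_cmp1_hom1[OF hm(2,4)]
    by (simp add: slice_hom1 e)
qed

section \<open>Bilimits of etale projections\<close>

text \<open>What the bilimit property says in terms of inverse images.  Compatibility with the transitions
  and coherence do not appear, because 2-cells over \<open>E\<close> into an etale projection are unique.\<close>

locale bilimit_points =
  fixes E L0 :: "('u::universe large, 'u large) category"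
    and Lp :: "('u large, 'u large, 'u large, 'u large) func"
    and I :: "('u, 'u) category" and A :: "'u \<Rightarrow> 'u large"
    and ci :: "'u \<Rightarrow> ('u large, 'u large, 'u large, 'u large) func" and gm :: "'u \<Rightarrow> 'u large \<Rightarrow> 'u large"
    and tu :: "'u \<Rightarrow> ('u large, 'u large, 'u large, 'u large) func" and ta ka :: "'u \<Rightarrow> 'u large \<Rightarrow> 'u large"
  assumes geoL: "geo E L0 Lp" and I: "category I"
    and A: "i \<in> Obj I \<Longrightarrow> A i \<in> Obj E"
    and geoP: "i \<in> Obj I \<Longrightarrow> geo E (slice E (A i)) (product_functor E (A i))"
    and geoc: "i \<in> Obj I \<Longrightarrow> geo (slice E (A i)) L0 (ci i)"
    and gm: "i \<in> Obj I \<Longrightarrow> ntiso E L0 Lp (cmp_func (ci i) (product_functor E (A i))) (gm i)"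
    and geot: "u \<in> Arr I \<Longrightarrow> geo (slice E (A (Cod I u))) (slice E (A (Dom I u))) (tu u)"
    and ta: "u \<in> Arr I \<Longrightarrow> ntiso E (slice E (A (Dom I u))) (product_functor E (A (Dom I u)))
        (cmp_func (tu u) (product_functor E (A (Cod I u)))) (ta u)"
    and ka: "u \<in> Arr I \<Longrightarrow> ntiso (slice E (A (Cod I u))) L0 (cmp_func (ci (Dom I u)) (tu u)) (ci (Cod I u)) (ka u)"
    and ka_over: "u \<in> Arr I \<Longrightarrow> D \<in> Obj E \<Longrightarrow>
      Cmp L0 (ka u (FO (product_functor E (A (Cod I u))) D)) (Cmp L0 (FA (ci (Dom I u)) (ta u D)) (gm (Dom I u) D)) =
      gm (Cod I u) D"
    and thin: "geo L0 X M \<Longrightarrow> ntrans L0 X M M s \<Longrightarrow>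
      (\<And>D. D \<in> Obj E \<Longrightarrow> s (FO Lp D) = Idn X (FO M (FO Lp D))) \<Longrightarrow> y \<in> Obj L0 \<Longrightarrow> s y = Idn X (FO M y)"
    and full: "geo L0 X M \<Longrightarrow> geo L0 X N \<Longrightarrow> ntiso E X (cmp_func M Lp) (cmp_func N Lp) io \<Longrightarrow>
      (\<And>i. i \<in> Obj I \<Longrightarrow> \<exists>w. ntrans (slice E (A i)) X (cmp_func M (ci i)) (cmp_func N (ci i)) w \<and>
        (\<forall>D\<in>Obj E. Cmp X (w (FO (product_functor E (A i)) D)) (FA M (gm i D)) = Cmp X (FA N (gm i D)) (io D))) \<Longrightarrow>
      \<exists>x. ntrans L0 X M N x \<and> (\<forall>D\<in>Obj E. x (FO Lp D) = io D)"
    and esurj: "geo E X q \<Longrightarrow> (\<And>i. i \<in> Obj I \<Longrightarrow> geo (slice E (A i)) X (Ki i)) \<Longrightarrow>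
      (\<And>i. i \<in> Obj I \<Longrightarrow> ntiso E X q (cmp_func (Ki i) (product_functor E (A i))) (mu i)) \<Longrightarrow>
      (\<And>u. u \<in> Arr I \<Longrightarrow> \<exists>l. ntiso (slice E (A (Cod I u))) X (cmp_func (Ki (Dom I u)) (tu u)) (Ki (Cod I u)) l \<and>
        (\<forall>D\<in>Obj E. Cmp X (l (FO (product_functor E (A (Cod I u))) D))
          (Cmp X (FA (Ki (Dom I u)) (ta u D)) (mu (Dom I u) D)) = mu (Cod I u) D)) \<Longrightarrow>
      \<exists>B io. geo L0 X B \<and> ntiso E X q (cmp_func B Lp) io \<and>
        (\<forall>i\<in>Obj I. \<exists>w. ntrans (slice E (A i)) X (Ki i) (cmp_func B (ci i)) w \<and>
          (\<forall>D\<in>Obj E. Cmp X (w (FO (product_functor E (A i)) D)) (mu i D) = Cmp X (FA B (gm i D)) (io D)))"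

section \<open>Pseudocones over diagrams of etale projections\<close>

lemma c2_inject: "c2 m n t = c2 m' n' t' \<longleftrightarrow> m = m' \<and> n = n' \<and> t = t'"
  by (auto simp: c2_def)

text \<open>The inverse lies over \<open>E\<close> as well: the condition on \<open>t\<close> is
  solved for \<open>TMap (tri_iso m) D\<close>.\<close>

lemma slice_iso2I:
  assumes x: "c2 m n t \<in> hom2 (pseudoslice GTop E) m n"
    and i: "\<And>y. y \<in> Obj (gsrc (tri_tgt m)) \<Longrightarrow> iso_arr (gsrc (tri_src m)) (t y)"
  shows "c2 m n t \<in> iso2 (pseudoslice GTop E) m n"
proof -
  let ?K = "pseudoslice GTop E" and ?X = "gsrc (tri_src m)" and ?R = "gsrc (tri_tgt m)"
  note m = c2_dom[OF x] and n = c2_cod[OF x] and e = c2_src[OF x] c2_tgt[OF x]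
  note t = c2_ntrans[OF x]
  note [simp] = slice_cell[OF m] slice_cell[OF n] e functor_simps[OF slice_pull_tgt[OF m]] functor_simps[OF slice_pull_cell[OF m]]
    functor_simps[OF slice_pull_cell[OF n, unfolded e]]
    ntrans_simps[OF ntiso_ntrans[OF slice_iso[OF m]]] cmp_func_simps cat_simps[OF functor_category_cod[OF slice_pull_cell[OF m]]]
    ntrans_simps[OF t] inv_simps[OF i]
  note X = functor_category_cod[OF slice_pull_cell[OF m]]
  let ?s = "\<lambda>y\<in>Obj ?R. inv_arr ?X (t y)"
  have s: "ntrans ?R ?X (pull (tri_cell n)) (pull (tri_cell m)) ?s"
    by (rule ntrans_inv[OF t i])
  have "Cmp ?X (inv_arr ?X (t (FO (pull (tri_tgt m)) D))) (TMap (tri_iso n) D) = TMap (tri_iso m) D" if D: "D \<in> Obj E" for D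
  proof -
    have "TMap (tri_iso n) D = Cmp ?X (t (FO (pull (tri_tgt m)) D)) (TMap (tri_iso m) D)"
      using c2_over[OF x D] by simp
    then show ?thesis
      using Cmp_inv_left[OF X i, of "FO (pull (tri_tgt m)) D" "TMap (tri_iso m) D"] D by simp
  qed
  then have b: "c2 n m ?s \<in> hom2 ?K n m"
    unfolding slice_c2 using m n s by simp
  have "vcmp ?K (c2 n m ?s) (c2 m n t) = id2 ?K m" "vcmp ?K (c2 m n t) (c2 n m ?s) = id2 ?K n"
    by (simp_all add: slice_ops cong: restrict_cong)
  then show ?thesis using x b by (auto simp: iso2_def)
qed

lemma slice_iso2D:
  assumes "x \<in> iso2 (pseudoslice GTop E) m n"
  obtains t where "x = c2 m n t" "c2 m n t \<in> hom2 (pseudoslice GTop E) m n"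
    "ntiso (gsrc (tri_tgt m)) (gsrc (tri_src m)) (pull (tri_cell m)) (pull (tri_cell n)) t"
proof -
  let ?K = "pseudoslice GTop E" and ?X = "gsrc (tri_src m)" and ?R = "gsrc (tri_tgt m)"
  obtain t where xt: "x = c2 m n t" and x: "c2 m n t \<in> hom2 ?K m n"
    using assms slice_hom2[of x E m n] by (auto simp: iso2_def)
  obtain y where y0: "y \<in> hom2 ?K n m" "vcmp ?K y x = id2 ?K m" "vcmp ?K x y = id2 ?K n"
    using assms by (auto simp: iso2_def)
  obtain s where ys: "y = c2 n m s" and y: "c2 n m s \<in> hom2 ?K n m"
    using y0(1) slice_hom2[of y E n m] by auto
  note m = c2_dom[OF x] and n = c2_cod[OF x] and e = c2_src[OF x] c2_tgt[OF x]
  note t = c2_ntrans[OF x] and s = c2_ntrans[OF y, unfolded e]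
  note [simp] = slice_cell[OF m] slice_cell[OF n] e ntrans_simps[OF t] ntrans_simps[OF s]
  have v: "(\<lambda>D\<in>Obj ?R. Cmp ?X (s D) (t D)) = (\<lambda>D\<in>Obj ?R. Idn ?X (FO (pull (tri_cell m)) D))"
    "(\<lambda>D\<in>Obj ?R. Cmp ?X (t D) (s D)) = (\<lambda>D\<in>Obj ?R. Idn ?X (FO (pull (tri_cell n)) D))"
    using y0(2,3) by (simp_all add: xt ys slice_ops c2_inject)
  have "iso_arr ?X (t D)" if D: "D \<in> Obj ?R" for D
    by (rule iso_arrI[of _ _ "s D"]) (use D fun_cong[OF v(1), of D] fun_cong[OF v(2), of D] in simp_all)
  then show ?thesis using that xt x t by (simp add: ntiso_def)
qed

context
  fixes E :: "('u::universe large, 'u large) category" and I :: "('u, 'u) category"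
    and A :: "'u \<Rightarrow> 'u large"
    and D :: "('u, 'u, 'u large geom,
      ('u large geom, ('u large geom, 'u large, 'u large) trans) triangle,
      ('u large geom, ('u large geom, 'u large, 'u large) trans) triangle \<times>
      ('u large geom, ('u large geom, 'u large, 'u large) trans) triangle \<times>
      ('u large geom, 'u large, 'u large) trans) psfunctor"
    and L :: "'u large geom"
    and c :: "('u, 'u, ('u large geom, ('u large geom, 'u large, 'u large) trans) triangle,
      ('u large geom, ('u large geom, 'u large, 'u large) trans) triangle \<times>
      ('u large geom, ('u large geom, 'u large, 'u large) trans) triangle \<times>
      ('u large geom, 'u large, 'u large) trans) pscone"
  assumes A: "\<And>i. i \<in> Obj I \<Longrightarrow> A i \<in> Obj E"
    and et: "\<And>i. i \<in> Obj I \<Longrightarrow> etale_projection E (A i) (P0 D i)"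
    and bil: "is_bilimit I (pseudoslice GTop E) D L c"
begin

private abbreviation K where "K \<equiv> pseudoslice GTop E"

private lemma D: "pseudofunctor I K D" and L: "L \<in> cells1 GTop" "gtgt L = E" and c: "pseudocone I K D L c"
  and comp: "q \<in> cells1 GTop \<Longrightarrow> gtgt q = E \<Longrightarrow> equivalence_functor (cone_comparison I K D L c q)"
  using bil by (simp_all add: is_bilimit_def slice_cells0)

private lemma I: "category I"
  using D by (simp add: pseudofunctor_def)

private lemma P0: "i \<in> Obj I \<Longrightarrow> P0 D i \<in> cells1 GTop" "i \<in> Obj I \<Longrightarrow> pull (P0 D i) = product_functor E (A i)"
  "i \<in> Obj I \<Longrightarrow> gtgt (P0 D i) = E" "i \<in> Obj I \<Longrightarrow> gsrc (P0 D i) = slice E (A i)"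
  using et by (auto simp: etale_projection_def gtgt_def gsrc_def product_functor_def)

private lemma geoP: "i \<in> Obj I \<Longrightarrow> geo E (slice E (A i)) (product_functor E (A i))"
  using cells1_geo[OF P0(1)] P0 by simp

private lemma P1: "u \<in> Arr I \<Longrightarrow> P1 D u \<in> hom1 K (P0 D (Dom I u)) (P0 D (Cod I u))"
  using D by (simp add: pseudofunctor_def)

private lemma leg_c: "i \<in> Obj I \<Longrightarrow> leg c i \<in> hom1 K L (P0 D i)"
  using c by (simp add: pseudocone_def)

text \<open>Lying over \<open>E\<close> prescribes the components at objects coming from
  \<open>E\<close>, after the invertible 2-cell of \<open>m\<close> is cancelled; by
  \<open>etale_thin\<close> these determine all components.\<close>

private lemma cone_thin:
  assumes x: "x \<in> hom2 K m n" and y: "y \<in> hom2 K m n" and i: "i \<in> Obj I" and m: "tri_tgt m = P0 D i"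
  shows "x = y"
proof -
  obtain t where xt: "x = c2 m n t" and X: "c2 m n t \<in> hom2 K m n" using x slice_hom2[of x E m n] by auto
  obtain s where ys: "y = c2 m n s" and Y: "c2 m n s \<in> hom2 K m n" using y slice_hom2[of y E m n] by auto
  note M = c2_dom[OF X] and N = c2_cod[OF X]
  let ?X = "gsrc (tri_src m)"
  have t: "ntrans (slice E (A i)) ?X (pull (tri_cell m)) (pull (tri_cell n)) t"
    and s: "ntrans (slice E (A i)) ?X (pull (tri_cell m)) (pull (tri_cell n)) s"
    using c2_ntrans[OF X] c2_ntrans[OF Y] by (simp_all add: m P0[OF i])
  note F = slice_pull_tgt[OF M, unfolded m P0[OF i]] and G = slice_pull_cell[OF M, unfolded m P0[OF i]]
  have iso: "ntiso E ?X (pull (tri_src m)) (cmp_func (pull (tri_cell m)) (product_functor E (A i))) (TMap (tri_iso m))"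
    using slice_iso[OF M] by (simp add: m P0[OF i])
  note [simp] = functor_simps[OF F] functor_simps[OF G] cmp_func_simps ntrans_simps[OF t] ntrans_simps[OF s]
    ntrans_simps[OF ntiso_ntrans[OF iso]]
  have "t (FO (product_functor E (A i)) D) = s (FO (product_functor E (A i)) D)" if D: "D \<in> Obj E" for D
  proof (rule iso_cancel_right[OF functor_category_cod[OF G] ntiso_iso[OF iso D]])
    show "Cmp ?X (t (FO (product_functor E (A i)) D)) (TMap (tri_iso m) D) =
        Cmp ?X (s (FO (product_functor E (A i)) D)) (TMap (tri_iso m) D)"
      using c2_over[OF X D] c2_over[OF Y D] by (simp add: m P0[OF i])
  qed (use D in simp_all)
  then have "t = s"
    by (rule etale_thin[OF geoP[OF i] A[OF i] t s geo_left_exact[OF cells1_geo[OF slice_cell(1)[OF N]]]])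
  then show ?thesis by (simp add: xt ys)
qed

private lemma comparison_functor:
  assumes q: "q \<in> cells1 GTop" "gtgt q = E"
  shows "functor_from_to (cone_comparison I K D L c q) (hom_category K q L) (pseudocone_category I K D q)"
  using comp[OF q] by (simp add: equivalence_functor_def functor_from_to_def cone_comparison_def)

private lemma hom_category_Arr: "x \<in> Arr (hom_category K q r) \<longleftrightarrow>
    x \<in> hom2 K (dom2 K x) (cod2 K x) \<and> dom2 K x \<in> hom1 K q r \<and> cod2 K x \<in> hom1 K q r"
  by (auto simp: hom_category_def hom2_def)

private lemma restrict_cone_leg: "i \<in> Obj I \<Longrightarrow> leg (restrict_cone I K c h) i = cmp1 K (leg c i) h"
  by (simp add: restrict_cone_def)

private lemma pseudocone_restrict:
  assumes h: "h \<in> hom1 K q L"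
  shows "pseudocone I K D q (restrict_cone I K c h)"
proof -
  have q: "q \<in> cells1 GTop" "gtgt q = E" using h slice_src[of h E] by (auto simp: slice_hom1)
  have "h \<in> Obj (hom_category K q L)" using h by (simp add: hom_category_def)
  from FO_Obj[OF comparison_functor[OF q] this] this show ?thesis
    by (simp add: cone_comparison_def pseudocone_category_def)
qed

text \<open>Compatibility with the transitions is automatic, as parallel 2-cells into an etale projection are equal.\<close>

private lemma pseudocone_arrow:
  assumes z: "pseudocone I K D q z" and z': "pseudocone I K D q z'"
    and w: "\<And>i. i \<in> Obj I \<Longrightarrow> w i \<in> hom2 K (leg z i) (leg z' i)"
  shows "\<lparr>TDom = z, TCod = z', TMap = restrict w (Obj I)\<rparr> \<in> Arr (pseudocone_category I K D q)"
proof -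
  note [simp] = cat_simps[OF I]
  have "vcmp K (leg_iso z' u) (whisker_left K (P1 D u) (w (Dom I u))) = vcmp K (w (Cod I u)) (leg_iso z u)"
    if u: "u \<in> Arr I" for u
  proof -
    have l: "leg_iso z u \<in> hom2 K (cmp1 K (P1 D u) (leg z (Dom I u))) (leg z (Cod I u))"
      "leg_iso z' u \<in> hom2 K (cmp1 K (P1 D u) (leg z' (Dom I u))) (leg z' (Cod I u))"
      and h: "leg z (Dom I u) \<in> hom1 K q (P0 D (Dom I u))"
      using z z' u by (simp_all add: pseudocone_def iso2_def)
    have pu: "P1 D u \<in> cells1 K" "tri_src (P1 D u) = P0 D (Dom I u)" using P1[OF u] by (simp_all add: slice_hom1)
    have hc: "hcmp K (id2 K (P1 D u)) (w (Dom I u)) \<in> hom2 K (cmp1 K (P1 D u) (leg z (Dom I u))) (cmp1 K (P1 D u) (leg z' (Dom I u)))"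
      by (rule slice_hcmp[OF w slice_id2[OF pu(1)]]) (use u h pu in \<open>simp_all add: slice_hom1\<close>)
    show ?thesis
      by (rule cone_thin[OF slice_vcmp[OF hc l(2)] slice_vcmp[OF l(1) w], of "Cod I u"])
        (use u slice_cmp1_hom1[OF h P1[OF u]] in \<open>simp_all add: slice_hom1\<close>)
  qed
  then show ?thesis
    using z z' w by (simp add: pseudocone_category_def)
qed

text \<open>The family \<open>w\<close> is an arrow of pseudocones by
  \<open>pseudocone_arrow\<close>, and fullness of the comparison functor lifts it.\<close>

private lemma bilimit_full:
  assumes h: "h \<in> hom1 K q L" and h': "h' \<in> hom1 K q L"
    and w: "\<And>i. i \<in> Obj I \<Longrightarrow> w i \<in> hom2 K (cmp1 K (leg c i) h) (cmp1 K (leg c i) h')"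
  obtains x where "x \<in> hom2 K h h'"
proof -
  have q: "q \<in> cells1 GTop" "gtgt q = E" using h slice_src[of h E] by (auto simp: slice_hom1)
  note F = comparison_functor[OF q] and eq = comp[OF q]
  have H: "h \<in> Obj (hom_category K q L)" "h' \<in> Obj (hom_category K q L)" using h h' by (simp_all add: hom_category_def)
  let ?a = "\<lparr>TDom = restrict_cone I K c h, TCod = restrict_cone I K c h', TMap = restrict w (Obj I)\<rparr>"
  have a: "?a \<in> Arr (pseudocone_category I K D q)"
    by (rule pseudocone_arrow[OF pseudocone_restrict[OF h] pseudocone_restrict[OF h']]) (simp add: restrict_cone_leg w)
  have da: "Dom (pseudocone_category I K D q) ?a = FO (cone_comparison I K D L c q) h"
    "Cod (pseudocone_category I K D q) ?a = FO (cone_comparison I K D L c q) h'"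
    using H by (simp_all add: pseudocone_category_def cone_comparison_def)
  obtain x where x: "x \<in> Arr (hom_category K q L)" "Dom (hom_category K q L) x = h" "Cod (hom_category K q L) x = h'"
    by (rule equivalence_functor_full[OF F eq H a da])
  then have "x \<in> hom2 K h h'"
    unfolding hom_category_Arr by (simp add: hom_category_def)
  then show ?thesis by (rule that)
qed

text \<open>Whiskered with a leg, \<open>x\<close> and \<open>y\<close> are parallel 2-cells into an
  etale projection, hence equal. Faithfulness of the comparison functor then makes \<open>x\<close>
  and \<open>y\<close> themselves equal.\<close>

private lemma bilimit_thin:
  assumes h: "h \<in> hom1 K q L" and h': "h' \<in> hom1 K q L" and x: "x \<in> hom2 K h h'" and y: "y \<in> hom2 K h h'"
  shows "x = y"
proof -
  have q: "q \<in> cells1 GTop" "gtgt q = E" using h slice_src[of h E] by (auto simp: slice_hom1)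
  note F = comparison_functor[OF q] and eq = comp[OF q]
  have d: "dom2 K x = h" "cod2 K x = h'" "dom2 K y = h" "cod2 K y = h'" using x y by (simp_all add: hom2_def)
  have xa: "x \<in> Arr (hom_category K q L)" "y \<in> Arr (hom_category K q L)"
    unfolding hom_category_Arr using x y h h' by (simp_all add: d)
  have "whisker_left K (leg c i) x = whisker_left K (leg c i) y" if i: "i \<in> Obj I" for i
  proof -
    have l: "leg c i \<in> cells1 K" "tri_src (leg c i) = L" "tri_tgt (leg c i) = P0 D i"
      using leg_c[OF i] by (simp_all add: slice_hom1)
    have s: "tri_src (leg c i) = tri_tgt h" using h l by (simp add: slice_hom1)
    show ?thesis
      by (rule cone_thin[OF slice_hcmp[OF x slice_id2[OF l(1)] s] slice_hcmp[OF y slice_id2[OF l(1)] s] i])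
        (use slice_cmp1_hom1[OF h leg_c[OF i]] in \<open>simp add: slice_hom1\<close>)
  qed
  then have "FA (cone_comparison I K D L c q) x = FA (cone_comparison I K D L c q) y"
    using xa by (simp add: cone_comparison_def d cong: restrict_cong)
  then show ?thesis
    by - (rule equivalence_functor_faithful[OF F eq xa], simp_all add: hom_category_def d)
qed

text \<open>Arbitrary 1-cells with arbitrary invertible transition cells form a pseudocone, as each
  coherence law compares parallel 2-cells into an etale projection. Essential surjectivity then
  yields \<open>h\<close>.\<close>

private lemma bilimit_ess_surj:
  assumes q: "q \<in> cells1 GTop" "gtgt q = E"
    and m: "\<And>i. i \<in> Obj I \<Longrightarrow> m i \<in> hom1 K q (P0 D i)"
    and l: "\<And>u. u \<in> Arr I \<Longrightarrow> l u \<in> iso2 K (cmp1 K (P1 D u) (m (Dom I u))) (m (Cod I u))"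
  obtains h w where "h \<in> hom1 K q L" "\<forall>i\<in>Obj I. w i \<in> hom2 K (m i) (cmp1 K (leg c i) h)"
proof -
  note F = comparison_functor[OF q] and eq = comp[OF q]
  note [simp] = cat_simps[OF I]
  define z where "z = \<lparr>leg = restrict m (Obj I), leg_iso = restrict l (Arr I)\<rparr>"
  have l2: "l u \<in> hom2 K (cmp1 K (P1 D u) (m (Dom I u))) (m (Cod I u))" if "u \<in> Arr I" for u
    using l[OF that] by (simp add: iso2_def)
  have mc: "m i \<in> cells1 K" "tri_src (m i) = q" "tri_tgt (m i) = P0 D i" if "i \<in> Obj I" for i
    using m[OF that] by (simp_all add: slice_hom1)
  have Pu: "P1 D u \<in> cells1 K" "tri_src (P1 D u) = P0 D (Dom I u)" "tri_tgt (P1 D u) = P0 D (Cod I u)" if "u \<in> Arr I" for u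
    using P1[OF that] by (simp_all add: slice_hom1)
  have z: "pseudocone I K D q z"
    unfolding pseudocone_def
  proof (intro conjI ballI impI)
    fix i assume i: "i \<in> Obj I"
    have un: "unitor D i \<in> hom2 K (id1 K (P0 D i)) (P1 D (Idn I i))"
      using D i by (simp add: pseudofunctor_def iso2_def)
    have id1: "id1 K (P0 D i) \<in> hom1 K (P0 D i) (P0 D i)" using slice_id1_hom1 P0 i by blast
    have w: "hcmp K (unitor D i) (id2 K (m i)) \<in> hom2 K (cmp1 K (id1 K (P0 D i)) (m i)) (cmp1 K (P1 D (Idn I i)) (m i))"
      by (rule slice_hcmp[OF slice_id2 un]) (use id1 mc[OF i] in \<open>simp_all add: slice_hom1\<close>)
    have w': "hcmp K (unitor D i) (id2 K (m i)) \<in> hom2 K (m i) (cmp1 K (P1 D (Idn I i)) (m i))"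
      using w by (simp add: slice_cmp1_id[OF m[OF i]])
    have "l (Idn I i) \<in> hom2 K (cmp1 K (P1 D (Idn I i)) (m i)) (m i)"
      using l2[of "Idn I i"] i by simp
    from cone_thin[OF slice_vcmp[OF w' this] slice_id2[OF mc(1)[OF i]] i mc(3)[OF i]]
    show "vcmp K (leg_iso z (Idn I i)) (whisker_right K (unitor D i) (leg z i)) = id2 K (leg z i)"
      using i by (simp add: z_def)
  next
    fix u v assume u: "u \<in> Arr I" and v: "v \<in> Arr I" and uv: "Cod I u = Dom I v"
    let ?i = "Dom I u" and ?j = "Dom I v" and ?k = "Cod I v"
    have co: "compositor D v u \<in> hom2 K (cmp1 K (P1 D v) (P1 D u)) (P1 D (Cmp I v u))"
      using D u v uv by (simp add: pseudofunctor_def iso2_def)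
    have Pvu: "cmp1 K (P1 D v) (P1 D u) \<in> hom1 K (P0 D ?i) (P0 D ?k)"
      by (rule slice_cmp1_hom1[OF P1[OF u] P1[OF v, folded uv]])
    have 1: "hcmp K (compositor D v u) (id2 K (m ?i)) \<in> hom2 K (cmp1 K (cmp1 K (P1 D v) (P1 D u)) (m ?i)) (cmp1 K (P1 D (Cmp I v u)) (m ?i))"
      by (rule slice_hcmp[OF slice_id2 co]) (use Pvu mc[of ?i] u in \<open>simp_all add: slice_hom1\<close>)
    have 2: "l (Cmp I v u) \<in> hom2 K (cmp1 K (P1 D (Cmp I v u)) (m ?i)) (m ?k)"
      using l2[of "Cmp I v u"] u v uv by simp
    have 3: "hcmp K (id2 K (P1 D v)) (l u) \<in> hom2 K (cmp1 K (P1 D v) (cmp1 K (P1 D u) (m ?i))) (cmp1 K (P1 D v) (m ?j))"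
      by (rule slice_hcmp[OF l2[OF u, unfolded uv] slice_id2[OF Pu(1)[OF v]]])
        (use slice_cmp1_hom1[OF m P1[OF u]] u Pu[OF v] uv in \<open>simp_all add: slice_hom1\<close>)
    have as: "cmp1 K (P1 D v) (cmp1 K (P1 D u) (m ?i)) = cmp1 K (cmp1 K (P1 D v) (P1 D u)) (m ?i)"
      by (rule slice_cmp1_assoc[OF m P1[OF u] P1[OF v, folded uv]]) (use u in simp)
    have t: "tri_tgt (cmp1 K (cmp1 K (P1 D v) (P1 D u)) (m ?i)) = P0 D ?k"
      using slice_cmp1_hom1[OF m Pvu] u by (simp add: slice_hom1)
    show "vcmp K (leg_iso z (Cmp I v u)) (whisker_right K (compositor D v u) (leg z ?i)) =
      vcmp K (leg_iso z v) (whisker_left K (P1 D v) (leg_iso z u))"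
      using cone_thin[OF slice_vcmp[OF 1 2] slice_vcmp[OF 3[unfolded as] l2[OF v]] _ t] u v uv
      by (simp add: z_def)
  qed (use m l in \<open>auto simp: z_def\<close>)
  let ?P = "pseudocone_category I K D q" and ?F = "cone_comparison I K D L c q"
  have "z \<in> Obj ?P" using z by (simp add: pseudocone_category_def)
  then obtain h s where h: "h \<in> Obj (hom_category K q L)" and s: "s \<in> Arr ?P" "Dom ?P s = FO ?F h" "Cod ?P s = z" "iso_arr ?P s"
    by (rule equivalence_functor_ess_surj[OF F eq])
  have h': "h \<in> hom1 K q L" using h by (simp add: hom_category_def)
  \<comment> \<open>The isomorphism \<open>s\<close> goes from the restricted cone to
    \<open>z\<close>; the 2-cells sought go the other way.\<close>
  let ?r = "inv_arr ?P s"
  have r: "?r \<in> Arr ?P" "Dom ?P ?r = z" "Cod ?P ?r = FO ?F h" using s by (simp_all add: inv_simps[OF s(4)])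
  have "TMap ?r i \<in> hom2 K (m i) (cmp1 K (leg c i) h)" if i: "i \<in> Obj I" for i
  proof -
    have "TMap ?r i \<in> hom2 K (leg (TDom ?r) i) (leg (TCod ?r) i)" "TDom ?r = z" "TCod ?r = FO ?F h"
      using r i by (simp_all add: pseudocone_category_def)
    then show ?thesis using i h by (simp add: z_def cone_comparison_def restrict_cone_leg)
  qed
  then show ?thesis using that[OF h', of "TMap ?r"] by simp
qed

text \<open>Faithfulness, fullness and essential surjectivity of the comparison functors become
  \<open>thin\<close>, \<open>full\<close> and \<open>esurj\<close>, after inverse images are
  completed to geometric morphisms by \<open>geo_cells1\<close>.\<close>

lemma bilimit_points: "bilimit_points E (gsrc L) (pull L) I A (\<lambda>i. pull (tri_cell (leg c i))) (\<lambda>i. TMap (tri_iso (leg c i)))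
  (\<lambda>u. pull (tri_cell (P1 D u))) (\<lambda>u. TMap (tri_iso (P1 D u))) (\<lambda>u. TMap (snd (snd (leg_iso c u))))"
proof -
  note [simp] = cat_simps[OF I]
  have lc: "leg c i \<in> cells1 K" "tri_src (leg c i) = L" "tri_tgt (leg c i) = P0 D i" if "i \<in> Obj I" for i
    using leg_c[OF that] by (simp_all add: slice_hom1)
  have Pu: "P1 D u \<in> cells1 K" "tri_src (P1 D u) = P0 D (Dom I u)" "tri_tgt (P1 D u) = P0 D (Cod I u)" if "u \<in> Arr I" for u
    using P1[OF that] by (simp_all add: slice_hom1)
  have gc: "geo (slice E (A i)) (gsrc L) (pull (tri_cell (leg c i)))" if i: "i \<in> Obj I" for i
    using cells1_geo[OF slice_cell(1)[OF lc(1)[OF i]]] slice_cell(2,3)[OF lc(1)[OF i]] by (simp add: lc[OF i] P0[OF i])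
  \<comment> \<open>A geometric morphism \<open>h\<close> into the source of \<open>L\<close>
    becomes a 1-cell over \<open>E\<close> when its source is taken to be the composite of
    \<open>h\<close> and \<open>L\<close>, with identities as the 2-cell.\<close>
  have tri_hom: "tri (cmp_geom L h) L h (\<lambda>D\<in>Obj E. Idn X (FO M (FO (pull L) D))) \<in> hom1 K (cmp_geom L h) L"
    if h: "h \<in> cells1 GTop" "pull h = M" "gsrc h = X" "gtgt h = gsrc L" for h M X
  proof -
    have F: "functor_from_to (cmp_func M (pull L)) E X"
      using functor_cmp[OF geo_functor[OF cells1_geo[OF L(1)]] geo_functor[OF cells1_geo[OF h(1)], unfolded h]] L by simp
    have "ntiso E X (cmp_func M (pull L)) (cmp_func M (pull L)) (\<lambda>D\<in>Obj E. Idn X (FO M (FO (pull L) D)))"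
      using ntiso_id[OF F] geo_functor[OF cells1_geo[OF L(1)]] L by (simp add: cmp_func_simps functor_simps cong: restrict_cong)
    then show ?thesis unfolding slice_tri using h L by (simp add: cmp_geom_simps cells1_cmp)
  qed
  show ?thesis
  proof
    show "geo E (gsrc L) (pull L)" using cells1_geo[OF L(1)] L by simp
    show "category I" by (rule I)
    show "A i \<in> Obj E" "geo E (slice E (A i)) (product_functor E (A i))" if "i \<in> Obj I" for i
      using A geoP that by simp_all
    show "geo (slice E (A i)) (gsrc L) (pull (tri_cell (leg c i)))" if "i \<in> Obj I" for i
      by (rule gc[OF that])
    show "ntiso E (gsrc L) (pull L) (cmp_func (pull (tri_cell (leg c i))) (product_functor E (A i))) (TMap (tri_iso (leg c i)))"
      if i: "i \<in> Obj I" for i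
      using slice_iso[OF lc(1)[OF i]] by (simp add: lc[OF i] P0[OF i])
    fix u assume u: "u \<in> Arr I"
    have ij: "Dom I u \<in> Obj I" "Cod I u \<in> Obj I" using u by simp_all
    show "geo (slice E (A (Cod I u))) (slice E (A (Dom I u))) (pull (tri_cell (P1 D u)))"
      using cells1_geo[OF slice_cell(1)[OF Pu(1)[OF u]]] slice_cell(2,3)[OF Pu(1)[OF u]] by (simp add: Pu[OF u] P0 ij)
    show "ntiso E (slice E (A (Dom I u))) (product_functor E (A (Dom I u)))
        (cmp_func (pull (tri_cell (P1 D u))) (product_functor E (A (Cod I u)))) (TMap (tri_iso (P1 D u)))"
      using slice_iso[OF Pu(1)[OF u]] by (simp add: Pu[OF u] P0 ij)
    note sel = slice_cmp1_sel[OF leg_c[OF ij(1)] P1[OF u]]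
    have "leg_iso c u \<in> iso2 K (cmp1 K (P1 D u) (leg c (Dom I u))) (leg c (Cod I u))"
      using c u by (simp add: pseudocone_def)
    then obtain t where t: "leg_iso c u = c2 (cmp1 K (P1 D u) (leg c (Dom I u))) (leg c (Cod I u)) t"
      and t2: "c2 (cmp1 K (P1 D u) (leg c (Dom I u))) (leg c (Cod I u)) t \<in> hom2 K (cmp1 K (P1 D u) (leg c (Dom I u))) (leg c (Cod I u))"
      and ti0: "ntiso (gsrc (tri_tgt (cmp1 K (P1 D u) (leg c (Dom I u))))) (gsrc (tri_src (cmp1 K (P1 D u) (leg c (Dom I u)))))
        (pull (tri_cell (cmp1 K (P1 D u) (leg c (Dom I u))))) (pull (tri_cell (leg c (Cod I u)))) t"
      by (rule slice_iso2D)
    note ti = ti0[unfolded sel(1-3)]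
    have T: "TMap (snd (snd (leg_iso c u))) = t" by (simp add: t c2_def)
    show "ntiso (slice E (A (Cod I u))) (gsrc L) (cmp_func (pull (tri_cell (leg c (Dom I u)))) (pull (tri_cell (P1 D u))))
        (pull (tri_cell (leg c (Cod I u)))) (TMap (snd (snd (leg_iso c u))))"
      using ti by (simp add: T P0 ij cmp_geom_simps)
    fix d assume d: "d \<in> Obj E"
    show "Cmp (gsrc L) (TMap (snd (snd (leg_iso c u))) (FO (product_functor E (A (Cod I u))) d))
        (Cmp (gsrc L) (FA (pull (tri_cell (leg c (Dom I u)))) (TMap (tri_iso (P1 D u)) d)) (TMap (tri_iso (leg c (Dom I u))) d)) =
      TMap (tri_iso (leg c (Cod I u))) d"
      using c2_over[OF t2 d] by (simp add: T sel d P0 ij)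
  next
    fix X M s y assume M: "geo (gsrc L) X M" and s: "ntrans (gsrc L) X M M s"
      and e: "\<And>D. D \<in> Obj E \<Longrightarrow> s (FO (pull L) D) = Idn X (FO M (FO (pull L) D))" and y: "y \<in> Obj (gsrc L)"
    obtain h where h: "h \<in> cells1 GTop" "pull h = M" "gsrc h = X" "gtgt h = gsrc L" by (rule geo_cells1[OF M])
    let ?m = "tri (cmp_geom L h) L h (\<lambda>D\<in>Obj E. Idn X (FO M (FO (pull L) D)))"
    note m = tri_hom[OF h]
    have mc: "?m \<in> cells1 K" using m by (simp add: slice_hom1)
    note F = geo_functor[OF cells1_geo[OF L(1)], unfolded L(2)] and FM = geo_functor[OF M]
    have "c2 ?m ?m s \<in> hom2 K ?m ?m"
      unfolding slice_c2 using mc s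
      by (simp add: tri_simps cmp_geom_simps h e functor_simps[OF F] functor_simps[OF FM] cat_simps[OF functor_category_cod[OF FM]])
    from bilimit_thin[OF m m this slice_id2[OF mc]]
    show "s y = Idn X (FO M y)"
      using y by (simp add: slice_ops c2_def tri_simps h)
  next
    fix X M N io assume M: "geo (gsrc L) X M" and N: "geo (gsrc L) X N"
      and io: "ntiso E X (cmp_func M (pull L)) (cmp_func N (pull L)) io"
      and w: "\<And>i. i \<in> Obj I \<Longrightarrow> \<exists>w. ntrans (slice E (A i)) X (cmp_func M (pull (tri_cell (leg c i)))) (cmp_func N (pull (tri_cell (leg c i)))) w \<and>
        (\<forall>D\<in>Obj E. Cmp X (w (FO (product_functor E (A i)) D)) (FA M (TMap (tri_iso (leg c i)) D)) =
          Cmp X (FA N (TMap (tri_iso (leg c i)) D)) (io D))"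
    obtain h where h: "h \<in> cells1 GTop" "pull h = M" "gsrc h = X" "gtgt h = gsrc L" by (rule geo_cells1[OF M])
    obtain k where k: "k \<in> cells1 GTop" "pull k = N" "gsrc k = X" "gtgt k = gsrc L" by (rule geo_cells1[OF N])
    let ?q = "cmp_geom L h"
    \<comment> \<open>Both 1-cells need the same source, so \<open>?n\<close> also starts at
      \<open>?q\<close>, with \<open>io\<close> as its 2-cell. A 2-cell from \<open>?m\<close> to
      \<open>?n\<close> then has the component \<open>io D\<close> at
      \<open>FO (pull L) D\<close>.\<close>
    let ?m = "tri ?q L h (\<lambda>D\<in>Obj E. Idn X (FO M (FO (pull L) D)))" and ?n = "tri ?q L k io"
    note m = tri_hom[OF h]
    have n: "?n \<in> hom1 K ?q L"
      unfolding slice_tri using h k L io by (simp add: cmp_geom_simps cells1_cmp)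
    note F = geo_functor[OF cells1_geo[OF L(1)], unfolded L(2)] and FM = geo_functor[OF M] and FN = geo_functor[OF N]
    have ws: "\<exists>w. w \<in> hom2 K (cmp1 K (leg c i) ?m) (cmp1 K (leg c i) ?n)" if i: "i \<in> Obj I" for i
    proof -
      obtain w where w: "ntrans (slice E (A i)) X (cmp_func M (pull (tri_cell (leg c i)))) (cmp_func N (pull (tri_cell (leg c i)))) w"
        "\<forall>D\<in>Obj E. Cmp X (w (FO (product_functor E (A i)) D)) (FA M (TMap (tri_iso (leg c i)) D)) =
          Cmp X (FA N (TMap (tri_iso (leg c i)) D)) (io D)"
        using w[OF i] by blast
      note sm = slice_cmp1_sel[OF m leg_c[OF i]] and sn = slice_cmp1_sel[OF n leg_c[OF i]]
      have mn: "cmp1 K (leg c i) ?m \<in> cells1 K" "cmp1 K (leg c i) ?n \<in> cells1 K"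
        using slice_cmp1_hom1[OF m leg_c[OF i]] slice_cmp1_hom1[OF n leg_c[OF i]] by (simp_all add: slice_hom1)
      have gi: "ntiso E (gsrc L) (pull L) (cmp_func (pull (tri_cell (leg c i))) (product_functor E (A i))) (TMap (tri_iso (leg c i)))"
        using slice_iso[OF lc(1)[OF i]] by (simp add: lc[OF i] P0[OF i])
      have "c2 (cmp1 K (leg c i) ?m) (cmp1 K (leg c i) ?n) w \<in> hom2 K (cmp1 K (leg c i) ?m) (cmp1 K (leg c i) ?n)"
        unfolding slice_c2 using mn w
        by (simp add: sm sn tri_simps cmp_geom_simps h k P0[OF i] functor_simps[OF F] functor_simps[OF FM]
            cat_simps[OF functor_category_cod[OF FM]] ntrans_simps[OF ntiso_ntrans[OF gi]])
      then show ?thesis by blast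
    qed
    have "\<exists>w. \<forall>i\<in>Obj I. w i \<in> hom2 K (cmp1 K (leg c i) ?m) (cmp1 K (leg c i) ?n)" using ws by metis
    then obtain w where w: "\<And>i. i \<in> Obj I \<Longrightarrow> w i \<in> hom2 K (cmp1 K (leg c i) ?m) (cmp1 K (leg c i) ?n)" by blast
    obtain x where x: "x \<in> hom2 K ?m ?n" by (rule bilimit_full[OF m n w])
    then obtain t where xt: "x = c2 ?m ?n t" and t: "c2 ?m ?n t \<in> hom2 K ?m ?n" using slice_hom2[of x E ?m ?n] by auto
    have t1: "ntrans (gsrc L) X M N t" using c2_ntrans[OF t] by (simp add: tri_simps cmp_geom_simps h k)
    have "t (FO (pull L) D) = io D" if D: "D \<in> Obj E" for D
      using c2_over[OF t D] D
      by (simp add: tri_simps cmp_geom_simps h functor_simps[OF F] ntrans_simps[OF t1] cat_simps[OF functor_category_cod[OF FM]])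
    with t1 show "\<exists>x. ntrans (gsrc L) X M N x \<and> (\<forall>D\<in>Obj E. x (FO (pull L) D) = io D)" by blast
  next
    fix X q Ki mu assume q: "geo E X q" and Ki: "\<And>i. i \<in> Obj I \<Longrightarrow> geo (slice E (A i)) X (Ki i)"
      and mu: "\<And>i. i \<in> Obj I \<Longrightarrow> ntiso E X q (cmp_func (Ki i) (product_functor E (A i))) (mu i)"
      and l: "\<And>u. u \<in> Arr I \<Longrightarrow> \<exists>l. ntiso (slice E (A (Cod I u))) X (cmp_func (Ki (Dom I u)) (pull (tri_cell (P1 D u)))) (Ki (Cod I u)) l \<and>
        (\<forall>d\<in>Obj E. Cmp X (l (FO (product_functor E (A (Cod I u))) d))
          (Cmp X (FA (Ki (Dom I u)) (TMap (tri_iso (P1 D u)) d)) (mu (Dom I u) d)) = mu (Cod I u) d)"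
    obtain qq where qq: "qq \<in> cells1 GTop" "pull qq = q" "gsrc qq = X" "gtgt qq = E" by (rule geo_cells1[OF q])
    have "\<forall>i\<in>Obj I. \<exists>k. k \<in> cells1 GTop \<and> pull k = Ki i \<and> gsrc k = X \<and> gtgt k = slice E (A i)"
    proof
      fix i assume "i \<in> Obj I"
      from geo_cells1[OF Ki[OF this]] show "\<exists>k. k \<in> cells1 GTop \<and> pull k = Ki i \<and> gsrc k = X \<and> gtgt k = slice E (A i)"
        by blast
    qed
    from bchoice[OF this] obtain k where
      k: "\<And>i. i \<in> Obj I \<Longrightarrow> k i \<in> cells1 GTop \<and> pull (k i) = Ki i \<and> gsrc (k i) = X \<and> gtgt (k i) = slice E (A i)"
      by blast
    define m where "m = (\<lambda>i. tri qq (P0 D i) (k i) (mu i))"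
    have m: "m i \<in> hom1 K qq (P0 D i)" if i: "i \<in> Obj I" for i
      unfolding m_def slice_tri using qq k[OF i] P0[OF i] mu[OF i] by simp
    have ls: "\<exists>l. l \<in> iso2 K (cmp1 K (P1 D u) (m (Dom I u))) (m (Cod I u))" if u: "u \<in> Arr I" for u
    proof -
      have ij: "Dom I u \<in> Obj I" "Cod I u \<in> Obj I" using u by simp_all
      obtain l where l: "ntiso (slice E (A (Cod I u))) X (cmp_func (Ki (Dom I u)) (pull (tri_cell (P1 D u)))) (Ki (Cod I u)) l"
        "\<forall>d\<in>Obj E. Cmp X (l (FO (product_functor E (A (Cod I u))) d))
          (Cmp X (FA (Ki (Dom I u)) (TMap (tri_iso (P1 D u)) d)) (mu (Dom I u) d)) = mu (Cod I u) d"
        using l[OF u] by blast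
      note sel = slice_cmp1_sel[OF m[OF ij(1)] P1[OF u]]
      have mc: "cmp1 K (P1 D u) (m (Dom I u)) \<in> cells1 K" "m (Cod I u) \<in> cells1 K"
        using slice_cmp1_hom1[OF m[OF ij(1)] P1[OF u]] m[OF ij(2)] by (simp_all add: slice_hom1)
      have ms: "tri_src (m i) = qq" "tri_tgt (m i) = P0 D i" "tri_cell (m i) = k i" "TMap (tri_iso (m i)) = mu i" for i
        by (simp_all add: m_def tri_simps)
      have "c2 (cmp1 K (P1 D u) (m (Dom I u))) (m (Cod I u)) l \<in> hom2 K (cmp1 K (P1 D u) (m (Dom I u))) (m (Cod I u))"
        unfolding slice_c2 using mc l k[OF ij(1)] k[OF ij(2)]
        by (simp add: sel ms qq P0 ij cmp_geom_simps ntiso_ntrans)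
      from slice_iso2I[OF this] have "c2 (cmp1 K (P1 D u) (m (Dom I u))) (m (Cod I u)) l \<in>
          iso2 K (cmp1 K (P1 D u) (m (Dom I u))) (m (Cod I u))"
        using ntiso_iso[OF l(1)] P0 ij by (simp add: sel qq)
      then show ?thesis by blast
    qed
    then have "\<exists>l. \<forall>u\<in>Arr I. l u \<in> iso2 K (cmp1 K (P1 D u) (m (Dom I u))) (m (Cod I u))" by metis
    then obtain l where l: "\<And>u. u \<in> Arr I \<Longrightarrow> l u \<in> iso2 K (cmp1 K (P1 D u) (m (Dom I u))) (m (Cod I u))" by blast
    obtain h w where h: "h \<in> hom1 K qq L" and w: "\<forall>i\<in>Obj I. w i \<in> hom2 K (m i) (cmp1 K (leg c i) h)"
      by (rule bilimit_ess_surj[OF qq(1,4) m l])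
    have hc: "h \<in> cells1 K" "tri_src h = qq" "tri_tgt h = L" using h by (simp_all add: slice_hom1)
    note hcell = slice_cell[OF hc(1), unfolded hc qq]
    have B: "geo (gsrc L) X (pull (tri_cell h))" using cells1_geo[OF hcell(1)] hcell by simp
    have io: "ntiso E X q (cmp_func (pull (tri_cell h)) (pull L)) (TMap (tri_iso h))"
      using slice_iso[OF hc(1)] by (simp add: hc qq)
    have "\<exists>w. ntrans (slice E (A i)) X (Ki i) (cmp_func (pull (tri_cell h)) (pull (tri_cell (leg c i)))) w \<and>
          (\<forall>d\<in>Obj E. Cmp X (w (FO (product_functor E (A i)) d)) (mu i d) =
            Cmp X (FA (pull (tri_cell h)) (TMap (tri_iso (leg c i)) d)) (TMap (tri_iso h) d))" if i: "i \<in> Obj I" for i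
    proof -
      obtain t where t: "c2 (m i) (cmp1 K (leg c i) h) t \<in> hom2 K (m i) (cmp1 K (leg c i) h)"
        using w i slice_hom2[of "w i" E "m i" "cmp1 K (leg c i) h"] by auto
      note sel = slice_cmp1_sel[OF h leg_c[OF i]]
      show ?thesis
        using c2_ntrans[OF t] c2_over[OF t] k[OF i]
        by (intro exI[of _ t]) (simp add: sel m_def tri_simps qq P0[OF i] cmp_geom_simps)
    qed
    then show "\<exists>B io. geo (gsrc L) X B \<and> ntiso E X q (cmp_func B (pull L)) io \<and>
        (\<forall>i\<in>Obj I. \<exists>w. ntrans (slice E (A i)) X (Ki i) (cmp_func B (pull (tri_cell (leg c i)))) w \<and>
          (\<forall>d\<in>Obj E. Cmp X (w (FO (product_functor E (A i)) d)) (mu i d) = Cmp X (FA B (TMap (tri_iso (leg c i)) d)) (io d)))"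
      using B io by (intro exI[of _ "pull (tri_cell h)"] exI[of _ "TMap (tri_iso h)"]) simp
  qed
qed

end

section \<open>Arrows of points as points valued in the Sierpinski topos\<close>

lemma geo_arr_fun:
  assumes F: "geo E SetCat F" and G: "geo E SetCat G" and t: "ntrans E SetCat F G t"
  shows "geo E (arrow_cat SetCat) (arr_fun F G t)"
proof -
  have "inverse_image E (arrow_cat SetCat) (arr_fun F G t)"
    by (rule inverse_image_arr_fun[OF t geo_inverse_image[OF F] geo_inverse_image[OF G]])
      (use topos_pullback[OF geo_dom[OF F]] in blast)
  then show ?thesis using geo_dom[OF F] grothendieck_topos_arrow_SetCat by (simp add: geo_def)
qed

lemma geo_ev:
  fixes E :: "('u::universe large, 'u large) category"
  assumes B: "geo E (arrow_cat SetCat) B"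
    and T: "grothendieck_topos (SetCat :: ('u large, 'u large) category)"
  shows "geo E SetCat (cmp_func (ev0 SetCat) B)" "geo E SetCat (cmp_func (ev1 SetCat) B)"
  using inverse_image_cmp[OF geo_inverse_image[OF B] inverse_image_ev0]
    inverse_image_cmp[OF geo_inverse_image[OF B] inverse_image_ev1] geo_dom[OF B] T
  by (simp_all add: geo_def)

text \<open>The triangle property, for the legs \<open>x\<close> and the identity of
  \<open>a\<close> over the inverse of \<open>x\<close> on \<open>E\<close>, gives an arrow back;
  faithfulness makes it a two-sided inverse.\<close>

lemma discof_conservative:
  assumes d: "discof E F P" and P: "functor_from_to P E F" and a: "geo F SetCat a" and b: "geo F SetCat b"
    and x: "ntrans F SetCat a b x" and i: "\<And>D. D \<in> Obj E \<Longrightarrow> iso_arr SetCat (x (FO P D))" and y: "y \<in> Obj F"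
  shows "iso_arr SetCat (x y)"
proof -
  note T = category_SetCat
  note Fa = geo_functor[OF a] and Fb = geo_functor[OF b]
  note [simp] = functor_simps[OF P] functor_simps[OF Fa] functor_simps[OF Fb] ntrans_simps[OF x] cat_simps[OF T]
    inv_simps[OF i] cmp_func_simps
  have xP: "ntrans E SetCat (cmp_func a P) (cmp_func b P) (\<lambda>D\<in>Obj E. x (FO P D))"
    by (rule ntrans_whisker[OF x P])
  have g: "ntrans E SetCat (cmp_func b P) (cmp_func a P) (\<lambda>D\<in>Obj E. inv_arr SetCat ((\<lambda>D\<in>Obj E. x (FO P D)) D))"
    by (rule ntrans_inv[OF xP]) (simp add: i)
  note ia = ntrans_id[OF Fa] and ib = ntrans_id[OF Fb]
  obtain z where z: "ntrans F SetCat b a z"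
    and zD: "\<forall>D\<in>Obj E. z (FO P D) = (\<lambda>D\<in>Obj E. inv_arr SetCat ((\<lambda>D\<in>Obj E. x (FO P D)) D)) D"
    by (rule discof_triangle[OF d a b a x ia g]) simp
  note [simp] = ntrans_simps[OF z]
  have 1: "(\<lambda>v\<in>Obj F. Cmp SetCat (z v) (x v)) = (\<lambda>v\<in>Obj F. Idn SetCat (FO a v))"
    by (rule discof_faithful[OF d a a ntrans_vcmp[OF x z] ia]) (simp add: zD)
  have 2: "(\<lambda>v\<in>Obj F. Cmp SetCat (x v) (z v)) = (\<lambda>v\<in>Obj F. Idn SetCat (FO b v))"
    by (rule discof_faithful[OF d b b ntrans_vcmp[OF z x] ib]) (simp add: zD)
  have "Cmp SetCat (z y) (x y) = Idn SetCat (FO a y)" "Cmp SetCat (x y) (z y) = Idn SetCat (FO b y)"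
    using fun_cong[OF 1, of y] fun_cong[OF 2, of y] y by simp_all
  then show ?thesis
    by (intro iso_arrI[of _ _ "z y"]) (use y in simp_all)
qed

section \<open>Points of the bilimit\<close>

context bilimit_points
begin

lemma Lp: "functor_from_to Lp E L0" by (rule geo_functor[OF geoL])

lemma Pf: "i \<in> Obj I \<Longrightarrow> functor_from_to (product_functor E (A i)) E (slice E (A i))"
  and cf: "i \<in> Obj I \<Longrightarrow> functor_from_to (ci i) (slice E (A i)) L0"
  and tf: "u \<in> Arr I \<Longrightarrow> functor_from_to (tu u) (slice E (A (Cod I u))) (slice E (A (Dom I u)))"
  using geo_functor geoP geoc geot by blast+

lemma disc: "i \<in> Obj I \<Longrightarrow> discof E (slice E (A i)) (product_functor E (A i))"
  by (rule discof_etale[OF geoP A])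

lemma gm_simps:
  assumes "i \<in> Obj I" "D \<in> Obj E"
  shows "gm i D \<in> Arr L0" "Dom L0 (gm i D) = FO Lp D" "Cod L0 (gm i D) = FO (ci i) (FO (product_functor E (A i)) D)"
    "iso_arr L0 (gm i D)"
  using ntrans_simps[OF ntiso_ntrans[OF gm[OF assms(1)]] assms(2)] ntiso_iso[OF gm[OF assms(1)] assms(2)]
    functor_simps[OF Pf[OF assms(1)]] assms(2) by (simp_all add: cmp_func_simps)

text \<open>A point \<open>a\<close> of the bilimit induces a point of \<open>E\<close> directly or
  through its projection to a slice; \<open>gm\<close> identifies the two.\<close>

lemma gm_ntiso:
  assumes i: "i \<in> Obj I" and a: "geo L0 X a"
  shows "ntiso E X (cmp_func a Lp) (cmp_func (cmp_func a (ci i)) (product_functor E (A i))) (\<lambda>D\<in>Obj E. FA a (gm i D))"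
  using ntiso_postwhisker[OF gm[OF i] geo_functor[OF a]]
  by (simp add: cmp_func_assoc[OF Pf[OF i] cf[OF i] geo_functor[OF a]])

text \<open>\<open>thin\<close> only compares an endomorphism with the identity, while
  \<open>s\<close> and \<open>t\<close> lie over an arbitrary arrow of points. The etale case makes
  them agree on the images of all \<open>ci\<close>, so as functors \<open>M\<close> and
  \<open>N\<close> into arrows of sets they are joined by some \<open>x\<close> from
  \<open>full\<close> that is the identity over \<open>E\<close>. The evaluations of
  \<open>x\<close> are endomorphisms of \<open>a\<close> and \<open>b\<close>, hence identities by
  \<open>thin\<close>, and its squares then say that \<open>s\<close> and \<open>t\<close>
  agree.\<close>

lemma faithful:
  assumes a: "geo L0 SetCat a" and b: "geo L0 SetCat b" and s: "ntrans L0 SetCat a b s" and t: "ntrans L0 SetCat a b t"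
    and e: "\<And>D. D \<in> Obj E \<Longrightarrow> s (FO Lp D) = t (FO Lp D)"
  shows "s = t"
proof -
  note T = category_SetCat
  let ?S = "arrow_cat SetCat"
  note S = category_arrow_cat[OF T]
  note Fa = geo_functor[OF a] and Fb = geo_functor[OF b]
  note [simp] = functor_simps[OF Lp] functor_simps[OF Fa] functor_simps[OF Fb] ntrans_simps[OF s] ntrans_simps[OF t]
    cat_simps[OF T] cmp_func_simps
  have ec: "s (FO (ci i) y) = t (FO (ci i) y)" if i: "i \<in> Obj I" and y: "y \<in> Obj (slice E (A i))" for i y
  proof -
    let ?P = "product_functor E (A i)"
    note [simp] = functor_simps[OF cf[OF i]] functor_simps[OF Pf[OF i]] gm_simps[OF i]
    have "(\<lambda>y\<in>Obj (slice E (A i)). s (FO (ci i) y)) = (\<lambda>y\<in>Obj (slice E (A i)). t (FO (ci i) y))"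
    proof (rule discof_faithful[OF disc[OF i] geo_cmp[OF geoc[OF i] a] geo_cmp[OF geoc[OF i] b]
          ntrans_whisker[OF s cf[OF i]] ntrans_whisker[OF t cf[OF i]]])
      fix D assume D: "D \<in> Obj E"
      have "Cmp SetCat (s (FO (ci i) (FO ?P D))) (FA a (gm i D)) = Cmp SetCat (t (FO (ci i) (FO ?P D))) (FA a (gm i D))"
        using ntrans_sq[OF s gm_simps(1)[OF i D]] ntrans_sq[OF t gm_simps(1)[OF i D]] e[OF D] D by simp
      then have "s (FO (ci i) (FO ?P D)) = t (FO (ci i) (FO ?P D))"
        using D by - (rule iso_cancel_right[OF T iso_FA[OF Fa gm_simps(4)[OF i D]], rotated -1], simp_all)
      then show "(\<lambda>y\<in>Obj (slice E (A i)). s (FO (ci i) y)) (FO ?P D) = (\<lambda>y\<in>Obj (slice E (A i)). t (FO (ci i) y)) (FO ?P D)"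
        using D by simp
    qed
    from fun_cong[OF this, of y] show ?thesis using y by simp
  qed
  define M N where "M = arr_fun a b s" and "N = arr_fun a b t"
  have gM: "geo L0 ?S M" and gN: "geo L0 ?S N"
    unfolding M_def N_def by (rule geo_arr_fun[OF a b s] geo_arr_fun[OF a b t])+
  note FM = geo_functor[OF gM] and FN = geo_functor[OF gN]
  have MN: "FO M y = s y" "FO N y = t y" if "y \<in> Obj L0" for y
    using that by (simp_all add: M_def N_def arr_fun_FO[OF s] arr_fun_FO[OF t])
  have MNA: "FA M f = sq (s (Dom L0 f)) (s (Cod L0 f)) (FA a f) (FA b f)"
    "FA N f = sq (t (Dom L0 f)) (t (Cod L0 f)) (FA a f) (FA b f)" if "f \<in> Arr L0" for f
    using that by (simp_all add: M_def N_def arr_fun_FA[OF s] arr_fun_FA[OF t])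
  \<comment> \<open>Agreement of \<open>s\<close> and \<open>t\<close> on the image of
    \<open>F\<close> makes these composites equal on the nose, so that identities can serve as the
    2-cells \<open>full\<close> asks for.\<close>
  have eq: "cmp_func M F = cmp_func N F" if F: "functor_from_to F B L0" and e: "\<And>y. y \<in> Obj B \<Longrightarrow> s (FO F y) = t (FO F y)"
    for F :: "('x, 'y, 'u large, 'u large) func" and B
    by (rule functor_eqI[OF functor_cmp[OF F FM] functor_cmp[OF F FN]])
      (simp_all add: functor_simps[OF F] MN MNA e cat_simps[OF functor_category_dom[OF F]])
  have eqL: "cmp_func M Lp = cmp_func N Lp" by (rule eq[OF Lp e])
  let ?io = "\<lambda>D\<in>Obj E. Idn ?S (FO (cmp_func M Lp) D)"
  have io: "ntiso E ?S (cmp_func M Lp) (cmp_func N Lp) ?io"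
    using ntiso_id[OF functor_cmp[OF Lp FM]] eqL by simp
  have "\<exists>w. ntrans (slice E (A i)) ?S (cmp_func M (ci i)) (cmp_func N (ci i)) w \<and>
        (\<forall>D\<in>Obj E. Cmp ?S (w (FO (product_functor E (A i)) D)) (FA M (gm i D)) = Cmp ?S (FA N (gm i D)) (?io D))"
    if i: "i \<in> Obj I" for i
  proof (intro exI conjI ballI)
    let ?w = "\<lambda>y\<in>Obj (slice E (A i)). Idn ?S (FO (cmp_func M (ci i)) y)"
    have "cmp_func M (ci i) = cmp_func N (ci i)" by (rule eq[OF cf[OF i] ec[OF i]])
    then show "ntrans (slice E (A i)) ?S (cmp_func M (ci i)) (cmp_func N (ci i)) ?w"
      using ntrans_id[OF functor_cmp[OF cf[OF i] FM]] by simp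
    fix D assume D: "D \<in> Obj E"
    note [simp] = functor_simps[OF cf[OF i]] functor_simps[OF Pf[OF i]] gm_simps[OF i] functor_simps[OF FM] cat_simps[OF S]
    have "FA M (gm i D) = FA N (gm i D)" using D e ec[OF i] by (simp add: MNA)
    then show "Cmp ?S (?w (FO (product_functor E (A i)) D)) (FA M (gm i D)) = Cmp ?S (FA N (gm i D)) (?io D)"
      using D by (simp flip: \<open>FA M (gm i D) = FA N (gm i D)\<close>)
  qed
  from full[OF gM gN io this] obtain x where x: "ntrans L0 ?S M N x" and xD: "\<forall>D\<in>Obj E. x (FO Lp D) = ?io D"
    by blast
  note xs = ntrans_simps[OF x]
  have x0: "ntrans L0 SetCat a a (\<lambda>y\<in>Obj L0. FA (ev0 SetCat) (x y))"
    using ntrans_postwhisker[OF x functor_ev0[OF T]] by (simp add: M_def N_def ev0_arr_fun[OF s] ev0_arr_fun[OF t])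
  have x1: "ntrans L0 SetCat b b (\<lambda>y\<in>Obj L0. FA (ev1 SetCat) (x y))"
    using ntrans_postwhisker[OF x functor_ev1[OF T]] by (simp add: M_def N_def ev1_arr_fun[OF s] ev1_arr_fun[OF t])
  have xL: "sq0 (x (FO Lp D)) = Idn SetCat (FO a (FO Lp D))" "sq1 (x (FO Lp D)) = Idn SetCat (FO b (FO Lp D))" if "D \<in> Obj E" for D
    using that xD by (simp_all add: functor_simps[OF FM] MN arrow_cat_Idn)
  show ?thesis
  proof (rule ntrans_eqI[OF s t])
    fix y assume y: "y \<in> Obj L0"
    have "sq0 (x y) = Idn SetCat (FO a y)"
      using thin[OF a x0 _ y] y xL by (simp add: ev_simps xs)
    moreover have "sq1 (x y) = Idn SetCat (FO b y)"
      using thin[OF b x1 _ y] y xL by (simp add: ev_simps xs)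
    ultimately show "s y = t y"
      using sq_comm[OF xs(1)[OF y]] y by (simp add: xs MN)
  qed
qed

text \<open>The etale case lifts \<open>f\<close> along each projection, to \<open>b i\<close>,
  \<open>k i\<close>, \<open>s i\<close>. Regarded as functors into arrows of sets, \<open>f\<close>
  and the \<open>k i\<close> form a compatible family \<open>q\<close>, \<open>Ki\<close> over
  \<open>E\<close>, which \<open>esurj\<close> for the Sierpinski topos glues to \<open>B\<close>.
  The lift is \<open>B\<close> evaluated at 1; \<open>full\<close> provides the arrow from
  \<open>a\<close> to \<open>B\<close> evaluated at 0.\<close>

lemma lift:
  assumes a: "geo L0 SetCat a" and y: "geo E SetCat y" and f: "ntrans E SetCat (cmp_func a Lp) y f"
  shows "\<exists>b k s. geo L0 SetCat b \<and> ntrans L0 SetCat a b k \<and> ntiso E SetCat (cmp_func b Lp) y s \<and>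
        (\<forall>D\<in>Obj E. Cmp SetCat (s D) (k (FO Lp D)) = f D)"
proof -
  note T = category_SetCat
  let ?S = "arrow_cat SetCat"
  note S = category_arrow_cat[OF T]
  note Fa = geo_functor[OF a] and Fy = geo_functor[OF y]
  note [simp] = cat_simps[OF T] cmp_func_simps functor_simps[OF Lp] functor_simps[OF Fa] functor_simps[OF Fy] ntrans_simps[OF f]
    cat_simps[OF I]
  let ?P = "\<lambda>i. product_functor E (A i)"
  let ?ai = "\<lambda>i. cmp_func a (ci i)"
  have gai: "geo (slice E (A i)) SetCat (?ai i)" if "i \<in> Obj I" for i
    by (rule geo_cmp[OF geoc[OF that] a])
  have "\<forall>i\<in>Obj I. \<exists>r. case r of (b, k, s) \<Rightarrow> geo (slice E (A i)) SetCat b \<and> ntrans (slice E (A i)) SetCat (?ai i) b k \<and>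
      ntiso E SetCat (cmp_func b (?P i)) y s \<and>
      (\<forall>D\<in>Obj E. Cmp SetCat (s D) (Cmp SetCat (k (FO (?P i) D)) (FA a (gm i D))) = f D)"
  proof
    fix i assume i: "i \<in> Obj I"
    note [simp] = functor_simps[OF cf[OF i]] functor_simps[OF Pf[OF i]] gm_simps[OF i]
    note v = gm_ntiso[OF i a]
    have iv: "iso_arr SetCat (FA a (gm i D))" if "D \<in> Obj E" for D by (rule iso_FA[OF Fa gm_simps(4)[OF i that]])
    note [simp] = inv_simps[OF iv]
    \<comment> \<open>The source of \<open>f\<close> is moved along \<open>FA a (gm i D)\<close> to
      the point of \<open>E\<close> induced by \<open>?ai i\<close>.\<close>
    let ?f = "\<lambda>D\<in>Obj E. Cmp SetCat (f D) ((\<lambda>D\<in>Obj E. inv_arr SetCat ((\<lambda>D\<in>Obj E. FA a (gm i D)) D)) D)"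
    have fi: "ntrans E SetCat (cmp_func (?ai i) (?P i)) y ?f"
      by (rule ntrans_vcmp[OF ntiso_ntrans[OF ntiso_inv[OF v]] f])
    obtain b k s where b: "geo (slice E (A i)) SetCat b" and k: "ntrans (slice E (A i)) SetCat (?ai i) b k"
      and s: "ntiso E SetCat (cmp_func b (?P i)) y s" and sk: "\<forall>D\<in>Obj E. Cmp SetCat (s D) (k (FO (?P i) D)) = ?f D"
      by (rule discof_lift[OF disc[OF i] gai[OF i] y fi])
    have "Cmp SetCat (s D) (Cmp SetCat (k (FO (?P i) D)) (FA a (gm i D))) = f D" if D: "D \<in> Obj E" for D
    proof -
      note [simp] = functor_simps[OF geo_functor[OF b]] ntrans_simps[OF k] ntrans_simps[OF ntiso_ntrans[OF s]]
      have "Cmp SetCat (s D) (k (FO (?P i) D)) = Cmp SetCat (f D) (inv_arr SetCat (FA a (gm i D)))" using sk D by simp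
      then have "Cmp SetCat (Cmp SetCat (s D) (k (FO (?P i) D))) (FA a (gm i D)) =
          Cmp SetCat (Cmp SetCat (f D) (inv_arr SetCat (FA a (gm i D)))) (FA a (gm i D))" by (simp only:)
      then show ?thesis using D by simp
    qed
    then show "\<exists>r. case r of (b, k, s) \<Rightarrow> geo (slice E (A i)) SetCat b \<and> ntrans (slice E (A i)) SetCat (?ai i) b k \<and>
      ntiso E SetCat (cmp_func b (?P i)) y s \<and>
      (\<forall>D\<in>Obj E. Cmp SetCat (s D) (Cmp SetCat (k (FO (?P i) D)) (FA a (gm i D))) = f D)"
      using b k s by (intro exI[of _ "(b, k, s)"]) simp
  qed
  from bchoice[OF this] obtain r where r: "\<forall>i\<in>Obj I. case r i of (b, k, s) \<Rightarrow> geo (slice E (A i)) SetCat b \<and>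
      ntrans (slice E (A i)) SetCat (?ai i) b k \<and> ntiso E SetCat (cmp_func b (?P i)) y s \<and>
      (\<forall>D\<in>Obj E. Cmp SetCat (s D) (Cmp SetCat (k (FO (?P i) D)) (FA a (gm i D))) = f D)" by blast
  define b k s where "b = (\<lambda>i. fst (r i))" and "k = (\<lambda>i. fst (snd (r i)))" and "s = (\<lambda>i. snd (snd (r i)))"
  have b: "geo (slice E (A i)) SetCat (b i)" and k: "ntrans (slice E (A i)) SetCat (?ai i) (b i) (k i)"
    and s: "ntiso E SetCat (cmp_func (b i) (?P i)) y (s i)"
    and sk: "D \<in> Obj E \<Longrightarrow> Cmp SetCat (s i D) (Cmp SetCat (k i (FO (?P i) D)) (FA a (gm i D))) = f D"
    if "i \<in> Obj I" for i D
    using bspec[OF r that] by (simp_all add: b_def k_def s_def split_beta)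
  have sinv: "Cmp SetCat (k i (FO (?P i) D)) (FA a (gm i D)) = Cmp SetCat (inv_arr SetCat (s i D)) (f D)"
    if i: "i \<in> Obj I" and D: "D \<in> Obj E" for i D
  proof -
    note [simp] = functor_simps[OF cf[OF i]] functor_simps[OF Pf[OF i]] gm_simps[OF i] functor_simps[OF geo_functor[OF b[OF i]]]
      ntrans_simps[OF k[OF i]] ntrans_simps[OF ntiso_ntrans[OF s[OF i]]]
    show ?thesis
      using Cmp_inv_left[OF T ntiso_iso[OF s[OF i] D], of "Cmp SetCat (k i (FO (?P i) D)) (FA a (gm i D))"] sk[OF i D] D by simp
  qed
  define q where "q = arr_fun (cmp_func a Lp) y f"
  define Ki where "Ki = (\<lambda>i. arr_fun (?ai i) (b i) (k i))"
  have gq: "geo E ?S q" unfolding q_def by (rule geo_arr_fun[OF geo_cmp[OF geoL a] y f])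
  have gK: "geo (slice E (A i)) ?S (Ki i)" if "i \<in> Obj I" for i
    unfolding Ki_def by (rule geo_arr_fun[OF gai[OF that] b[OF that] k[OF that]])
  note Fq = geo_functor[OF gq]
  have qs: "FO q D = f D" if "D \<in> Obj E" for D using that by (simp add: q_def arr_fun_FO[OF f])
  have Ks: "FO (Ki i) v = k i v" if "i \<in> Obj I" "v \<in> Obj (slice E (A i))" for i v
    using that by (simp add: Ki_def arr_fun_FO[OF k])
  have evq: "cmp_func (ev0 SetCat) q = cmp_func a Lp" "cmp_func (ev1 SetCat) q = y"
    by (simp_all add: q_def ev0_arr_fun[OF f] ev1_arr_fun[OF f])
  have evK: "cmp_func (ev0 SetCat) (cmp_func (Ki i) F) = cmp_func (?ai i) F" "cmp_func (ev1 SetCat) (cmp_func (Ki i) F) = cmp_func (b i) F"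
    if i: "i \<in> Obj I" and F: "functor_from_to F B (slice E (A i))" for i B and F :: "('x, 'y, 'u large, 'u large) func"
    using cmp_func_assoc[OF F geo_functor[OF gK[OF i]] functor_ev0[OF T]] cmp_func_assoc[OF F geo_functor[OF gK[OF i]] functor_ev1[OF T]]
    by (simp_all add: Ki_def ev0_arr_fun[OF k[OF i]] ev1_arr_fun[OF k[OF i]])
  have evK': "cmp_func (ev0 SetCat) (Ki i) = ?ai i" "cmp_func (ev1 SetCat) (Ki i) = b i" if i: "i \<in> Obj I" for i
    by (simp_all add: Ki_def ev0_arr_fun[OF k[OF i]] ev1_arr_fun[OF k[OF i]])
  \<comment> \<open>A square from \<open>f D\<close> to \<open>k i (FO (?P i) D)\<close>: the
    structure isomorphism \<open>gm\<close> on domains, the inverse of \<open>s i\<close> on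
    codomains, because \<open>b i\<close> lies over \<open>y\<close> only up to
    \<open>s i\<close>.\<close>
  define mu where "mu = (\<lambda>i. \<lambda>D\<in>Obj E. sq (FO q D) (FO (cmp_func (Ki i) (?P i)) D) ((\<lambda>D\<in>Obj E. FA a (gm i D)) D)
      ((\<lambda>D\<in>Obj E. inv_arr SetCat (s i D)) D))"
  have mu: "ntiso E ?S q (cmp_func (Ki i) (?P i)) (mu i)" if i: "i \<in> Obj I" for i
  proof -
    note [simp] = functor_simps[OF cf[OF i]] functor_simps[OF Pf[OF i]] gm_simps[OF i]
    note KP = functor_cmp[OF Pf[OF i] geo_functor[OF gK[OF i]]]
    have n: "ntrans E ?S q (cmp_func (Ki i) (?P i)) (mu i)"
      unfolding mu_def
    proof (rule ntrans_arrow_catI[OF Fq KP T])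
      show "ntrans E SetCat (cmp_func (ev0 SetCat) q) (cmp_func (ev0 SetCat) (cmp_func (Ki i) (?P i))) (\<lambda>D\<in>Obj E. FA a (gm i D))"
        using ntiso_ntrans[OF gm_ntiso[OF i a]] by (simp add: evq evK[OF i Pf[OF i]])
      show "ntrans E SetCat (cmp_func (ev1 SetCat) q) (cmp_func (ev1 SetCat) (cmp_func (Ki i) (?P i))) (\<lambda>D\<in>Obj E. inv_arr SetCat (s i D))"
        using ntiso_ntrans[OF ntiso_inv[OF s[OF i]]] by (simp add: evq evK[OF i Pf[OF i]])
      fix D assume D: "D \<in> Obj E"
      then show "Cmp SetCat (FO (cmp_func (Ki i) (?P i)) D) ((\<lambda>D\<in>Obj E. FA a (gm i D)) D) =
        Cmp SetCat ((\<lambda>D\<in>Obj E. inv_arr SetCat (s i D)) D) (FO q D)"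
        using sinv[OF i D] by (simp add: qs Ks i)
    qed
    have "iso_arr ?S (mu i D)" if D: "D \<in> Obj E" for D
      by (rule arrow_cat_isoI[OF T ntrans_Arr[OF n D]])
        (use D iso_FA[OF Fa gm_simps(4)[OF i D]] iso_inv[OF ntiso_iso[OF s[OF i] D]] in \<open>simp_all add: mu_def\<close>)
    then show ?thesis using n by (simp add: ntiso_def)
  qed
  have mus: "mu i D = sq (f D) (k i (FO (?P i) D)) (FA a (gm i D)) (inv_arr SetCat (s i D))" if "i \<in> Obj I" "D \<in> Obj E" for i D
    using that functor_simps[OF Pf[OF that(1)]] by (simp add: mu_def qs Ks)
  have lam: "\<exists>l. ntiso (slice E (A (Cod I u))) ?S (cmp_func (Ki (Dom I u)) (tu u)) (Ki (Cod I u)) l \<and>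
        (\<forall>D\<in>Obj E. Cmp ?S (l (FO (?P (Cod I u)) D))
          (Cmp ?S (FA (Ki (Dom I u)) (ta u D)) (mu (Dom I u) D)) = mu (Cod I u) D)" if u: "u \<in> Arr I" for u
  proof -
    define i j where "i = Dom I u" and "j = Cod I u"
    have i: "i \<in> Obj I" and j: "j \<in> Obj I" using u by (simp_all add: i_def j_def)
    note tfu = tf[OF u, folded i_def j_def] and tau = ta[OF u, folded i_def j_def] and kau = ka[OF u, folded i_def j_def]
      and kov = ka_over[OF u, folded i_def j_def] and gtu = geot[OF u, folded i_def j_def]
    note tan = ntiso_ntrans[OF tau] and kan = ntiso_ntrans[OF kau]
    note ki = k[OF i] and kj = k[OF j] and si = ntiso_ntrans[OF s[OF i]] and sj = ntiso_ntrans[OF s[OF j]]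
    note Fbi = geo_functor[OF b[OF i]] and Fbj = geo_functor[OF b[OF j]]
    note isi = ntiso_iso[OF s[OF i]] and isj = ntiso_iso[OF s[OF j]]
    note [simp] = functor_simps[OF cf[OF i]] functor_simps[OF Pf[OF i]] gm_simps[OF i]
      functor_simps[OF cf[OF j]] functor_simps[OF Pf[OF j]] gm_simps[OF j] functor_simps[OF tfu]
      ntrans_simps[OF tan] ntrans_simps[OF kan] ntrans_simps[OF ki] ntrans_simps[OF kj] ntrans_simps[OF si] ntrans_simps[OF sj]
      functor_simps[OF Fbi] functor_simps[OF Fbj] inv_simps[OF isi] inv_simps[OF isj]
      cat_simps(1-9)[OF functor_category_cod[OF Lp]]
    let ?Sj = "slice E (A j)"
    have a0: "ntiso ?Sj SetCat (cmp_func (?ai i) (tu u)) (?ai j) (\<lambda>v\<in>Obj ?Sj. FA a (ka u v))"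
      using ntiso_postwhisker[OF kau Fa] by (simp add: cmp_func_assoc[OF tfu cf[OF i] Fa])
    have kt: "ntrans ?Sj SetCat (cmp_func (?ai i) (tu u)) (cmp_func (b i) (tu u)) (\<lambda>v\<in>Obj ?Sj. k i (FO (tu u) v))"
      by (rule ntrans_whisker[OF ki tfu])
    have h: "ntrans ?Sj SetCat (cmp_func (?ai i) (tu u)) (b j) (\<lambda>v\<in>Obj ?Sj. Cmp SetCat (k j v) ((\<lambda>v\<in>Obj ?Sj. FA a (ka u v)) v))"
      by (rule ntrans_vcmp[OF ntiso_ntrans[OF a0] kj])
    have bt: "ntiso E SetCat (cmp_func (b i) (?P i)) (cmp_func (cmp_func (b i) (tu u)) (?P j)) (\<lambda>D\<in>Obj E. FA (b i) (ta u D))"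
      using ntiso_postwhisker[OF tau Fbi] by (simp add: cmp_func_assoc[OF Pf[OF j] tfu Fbi])
    have ibt: "iso_arr SetCat (FA (b i) (ta u D))" if "D \<in> Obj E" for D
      by (rule iso_FA[OF Fbi ntiso_iso[OF tau that]])
    note [simp] = inv_simps[OF ibt]
    \<comment> \<open>The point \<open>b i\<close> restricted along the transition and the point
      \<open>b j\<close> both lie over \<open>y\<close>; \<open>g\<close> compares them through
      \<open>y\<close>.\<close>
    define g where "g = (\<lambda>D\<in>Obj E. Cmp SetCat ((\<lambda>D\<in>Obj E. inv_arr SetCat (s j D)) D)
      ((\<lambda>D\<in>Obj E. Cmp SetCat (s i D) ((\<lambda>D\<in>Obj E. inv_arr SetCat ((\<lambda>D\<in>Obj E. FA (b i) (ta u D)) D)) D)) D))"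
    have g: "ntiso E SetCat (cmp_func (cmp_func (b i) (tu u)) (?P j)) (cmp_func (b j) (?P j)) g"
      unfolding g_def by (rule ntiso_vcmp[OF ntiso_vcmp[OF ntiso_inv[OF bt] s[OF i]] ntiso_inv[OF s[OF j]]])
    have gs: "g D = Cmp SetCat (inv_arr SetCat (s j D)) (Cmp SetCat (s i D) (inv_arr SetCat (FA (b i) (ta u D))))" if "D \<in> Obj E" for D
      using that by (simp add: g_def)
    note [simp] = ntrans_simps[OF ntiso_ntrans[OF g]]
    have gb: "Cmp SetCat (g D) (FA (b i) (ta u D)) = Cmp SetCat (inv_arr SetCat (s j D)) (s i D)" if D: "D \<in> Obj E" for D
      using D by (simp add: gs)
    have kao: "Cmp SetCat (FA a (ka u (FO (?P j) D))) (Cmp SetCat (FA a (FA (ci i) (ta u D))) (FA a (gm i D))) = FA a (gm j D)"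
      if D: "D \<in> Obj E" for D
    proof -
      have "FA a (Cmp L0 (ka u (FO (?P j) D)) (Cmp L0 (FA (ci i) (ta u D)) (gm i D))) = FA a (gm j D)"
        by (simp only: kov[OF D])
      then show ?thesis using D by simp
    qed
    \<comment> \<open>Tested after the invertible arrow \<open>Cmp SetCat ?z ?v\<close>, where both
      sides become the inverse of \<open>s j D\<close> after \<open>f D\<close>.\<close>
    have gk: "Cmp SetCat (g D) (k i (FO (tu u) (FO (?P j) D))) = Cmp SetCat (k j (FO (?P j) D)) (FA a (ka u (FO (?P j) D)))"
      if D [simp]: "D \<in> Obj E" for D
    proof -
      let ?z = "FA a (FA (ci i) (ta u D))" and ?v = "FA a (gm i D)"
      have iz: "iso_arr SetCat ?z" by (rule iso_FA[OF Fa iso_FA[OF cf[OF i] ntiso_iso[OF tau D]]])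
      have iv: "iso_arr SetCat ?v" by (rule iso_FA[OF Fa gm_simps(4)[OF i D]])
      have zv: "iso_arr SetCat (Cmp SetCat ?z ?v)" by (rule iso_Cmp[OF T iv iz]) simp
      have nk: "Cmp SetCat (k i (FO (tu u) (FO (?P j) D))) (Cmp SetCat ?z ?v) = Cmp SetCat (FA (b i) (ta u D)) (Cmp SetCat (k i (FO (?P i) D)) ?v)"
        using ntrans_sq_prefix[OF ki, of "ta u D" ?v] by simp
      have "Cmp SetCat (g D) (Cmp SetCat (k i (FO (tu u) (FO (?P j) D))) (Cmp SetCat ?z ?v)) =
          Cmp SetCat (inv_arr SetCat (s j D)) (Cmp SetCat (s i D) (Cmp SetCat (k i (FO (?P i) D)) ?v))"
        using Cmp_eq_prefix[OF T gb[OF D], of "Cmp SetCat (k i (FO (?P i) D)) ?v"] by (simp add: nk)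
      also have "\<dots> = Cmp SetCat (inv_arr SetCat (s j D)) (f D)" by (simp add: sk[OF i])
      also have "\<dots> = Cmp SetCat (k j (FO (?P j) D)) (FA a (gm j D))" by (simp add: sinv[OF j])
      also have "\<dots> = Cmp SetCat (k j (FO (?P j) D)) (Cmp SetCat (FA a (ka u (FO (?P j) D))) (Cmp SetCat ?z ?v))"
        by (simp add: kao)
      finally show ?thesis
        by - (rule iso_cancel_right[OF T zv, rotated -1], simp_all)
    qed
    \<comment> \<open>The codomain part of the transition cell: the triangle property of the etale
      projection at \<open>j\<close> lifts \<open>g\<close>.\<close>
    obtain a1 where a1: "ntrans ?Sj SetCat (cmp_func (b i) (tu u)) (b j) a1" and a1D: "\<forall>D\<in>Obj E. a1 (FO (?P j) D) = g D"
      by (rule discof_triangle[OF disc[OF j] geo_cmp[OF gtu gai[OF i]] geo_cmp[OF gtu b[OF i]] b[OF j] kt h ntiso_ntrans[OF g]])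
        (simp add: gk)
    note [simp] = ntrans_simps[OF a1]
    \<comment> \<open>Both sides are arrows of points of the slice over \<open>A j\<close>, and they
      agree over \<open>E\<close> by \<open>gk\<close>.\<close>
    have comm: "(\<lambda>v\<in>Obj ?Sj. Cmp SetCat (k j v) ((\<lambda>v\<in>Obj ?Sj. FA a (ka u v)) v)) =
        (\<lambda>v\<in>Obj ?Sj. Cmp SetCat (a1 v) ((\<lambda>v\<in>Obj ?Sj. k i (FO (tu u) v)) v))"
      by (rule discof_faithful[OF disc[OF j] geo_cmp[OF gtu gai[OF i]] b[OF j] h ntrans_vcmp[OF kt a1]])
        (simp add: a1D gk)
    let ?l = "\<lambda>v\<in>Obj ?Sj. sq (FO (cmp_func (Ki i) (tu u)) v) (FO (Ki j) v) ((\<lambda>v\<in>Obj ?Sj. FA a (ka u v)) v) (a1 v)"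
    have l: "ntrans ?Sj ?S (cmp_func (Ki i) (tu u)) (Ki j) ?l"
    proof (rule ntrans_arrow_catI[OF functor_cmp[OF tfu geo_functor[OF gK[OF i]]] geo_functor[OF gK[OF j]] T])
      show "ntrans ?Sj SetCat (cmp_func (ev0 SetCat) (cmp_func (Ki i) (tu u))) (cmp_func (ev0 SetCat) (Ki j)) (\<lambda>v\<in>Obj ?Sj. FA a (ka u v))"
        using ntiso_ntrans[OF a0] by (simp add: evK[OF i tfu] evK'[OF j])
      show "ntrans ?Sj SetCat (cmp_func (ev1 SetCat) (cmp_func (Ki i) (tu u))) (cmp_func (ev1 SetCat) (Ki j)) a1"
        using a1 by (simp add: evK[OF i tfu] evK'[OF j])
      fix v assume v: "v \<in> Obj ?Sj"
      show "Cmp SetCat (FO (Ki j) v) ((\<lambda>v\<in>Obj ?Sj. FA a (ka u v)) v) = Cmp SetCat (a1 v) (FO (cmp_func (Ki i) (tu u)) v)"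
        using fun_cong[OF comm, of v] v by (simp add: Ks i j)
    qed
    have "iso_arr ?S (?l v)" if v: "v \<in> Obj ?Sj" for v
    proof (rule arrow_cat_isoI[OF T ntrans_Arr[OF l v]])
      show "iso_arr SetCat (sq0 (?l v))" using v iso_FA[OF Fa ntiso_iso[OF kau v]] by simp
      have "iso_arr SetCat (a1 v)"
        by (rule discof_conservative[OF disc[OF j] Pf[OF j] geo_cmp[OF gtu b[OF i]] b[OF j] a1 _ v])
          (use ntiso_iso[OF g] a1D in simp)
      then show "iso_arr SetCat (sq1 (?l v))" using v by simp
    qed
    then have li: "ntiso ?Sj ?S (cmp_func (Ki i) (tu u)) (Ki j) ?l" using l by (simp add: ntiso_def)
    have "Cmp ?S (?l (FO (?P j) D)) (Cmp ?S (FA (Ki i) (ta u D)) (mu i D)) = mu j D" if D [simp]: "D \<in> Obj E" for D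
    proof -
      have KA: "FA (Ki i) (ta u D) = sq (k i (FO (?P i) D)) (k i (FO (tu u) (FO (?P j) D))) (FA a (FA (ci i) (ta u D))) (FA (b i) (ta u D))"
        by (simp add: Ki_def arr_fun_FA[OF ki])
      have "Cmp SetCat (a1 (FO (?P j) D)) (Cmp SetCat (FA (b i) (ta u D)) (inv_arr SetCat (s i D))) = inv_arr SetCat (s j D)"
        using Cmp_eq_prefix[OF T gb[OF D], of "inv_arr SetCat (s i D)"] a1D by simp
      then show ?thesis
        by (simp add: mus[OF i] mus[OF j] KA arrow_cat_Cmp arrow_cat_Dom_sq arrow_cat_Cod_sq kao Ks[OF j])
    qed
    then show ?thesis using li unfolding i_def j_def by blast
  qed
  from esurj[OF gq gK mu lam] obtain B io where B: "geo L0 ?S B" and io: "ntiso E ?S q (cmp_func B Lp) io"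
    and w: "\<forall>i\<in>Obj I. \<exists>w. ntrans (slice E (A i)) ?S (Ki i) (cmp_func B (ci i)) w \<and>
          (\<forall>D\<in>Obj E. Cmp ?S (w (FO (?P i) D)) (mu i D) = Cmp ?S (FA B (gm i D)) (io D))" by blast
  note FB = geo_functor[OF B] and ion = ntiso_ntrans[OF io]
  note BE = geo_ev[OF B geo_cod[OF y]]
  let ?B0 = "cmp_func (ev0 SetCat) B" and ?B1 = "cmp_func (ev1 SetCat) B"
  note ev0 = functor_ev0[OF T] and ev1 = functor_ev1[OF T]
  note [simp] = functor_simps[OF FB] ntrans_simps[OF ion]
  have BO: "FO B v \<in> Arr SetCat" if "v \<in> Obj L0" for v
    using FO_Obj[OF FB that] by (simp add: arrow_cat_Obj)
  have io0: "ntiso E SetCat (cmp_func a Lp) (cmp_func ?B0 Lp) (\<lambda>D\<in>Obj E. FA (ev0 SetCat) (io D))"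
    using ntiso_postwhisker[OF io ev0] by (simp add: evq cmp_func_assoc[OF Lp FB ev0])
  have io1: "ntiso E SetCat y (cmp_func ?B1 Lp) (\<lambda>D\<in>Obj E. FA (ev1 SetCat) (io D))"
    using ntiso_postwhisker[OF io ev1] by (simp add: evq cmp_func_assoc[OF Lp FB ev1])
  \<comment> \<open>Evaluating the 2-cells from \<open>esurj\<close> at 0 gives the data from which
    \<open>full\<close> produces an arrow from \<open>a\<close> to \<open>?B0\<close>.\<close>
  have "\<exists>w. ntrans (slice E (A i)) SetCat (?ai i) (cmp_func ?B0 (ci i)) w \<and>
        (\<forall>D\<in>Obj E. Cmp SetCat (w (FO (?P i) D)) (FA a (gm i D)) = Cmp SetCat (FA ?B0 (gm i D)) ((\<lambda>D\<in>Obj E. FA (ev0 SetCat) (io D)) D))"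
    if i: "i \<in> Obj I" for i
  proof -
    obtain w where w: "ntrans (slice E (A i)) ?S (Ki i) (cmp_func B (ci i)) w"
      and wD: "\<forall>D\<in>Obj E. Cmp ?S (w (FO (?P i) D)) (mu i D) = Cmp ?S (FA B (gm i D)) (io D)" using w i by blast
    note [simp] = functor_simps[OF cf[OF i]] functor_simps[OF Pf[OF i]] gm_simps[OF i] ntrans_simps[OF w]
    have w0: "ntrans (slice E (A i)) SetCat (?ai i) (cmp_func ?B0 (ci i)) (\<lambda>v\<in>Obj (slice E (A i)). FA (ev0 SetCat) (w v))"
      using ntrans_postwhisker[OF w ev0] by (simp add: evK'[OF i] cmp_func_assoc[OF cf[OF i] FB ev0])
    have "Cmp SetCat (sq0 (w (FO (?P i) D))) (FA a (gm i D)) = Cmp SetCat (sq0 (FA B (gm i D))) (sq0 (io D))" if D: "D \<in> Obj E" for D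
      using arg_cong[OF bspec[OF wD D], of sq0] by (simp add: arrow_cat_Cmp mus[OF i D])
    then show ?thesis using w0 by (intro exI[of _ "\<lambda>v\<in>Obj (slice E (A i)). FA (ev0 SetCat) (w v)"]) (simp add: ev_simps)
  qed
  from full[OF a BE(1) io0 this] obtain x where x: "ntrans L0 SetCat a ?B0 x"
    and xD: "\<forall>D\<in>Obj E. x (FO Lp D) = (\<lambda>D\<in>Obj E. FA (ev0 SetCat) (io D)) D" by blast
  \<comment> \<open>The lifted arrow: \<open>x\<close> leads from \<open>a\<close> to the domains of
    the arrows \<open>FO B v\<close>, and these arrows themselves lead on to the codomains.\<close>
  have "ntrans L0 SetCat a ?B1 (\<lambda>v\<in>Obj L0. Cmp SetCat (restrict (FO B) (Obj L0) v) (x v))"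
    by (rule ntrans_vcmp[OF x ntrans_ev[OF FB T]])
  moreover have "Cmp SetCat ((\<lambda>D\<in>Obj E. inv_arr SetCat ((\<lambda>D\<in>Obj E. FA (ev1 SetCat) (io D)) D)) D)
      ((\<lambda>v\<in>Obj L0. Cmp SetCat (restrict (FO B) (Obj L0) v) (x v)) (FO Lp D)) = f D" if D [simp]: "D \<in> Obj E" for D
  proof -
    have i1: "iso_arr SetCat (sq1 (io D))" using ntiso_iso[OF io1 D] by (simp add: ev_simps)
    have "Cmp SetCat (FO B (FO Lp D)) (sq0 (io D)) = Cmp SetCat (sq1 (io D)) (f D)"
      using sq_comm[of "io D" SetCat] by (simp add: qs)
    moreover have "Dom SetCat (sq1 (io D)) = FO y D" using sq1_Dom[of "io D" SetCat] by (simp add: qs)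
    ultimately show ?thesis
      using xD Cmp_inv_left[OF T i1, of "f D"] by (simp add: ev_simps)
  qed
  ultimately show ?thesis
    using BE(2) ntiso_inv[OF io1] by blast
qed

text \<open>Lifting \<open>g\<close> from \<open>b\<close> gives \<open>k'\<close> into a point
  \<open>d\<close> that lies over the same point of \<open>E\<close> as \<open>c\<close>, up to
  \<open>s\<close>. In each slice the triangle property, with the composite of \<open>k\<close> and
  \<open>k'\<close> as first leg, leads from \<open>d\<close> to \<open>c\<close>.
  \<open>full\<close> assembles these arrows to \<open>x\<close>, and \<open>x\<close> after
  \<open>k'\<close> is the arrow sought.\<close>

lemma triangle:
  assumes a: "geo L0 SetCat a" and b: "geo L0 SetCat b" and c: "geo L0 SetCat c"
    and k: "ntrans L0 SetCat a b k" and h: "ntrans L0 SetCat a c h"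
    and g: "ntrans E SetCat (cmp_func b Lp) (cmp_func c Lp) g"
    and gk: "\<And>D. D \<in> Obj E \<Longrightarrow> Cmp SetCat (g D) (k (FO Lp D)) = h (FO Lp D)"
  shows "\<exists>x. ntrans L0 SetCat b c x \<and> (\<forall>D\<in>Obj E. x (FO Lp D) = g D)"
proof -
  note T = category_SetCat
  note Fa = geo_functor[OF a] and Fb = geo_functor[OF b] and Fc = geo_functor[OF c]
  obtain d k' s where d: "geo L0 SetCat d" and k': "ntrans L0 SetCat b d k'" and s: "ntiso E SetCat (cmp_func d Lp) (cmp_func c Lp) s"
    and sk: "\<forall>D\<in>Obj E. Cmp SetCat (s D) (k' (FO Lp D)) = g D"
    using lift[OF b geo_cmp[OF geoL c] g] by blast
  note Fd = geo_functor[OF d] and sn = ntiso_ntrans[OF s]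
  note [simp] = cat_simps[OF T] cmp_func_simps functor_simps[OF Lp] functor_simps[OF Fa] functor_simps[OF Fb]
    functor_simps[OF Fc] functor_simps[OF Fd] ntrans_simps[OF k] ntrans_simps[OF h] ntrans_simps[OF g] ntrans_simps[OF k'] ntrans_simps[OF sn]
  have "\<exists>w. ntrans (slice E (A i)) SetCat (cmp_func d (ci i)) (cmp_func c (ci i)) w \<and>
        (\<forall>D\<in>Obj E. Cmp SetCat (w (FO (product_functor E (A i)) D)) (FA d (gm i D)) = Cmp SetCat (FA c (gm i D)) (s D))"
    if i: "i \<in> Obj I" for i
  proof -
    let ?P = "product_functor E (A i)" and ?Si = "slice E (A i)"
    note [simp] = functor_simps[OF cf[OF i]] functor_simps[OF Pf[OF i]] gm_simps[OF i]
    have id: "iso_arr SetCat (FA d (gm i D))" if "D \<in> Obj E" for D by (rule iso_FA[OF Fd gm_simps(4)[OF i that]])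
    note [simp] = inv_simps[OF id]
    \<comment> \<open>\<open>s\<close>, conjugated by \<open>gm\<close> into an arrow between the
      points of \<open>E\<close> that \<open>d\<close> and \<open>c\<close> induce through the slice
      over \<open>A i\<close>.\<close>
    define gi where "gi = (\<lambda>D\<in>Obj E. Cmp SetCat ((\<lambda>D\<in>Obj E. FA c (gm i D)) D)
      ((\<lambda>D\<in>Obj E. Cmp SetCat (s D) ((\<lambda>D\<in>Obj E. inv_arr SetCat ((\<lambda>D\<in>Obj E. FA d (gm i D)) D)) D)) D))"
    have gi: "ntrans E SetCat (cmp_func (cmp_func d (ci i)) ?P) (cmp_func (cmp_func c (ci i)) ?P) gi"
      unfolding gi_def
      by (rule ntrans_vcmp[OF ntrans_vcmp[OF ntiso_ntrans[OF ntiso_inv[OF gm_ntiso[OF i d]]] sn] ntiso_ntrans[OF gm_ntiso[OF i c]]])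
    note [simp] = ntrans_simps[OF gi]
    have gis: "Cmp SetCat (gi D) (FA d (gm i D)) = Cmp SetCat (FA c (gm i D)) (s D)" if "D \<in> Obj E" for D
      using that by (simp add: gi_def)
    let ?kk = "\<lambda>v\<in>Obj L0. Cmp SetCat (k' v) (k v)"
    note kk = ntrans_vcmp[OF k k']
    \<comment> \<open>Checked after the isomorphism \<open>FA a (gm i D)\<close>: naturality moves
      both sides to components at \<open>FO Lp D\<close>, where \<open>sk\<close> and
      \<open>gk\<close> apply.\<close>
    have e: "Cmp SetCat (gi D) (Cmp SetCat (k' (FO (ci i) (FO ?P D))) (k (FO (ci i) (FO ?P D)))) = h (FO (ci i) (FO ?P D))"
      if D [simp]: "D \<in> Obj E" for D
    proof -
      let ?v = "FA a (gm i D)" and ?y = "FO (ci i) (FO ?P D)"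
      have "Cmp SetCat (gi D) (Cmp SetCat (k' ?y) (Cmp SetCat (k ?y) ?v)) =
          Cmp SetCat (gi D) (Cmp SetCat (FA d (gm i D)) (Cmp SetCat (k' (FO Lp D)) (k (FO Lp D))))"
        using ntrans_sq[OF kk gm_simps(1)[OF i D]] by simp
      also have "\<dots> = Cmp SetCat (FA c (gm i D)) (Cmp SetCat (s D) (Cmp SetCat (k' (FO Lp D)) (k (FO Lp D))))"
        using Cmp_eq_prefix[OF T gis[OF D], of "Cmp SetCat (k' (FO Lp D)) (k (FO Lp D))"] by simp
      also have "Cmp SetCat (s D) (Cmp SetCat (k' (FO Lp D)) (k (FO Lp D))) = h (FO Lp D)"
        using Cmp_eq_prefix1[OF T bspec[OF sk D], of "k (FO Lp D)"] gk[OF D] by simp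
      also have "Cmp SetCat (FA c (gm i D)) (h (FO Lp D)) = Cmp SetCat (h ?y) ?v"
        using ntrans_sq[OF h gm_simps(1)[OF i D]] by simp
      finally have "Cmp SetCat (Cmp SetCat (gi D) (Cmp SetCat (k' ?y) (k ?y))) ?v = Cmp SetCat (h ?y) ?v" by simp
      then show ?thesis
        by - (rule iso_cancel_right[OF T iso_FA[OF Fa gm_simps(4)[OF i D]], rotated -1], simp_all)
    qed
    obtain w where w: "ntrans ?Si SetCat (cmp_func d (ci i)) (cmp_func c (ci i)) w" and wD: "\<forall>D\<in>Obj E. w (FO ?P D) = gi D"
      by (rule discof_triangle[OF disc[OF i] geo_cmp[OF geoc[OF i] a] geo_cmp[OF geoc[OF i] d] geo_cmp[OF geoc[OF i] c]
            ntrans_whisker[OF kk cf[OF i]] ntrans_whisker[OF h cf[OF i]] gi]) (simp add: e)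
    show ?thesis using w wD gis by auto
  qed
  from full[OF d c s this] obtain x where x: "ntrans L0 SetCat d c x" and xD: "\<forall>D\<in>Obj E. x (FO Lp D) = s D" by blast
  have "\<forall>D\<in>Obj E. (\<lambda>v\<in>Obj L0. Cmp SetCat (x v) (k' v)) (FO Lp D) = g D" using xD sk by simp
  then show ?thesis using ntrans_vcmp[OF k' x] by blast
qed

lemma discof_bilimit: "discof E L0 Lp"
  unfolding discof_def
proof (intro conjI allI impI)
  show "s = t" if "geo L0 SetCat a" "geo L0 SetCat b" "ntrans L0 SetCat a b s" "ntrans L0 SetCat a b t"
    "\<forall>D\<in>Obj E. s (FO Lp D) = t (FO Lp D)" for a b s t
    by (rule faithful[OF that(1-4)]) (use that(5) in simp)
  show "\<exists>x. ntrans L0 SetCat b c x \<and> (\<forall>D\<in>Obj E. x (FO Lp D) = g D)"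
    if "geo L0 SetCat a" "geo L0 SetCat b" "geo L0 SetCat c" "ntrans L0 SetCat a b k" "ntrans L0 SetCat a c h"
      "ntrans E SetCat (cmp_func b Lp) (cmp_func c Lp) g" "\<forall>D\<in>Obj E. Cmp SetCat (g D) (k (FO Lp D)) = h (FO Lp D)"
    for a b c k h g
    by (rule triangle[OF that(1-6)]) (use that(7) in simp)
qed (rule lift)

end

section \<open>Points of pro-etale geometric morphisms\<close>

lemma ntrans_iso_eq:
  assumes s: "ntrans C D F G s" and t: "ntrans C D F G t" and f: "iso_arr C f" and e: "s (Dom C f) = t (Dom C f)"
  shows "s (Cod C f) = t (Cod C f)"
proof (rule iso_cancel_right)
  note F = ntrans_dom[OF s]
  note [simp] = functor_simps[OF F] cat_simps[OF functor_category_dom[OF F]] ntrans_simps[OF s] ntrans_simps[OF t] iso_Arr[OF f]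
  show "iso_arr D (FA F f)" by (rule iso_FA[OF F f])
  show "Cmp D (s (Cod C f)) (FA F f) = Cmp D (t (Cod C f)) (FA F f)"
    by (simp add: ntrans_sq[OF s] ntrans_sq[OF t] e)
qed (simp_all add: functor_category_cod[OF ntrans_dom[OF s]] functor_simps[OF ntrans_dom[OF s]]
    cat_simps[OF functor_category_dom[OF ntrans_dom[OF s]]] ntrans_simps[OF s] ntrans_simps[OF t] iso_Arr[OF f])

text \<open>\<open>U\<close> and \<open>V\<close> are the inverse images of the two halves of an
  equivalence over \<open>E\<close>. Composing with \<open>U\<close> turns points of
  \<open>F\<close> into points of \<open>L0\<close>, where \<open>d\<close> applies; composing with
  \<open>V\<close> leads back. The ends are corrected by \<open>iu\<close>, \<open>iv\<close> and
  \<open>e\<close>, and since \<open>e\<close> is a 2-cell over \<open>E\<close>, by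
  \<open>over\<close>, the corrected arrows induce the prescribed ones.\<close>

lemma discof_transfer:
  assumes d: "discof E L0 Lp" and geoL: "geo E L0 Lp" and geoP: "geo E F P"
    and geoU: "geo L0 F U" and geoV: "geo F L0 V"
    and iu: "ntiso E F P (cmp_func U Lp) iu" and iv: "ntiso E L0 Lp (cmp_func V P) iv"
    and e: "ntiso F F (cmp_func U V) (id_func F) e"
    and over: "\<And>D. D \<in> Obj E \<Longrightarrow> Cmp F (e (FO P D)) (Cmp F (FA U (iv D)) (iu D)) = Idn F (FO P D)"
  shows "discof E F P"
proof -
  note Lp = geo_functor[OF geoL] and P = geo_functor[OF geoP] and U = geo_functor[OF geoU] and V = geo_functor[OF geoV]
  note T = category_SetCat
  note CE = functor_category_dom[OF P] and CF = functor_category_cod[OF P] and CL = functor_category_cod[OF Lp]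
  note tu = ntiso_ntrans[OF iu] and tv = ntiso_ntrans[OF iv] and te = ntiso_ntrans[OF e]
  note [simp] = functor_simps[OF Lp] functor_simps[OF P] functor_simps[OF U] functor_simps[OF V] cat_simps[OF T]
    cat_simps[OF CE] cat_simps[OF CF] cat_simps[OF CL] cmp_func_simps id_func_simps
    ntrans_simps[OF tu] ntrans_simps[OF tv] ntrans_simps[OF te]
    inv_simps[OF ntiso_iso[OF iu]] inv_simps[OF ntiso_iso[OF iv]] inv_simps[OF ntiso_iso[OF e]]
  \<comment> \<open>The form in which \<open>over\<close> is used: the correction by
    \<open>e\<close> at objects coming from \<open>E\<close> is expressed through \<open>iv\<close>
    and \<open>iu\<close>.\<close>
  have inv_e: "inv_arr F (e (FO P D)) = Cmp F (FA U (iv D)) (iu D)" if D: "D \<in> Obj E" for D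
    by (rule iso_cancel_left[OF CF ntiso_iso[OF e, of "FO P D"]]) (use D over in simp_all)
  show ?thesis
    unfolding discof_def
  proof (intro conjI allI impI)
    fix a b s t
    assume a: "geo F SetCat a" and b: "geo F SetCat b" and s: "ntrans F SetCat a b s" and t: "ntrans F SetCat a b t"
      and st: "\<forall>D\<in>Obj E. s (FO P D) = t (FO P D)"
    have "s (FO U (FO Lp D)) = t (FO U (FO Lp D))" if D: "D \<in> Obj E" for D
      using ntrans_iso_eq[OF s t ntiso_iso[OF iu D]] st D by simp
    then have "(\<lambda>x\<in>Obj L0. s (FO U x)) = (\<lambda>x\<in>Obj L0. t (FO U x))"
      by (intro discof_faithful[OF d geo_cmp[OF geoU a] geo_cmp[OF geoU b] ntrans_whisker[OF s U] ntrans_whisker[OF t U]]) simp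
    then have UV: "s (FO U (FO V y)) = t (FO U (FO V y))" if "y \<in> Obj F" for y
      using that by (simp add: fun_eq_iff) (metis FO_Obj V)
    have "s y = t y" if y: "y \<in> Obj F" for y
      using ntrans_iso_eq[OF s t ntiso_iso[OF e y]] UV y by simp
    then show "s = t" by (rule ntrans_eqI[OF s t])
  next
    fix a b c k h g
    assume a: "geo F SetCat a" and b: "geo F SetCat b" and c: "geo F SetCat c"
      and k: "ntrans F SetCat a b k" and h: "ntrans F SetCat a c h"
      and g: "ntrans E SetCat (cmp_func b P) (cmp_func c P) g"
      and gk: "\<forall>D\<in>Obj E. Cmp SetCat (g D) (k (FO P D)) = h (FO P D)"
    note Fa = geo_functor[OF a] and Fb = geo_functor[OF b] and Fc = geo_functor[OF c]
    note [simp] = functor_simps[OF Fa] functor_simps[OF Fb] functor_simps[OF Fc] ntrans_simps[OF k] ntrans_simps[OF h] ntrans_simps[OF g]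
    let ?iu = "\<lambda>D\<in>Obj E. inv_arr F (iu D)"
    note g'0 = ntrans_vcmp[OF ntrans_vcmp[OF ntrans_postwhisker[OF ntiso_ntrans[OF ntiso_inv[OF iu]] Fb] g] ntrans_postwhisker[OF tu Fc]]
    \<comment> \<open>\<open>g\<close> conjugated by \<open>iu\<close>, an arrow between the points
      of \<open>E\<close> induced by \<open>cmp_func b U\<close> and
      \<open>cmp_func c U\<close>.\<close>
    let ?g' = "\<lambda>D\<in>Obj E. Cmp SetCat (FA c (iu D)) (Cmp SetCat (g D) (FA b (inv_arr F (iu D))))"
    have g': "ntrans E SetCat (cmp_func (cmp_func b U) Lp) (cmp_func (cmp_func c U) Lp) ?g'"
      using g'0 unfolding cmp_func_assoc[OF Lp U Fb] cmp_func_assoc[OF Lp U Fc] by (simp cong: restrict_cong)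
    have g'k: "Cmp SetCat (?g' D) ((\<lambda>x\<in>Obj L0. k (FO U x)) (FO Lp D)) = (\<lambda>x\<in>Obj L0. h (FO U x)) (FO Lp D)" if D: "D \<in> Obj E" for D
    proof -
      have "Cmp SetCat (FA b (inv_arr F (iu D))) (k (FO U (FO Lp D))) = Cmp SetCat (k (FO P D)) (FA a (inv_arr F (iu D)))"
        using ntrans_sq[OF k, of "inv_arr F (iu D)"] D by simp
      then have "Cmp SetCat (?g' D) (k (FO U (FO Lp D))) =
          Cmp SetCat (FA c (iu D)) (Cmp SetCat (Cmp SetCat (g D) (k (FO P D))) (FA a (inv_arr F (iu D))))"
        using D by simp
      also have "\<dots> = Cmp SetCat (FA c (iu D)) (Cmp SetCat (h (FO P D)) (FA a (inv_arr F (iu D))))"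
        using gk D by (simp del: Cmp_assoc)
      also have "\<dots> = Cmp SetCat (h (FO U (FO Lp D))) (Cmp SetCat (FA a (iu D)) (FA a (inv_arr F (iu D))))"
        using ntrans_sq_prefix[OF h, of "iu D" "FA a (inv_arr F (iu D))"] D by simp
      also have "\<dots> = h (FO U (FO Lp D))"
        using D FA_Cmp[OF Fa, of "inv_arr F (iu D)" "iu D", symmetric] by simp
      finally show ?thesis using D by simp
    qed
    obtain x' where x': "ntrans L0 SetCat (cmp_func b U) (cmp_func c U) x'" and x'D: "\<forall>D\<in>Obj E. x' (FO Lp D) = ?g' D"
      by (rule discof_triangle[OF d geo_cmp[OF geoU a] geo_cmp[OF geoU b] geo_cmp[OF geoU c] ntrans_whisker[OF k U]
            ntrans_whisker[OF h U] g' g'k])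
    note x0 = ntrans_vcmp[OF ntrans_vcmp[OF ntrans_postwhisker[OF ntiso_ntrans[OF ntiso_inv[OF e]] Fb]
          ntrans_whisker[OF x' V, folded cmp_func_assoc[OF V U Fb] cmp_func_assoc[OF V U Fc]]] ntrans_postwhisker[OF te Fc]]
    \<comment> \<open>Composed with \<open>V\<close>, \<open>x'\<close> connects \<open>b\<close>
      and \<open>c\<close> precomposed with \<open>cmp_func U V\<close>; conjugation by
      \<open>e\<close> makes it an arrow from \<open>b\<close> to \<open>c\<close>.\<close>
    let ?x = "\<lambda>y\<in>Obj F. Cmp SetCat (FA c (e y)) (Cmp SetCat (x' (FO V y)) (FA b (inv_arr F (e y))))"
    have x: "ntrans F SetCat b c ?x"
      using x0 unfolding cmp_func_id[OF Fb] cmp_func_id[OF Fc] by (simp cong: restrict_cong)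
    note [simp] = ntrans_simps[OF x']
    have "?x (FO P D) = g D" if D: "D \<in> Obj E" for D
    proof -
      have "?x (FO P D) = Cmp SetCat (FA c (e (FO P D))) (Cmp SetCat (x' (FO V (FO P D))) (Cmp SetCat (FA b (FA U (iv D))) (FA b (iu D))))"
        using D by (simp add: inv_e)
      also have "\<dots> = Cmp SetCat (FA c (e (FO P D))) (Cmp SetCat (FA c (FA U (iv D))) (Cmp SetCat (x' (FO Lp D)) (FA b (iu D))))"
        using ntrans_sq_prefix[OF x', of "iv D" "FA b (iu D)"] D by simp
      also have "\<dots> = Cmp SetCat (Cmp SetCat (FA c (e (FO P D))) (Cmp SetCat (FA c (FA U (iv D))) (FA c (iu D))))
          (Cmp SetCat (g D) (Cmp SetCat (FA b (inv_arr F (iu D))) (FA b (iu D))))"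
        using D x'D by simp
      also have "Cmp SetCat (FA b (inv_arr F (iu D))) (FA b (iu D)) = Idn SetCat (FO b (FO P D))"
        using D FA_Cmp[OF Fb, of "iu D" "inv_arr F (iu D)", symmetric] by simp
      also have "Cmp SetCat (FA c (e (FO P D))) (Cmp SetCat (FA c (FA U (iv D))) (FA c (iu D))) = Idn SetCat (FO c (FO P D))"
        using D arg_cong[OF over[OF D], of "FA c"] by simp
      finally show ?thesis using D by simp
    qed
    with x show "\<exists>x. ntrans F SetCat b c x \<and> (\<forall>D\<in>Obj E. x (FO P D) = g D)" by blast
  next
    fix a y f
    assume a: "geo F SetCat a" and y: "geo E SetCat y" and f: "ntrans E SetCat (cmp_func a P) y f"
    note Fa = geo_functor[OF a] and Fy = geo_functor[OF y]
    note [simp] = functor_simps[OF Fa] functor_simps[OF Fy] ntrans_simps[OF f]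
    let ?f' = "\<lambda>D\<in>Obj E. Cmp SetCat (f D) (FA a (inv_arr F (iu D)))"
    have f': "ntrans E SetCat (cmp_func (cmp_func a U) Lp) y ?f'"
      using ntrans_vcmp[OF ntrans_postwhisker[OF ntiso_ntrans[OF ntiso_inv[OF iu]] Fa] f]
      unfolding cmp_func_assoc[OF Lp U Fa] by (simp cong: restrict_cong)
    obtain b' k' s' where b': "geo L0 SetCat b'" and k': "ntrans L0 SetCat (cmp_func a U) b' k'"
      and s': "ntiso E SetCat (cmp_func b' Lp) y s'" and sk: "\<forall>D\<in>Obj E. Cmp SetCat (s' D) (k' (FO Lp D)) = ?f' D"
      by (rule discof_lift[OF d geo_cmp[OF geoU a] y f'])
    note Fb = geo_functor[OF b']
    note [simp] = functor_simps[OF Fb] ntrans_simps[OF k'] ntrans_simps[OF ntiso_ntrans[OF s']]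
    \<comment> \<open>Composed with \<open>V\<close>, \<open>k'\<close> starts at \<open>a\<close>
      precomposed with \<open>cmp_func U V\<close>, which \<open>e\<close> identifies with
      \<open>a\<close>.\<close>
    let ?k = "\<lambda>y\<in>Obj F. Cmp SetCat (k' (FO V y)) (FA a (inv_arr F (e y)))"
    have k: "ntrans F SetCat a (cmp_func b' V) ?k"
      using ntrans_vcmp[OF ntrans_postwhisker[OF ntiso_ntrans[OF ntiso_inv[OF e]] Fa]
          ntrans_whisker[OF k' V, folded cmp_func_assoc[OF V U Fa]]]
      unfolding cmp_func_id[OF Fa] by (simp cong: restrict_cong)
    let ?s = "\<lambda>D\<in>Obj E. Cmp SetCat (s' D) (FA b' (inv_arr L0 (iv D)))"
    have s: "ntiso E SetCat (cmp_func (cmp_func b' V) P) y ?s"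
      using ntiso_vcmp[OF ntiso_postwhisker[OF ntiso_inv[OF iv] Fb] s']
      unfolding cmp_func_assoc[OF P V Fb] by (simp cong: restrict_cong)
    have "Cmp SetCat (?s D) (?k (FO P D)) = f D" if D: "D \<in> Obj E" for D
    proof -
      have "Cmp SetCat (?s D) (?k (FO P D)) = Cmp SetCat (s' D) (Cmp SetCat (FA b' (inv_arr L0 (iv D)))
          (Cmp SetCat (k' (FO V (FO P D))) (FA a (inv_arr F (e (FO P D))))))"
        using D by simp
      also have "\<dots> = Cmp SetCat (s' D) (Cmp SetCat (k' (FO Lp D))
          (Cmp SetCat (FA a (FA U (inv_arr L0 (iv D)))) (FA a (inv_arr F (e (FO P D))))))"
        using ntrans_sq_prefix[OF k', of "inv_arr L0 (iv D)" "FA a (inv_arr F (e (FO P D)))"] D by simp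
      also have "\<dots> = Cmp SetCat (Cmp SetCat (s' D) (k' (FO Lp D)))
          (Cmp SetCat (FA a (FA U (inv_arr L0 (iv D)))) (FA a (inv_arr F (e (FO P D)))))"
        using D by simp
      also have "\<dots> = Cmp SetCat (f D) (FA a (Cmp F (inv_arr F (iu D))
          (Cmp F (Cmp F (FA U (inv_arr L0 (iv D))) (FA U (iv D))) (iu D))))"
        using D sk by (simp add: inv_e)
      also have "Cmp F (FA U (inv_arr L0 (iv D))) (FA U (iv D)) = Idn F (FO U (FO Lp D))"
        using D FA_Cmp[OF U, of "iv D" "inv_arr L0 (iv D)", symmetric] by simp
      finally show ?thesis using D by simp
    qed
    with geo_cmp[OF geoV b'] k s
    show "\<exists>b k s. geo F SetCat b \<and> ntrans F SetCat a b k \<and> ntiso E SetCat (cmp_func b P) y s \<and>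
        (\<forall>D\<in>Obj E. Cmp SetCat (s D) (k (FO P D)) = f D)" by blast
  qed
qed

section \<open>Thin groupoids and fibres\<close>

lemma thin_groupoid_equivalent_discrete:
  fixes C :: "('o, 'a) category"
  assumes C: "category C"
    and thin: "\<And>f g. f \<in> Arr C \<Longrightarrow> g \<in> Arr C \<Longrightarrow> Dom C f = Dom C g \<Longrightarrow> Cod C f = Cod C g \<Longrightarrow> f = g"
    and iso: "\<And>f. f \<in> Arr C \<Longrightarrow> iso_arr C f"
  shows "\<exists>D :: ('o, 'a) category. discrete_category D \<and> equivalent_categories C D"
proof -
  note [simp] = cat_simps[OF C]
  \<comment> \<open>The representative is chosen among the sources of arrows into \<open>x\<close>.
    Isomorphic objects have the same such sources, so they receive equal representatives and not
    merely isomorphic ones.\<close>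
  define r where "r = (\<lambda>x. SOME y. \<exists>f\<in>Arr C. Dom C f = y \<and> Cod C f = x)"
  have rx: "\<exists>f\<in>Arr C. Dom C f = r x \<and> Cod C f = x" if "x \<in> Obj C" for x
    unfolding r_def by (rule someI_ex) (use that in \<open>auto intro!: exI[of _ x] bexI[of _ "Idn C x"]\<close>)
  define s where "s = (\<lambda>x\<in>Obj C. SOME f. f \<in> Arr C \<and> Dom C f = r x \<and> Cod C f = x)"
  have s: "s x \<in> Arr C \<and> Dom C (s x) = r x \<and> Cod C (s x) = x" if "x \<in> Obj C" for x
    using someI_ex[of "\<lambda>f. f \<in> Arr C \<and> Dom C f = r x \<and> Cod C f = x"] rx[OF that] that by (auto simp: s_def)
  have rO: "r x \<in> Obj C" if "x \<in> Obj C" for x using s[OF that] Dom_Obj[OF C] by metis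
  have r_eq: "r (Dom C f) = r (Cod C f)" if f: "f \<in> Arr C" for f
  proof -
    have "(\<exists>g\<in>Arr C. Dom C g = y \<and> Cod C g = Dom C f) \<longleftrightarrow> (\<exists>g\<in>Arr C. Dom C g = y \<and> Cod C g = Cod C f)" for y
    proof
      assume "\<exists>g\<in>Arr C. Dom C g = y \<and> Cod C g = Dom C f"
      then obtain g where "g \<in> Arr C" "Dom C g = y" "Cod C g = Dom C f" by blast
      then show "\<exists>g\<in>Arr C. Dom C g = y \<and> Cod C g = Cod C f"
        by (intro bexI[of _ "Cmp C f g"]) (use f in simp_all)
    next
      assume "\<exists>g\<in>Arr C. Dom C g = y \<and> Cod C g = Cod C f"
      then obtain g where "g \<in> Arr C" "Dom C g = y" "Cod C g = Cod C f" by blast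
      then show "\<exists>g\<in>Arr C. Dom C g = y \<and> Cod C g = Dom C f"
        by (intro bexI[of _ "Cmp C (inv_arr C f) g"]) (use f inv_simps[OF iso[OF f]] in simp_all)
    qed
    then show ?thesis by (simp add: r_def)
  qed
  have rr: "r (r x) = r x" if "x \<in> Obj C" for x
    using r_eq[of "s x"] s[OF that] by simp
  define D where "D = \<lparr>Obj = r ` Obj C, Arr = Idn C ` r ` Obj C, Dom = Dom C, Cod = Cod C, Idn = Idn C, Cmp = Cmp C\<rparr>"
  have D_simps: "Obj D = r ` Obj C" "Arr D = Idn C ` r ` Obj C" "Dom D = Dom C" "Cod D = Cod C" "Idn D = Idn C" "Cmp D = Cmp C"
    by (simp_all add: D_def)
  have D: "category D"
    unfolding category_def mem_homset D_simps by (auto simp: rO)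
  have dD: "discrete_category D"
    unfolding discrete_category_def using D by (auto simp: D_simps rO)
  define F where "F = \<lparr>FDom = C, FCod = D, FO = (\<lambda>x\<in>Obj C. r x), FA = (\<lambda>f\<in>Arr C. Idn C (r (Dom C f)))\<rparr>"
  define G where "G = \<lparr>FDom = D, FCod = C, FO = (\<lambda>x\<in>Obj D. x), FA = (\<lambda>f\<in>Arr D. f)\<rparr>"
  have F: "functor_from_to F C D"
  proof (rule functorI[OF C D])
    fix f g assume fg: "f \<in> Arr C" "g \<in> Arr C" "Cod C f = Dom C g"
    then have "r (Dom C g) = r (Dom C f)" using r_eq[of f] by simp
    then show "FA F (Cmp C g f) = Cmp D (FA F g) (FA F f)" using fg by (simp add: F_def D_simps rO)
  qed (auto simp: F_def D_simps rO r_eq)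
  have G: "functor_from_to G D C"
    by (rule functorI[OF D C]) (use cat_simps[OF D] in \<open>auto simp: G_def D_simps rO\<close>)
  note [simp] = functor_simps[OF F] functor_simps[OF G] cmp_func_simps id_func_simps
  have FOA: "x \<in> Obj C \<Longrightarrow> FO F x = r x" "f \<in> Arr C \<Longrightarrow> FA F f = Idn C (r (Dom C f))"
    "y \<in> Obj D \<Longrightarrow> FO G y = y" "h \<in> Arr D \<Longrightarrow> FA G h = h" for x f y h
    by (simp_all add: F_def G_def)
  have Fin: "r x \<in> Obj D" "Idn C (r x) \<in> Arr D" if "x \<in> Obj C" for x using that by (auto simp: D_simps)
  have "ntrans C C (cmp_func G F) (id_func C) s"
  proof (rule ntransI[OF functor_cmp[OF F G] functor_id[OF C]])
    show "Cmp C (s (Cod C f)) (FA (cmp_func G F) f) = Cmp C (FA (id_func C) f) (s (Dom C f))" if "f \<in> Arr C" for f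
      using that s[of "Cod C f"] s[of "Dom C f"] r_eq[OF that] by (intro thin) (simp_all add: FOA Fin rO)
  qed (use s in \<open>simp_all add: FOA Fin s_def\<close>)
  then have 1: "ntiso C C (cmp_func G F) (id_func C) s"
    using s iso by (simp add: ntiso_def)
  have "cmp_func F G = id_func D"
    by (rule functor_eqI[OF functor_cmp[OF G F] functor_id[OF D]])
      (auto simp: FOA, auto simp: FOA D_simps rr rO)
  then have 2: "ntiso D D (cmp_func F G) (id_func D) (\<lambda>y\<in>Obj D. Idn D (FO (id_func D) y))"
    using ntiso_id[OF functor_id[OF D]] by simp
  have "equivalence_functor F"
    unfolding equivalence_functor_def natural_iso_iff_ntiso
    using F 1 2 by (intro conjI exI[of _ G] exI) (simp_all add: G, simp add: functor_from_to_def)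
  then show ?thesis using dD F by (auto simp: equivalent_categories_def)
qed

lemma fiber_simps:
  "x \<in> Obj (fiber P b) \<longleftrightarrow> fst x \<in> Obj (FDom P) \<and> iso_arr (FCod P) (snd x) \<and>
    Dom (FCod P) (snd x) = FO P (fst x) \<and> Cod (FCod P) (snd x) = b"
  "(x, y, k) \<in> Arr (fiber P b) \<longleftrightarrow> x \<in> Obj (fiber P b) \<and> y \<in> Obj (fiber P b) \<and> k \<in> Arr (FDom P) \<and>
    Dom (FDom P) k = fst x \<and> Cod (FDom P) k = fst y \<and> Cmp (FCod P) (snd y) (FA P k) = snd x"
  "Dom (fiber P b) (x, y, k) = x" "Cod (fiber P b) (x, y, k) = y" "Idn (fiber P b) x = (x, x, Idn (FDom P) (fst x))"
  "Cmp (fiber P b) (y', z, l) (x, y, k) = (x, z, Cmp (FDom P) l k)"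
  by (auto simp: fiber_def Let_def mem_homset iso_arr_def)

lemma category_fiber:
  assumes P: "functor_from_to P C B"
  shows "category (fiber P b)"
proof -
  note [simp] = functor_simps[OF P] cat_simps[OF functor_category_dom[OF P]] cat_simps[OF functor_category_cod[OF P]]
  have m: "Cmp B s (Cmp B (FA P l) (FA P k)) = s''" if "Cmp B s (FA P l) = s'" "Cmp B s' (FA P k) = s''" "iso_arr B s"
    "k \<in> Arr C" "l \<in> Arr C" "Cod C k = Dom C l" "Dom B s = FO P (Cod C l)" for s s' s'' k l
    using that iso_Arr[OF that(3)] by (metis Cmp_assoc FA_Arr FA_Cod FA_Dom P functor_category_cod)
  show ?thesis
    unfolding category_def mem_homset
    by (safe; auto simp: fiber_simps iso_Arr intro: m)
qed

text \<open>An arrow of the fibre lies over the isomorphism determined by the structure maps of its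
  ends. Faithfulness therefore leaves at most one arrow between two objects, and conservativity
  makes it invertible.\<close>

lemma fiber_equivalent_discrete:
  fixes P :: "('o, 'a, 'p, 'b) func"
  assumes P: "functor_from_to P C B"
    and faithful: "\<And>k l. k \<in> Arr C \<Longrightarrow> l \<in> Arr C \<Longrightarrow> Dom C k = Dom C l \<Longrightarrow> Cod C k = Cod C l \<Longrightarrow> FA P k = FA P l \<Longrightarrow> k = l"
    and conservative: "\<And>k. k \<in> Arr C \<Longrightarrow> iso_arr B (FA P k) \<Longrightarrow> iso_arr C k"
  shows "\<exists>D :: ('o \<times> 'b, ('o \<times> 'b) \<times> ('o \<times> 'b) \<times> 'a) category.
    discrete_category D \<and> equivalent_categories (fiber P b) D"
proof (rule thin_groupoid_equivalent_discrete[OF category_fiber[OF P]])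
  note BC = functor_category_cod[OF P]
  note [simp] = functor_simps[OF P] cat_simps[OF functor_category_dom[OF P]] cat_simps[OF BC]
  fix f g assume "f \<in> Arr (fiber P b)" "g \<in> Arr (fiber P b)" "Dom (fiber P b) f = Dom (fiber P b) g"
    "Cod (fiber P b) f = Cod (fiber P b) g"
  then obtain x y k l where fg: "f = (x, y, k)" "g = (x, y, l)" and a: "(x, y, k) \<in> Arr (fiber P b)" "(x, y, l) \<in> Arr (fiber P b)"
    by (cases f, cases g) (auto simp: fiber_simps(3,4))
  have "FA P k = FA P l"
    by (rule iso_cancel_left[OF BC, of "snd y"]) (use a in \<open>simp_all add: fiber_simps\<close>)
  then have "k = l" using a by (intro faithful) (simp_all add: fiber_simps)
  then show "f = g" by (simp add: fg)
next
  note BC = functor_category_cod[OF P]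
  note [simp] = functor_simps[OF P] cat_simps[OF functor_category_dom[OF P]] cat_simps[OF BC]
  fix f assume "f \<in> Arr (fiber P b)"
  then obtain x y k where f: "f = (x, y, k)" and a: "(x, y, k) \<in> Arr (fiber P b)" by (cases f) auto
  have y: "iso_arr B (snd y)" "iso_arr B (snd x)" "k \<in> Arr C" "Cmp B (snd y) (FA P k) = snd x" "Dom C k = fst x" "Cod C k = fst y"
    "Dom B (snd y) = FO P (fst y)" "Dom B (snd x) = FO P (fst x)" "Cod B (snd y) = b" "Cod B (snd x) = b"
    using a by (simp_all add: fiber_simps)
  have "FA P k = Cmp B (inv_arr B (snd y)) (snd x)"
    using Cmp_inv_left[OF BC y(1), of "FA P k"] y by simp
  then have "iso_arr B (FA P k)"
    using iso_Cmp[OF BC y(2) iso_inv[OF y(1)]] y inv_Dom[OF y(1)] by simp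
  then have i: "iso_arr C k" by (rule conservative[OF y(3)])
  note [simp] = inv_simps[OF i]
  have "Cmp B (Cmp B (snd y) (FA P k)) (FA P (inv_arr C k)) = Cmp B (snd y) (Cmp B (FA P k) (FA P (inv_arr C k)))"
    by (rule Cmp_assoc[OF BC]) (use y(3-7) iso_Arr[OF y(1)] in simp_all)
  also have "Cmp B (FA P k) (FA P (inv_arr C k)) = Idn B (FO P (fst y))"
    using y FA_Cmp[OF P, of "inv_arr C k" k] Cod_Obj[OF functor_category_dom[OF P] y(3)] by simp
  finally have "Cmp B (snd x) (FA P (inv_arr C k)) = snd y" using y(4,7) iso_Arr[OF y(1)] by (metis BC Cmp_Idn_right)
  then have "(y, x, inv_arr C k) \<in> Arr (fiber P b)" using a y by (simp add: fiber_simps(2))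
  then show "iso_arr (fiber P b) f"
    by (intro iso_arrI[of _ _ "(y, x, inv_arr C k)"]) (use a y in \<open>simp_all add: f fiber_simps(3-6)\<close>)
qed

section \<open>From bilimits to pro-etale geometric morphisms\<close>

lemma discof_equivalent0:
  assumes pL: "equivalent0 (pseudoslice GTop E) p L" and d: "discof E (gsrc L) (pull L)"
  shows "discof E (gsrc p) (pull p)"
proof -
  let ?K = "pseudoslice GTop E"
  have p: "p \<in> cells1 GTop" "gtgt p = E" and L: "L \<in> cells1 GTop" "gtgt L = E"
    using pL by (simp_all add: equivalent0_def slice_cells0)
  obtain u v x where u: "u \<in> hom1 ?K p L" and v: "v \<in> hom1 ?K L p" and x: "x \<in> iso2 ?K (cmp1 ?K v u) (id1 ?K p)"
    using pL by (auto simp: equivalent0_def)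
  obtain t where t: "c2 (cmp1 ?K v u) (id1 ?K p) t \<in> hom2 ?K (cmp1 ?K v u) (id1 ?K p)"
    and ti: "ntiso (gsrc (tri_tgt (cmp1 ?K v u))) (gsrc (tri_src (cmp1 ?K v u))) (pull (tri_cell (cmp1 ?K v u))) (pull (tri_cell (id1 ?K p))) t"
    by (rule slice_iso2D[OF x])
  note sel = slice_cmp1_sel[OF u v] and one = slice_id1[OF p]
  have U: "u \<in> cells1 ?K" "tri_src u = p" "tri_tgt u = L" and V: "v \<in> cells1 ?K" "tri_src v = L" "tri_tgt v = p"
    using u v by (simp_all add: slice_hom1)
  note cu = slice_cell[OF U(1), unfolded U] and cv = slice_cell[OF V(1), unfolded V]
  show ?thesis
  proof (rule discof_transfer[OF d])
    show "geo E (gsrc L) (pull L)" "geo E (gsrc p) (pull p)"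
      using cells1_geo[OF L(1)] cells1_geo[OF p(1)] p L by simp_all
    show "geo (gsrc L) (gsrc p) (pull (tri_cell u))" "geo (gsrc p) (gsrc L) (pull (tri_cell v))"
      using cells1_geo[OF cu(1)] cells1_geo[OF cv(1)] cu cv by simp_all
    show "ntiso E (gsrc p) (pull p) (cmp_func (pull (tri_cell u)) (pull L)) (TMap (tri_iso u))"
      "ntiso E (gsrc L) (pull L) (cmp_func (pull (tri_cell v)) (pull p)) (TMap (tri_iso v))"
      using slice_iso[OF U(1), unfolded U] slice_iso[OF V(1), unfolded V] by simp_all
    show "ntiso (gsrc p) (gsrc p) (cmp_func (pull (tri_cell u)) (pull (tri_cell v))) (id_func (gsrc p)) t"
      using ti by (simp add: sel one tri_simps cmp_geom_simps id_geom_def)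
    \<comment> \<open>The condition that the invertible 2-cell from the composite to the identity of
      \<open>p\<close> lies over \<open>E\<close>.\<close>
    show "Cmp (gsrc p) (t (FO (pull p) D)) (Cmp (gsrc p) (FA (pull (tri_cell u)) (TMap (tri_iso v) D)) (TMap (tri_iso u) D)) =
        Idn (gsrc p) (FO (pull p) D)" if D: "D \<in> Obj E" for D
      using c2_over[OF t D] D by (simp add: sel one tri_simps)
  qed
qed

lemma discof_pro_etale:
  fixes p :: "'u::universe large geom"
  assumes "pro_etale p"
  shows "discof (gtgt p) (gsrc p) (pull p)"
proof -
  obtain I :: "('u, 'u) category" and e D L c where e: "functor_from_to e I (gtgt p)" and D: "etale_diagram I e D"
    and bil: "is_bilimit I (pseudoslice GTop (gtgt p)) D L c" and pL: "equivalent0 (pseudoslice GTop (gtgt p)) p L"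
    using assms unfolding pro_etale_def by blast
  have "bilimit_points (gtgt p) (gsrc L) (pull L) I (FO e) (\<lambda>i. pull (tri_cell (leg c i))) (\<lambda>i. TMap (tri_iso (leg c i)))
      (\<lambda>u. pull (tri_cell (P1 D u))) (\<lambda>u. TMap (tri_iso (P1 D u))) (\<lambda>u. TMap (snd (snd (leg_iso c u))))"
    by (rule bilimit_points[OF _ _ bil]) (use D functor_simps[OF e] in \<open>simp_all add: etale_diagram_def\<close>)
  from bilimit_points.discof_bilimit[OF this] show ?thesis by (rule discof_equivalent0[OF pL])
qed

section \<open>Categories of points and the induced functor\<close>

lemma pt0_simps:
  "Dom (pt0 F) = TDom" "Cod (pt0 F) = TCod"
  "f \<in> Obj (pt0 F) \<longleftrightarrow> f \<in> cells1 GTop \<and> gsrc f = SetCat \<and> gtgt f = F"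
  "x \<in> Arr (pt0 F) \<longleftrightarrow> TDom x \<in> Obj (pt0 F) \<and> TCod x \<in> Obj (pt0 F) \<and>
    ntrans F SetCat (pull (TDom x)) (pull (TCod x)) (TMap x)"
  "f \<in> Obj (pt0 F) \<Longrightarrow> Idn (pt0 F) f = \<lparr>TDom = f, TCod = f, TMap = (\<lambda>D\<in>Obj F. Idn SetCat (FO (pull f) D))\<rparr>"
  "x \<in> Arr (pt0 F) \<Longrightarrow> Cmp (pt0 F) y x =
    \<lparr>TDom = TDom x, TCod = TCod y, TMap = (\<lambda>D\<in>Obj F. Cmp SetCat (TMap y D) (TMap x D))\<rparr>"
proof -
  show O: "f \<in> Obj (pt0 F) \<longleftrightarrow> f \<in> cells1 GTop \<and> gsrc f = SetCat \<and> gtgt f = F" for f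
    by (simp add: pt0_def hom_category_def hom1_def GTop_simps)
  have c2: "x \<in> cells2 GTop \<longleftrightarrow> TDom x \<in> cells1 GTop \<and> TCod x \<in> cells1 GTop \<and>
      natural (pull (TDom x)) (pull (TCod x)) (TMap x)" for x
    by (simp add: GTop_def Let_def)
  have "x \<in> Arr (pt0 F) \<longleftrightarrow> x \<in> cells2 GTop \<and> TDom x \<in> Obj (pt0 F) \<and> TCod x \<in> Obj (pt0 F)"
    by (simp add: pt0_def hom_category_def GTop_simps)
  also have "\<dots> \<longleftrightarrow> TDom x \<in> Obj (pt0 F) \<and> TCod x \<in> Obj (pt0 F) \<and> natural (pull (TDom x)) (pull (TCod x)) (TMap x)"
    unfolding c2 O by blast
  also have "\<dots> \<longleftrightarrow> TDom x \<in> Obj (pt0 F) \<and> TCod x \<in> Obj (pt0 F) \<and> ntrans F SetCat (pull (TDom x)) (pull (TCod x)) (TMap x)"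
    unfolding natural_iff_ntrans O by (metis gsrc_def gtgt_def)
  finally show A: "x \<in> Arr (pt0 F) \<longleftrightarrow> TDom x \<in> Obj (pt0 F) \<and> TCod x \<in> Obj (pt0 F) \<and>
      ntrans F SetCat (pull (TDom x)) (pull (TCod x)) (TMap x)" .
  show "f \<in> Obj (pt0 F) \<Longrightarrow> Idn (pt0 F) f = \<lparr>TDom = f, TCod = f, TMap = (\<lambda>D\<in>Obj F. Idn SetCat (FO (pull f) D))\<rparr>"
    unfolding O by (simp add: pt0_def hom_category_def GTop_simps)
  show "x \<in> Arr (pt0 F) \<Longrightarrow> Cmp (pt0 F) y x =
    \<lparr>TDom = TDom x, TCod = TCod y, TMap = (\<lambda>D\<in>Obj F. Cmp SetCat (TMap y D) (TMap x D))\<rparr>"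
    unfolding A O by (simp add: pt0_def hom_category_def GTop_simps)
qed (simp_all add: pt0_def hom_category_def GTop_simps)

lemma pt0_geo: "f \<in> Obj (pt0 F) \<Longrightarrow> geo F SetCat (pull f)"
  using cells1_geo[of f] by (auto simp: pt0_simps(3))

lemma pt0_ntrans: "x \<in> Arr (pt0 F) \<Longrightarrow> ntrans F SetCat (pull (TDom x)) (pull (TCod x)) (TMap x)"
  by (simp add: pt0_simps(4))

lemma pt0_eqI:
  assumes "x \<in> Arr (pt0 F)" "y \<in> Arr (pt0 F)" "TDom x = TDom y" "TCod x = TCod y"
    and "\<And>D. D \<in> Obj F \<Longrightarrow> TMap x D = TMap y D"
  shows "x = y"
  using ntrans_eqI[OF pt0_ntrans[OF assms(1)] pt0_ntrans[OF assms(2)] assms(5)] assms(3,4)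
  by (cases x, cases y) simp

lemma pt0_comp_Arr:
  assumes "x \<in> Arr (pt0 F)" "y \<in> Arr (pt0 F)" "TCod x = TDom y"
  shows "Cmp (pt0 F) y x \<in> Arr (pt0 F)"
  using ntrans_vcmp[OF pt0_ntrans[OF assms(1)], of "pull (TCod y)" "TMap y"] pt0_ntrans[OF assms(2)] assms
  by (simp add: pt0_simps(4)[of "Cmp (pt0 F) y x"] pt0_simps(6)) (simp add: pt0_simps(4))

lemma category_pt0: "category (pt0 F)"
  unfolding category_def mem_homset
proof (intro conjI ballI impI)
  fix x assume "x \<in> Obj (pt0 F)"
  then show "Idn (pt0 F) x \<in> Arr (pt0 F)" "Dom (pt0 F) (Idn (pt0 F) x) = x" "Cod (pt0 F) (Idn (pt0 F) x) = x"
    using ntrans_id[OF geo_functor[OF pt0_geo]] by (simp_all add: pt0_simps(1,2,4,5))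
next
  fix x assume x: "x \<in> Arr (pt0 F)"
  then have d: "TDom x \<in> Obj (pt0 F)" "TCod x \<in> Obj (pt0 F)" by (simp_all add: pt0_simps(4))
  then show "Dom (pt0 F) x \<in> Obj (pt0 F)" "Cod (pt0 F) x \<in> Obj (pt0 F)" by (simp_all add: pt0_simps(1,2))
  have i: "Idn (pt0 F) (TDom x) \<in> Arr (pt0 F)" "Idn (pt0 F) (TCod x) \<in> Arr (pt0 F)"
    using d ntrans_id[OF geo_functor[OF pt0_geo]] by (simp_all add: pt0_simps(4,5))
  note n = pt0_ntrans[OF x]
  note [simp] = ntrans_simps[OF n] cat_simps[OF category_SetCat]
  have e: "TDom (Idn (pt0 F) (TDom x)) = TDom x" "TCod (Idn (pt0 F) (TDom x)) = TDom x"
    "TDom (Idn (pt0 F) (TCod x)) = TCod x" "TCod (Idn (pt0 F) (TCod x)) = TCod x"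
    using d by (simp_all add: pt0_simps(5))
  show "Cmp (pt0 F) x (Idn (pt0 F) (Dom (pt0 F) x)) = x"
    by (rule pt0_eqI[OF pt0_comp_Arr]) (use x i d in \<open>simp_all add: pt0_simps(1,6) e, simp add: pt0_simps(5)\<close>)
  show "Cmp (pt0 F) (Idn (pt0 F) (Cod (pt0 F) x)) x = x"
    by (rule pt0_eqI[OF pt0_comp_Arr]) (use x i d in \<open>simp_all add: pt0_simps(2,6) e, simp add: pt0_simps(5)\<close>)
  fix y assume y: "y \<in> Arr (pt0 F)"
  {
    assume "Cod (pt0 F) x = Dom (pt0 F) y"
    then have xy: "TCod x = TDom y" by (simp add: pt0_simps(1,2))
    show xyA: "Cmp (pt0 F) y x \<in> Arr (pt0 F)" by (rule pt0_comp_Arr[OF x y xy])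
    show "Dom (pt0 F) (Cmp (pt0 F) y x) = Dom (pt0 F) x" "Cod (pt0 F) (Cmp (pt0 F) y x) = Cod (pt0 F) y"
      using x by (simp_all add: pt0_simps(1,2,6))
    fix z assume z: "z \<in> Arr (pt0 F)" and "Cod (pt0 F) y = Dom (pt0 F) z"
    then have yz: "TCod y = TDom z" by (simp add: pt0_simps(1,2))
    note [simp] = ntrans_simps[OF pt0_ntrans[OF y]] ntrans_simps[OF pt0_ntrans[OF z]]
    have yzA: "Cmp (pt0 F) z y \<in> Arr (pt0 F)" by (rule pt0_comp_Arr[OF y z yz])
    show "Cmp (pt0 F) z (Cmp (pt0 F) y x) = Cmp (pt0 F) (Cmp (pt0 F) z y) x"
      unfolding pt0_simps(6)[OF x] pt0_simps(6)[OF y] pt0_simps(6)[OF xyA, unfolded pt0_simps(6)[OF x]]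
      by (auto simp: fun_eq_iff xy yz)
  }
qed

lemma iso_pt0:
  assumes x: "x \<in> Arr (pt0 F)" and i: "\<And>D. D \<in> Obj F \<Longrightarrow> iso_arr SetCat (TMap x D)"
  shows "iso_arr (pt0 F) x"
proof -
  let ?y = "\<lparr>TDom = TCod x, TCod = TDom x, TMap = (\<lambda>D\<in>Obj F. inv_arr SetCat (TMap x D))\<rparr>"
  note n = pt0_ntrans[OF x]
  note [simp] = ntrans_simps[OF n] cat_simps[OF category_SetCat] inv_simps[OF i]
  have d: "TDom x \<in> Obj (pt0 F)" "TCod x \<in> Obj (pt0 F)" using x by (simp_all add: pt0_simps(4))
  have y: "?y \<in> Arr (pt0 F)"
    using d ntrans_inv[OF n i] by (simp add: pt0_simps(4)[of ?y])
  show ?thesis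
    by (rule iso_arrI[of _ _ ?y]) (use x y d in \<open>simp_all add: pt0_simps(1,2,5,6) cong: restrict_cong\<close>)
qed

lemma pt0_isoD:
  assumes x: "iso_arr (pt0 F) x" and D: "D \<in> Obj F"
  shows "iso_arr SetCat (TMap x D)"
proof -
  let ?y = "inv_arr (pt0 F) x"
  note xA = iso_Arr[OF x] and yA = inv_Arr[OF x] and yd = inv_Dom[OF x, unfolded pt0_simps(1,2)] inv_Cod[OF x, unfolded pt0_simps(1,2)]
  have d: "TDom x \<in> Obj (pt0 F)" "TCod x \<in> Obj (pt0 F)" using xA by (simp_all add: pt0_simps(4))
  note [simp] = ntrans_simps[OF pt0_ntrans[OF xA]] ntrans_simps[OF pt0_ntrans[OF yA]]
  have "Cmp SetCat (TMap ?y D) (TMap x D) = Idn SetCat (FO (pull (TDom x)) D)"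
    using fun_cong[OF arg_cong[OF inv_left[OF x], of TMap], of D] D xA d by (simp add: pt0_simps(1,5,6))
  moreover have "Cmp SetCat (TMap x D) (TMap ?y D) = Idn SetCat (FO (pull (TCod x)) D)"
    using fun_cong[OF arg_cong[OF inv_right[OF x], of TMap], of D] D yA d by (simp add: pt0_simps(2,5,6))
  ultimately show ?thesis
    by (intro iso_arrI[of _ _ "TMap ?y D"]) (use D in \<open>simp_all add: yd\<close>)
qed

text \<open>Whiskering with \<open>p\<close> composes each component with the image of an identity,
  which disappears; what remains is evaluation of \<open>TMap x\<close> at objects of the form
  \<open>FO (pull p) D\<close>.\<close>

lemma pt1_simps:
  assumes p: "p \<in> cells1 GTop"
  shows "f \<in> Obj (pt0 (gsrc p)) \<Longrightarrow> FO (pt1 p) f = cmp_geom p f"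
    and "x \<in> Arr (pt0 (gsrc p)) \<Longrightarrow> FA (pt1 p) x =
      \<lparr>TDom = cmp_geom p (TDom x), TCod = cmp_geom p (TCod x), TMap = (\<lambda>D\<in>Obj (gtgt p). TMap x (FO (pull p) D))\<rparr>"
proof -
  show "f \<in> Obj (pt0 (gsrc p)) \<Longrightarrow> FO (pt1 p) f = cmp_geom p f"
    by (simp add: pt1_def pt0_def postcompose_def GTop_simps)
  assume x: "x \<in> Arr (pt0 (gsrc p))"
  note P = geo_functor[OF cells1_geo[OF p]]
  have d: "TDom x \<in> Obj (pt0 (gsrc p))" "TCod x \<in> Obj (pt0 (gsrc p))" using x by (simp_all add: pt0_simps(4))
  note G = geo_functor[OF pt0_geo[OF d(1)]]
  have s: "gsrc (TDom x) = SetCat" using d by (simp add: pt0_simps(3))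
  note [simp] = functor_simps[OF P] functor_simps[OF G] ntrans_simps[OF pt0_ntrans[OF x]] cat_simps[OF category_SetCat]
  show "FA (pt1 p) x =
      \<lparr>TDom = cmp_geom p (TDom x), TCod = cmp_geom p (TCod x), TMap = (\<lambda>D\<in>Obj (gtgt p). TMap x (FO (pull p) D))\<rparr>"
    using x by (simp add: pt1_def pt0_def postcompose_def) (simp add: GTop_simps s cong: restrict_cong)
qed

lemma functor_pt1:
  assumes p: "p \<in> cells1 GTop"
  shows "functor_from_to (pt1 p) (pt0 (gsrc p)) (pt0 (gtgt p))"
proof -
  let ?F = "gsrc p" and ?E = "gtgt p"
  note P = geo_functor[OF cells1_geo[OF p]]
  note [simp] = functor_simps[OF P]
  have O: "cmp_geom p f \<in> Obj (pt0 ?E)" if "f \<in> Obj (pt0 ?F)" for f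
    using that cells1_cmp[OF _ p] by (simp add: pt0_simps(3) cmp_geom_simps)
  have A: "FA (pt1 p) x \<in> Arr (pt0 ?E)" if x: "x \<in> Arr (pt0 ?F)" for x
    using ntrans_whisker[OF pt0_ntrans[OF x] P] x
    by (simp add: pt1_simps(2)[OF p] pt0_simps(4)[of _ ?E] cmp_geom_simps) (simp add: pt0_simps(4) O)
  show ?thesis
  proof (rule functorI[OF category_pt0 category_pt0 pt1_from_to])
    show "FO (pt1 p) \<in> extensional (Obj (pt0 ?F))" "FA (pt1 p) \<in> extensional (Arr (pt0 ?F))"
      by (simp_all add: pt1_def pt0_def postcompose_def GTop_simps)
    fix f assume f: "f \<in> Obj (pt0 ?F)"
    then show "FO (pt1 p) f \<in> Obj (pt0 ?E)" by (simp add: pt1_simps[OF p] O)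
    have "Idn (pt0 ?F) f \<in> Arr (pt0 ?F)" by (rule Idn_Arr[OF category_pt0 f])
    then show "FA (pt1 p) (Idn (pt0 ?F) f) = Idn (pt0 ?E) (FO (pt1 p) f)"
      using f O[OF f] by (simp add: pt1_simps[OF p] pt0_simps(5) cmp_geom_simps cmp_func_simps cong: restrict_cong)
  next
    fix x assume x: "x \<in> Arr (pt0 ?F)"
    show "FA (pt1 p) x \<in> Arr (pt0 ?E)" by (rule A[OF x])
    have d: "TDom x \<in> Obj (pt0 ?F)" "TCod x \<in> Obj (pt0 ?F)" using x by (simp_all add: pt0_simps(4))
    show "Dom (pt0 ?E) (FA (pt1 p) x) = FO (pt1 p) (Dom (pt0 ?F) x)" "Cod (pt0 ?E) (FA (pt1 p) x) = FO (pt1 p) (Cod (pt0 ?F) x)"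
      using x d by (simp_all add: pt0_simps(1,2) pt1_simps[OF p])
    fix y assume y: "y \<in> Arr (pt0 ?F)" and "Cod (pt0 ?F) x = Dom (pt0 ?F) y"
    then have xy: "TCod x = TDom y" by (simp add: pt0_simps(1,2))
    show "FA (pt1 p) (Cmp (pt0 ?F) y x) = Cmp (pt0 ?E) (FA (pt1 p) y) (FA (pt1 p) x)"
      unfolding pt0_simps(6)[OF A[OF x]] pt1_simps(2)[OF p pt0_comp_Arr[OF x y xy]]
      unfolding pt1_simps(2)[OF p x] pt1_simps(2)[OF p y] pt0_simps(6)[OF x] by (simp cong: restrict_cong)
  qed
qed

text \<open>The triangle property makes all arrows of points opcartesian, in particular those
  provided by the lifting property of \<open>discof\<close>. Fibres are thin by faithfulness, and
  groupoids since an arrow over an invertible one is invertible.\<close>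

lemma discrete_opfibration_pt1:
  assumes p: "p \<in> cells1 GTop" and d: "discof (gtgt p) (gsrc p) (pull p)"
  shows "discrete_opfibration (pt1 p)"
proof -
  let ?F = "gsrc p" and ?E = "gtgt p"
  note P = geo_functor[OF cells1_geo[OF p]] and PT = functor_pt1[OF p]
  note [simp] = functor_simps[OF P] cmp_func_simps
  have faithful: "x = y" if x: "x \<in> Arr (pt0 ?F)" and y: "y \<in> Arr (pt0 ?F)" and xy: "TDom x = TDom y" "TCod x = TCod y"
    and e: "FA (pt1 p) x = FA (pt1 p) y" for x y
  proof -
    have "TMap x (FO (pull p) D) = TMap y (FO (pull p) D)" if "D \<in> Obj ?E" for D
      using fun_cong[OF arg_cong[OF e, of TMap], of D] that by (simp add: pt1_simps(2)[OF p] x y)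
    moreover have "geo ?F SetCat (pull (TDom x))" "geo ?F SetCat (pull (TCod x))"
      using x by (simp_all add: pt0_simps(4) pt0_geo)
    ultimately have "TMap x = TMap y"
      using discof_faithful[OF d _ _ pt0_ntrans[OF x] pt0_ntrans[OF y, folded xy]] by blast
    then show ?thesis using xy by (intro pt0_eqI[OF x y]) simp_all
  qed
  \<comment> \<open>\<open>discof_triangle\<close> produces the factorisation through
    \<open>k\<close>, and faithfulness of \<open>pt1 p\<close> makes it unique.\<close>
  have opcart: "opcartesian (pt1 p) k" if k: "k \<in> Arr (pt0 ?F)" for k
    unfolding opcartesian_def pt1_from_to pt0_simps(1,2) mem_homset
  proof (intro conjI ballI impI k)
    fix h g
    assume h: "h \<in> Arr (pt0 ?F)" and g: "g \<in> Arr (pt0 ?E)"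
    assume "TDom h = TDom k \<and> (g \<in> Arr (pt0 ?E) \<and> TDom g = FO (pt1 p) (TCod k) \<and> TCod g = FO (pt1 p) (TCod h)) \<and>
      Cmp (pt0 ?E) g (FA (pt1 p) k) = FA (pt1 p) h"
    then have hk: "TDom h = TDom k" and gd: "TDom g = FO (pt1 p) (TCod k)" "TCod g = FO (pt1 p) (TCod h)"
      and gk: "Cmp (pt0 ?E) g (FA (pt1 p) k) = FA (pt1 p) h" by blast+
    have O: "TDom k \<in> Obj (pt0 ?F)" "TCod k \<in> Obj (pt0 ?F)" "TCod h \<in> Obj (pt0 ?F)" using k h by (simp_all add: pt0_simps(4))
    have gn: "ntrans ?E SetCat (cmp_func (pull (TCod k)) (pull p)) (cmp_func (pull (TCod h)) (pull p)) (TMap g)"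
      using pt0_ntrans[OF g] by (simp add: gd pt1_simps(1)[OF p] O cmp_geom_simps)
    have e: "Cmp SetCat (TMap g D) (TMap k (FO (pull p) D)) = TMap h (FO (pull p) D)" if "D \<in> Obj ?E" for D
      using fun_cong[OF arg_cong[OF gk[unfolded pt0_simps(6)[OF FA_Arr[OF PT k]]], of TMap], of D] that
      by (simp add: pt1_simps(2)[OF p] k h)
    obtain t where t: "ntrans ?F SetCat (pull (TCod k)) (pull (TCod h)) t" and tg: "\<forall>D\<in>Obj ?E. t (FO (pull p) D) = TMap g D"
      by (rule discof_triangle[OF d pt0_geo[OF O(1)] pt0_geo[OF O(2)] pt0_geo[OF O(3)] pt0_ntrans[OF k]
          pt0_ntrans[OF h, unfolded hk] gn e])
    let ?x = "\<lparr>TDom = TCod k, TCod = TCod h, TMap = t\<rparr>"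
    have x: "?x \<in> Arr (pt0 ?F)" using t O by (simp add: pt0_simps(4)[of ?x])
    have xg: "FA (pt1 p) ?x = g"
      by (rule pt0_eqI[OF FA_Arr[OF PT x] g]) (use tg in \<open>simp_all add: pt1_simps[OF p] x O gd\<close>)
    have "FA (pt1 p) (Cmp (pt0 ?F) ?x k) = FA (pt1 p) h"
      using FA_Cmp[OF PT k x] by (simp add: xg gk pt0_simps(1,2))
    then have xk: "Cmp (pt0 ?F) ?x k = h"
      by (rule faithful[OF pt0_comp_Arr[OF k x] h, rotated 3]) (simp_all add: pt0_simps(6)[OF k] hk)
    show "\<exists>!x. (x \<in> Arr (pt0 ?F) \<and> TDom x = TCod k \<and> TCod x = TCod h) \<and> Cmp (pt0 ?F) x k = h \<and> FA (pt1 p) x = g"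
    proof (rule ex1I[of _ ?x])
      show "(?x \<in> Arr (pt0 ?F) \<and> TDom ?x = TCod k \<and> TCod ?x = TCod h) \<and> Cmp (pt0 ?F) ?x k = h \<and> FA (pt1 p) ?x = g"
        using x xk xg by simp
      show "z = ?x" if "(z \<in> Arr (pt0 ?F) \<and> TDom z = TCod k \<and> TCod z = TCod h) \<and> Cmp (pt0 ?F) z k = h \<and> FA (pt1 p) z = g" for z
        by (rule faithful) (use that x xg in simp_all)
    qed
  qed
  have lift: "\<exists>k s. opcartesian (pt1 p) k \<and> TDom k = a \<and> iso_arr (pt0 ?E) s \<and>
      s \<in> homset (pt0 ?E) (FO (pt1 p) (TCod k)) (TCod f) \<and> Cmp (pt0 ?E) s (FA (pt1 p) k) = f"
    if a: "a \<in> Obj (pt0 ?F)" and f: "f \<in> Arr (pt0 ?E)" and fa: "TDom f = FO (pt1 p) a" for a f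
  proof -
    have y: "TCod f \<in> Obj (pt0 ?E)" using f by (simp add: pt0_simps(4))
    have "ntrans ?E SetCat (cmp_func (pull a) (pull p)) (pull (TCod f)) (TMap f)"
      using pt0_ntrans[OF f] by (simp add: fa pt1_simps(1)[OF p a] cmp_geom_simps)
    then obtain b k s where b: "geo ?F SetCat b" and k: "ntrans ?F SetCat (pull a) b k"
      and s: "ntiso ?E SetCat (cmp_func b (pull p)) (pull (TCod f)) s"
      and sk: "\<forall>D\<in>Obj ?E. Cmp SetCat (s D) (k (FO (pull p) D)) = TMap f D"
      by (rule discof_lift[OF d pt0_geo[OF a] pt0_geo[OF y]])
    \<comment> \<open>\<open>b\<close> is only an inverse image; an object of \<open>pt0\<close>
      also includes a direct image, chosen here.\<close>
    obtain g where g: "g \<in> cells1 GTop" "pull g = b" "gsrc g = SetCat" "gtgt g = ?F" by (rule geo_cells1[OF b])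
    then have gO: "g \<in> Obj (pt0 ?F)" by (simp add: pt0_simps(3))
    let ?k = "\<lparr>TDom = a, TCod = g, TMap = k\<rparr>" and ?s = "\<lparr>TDom = cmp_geom p g, TCod = TCod f, TMap = s\<rparr>"
    have kA: "?k \<in> Arr (pt0 ?F)" using a gO k by (simp add: pt0_simps(4)[of ?k] g)
    have sA: "?s \<in> Arr (pt0 ?E)"
      using FO_Obj[OF PT gO] y ntiso_ntrans[OF s] by (simp add: pt0_simps(4)[of ?s] pt1_simps(1)[OF p gO] cmp_geom_simps g)
    have s_iso: "iso_arr (pt0 ?E) ?s" by (rule iso_pt0[OF sA]) (simp add: ntiso_iso[OF s])
    have Fk: "FA (pt1 p) ?k =
        \<lparr>TDom = cmp_geom p a, TCod = cmp_geom p g, TMap = (\<lambda>D\<in>Obj ?E. k (FO (pull p) D))\<rparr>"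
      by (simp add: pt1_simps(2)[OF p kA])
    note FkA = FA_Arr[OF PT kA, unfolded Fk]
    have "Cmp (pt0 ?E) ?s (FA (pt1 p) ?k) = f"
      unfolding Fk by (rule pt0_eqI[OF pt0_comp_Arr[OF FkA sA] f])
        (use sk in \<open>simp_all add: pt0_simps(6)[OF FkA] pt1_simps(1)[OF p a] fa\<close>)
    then show ?thesis
      using opcart[OF kA] sA s_iso by (intro exI[of _ ?k] exI[of _ ?s]) (simp add: mem_homset pt0_simps(1,2) pt1_simps(1)[OF p gO])
  qed
  have conservative: "iso_arr (pt0 ?F) k" if k: "k \<in> Arr (pt0 ?F)" and i: "iso_arr (pt0 ?E) (FA (pt1 p) k)" for k
  proof (rule iso_pt0[OF k])
    have O: "TDom k \<in> Obj (pt0 ?F)" "TCod k \<in> Obj (pt0 ?F)" using k by (simp_all add: pt0_simps(4))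
    have "iso_arr SetCat (TMap k (FO (pull p) D))" if "D \<in> Obj ?E" for D
      using pt0_isoD[OF i that] that by (simp add: pt1_simps(2)[OF p k])
    then show "iso_arr SetCat (TMap k D)" if "D \<in> Obj ?F" for D
      using discof_conservative[OF d P pt0_geo[OF O(1)] pt0_geo[OF O(2)] pt0_ntrans[OF k] _ that] by blast
  qed
  have "opfibration (pt1 p)"
    unfolding opfibration_def pt1_from_to using PT lift by (simp add: functor_from_to_def pt0_simps(1,2))
  then show ?thesis
    unfolding discrete_opfibration_def
    using fiber_equivalent_discrete[OF PT _ conservative] faithful by (simp add: pt0_simps(1,2))
qed

theorem proposition4p3p3:
  fixes p :: "('u::universe) large geom"
  assumes "pro_etale p"
  shows "discrete_opfibration (pt1 p)"
  using assms discof_pro_etale[OF assms] by (intro discrete_opfibration_pt1) (simp_all add: pro_etale_def)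

end
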